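(* Suppose $1<\alpha<\infty$ and that $X_1$ has a tail of index $\theta\in(2,1+\alpha)$, i.e. $\mathbf{P}(X_1\ge x)\sim a x^{-\theta}$ as $x\to\infty$ for some constant $a>0$. Put $\varkappa:=(1+\alpha-\theta)/(2\alpha-\theta)$. Let $\varepsilon_n>0$. (a) If $\varepsilon_nm^{\varkappa n}\to0$ and $\varepsilon_n^2m^n\to\infty$, then \[V_*\Gamma_\alpha\le\liminf_{n}\varepsilon_n^{2\alpha}m^{\alpha n}\mathbf{P}(R_n\ge\varepsilon_n)\le\limsup_n\varepsilon_n^{2\alpha}m^{\alpha n}\mathbf{P}(R_n\ge\varepsilon_n)\le V^*\Gamma_\alpha,\] with $0<V_*\Gamma_\alpha$ and $V^*\Gamma_\alpha<\infty$. (b) If $\varepsilon_nm^{\varkappa n}\to\infty$, then $\lim_{n\to\infty}\varepsilon_n^\theta m^{(\theta-1)n}\mathbf{P}(R_n\ge\varepsilon_n)=aI_\theta$, where $I_\theta:=\frac{1}{\Gamma(\theta-1)}\int_0^\infty\varphi(v)v^{\theta-2}\,dv$. (c) If $\varepsilon_nm^{\varkappa n}\to\tau^{-1}\in(0,\infty)$, then \[\tau^{2\alpha}V_*\Gamma_\alpha+\tau^\theta aI_\theta\le\liminf_n m^{\alpha(\theta-2)n/(2\alpha-\theta)}\mathbf{P}(R_n\ge\varepsilon_n)\le\limsup_n m^{\alpha(\theta-2)n/(2\alpha-\theta)}\mathbf{P}(R_n\ge\varepsilon_n)\le\tau^{2\alpha}V^*\Gamma_\alpha+\tau^\theta aI_\theta.\]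 Here $V_*:=\liminf_{u\downarrow0}u^{1-\alpha}w(u)$, $V^*:=\limsup_{u\downarrow0}u^{1-\alpha}w(u)$, $\Gamma_\alpha:=\frac{2^{\alpha-1}\Gamma(\alpha+1/2)}{\alpha\sqrt\pi}\sigma^{2\alpha}$.
   Context: Standing setup: $Z=(Z_n)_{n\ge0}$ is a Galton–Watson process with $Z_0=1$ and offspring law $\{p_k\}$ with mean $m\in(1,\infty)$ and $\mathbf{E}Z_1\log Z_1<\infty$. Independently, $(X_n)$ are i.i.d. with $\mathbf{E}X_1=0$, $\sigma^2:=\mathbf{E}X_1^2\in(0,\infty)$; $S_k:=X_1+\dots+X_k$; $R_n:=S_{Z_n}/Z_n$ on $\{Z_n>0\}$, and $\mathbf{P}(R_n\ge x)$ means $\mathbf{P}(R_n\ge x, Z_n>0)$. $f$ is the offspring generating function, $q$ the extinction probability, and $\alpha\in(0,\infty]$ is defined by $f'(q)=m^{-\alpha}$ (Schröder constant; $\alpha<\infty$ iff $p_0+p_1>0$). $W:=\lim_nm^{-n}Z_n$ a.s., $w$ the density of $W$ on $(0,\infty)$, and $\varphi(h):=\mathbf{E}e^{-hW}$.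
   Formalization: In (b) and (c) the integral defining I_θ is assumed finite, which amounts to q = 0: for q > 0 one has φ(v) → q, so I_θ = ∞, while the rescaled probability stays bounded and the stated claim fails. The density w is taken in its continuous version. *)

theory Defs
  imports "HOL-Probability.Probability"
begin

definition offspring_gf :: "nat pmf \<Rightarrow> real \<Rightarrow> real" where
  "offspring_gf p s = (\<Sum>k. pmf p k * s ^ k)"

definition offspring_mean :: "nat pmf \<Rightarrow> real" where
  "offspring_mean p = measure_pmf.expectation p real"

text \<open>The standing probabilistic setup: on the probability space M, xi n i is the
  number of children of the i-th individual of generation n (i.i.d. with law p),
  Z is the resulting Galton-Watson process with Z 0 = 1, and X 1, X 2, ... are
  i.i.d. real random variables, the whole family being independent.\<close>
definition gw_setup ::
  "'a measure \<Rightarrow> nat pmf \<Rightarrow> (nat \<Rightarrow> nat \<Rightarrow> 'a \<Rightarrow> nat) \<Rightarrow> (nat \<Rightarrow> 'a \<Rightarrow> nat) \<Rightarrow> (nat \<Rightarrow> 'a \<Rightarrow> real) \<Rightarrow> bool"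
where
  "gw_setup M p \<xi> Z X \<longleftrightarrow>
     prob_space M \<and>
     (\<forall>n i. \<xi> n i \<in> measurable M (count_space UNIV)) \<and>
     (\<forall>n i. distr M (count_space UNIV) (\<xi> n i) = measure_pmf p) \<and>
     prob_space.indep_vars M (\<lambda>_. borel)
        (case_sum (\<lambda>(n, i) \<omega>. real (\<xi> n i \<omega>)) X) (range Inl \<union> Inr ` {1..}) \<and>
     (\<forall>k\<ge>1. distr M borel (X k) = distr M borel (X 1)) \<and>
     (\<forall>\<omega>. Z 0 \<omega> = 1) \<and>
     (\<forall>n \<omega>. Z (Suc n) \<omega> = (\<Sum>i<Z n \<omega>. \<xi> n i \<omega>))"

definition psum :: "(nat \<Rightarrow> 'a \<Rightarrow> real) \<Rightarrow> nat \<Rightarrow> 'a \<Rightarrow> real" where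
  "psum X k \<omega> = (\<Sum>i\<in>{1..k}. X i \<omega>)"

definition prob_R_ge ::
  "'a measure \<Rightarrow> (nat \<Rightarrow> 'a \<Rightarrow> nat) \<Rightarrow> (nat \<Rightarrow> 'a \<Rightarrow> real) \<Rightarrow> nat \<Rightarrow> real \<Rightarrow> real" where
  "prob_R_ge M Z X n x =
     measure M {\<omega>\<in>space M. Z n \<omega> > 0 \<and> psum X (Z n \<omega>) \<omega> / real (Z n \<omega>) \<ge> x}"

end

theory Submission
  imports Defs
begin

text \<open>Given Z n = k, the event R n \<ge> e is a random walk of length k exceeding e k. Two mechanisms compete.
  Either Z n is atypically small, of order 1 / e^2, and the central limit theorem makes the walk exceed
  e k with positive probability; since P(0 < W \<le> u) is comparable to u^\<alpha>, this costs (e^2 m^n)^(-\<alpha>).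
  Or Z n is of its typical order m^n and one single step exceeds e k, which costs
  e^(-\<theta>) m^(-(\<theta> - 1) n) by the negative moment of order \<theta> - 1 of W. The two costs balance when
  e is of order m^(-\<kappa> n).

  The walk is controlled uniformly in k by the Fuk-Nagaev inequality (upper bound), Bonferroni's
  inequality (lower bound) and the central limit theorem. The lower tail of Z n at intermediate
  scales is transferred from that of W, because W given Z n = k is a sum of k independent copies of W / m^n.
  The upper bound w u \<le> C u^(\<alpha> - 1) comes from Fourier inversion together with the decay
  of the iterated generating function at rate f'(q)^n = m^(-\<alpha> n); the lower bound from the positivity of w on one
  fundamental domain [c, c m] and the inequality w (u / m) \<ge> m f'(q) w u.\<close>

section \<open>Tail bounds for centred random walks\<close>

text \<open>The overview does not say where the hypotheses act. The \<open>k ln k\<close> moment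
  makes the defects \<open>pgf_defect\<close> summable along a geometric scale. Hence
  \<open>Phi\<close> has slope -1 at 0: no mean is lost in the limit, \<open>W\<close> does not
  vanish identically, and a law of large numbers for copies of \<open>W\<close> ties
  \<open>Z n\<close> to \<open>m ^ n * W\<close>. The condition \<open>1 < \<alpha>\<close> says
  that \<open>m * dpgf p q < 1\<close>; this makes the Gaussian average of the Fourier transform of
  \<open>W\<close>, freed of the atom at 0, small enough to bound the density pointwise. The
  condition \<open>\<theta> < 1 + \<alpha>\<close> puts the negative moment of order
  \<open>\<theta> - 1\<close> below the critical order \<open>\<alpha>\<close>, so that small
  populations do not disturb the jump part. The obstacle is that
  \<open>u powr (1 - \<alpha>) * w u\<close> may oscillate as \<open>u\<close> tends to 0, so no
  asymptotic equivalence is available. Limits of the population part are therefore taken through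
  one-sided eventual inequalities, once from above and once from below. All errors are measured in
  units of the two costs \<open>Dsc\<close> and \<open>Jsc\<close>, so that the same estimates serve
  all three regimes.\<close>

lemma exp_minus_affine_le:
  fixes z w :: real
  assumes "z \<le> w" "0 < w"
  shows "exp z - 1 - z \<le> z\<^sup>2 * ((exp w - 1 - w) / w\<^sup>2)"
proof -
  \<comment> \<open>The quotient is a power series with nonnegative coefficients and constant term
    1/2, hence increasing for positive arguments. For negative \<open>z\<close> the bound 1/2 is
    enough.\<close>
  have series: "((\<lambda>n. x ^ n / fact (n + 2)) sums ((exp x - 1 - x) / x\<^sup>2))" if "x \<noteq> 0" for x :: real
  proof -
    have "(\<lambda>n. x ^ n /\<^sub>R fact n) sums exp x" by (rule exp_converges)
    then have "(\<lambda>n. x ^ (n + 2) /\<^sub>R fact (n + 2)) sums (exp x - (\<Sum>n<2. x ^ n /\<^sub>R fact n))"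
      by (rule sums_split_initial_segment)
    then have "(\<lambda>n. x ^ (n + 2) / fact (n + 2)) sums (exp x - 1 - x)"
      by (simp add: divide_inverse mult.commute numeral_2_eq_2 algebra_simps)
    then have "(\<lambda>n. x ^ (n + 2) / fact (n + 2) / x\<^sup>2) sums ((exp x - 1 - x) / x\<^sup>2)"
      by (rule sums_divide)
    moreover have "x ^ (n + 2) / fact (n + 2) / x\<^sup>2 = x ^ n / fact (n + 2)" for n
      using that by (simp add: power_add power2_eq_square del: fact_Suc fact_2)
    ultimately show ?thesis by simp
  qed
  have aux: "exp z - 1 - z \<le> z\<^sup>2 / 2" if z: "z \<le> 0"
  proof -
    have d: "((\<lambda>x. exp x - 1 - x - x\<^sup>2 / 2) has_real_derivative (exp x - 1 - x)) (at x)" for x :: real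
      by (auto intro!: derivative_eq_intros)
    have "exp z - 1 - z - z\<^sup>2/2 \<le> exp 0 - 1 - 0 - 0\<^sup>2 / (2::real)"
      by (rule DERIV_nonneg_imp_nondecreasing[OF z])
         (use d exp_ge_add_one_self in \<open>force simp: algebra_simps\<close>)
    then show ?thesis by simp
  qed
  have w2: "1 / 2 \<le> (exp w - 1 - w) / w\<^sup>2"
  proof -
    have ser: "(\<lambda>n. w ^ n / fact (n + 2)) sums ((exp w - 1 - w) / w\<^sup>2)"
      using series assms by simp
    have "(\<Sum>n\<in>{0}. w ^ n / fact (n + 2)) \<le> (\<Sum>n. w ^ n / fact (n + 2))"
      by (rule sum_le_suminf[OF sums_summable[OF ser]]) (use assms in auto)
    then show ?thesis using sums_unique[OF ser] by (simp add: numeral_2_eq_2)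
  qed
  show ?thesis
  proof (cases "z \<le> 0")
    case True
    have "z\<^sup>2 * (1/2) \<le> z\<^sup>2 * ((exp w - 1 - w) / w\<^sup>2)"
      by (intro mult_left_mono w2) auto
    with aux[OF True] show ?thesis by linarith
  next
    case False
    have "(exp z - 1 - z) / z\<^sup>2 \<le> (exp w - 1 - w) / w\<^sup>2"
    proof (rule sums_le[OF _ series series])
      show "z ^ n / fact (n + 2) \<le> w ^ n / fact (n + 2)" for n
        using False assms by (intro divide_right_mono power_mono) auto
    qed (use False assms in auto)
    then show ?thesis using False by (simp add: divide_le_eq mult.commute)
  qed
qed

text \<open>Polya's theorem: between two neighbouring grid points a monotone function is trapped by
  its values there, so convergence at finitely many points and continuity of the limit suffice.
  Uniformity is needed because the level at which the walk is tested depends on its length.\<close>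

lemma polya_uniform:
  fixes F :: "nat \<Rightarrow> real \<Rightarrow> real" and G :: "real \<Rightarrow> real"
  assumes F_mono: "\<And>n x y. x \<le> y \<Longrightarrow> F n x \<le> F n y" and F_range: "\<And>n x. 0 \<le> F n x \<and> F n x \<le> 1"
    and G_mono: "\<And>x y. x \<le> y \<Longrightarrow> G x \<le> G y" and G_range: "\<And>x. 0 \<le> G x \<and> G x \<le> 1"
    and G_cont: "continuous_on UNIV G"
    and G_bot: "(G \<longlongrightarrow> 0) at_bot" and G_top: "(G \<longlongrightarrow> 1) at_top"
    and conv: "\<And>x. (\<lambda>n. F n x) \<longlonglongrightarrow> G x" and e: "0 < e"
  shows "\<forall>\<^sub>F n in sequentially. \<forall>x. \<bar>F n x - G x\<bar> \<le> 2 * e"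
proof -
  have "\<forall>\<^sub>F x in at_bot. G x < e" using G_bot e by (rule order_tendstoD(2))
  then obtain A1 where A1: "\<And>x. x \<le> A1 \<Longrightarrow> G x < e" by (auto simp: eventually_at_bot_linorder)
  have "\<forall>\<^sub>F x in at_top. G x > 1 - e" using G_top e by (intro order_tendstoD(1)) auto
  then obtain A2 where A2: "\<And>x. x \<ge> A2 \<Longrightarrow> G x > 1 - e" by (auto simp: eventually_at_top_linorder)
  define A where "A = max (max (-A1) A2) 1"
  have A: "0 < A" "- A \<le> A1" "A2 \<le> A" by (auto simp: A_def)
  have "uniformly_continuous_on {-A..A+1} G"
    by (rule compact_uniformly_continuous) (auto intro: continuous_on_subset[OF G_cont])
  then obtain d0 where d0: "0 < d0"
    "\<And>x y. x \<in> {-A..A+1} \<Longrightarrow> y \<in> {-A..A+1} \<Longrightarrow> dist y x < d0 \<Longrightarrow> dist (G y) (G x) < e"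
    using e unfolding uniformly_continuous_on_def by metis
  define d where "d = min (d0 / 2) 1"
  have d: "0 < d" "d < d0" "d \<le> 1" using d0(1) by (auto simp: d_def)
  \<comment> \<open>The grid starts at \<open>- A\<close> and has mesh \<open>d\<close>. The grid
    point just above some \<open>x \<le> A\<close> may pass \<open>A\<close>, but by at most 1; this
    is why uniform continuity was taken on an interval ending at \<open>A + 1\<close>.\<close>
  define K where "K = nat \<lceil>2 * A / d\<rceil> + 1"
  define pt where "pt i = - A + real i * d" for i :: nat
  have "\<forall>\<^sub>F n in sequentially. \<forall>i\<in>{..K}. \<bar>F n (pt i) - G (pt i)\<bar> < e"
  proof (rule eventually_ball_finite)
    show "\<forall>i\<in>{..K}. \<forall>\<^sub>F n in sequentially. \<bar>F n (pt i) - G (pt i)\<bar> < e"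
      using conv e by (auto simp: tendsto_iff dist_real_def)
  qed auto
  moreover have "\<forall>\<^sub>F n in sequentially. \<bar>F n A - G A\<bar> < e"
    using conv e by (auto simp: tendsto_iff dist_real_def)
  ultimately show ?thesis
  proof eventually_elim
    case (elim n)
    show ?case
    proof
      fix x
      consider "x < - A" | "A < x" | "-A \<le> x" "x \<le> A" by linarith
      then show "\<bar>F n x - G x\<bar> \<le> 2 * e"
      proof cases
        case 1
        have "pt 0 = - A" by (simp add: pt_def)
        then have "F n (-A) < G (-A) + e" using elim(1) by (force simp: abs_if split: if_splits)
        moreover have "G (-A) < e" "G x < e" using A1 A 1 by auto
        ultimately show ?thesis using F_mono[of x "-A" n] 1 F_range[of n x] G_range[of x] by auto
      next
        case 2
        have "G A > 1 - e" "G x > 1 - e" using A2 A 2 by auto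
        then show ?thesis using elim(2) F_mono[of A x n] 2 F_range[of n x] G_range[of x]
          by (auto simp: abs_if split: if_splits)
      next
        case 3
        define i where "i = nat \<lfloor>(x + A) / d\<rfloor>"
        have i_eq: "real i = of_int \<lfloor>(x + A) / d\<rfloor>" using 3 d by (simp add: i_def)
        have i1: "real i \<le> (x + A) / d" "(x + A) / d < real i + 1"
          unfolding i_eq by linarith+
        then have px: "pt i \<le> x" "x < pt (Suc i)"
          using d by (auto simp: pt_def field_simps)
        have "(x + A) / d \<le> (A + A) / d" using 3 d by (intro divide_right_mono) auto
        then have "real i \<le> 2 * A / d" using i1(1) by simp
        then have iK: "i \<le> K" "Suc i \<le> K" unfolding K_def by linarith+
        have ptd: "pt (Suc i) = pt i + d" by (simp add: pt_def algebra_simps)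
        have in1: "pt i \<in> {-A..A+1}" "pt (Suc i) \<in> {-A..A+1}" "x \<in> {-A..A+1}"
          using px 3 d ptd by (auto simp: pt_def)
        have "dist (pt (Suc i)) x < d0" "dist (pt i) x < d0"
          using px d ptd by (auto simp: dist_real_def)
        then have "dist (G (pt (Suc i))) (G x) < e" "dist (G (pt i)) (G x) < e"
          using d0(2) in1 by auto
        moreover have "\<bar>F n (pt i) - G (pt i)\<bar> < e" "\<bar>F n (pt (Suc i)) - G (pt (Suc i))\<bar> < e"
          using elim(1) iK by auto
        moreover have "F n (pt i) \<le> F n x" "F n x \<le> F n (pt (Suc i))" using F_mono px by auto
        ultimately show ?thesis unfolding dist_real_def abs_le_iff abs_less_iff by linarith
      qed
    qed
  qed
qed

locale centered_walk = prob_space M for M :: "'a measure" +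
  fixes Y :: "nat \<Rightarrow> 'a \<Rightarrow> real" and \<sigma>2 :: real
  assumes indep: "indep_vars (\<lambda>_. borel) Y UNIV"
    and ident: "\<And>i. distr M borel (Y i) = distr M borel (Y 0)"
    and Y0_int: "integrable M (Y 0)" and Y0_mean: "expectation (Y 0) = 0"
    and Y0_sq_int: "integrable M (\<lambda>\<omega>. (Y 0 \<omega>)\<^sup>2)"
    and \<sigma>2_eq: "\<sigma>2 = expectation (\<lambda>\<omega>. (Y 0 \<omega>)\<^sup>2)" and \<sigma>2_gt0: "0 < \<sigma>2"
begin

definition xtail :: "real \<Rightarrow> real" where
  "xtail x = \<P>(\<omega> in M. x \<le> Y 0 \<omega>)"

definition Sm :: "nat \<Rightarrow> 'a \<Rightarrow> real" where
  "Sm k \<omega> = (\<Sum>i<k. Y i \<omega>)"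

lemma Y_meas [measurable]: "Y i \<in> borel_measurable M"
  using indep unfolding indep_vars_def2 by simp

lemma Sm_meas [measurable]: "Sm k \<in> borel_measurable M"
  unfolding Sm_def by measurable

lemma
  fixes g :: "real \<Rightarrow> 'b::{banach, second_countable_topology}"
  assumes [measurable]: "g \<in> borel_measurable borel"
  shows integrable_Y_iff: "integrable M (\<lambda>\<omega>. g (Y i \<omega>)) \<longleftrightarrow> integrable M (\<lambda>\<omega>. g (Y 0 \<omega>))"
    and expectation_Y_eq: "expectation (\<lambda>\<omega>. g (Y i \<omega>)) = expectation (\<lambda>\<omega>. g (Y 0 \<omega>))"
proof -
  have "integrable (distr M borel (Y i)) g = integrable (distr M borel (Y 0)) g" by (simp only: ident[of i])
  then show "integrable M (\<lambda>\<omega>. g (Y i \<omega>)) \<longleftrightarrow> integrable M (\<lambda>\<omega>. g (Y 0 \<omega>))"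
    by (simp add: integrable_distr_eq)
  have "integral\<^sup>L (distr M borel (Y i)) g = integral\<^sup>L (distr M borel (Y 0)) g" by (simp only: ident[of i])
  then show "expectation (\<lambda>\<omega>. g (Y i \<omega>)) = expectation (\<lambda>\<omega>. g (Y 0 \<omega>))"
    by (simp add: integral_distr)
qed

lemma prob_Y_ge: "\<P>(\<omega> in M. x \<le> Y i \<omega>) = xtail x"
proof -
  have "measure (distr M borel (Y i)) {x..} = measure (distr M borel (Y 0)) {x..}" by (simp only: ident[of i])
  then show ?thesis by (simp add: measure_distr xtail_def vimage_def Int_def conj_commute)
qed

lemma xtail_nonneg: "0 \<le> xtail x" and xtail_le_1: "xtail x \<le> 1"
  by (simp_all add: xtail_def)

lemma xtail_antimono: "x \<le> y \<Longrightarrow> xtail y \<le> xtail x"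
  unfolding xtail_def by (rule finite_measure_mono) auto

lemma Y_int: "integrable M (Y i)" and Y_mean: "expectation (Y i) = 0"
  using integrable_Y_iff[of "\<lambda>x. x" i] expectation_Y_eq[of "\<lambda>x. x" i] Y0_int Y0_mean by auto

lemma Y_sq_int: "integrable M (\<lambda>\<omega>. (Y i \<omega>)\<^sup>2)" and Y_sq: "expectation (\<lambda>\<omega>. (Y i \<omega>)\<^sup>2) = \<sigma>2"
  using integrable_Y_iff[of "\<lambda>x. x\<^sup>2" i] expectation_Y_eq[of "\<lambda>x. x\<^sup>2" i] Y0_sq_int \<sigma>2_eq by auto

text \<open>Independence and centring kill the cross terms. The index set is arbitrary because the
  walk with one step removed is needed below.\<close>

lemma sum_square:
  assumes "finite I"
  shows "integrable M (\<lambda>\<omega>. (\<Sum>i\<in>I. Y i \<omega>)\<^sup>2) \<and>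
    expectation (\<lambda>\<omega>. (\<Sum>i\<in>I. Y i \<omega>)\<^sup>2) = card I * \<sigma>2"
  using assms
proof (induction I rule: finite_induct)
  case (insert x F)
  have ind: "indep_var borel (Y x) borel (\<lambda>\<omega>. \<Sum>i\<in>F. Y i \<omega>)"
    by (rule indep_vars_sum[OF insert(1,2)]) (rule indep_vars_subset[OF indep], auto)
  have intS: "integrable M (\<lambda>\<omega>. \<Sum>i\<in>F. Y i \<omega>)"
    by (intro Bochner_Integration.integrable_sum Y_int)
  have i: "integrable M (\<lambda>\<omega>. Y x \<omega> * (\<Sum>i\<in>F. Y i \<omega>))"
    and e: "expectation (\<lambda>\<omega>. Y x \<omega> * (\<Sum>i\<in>F. Y i \<omega>)) = 0"
    using indep_var_integrable[OF ind Y_int intS] indep_var_lebesgue_integral[OF ind Y_int intS]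
    by (simp_all add: Y_mean)
  have eq: "(\<Sum>i\<in>insert x F. Y i \<omega>)\<^sup>2 =
      (Y x \<omega>)\<^sup>2 + 2 * (Y x \<omega> * (\<Sum>i\<in>F. Y i \<omega>)) + (\<Sum>i\<in>F. Y i \<omega>)\<^sup>2" for \<omega>
    using insert by (simp add: power2_sum)
  show ?case
    unfolding eq using insert Y_sq_int i e
    by (auto simp: Y_sq algebra_simps)
qed simp

lemma chebyshev_sum:
  assumes "finite I" "0 < x"
  shows "\<P>(\<omega> in M. x \<le> \<bar>\<Sum>i\<in>I. Y i \<omega>\<bar>) \<le> card I * \<sigma>2 / x\<^sup>2"
proof -
  have "\<P>(\<omega> in M. x\<^sup>2 \<le> (\<Sum>i\<in>I. Y i \<omega>)\<^sup>2) \<le> expectation (\<lambda>\<omega>. (\<Sum>i\<in>I. Y i \<omega>)\<^sup>2) / x\<^sup>2"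
    by (rule integral_Markov_inequality_measure[where A="{}"])
       (use sum_square[OF assms(1)] assms(2) in auto)
  also have "{\<omega>\<in>space M. x\<^sup>2 \<le> (\<Sum>i\<in>I. Y i \<omega>)\<^sup>2} = {\<omega>\<in>space M. x \<le> \<bar>\<Sum>i\<in>I. Y i \<omega>\<bar>}"
    using assms(2) by (auto simp: abs_le_square_iff[symmetric])
  finally show ?thesis using sum_square[OF assms(1)] by simp
qed

lemma xtail_chebyshev: "0 < x \<Longrightarrow> xtail x \<le> \<sigma>2 / x\<^sup>2"
proof -
  assume "0 < x"
  have "xtail x \<le> \<P>(\<omega> in M. x \<le> \<bar>\<Sum>i\<in>{0}. Y i \<omega>\<bar>)"
    unfolding xtail_def by (rule finite_measure_mono) auto
  also have "\<dots> \<le> card {0::nat} * \<sigma>2 / x\<^sup>2" by (rule chebyshev_sum) (use \<open>0 < x\<close> in auto)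
  finally show ?thesis by simp
qed

text \<open>A Chernoff bound for steps truncated at \<open>y\<close>. The truncated exponential lies
  below a quadratic polynomial, so its mean is controlled by the variance alone. With
  \<open>y = \<eta> * x\<close> the bound decays with exponent \<open>1 / \<eta>\<close>, which can
  be made larger than \<open>\<alpha>\<close>.\<close>

lemma fuk_nagaev:
  assumes x: "0 < x" and y: "0 < y" and k: "0 < k"
  shows "\<P>(\<omega> in M. x \<le> Sm k \<omega> \<and> (\<forall>i<k. Y i \<omega> \<le> y))
    \<le> (exp 1 * k * \<sigma>2 / (x * y)) powr (x / y)"
proof -
  \<comment> \<open>This choice makes \<open>exp (h * y) - 1\<close> equal to
    \<open>x * y / (k * \<sigma>2)\<close>, so that the variance term
    \<open>k * \<sigma>2 * b\<close> costs at most \<open>x / y\<close> in the exponent.\<close>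
  define h where "h = ln (1 + x * y / (k * \<sigma>2)) / y"
  have kp: "0 < real k * \<sigma>2" using k \<sigma>2_gt0 by simp
  have arg: "1 + x * y / (k * \<sigma>2) > 1" using x y kp by simp
  have h: "0 < h" unfolding h_def using arg y by simp
  have ehy: "exp (h * y) = 1 + x * y / (k * \<sigma>2)"
    unfolding h_def using arg y by simp
  \<comment> \<open>The exponential is set to 0 above \<open>y\<close>: the product over all steps
    then vanishes unless every step stays below \<open>y\<close>.\<close>
  define g where "g z = indicator {..y} z * exp (h * z)" for z :: real
  have [measurable]: "g \<in> borel_measurable borel" unfolding g_def by measurable
  have g_bd: "\<bar>g z\<bar> \<le> exp (h * y)" for z
    unfolding g_def using h by (auto simp: indicator_def)
  have gY_int: "integrable M (\<lambda>\<omega>. g (Y i \<omega>))" for i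
    by (rule integrable_const_bound[where B="exp (h*y)"]) (use g_bd in auto)
  define b where "b = (exp (h * y) - 1 - h * y) / y\<^sup>2"
  have hyp: "0 < h * y" using h y by simp
  have g0: "expectation (\<lambda>\<omega>. g (Y 0 \<omega>)) \<le> 1 + \<sigma>2 * b"
  proof -
    have pt: "g z \<le> 1 + h * z + z\<^sup>2 * b" for z
    proof (cases "z \<le> y")
      case True
      have "exp (h*z) - 1 - h*z \<le> (h*z)\<^sup>2 * ((exp (h*y) - 1 - h*y)/(h*y)\<^sup>2)"
        by (rule exp_minus_affine_le) (use True h hyp in auto)
      also have "\<dots> = z\<^sup>2 * b" using h by (simp add: b_def power_mult_distrib)
      finally show ?thesis using True by (simp add: g_def)
    next
      case False
      have "0 \<le> exp (h*y) - 1 - h*y" using exp_ge_add_one_self[of "h*y"] by linarith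
      then have "0 \<le> z\<^sup>2 * b" by (simp add: b_def)
      moreover have "0 < h * z" using False h y by simp
      ultimately show ?thesis using False by (simp add: g_def)
    qed
    have "expectation (\<lambda>\<omega>. g (Y 0 \<omega>)) \<le> expectation (\<lambda>\<omega>. 1 + h * Y 0 \<omega> + (Y 0 \<omega>)\<^sup>2 * b)"
      by (rule integral_mono) (use gY_int Y_int Y_sq_int pt in auto)
    also have "\<dots> = 1 + \<sigma>2 * b"
      using Y_int[of 0] Y_sq_int[of 0] by (simp add: Y_mean Y_sq prob_space)
    finally show ?thesis .
  qed
  have b0: "0 \<le> b"
    using exp_ge_add_one_self[of "h*y"] unfolding b_def
    by (intro divide_nonneg_nonneg zero_le_power2) linarith
  have indg: "indep_vars (\<lambda>_. borel) (\<lambda>i \<omega>. g (Y i \<omega>)) {..<k}"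
    by (rule indep_vars_compose2[OF indep_vars_subset[OF indep]]) auto
  have prod_int: "integrable M (\<lambda>\<omega>. \<Prod>i<k. g (Y i \<omega>))"
    by (rule indep_vars_integrable[OF _ indg]) (use gY_int in auto)
  have "\<P>(\<omega> in M. x \<le> Sm k \<omega> \<and> (\<forall>i<k. Y i \<omega> \<le> y))
      \<le> \<P>(\<omega> in M. exp (h * x) \<le> (\<Prod>i<k. g (Y i \<omega>)))"
  proof (rule finite_measure_mono)
    show "{\<omega>\<in>space M. x \<le> Sm k \<omega> \<and> (\<forall>i<k. Y i \<omega> \<le> y)}
        \<subseteq> {\<omega>\<in>space M. exp (h * x) \<le> (\<Prod>i<k. g (Y i \<omega>))}"
    proof safe
      fix \<omega> assume w: "x \<le> Sm k \<omega>" "\<forall>i<k. Y i \<omega> \<le> y"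
      have "(\<Prod>i<k. g (Y i \<omega>)) = (\<Prod>i<k. exp (h * Y i \<omega>))"
        by (rule prod.cong) (use w in \<open>auto simp: g_def\<close>)
      also have "\<dots> = exp (h * Sm k \<omega>)" by (simp add: Sm_def sum_distrib_left exp_sum)
      finally show "exp (h * x) \<le> (\<Prod>i<k. g (Y i \<omega>))" using w h by simp
    qed
  qed measurable
  also have "\<dots> \<le> expectation (\<lambda>\<omega>. \<Prod>i<k. g (Y i \<omega>)) / exp (h * x)"
    by (rule integral_Markov_inequality_measure[where A="{}"])
       (use prod_int in \<open>auto intro!: prod_nonneg simp: g_def\<close>)
  also have "expectation (\<lambda>\<omega>. \<Prod>i<k. g (Y i \<omega>)) = (\<Prod>i<k. expectation (\<lambda>\<omega>. g (Y i \<omega>)))"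
    by (rule indep_vars_lebesgue_integral[OF _ indg]) (use gY_int in auto)
  also have "\<dots> = (\<Prod>i<k. expectation (\<lambda>\<omega>. g (Y 0 \<omega>)))"
    by (intro prod.cong refl expectation_Y_eq) simp
  also have "\<dots> = expectation (\<lambda>\<omega>. g (Y 0 \<omega>)) ^ k" by simp
  also have "\<dots> \<le> (1 + \<sigma>2 * b) ^ k"
    by (intro power_mono g0 integral_nonneg) (auto simp: g_def)
  also have "(1 + \<sigma>2 * b) ^ k \<le> exp (\<sigma>2 * b) ^ k"
    using b0 \<sigma>2_gt0 by (intro power_mono exp_ge_add_one_self) auto
  also have "\<dots> / exp (h * x) = exp (k * \<sigma>2 * b - h * x)"
    by (simp add: exp_diff exp_of_nat_mult[symmetric] mult.assoc)
  also have "k * \<sigma>2 * b \<le> x / y"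
  proof -
    have "b \<le> (x * y / (k * \<sigma>2)) / y\<^sup>2"
      unfolding b_def using hyp by (intro divide_right_mono) (auto simp: ehy)
    then have "k * \<sigma>2 * b \<le> k * \<sigma>2 * ((x * y / (k * \<sigma>2)) / y\<^sup>2)"
      using kp by (intro mult_left_mono) auto
    also have "\<dots> = x / y" using \<sigma>2_gt0 y k by (simp add: power2_eq_square field_simps)
    finally show ?thesis .
  qed
  also have "h * x = (x / y) * ln (1 + x * y / (k * \<sigma>2))" by (simp add: h_def)
  also have "x / y - (x / y) * ln (1 + x * y / (k * \<sigma>2)) \<le> x / y - (x / y) * ln (x * y / (k * \<sigma>2))"
  proof (intro diff_left_mono mult_left_mono)
    show "ln (x * y / (k * \<sigma>2)) \<le> ln (1 + x * y / (k * \<sigma>2))"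
      using x y kp by (intro ln_mono) (auto simp: divide_pos_pos)
  qed (use x y in auto)
  also have "\<dots> = (x / y) * ln (exp 1 * k * \<sigma>2 / (x * y))"
  proof -
    have "ln (exp 1 * k * \<sigma>2 / (x * y)) = ln (exp 1) + ln (k * \<sigma>2) - ln (x * y)"
      using x y k \<sigma>2_gt0 by (subst ln_div) (auto simp: ln_mult mult.assoc)
    moreover have "ln (x * y / (k * \<sigma>2)) = ln (x*y) - ln (k*\<sigma>2)"
      using x y k \<sigma>2_gt0 by (subst ln_div) auto
    ultimately have "ln (exp 1 * k * \<sigma>2 / (x * y)) = 1 - ln (x * y / (k * \<sigma>2))" by simp
    then show ?thesis by (simp only: right_diff_distrib mult_1_right)
  qed
  also have "exp \<dots> = (exp 1 * k * \<sigma>2 / (x * y)) powr (x / y)"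
    using x y kp k \<sigma>2_gt0 by (simp add: powr_def)
  finally show ?thesis by (simp add: divide_right_mono)
qed

lemma prob_split_ge:
  assumes "i < k"
  shows "\<P>(\<omega> in M. u \<le> Y i \<omega> \<and> v \<le> (\<Sum>j\<in>{..<k}-{i}. Y j \<omega>))
      = xtail u * \<P>(\<omega> in M. v \<le> (\<Sum>j\<in>{..<k}-{i}. Y j \<omega>))"
proof -
  have ind: "indep_var borel (Y i) borel (\<lambda>\<omega>. \<Sum>j\<in>{..<k}-{i}. Y j \<omega>)"
    by (rule indep_vars_sum) (auto intro: indep_vars_subset[OF indep])
  show ?thesis
    using indep_varD[OF ind, of "{u..}" "{v..}"] prob_Y_ge[of u i]
    by (simp add: vimage_def Int_def conj_commute conj_ac)
qed

text \<open>Three ways to reach \<open>x\<close>: one step exceeds \<open>(1 - \<eta>) * x\<close>;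
  one step exceeds \<open>\<eta> * x\<close> and the others still contribute
  \<open>\<eta> * x\<close>, which Chebyshev makes rare; or no step exceeds
  \<open>\<eta> * x\<close>, which is the Fuk-Nagaev case. Only the first term matters for the
  constant.\<close>

lemma walk_tail_upper:
  assumes x: "0 < x" and \<eta>: "0 < \<eta>" "\<eta> < 1" and k: "0 < k"
  shows "\<P>(\<omega> in M. x \<le> Sm k \<omega>) \<le> k * xtail ((1 - \<eta>) * x)
    + k * xtail (\<eta> * x) * (k * \<sigma>2 / (\<eta> * x)\<^sup>2) + (exp 1 * k * \<sigma>2 / (\<eta> * x\<^sup>2)) powr (1 / \<eta>)"
proof -
  let ?A = "\<lambda>i. {\<omega>\<in>space M. (1 - \<eta>) * x \<le> Y i \<omega>}"
  let ?B = "\<lambda>i. {\<omega>\<in>space M. \<eta> * x \<le> Y i \<omega> \<and> \<eta> * x \<le> (\<Sum>j\<in>{..<k}-{i}. Y j \<omega>)}"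
  let ?C = "{\<omega>\<in>space M. x \<le> Sm k \<omega> \<and> (\<forall>i<k. Y i \<omega> \<le> \<eta> * x)}"
  have "{\<omega>\<in>space M. x \<le> Sm k \<omega>} \<subseteq> ((\<Union>i<k. ?A i) \<union> (\<Union>i<k. ?B i)) \<union> ?C"
  proof
    fix \<omega> assume w: "\<omega> \<in> {\<omega>\<in>space M. x \<le> Sm k \<omega>}"
    show "\<omega> \<in> ((\<Union>i<k. ?A i) \<union> (\<Union>i<k. ?B i)) \<union> ?C"
    proof (cases "\<forall>i<k. Y i \<omega> \<le> \<eta> * x")
      case False
      then obtain i where i: "i < k" "\<eta> * x < Y i \<omega>" by auto
      have "Sm k \<omega> = Y i \<omega> + (\<Sum>j\<in>{..<k}-{i}. Y j \<omega>)"
        unfolding Sm_def using i by (simp add: sum.remove)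
      then have "\<omega> \<in> ?A i \<or> \<omega> \<in> ?B i"
        using i w by (cases "(1 - \<eta>) * x \<le> Y i \<omega>") (auto simp: algebra_simps)
      then show ?thesis using i by blast
    qed (use w in auto)
  qed
  then have "\<P>(\<omega> in M. x \<le> Sm k \<omega>) \<le> prob (((\<Union>i<k. ?A i) \<union> (\<Union>i<k. ?B i)) \<union> ?C)"
    by (rule finite_measure_mono) measurable
  also have "\<dots> \<le> prob ((\<Union>i<k. ?A i) \<union> (\<Union>i<k. ?B i)) + prob ?C"
    by (rule measure_Un_le) measurable
  also have "prob ((\<Union>i<k. ?A i) \<union> (\<Union>i<k. ?B i)) \<le> prob (\<Union>i<k. ?A i) + prob (\<Union>i<k. ?B i)"
    by (rule measure_Un_le) measurable
  also have "prob (\<Union>i<k. ?A i) \<le> (\<Sum>i<k. prob (?A i))"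
    by (rule finite_measure_subadditive_finite) auto
  also have "\<dots> = k * xtail ((1 - \<eta>) * x)" by (simp add: prob_Y_ge)
  also have "prob (\<Union>i<k. ?B i) \<le> (\<Sum>i<k. prob (?B i))"
    by (rule finite_measure_subadditive_finite) auto
  also have "\<dots> \<le> (\<Sum>i<k. xtail (\<eta> * x) * (k * \<sigma>2 / (\<eta> * x)\<^sup>2))"
  proof (rule sum_mono)
    fix i assume "i \<in> {..<k}"
    then have i: "i < k" by simp
    have "\<P>(\<omega> in M. \<eta> * x \<le> (\<Sum>j\<in>{..<k}-{i}. Y j \<omega>))
        \<le> \<P>(\<omega> in M. \<eta> * x \<le> \<bar>\<Sum>j\<in>{..<k}-{i}. Y j \<omega>\<bar>)"
      by (rule finite_measure_mono) auto
    also have "\<dots> \<le> card ({..<k}-{i}) * \<sigma>2 / (\<eta> * x)\<^sup>2"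
      by (rule chebyshev_sum) (use x \<eta> in auto)
    also have "\<dots> \<le> k * \<sigma>2 / (\<eta> * x)\<^sup>2"
      using i \<sigma>2_gt0 by (intro divide_right_mono mult_right_mono) auto
    finally show "prob (?B i) \<le> xtail (\<eta> * x) * (k * \<sigma>2 / (\<eta> * x)\<^sup>2)"
      unfolding prob_split_ge[OF i] by (rule mult_left_mono[OF _ xtail_nonneg])
  qed
  also have "\<dots> = k * xtail (\<eta> * x) * (k * \<sigma>2 / (\<eta> * x)\<^sup>2)" by simp
  also have "prob ?C \<le> (exp 1 * k * \<sigma>2 / (x * (\<eta> * x))) powr (x / (\<eta> * x))"
    by (rule fuk_nagaev) (use x \<eta> k in auto)
  also have "\<dots> = (exp 1 * k * \<sigma>2 / (\<eta> * x\<^sup>2)) powr (1 / \<eta>)"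
    using x by (simp add: power2_eq_square mult_ac)
  finally show ?thesis by simp
qed

text \<open>The events that the i-th step alone exceeds \<open>(1 + \<eta>) * x\<close> and the
  other steps do not pull the sum down by more than \<open>\<eta> * x\<close> are disjoint. The two
  subtracted fractions pay for a strongly negative remainder and for a second large step, both by
  Chebyshev.\<close>

lemma walk_tail_lower:
  assumes x: "0 < x" and \<eta>: "0 < \<eta>" and k: "0 < k"
  shows "k * xtail ((1 + \<eta>) * x) * (1 - k * \<sigma>2 / (\<eta> * x)\<^sup>2 - k * \<sigma>2 / x\<^sup>2)
    \<le> \<P>(\<omega> in M. x \<le> Sm k \<omega>)"
proof -
  define u where "u = (1 + \<eta>) * x"
  have u: "x < u" using x \<eta> by (simp add: u_def algebra_simps)
  let ?E = "\<lambda>i. {\<omega>\<in>space M. u \<le> Y i \<omega> \<and> - (\<eta> * x) \<le> (\<Sum>j\<in>{..<k}-{i}. Y j \<omega>)}"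
  let ?G = "\<lambda>i j. {\<omega>\<in>space M. u \<le> Y i \<omega> \<and> u \<le> Y j \<omega>}"
  let ?F = "\<lambda>i. ?E i - (\<Union>j\<in>{..<k}-{i}. ?G i j)"
  have [measurable]: "?F i \<in> sets M" for i by measurable
  have pF: "xtail u * (1 - k * \<sigma>2 / (\<eta> * x)\<^sup>2 - k * \<sigma>2 / x\<^sup>2) \<le> prob (?F i)" if i: "i < k" for i
  proof -
    have "prob (?E i) \<le> prob (?F i \<union> (\<Union>j\<in>{..<k}-{i}. ?G i j))"
      by (rule finite_measure_mono) auto
    also have "\<dots> \<le> prob (?F i) + prob (\<Union>j\<in>{..<k}-{i}. ?G i j)"
      by (rule measure_Un_le) measurable
    also have "prob (\<Union>j\<in>{..<k}-{i}. ?G i j) \<le> (\<Sum>j\<in>{..<k}-{i}. prob (?G i j))"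
      by (rule finite_measure_subadditive_finite) auto
    also have "\<dots> = (\<Sum>j\<in>{..<k}-{i}. xtail u * xtail u)"
    proof (rule sum.cong[OF refl])
      fix j assume j: "j \<in> {..<k} - {i}"
      have ind: "indep_var borel (Y i) borel (\<lambda>\<omega>. \<Sum>j\<in>{j}. Y j \<omega>)"
        by (rule indep_vars_sum) (use j in \<open>auto intro: indep_vars_subset[OF indep]\<close>)
      show "prob (?G i j) = xtail u * xtail u"
        using indep_varD[OF ind, of "{u..}" "{u..}"] prob_Y_ge[of u i] prob_Y_ge[of u j]
        by (simp add: vimage_def Int_def conj_commute conj_ac)
    qed
    also have "\<dots> \<le> k * (xtail u * xtail u)"
      by (simp add: i card_Diff_singleton mult_right_mono xtail_nonneg)
    also have "\<dots> \<le> k * (xtail u * (\<sigma>2 / x\<^sup>2))"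
    proof (intro mult_left_mono xtail_nonneg)
      show "xtail u \<le> \<sigma>2 / x\<^sup>2" using xtail_antimono[of x u] xtail_chebyshev[OF x] u by linarith
    qed auto
    finally have 1: "prob (?E i) \<le> prob (?F i) + xtail u * (k * \<sigma>2 / x\<^sup>2)"
      by (simp add: mult_ac)
    have "1 - k * \<sigma>2 / (\<eta> * x)\<^sup>2 \<le> \<P>(\<omega> in M. - (\<eta> * x) \<le> (\<Sum>j\<in>{..<k}-{i}. Y j \<omega>))"
    proof -
      have "prob (space M - {\<omega>\<in>space M. - (\<eta> * x) \<le> (\<Sum>j\<in>{..<k}-{i}. Y j \<omega>)})
        \<le> \<P>(\<omega> in M. \<eta> * x \<le> \<bar>\<Sum>j\<in>{..<k}-{i}. Y j \<omega>\<bar>)"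
        by (rule finite_measure_mono) auto
      also have "\<dots> \<le> card ({..<k}-{i}) * \<sigma>2 / (\<eta> * x)\<^sup>2"
        by (rule chebyshev_sum) (use x \<eta> in auto)
      also have "\<dots> \<le> k * \<sigma>2 / (\<eta> * x)\<^sup>2"
        using i \<sigma>2_gt0 by (intro divide_right_mono mult_right_mono) auto
      finally show ?thesis by (subst (asm) prob_compl) auto
    qed
    then have "xtail u * (1 - k * \<sigma>2 / (\<eta> * x)\<^sup>2) \<le> prob (?E i)"
      unfolding prob_split_ge[OF i] by (rule mult_left_mono[OF _ xtail_nonneg])
    with 1 show ?thesis by (simp add: algebra_simps)
  qed
  have "k * (xtail u * (1 - k * \<sigma>2 / (\<eta> * x)\<^sup>2 - k * \<sigma>2 / x\<^sup>2)) \<le> (\<Sum>i<k. prob (?F i))"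
    using sum_mono[of "{..<k}" "\<lambda>_. xtail u * (1 - k * \<sigma>2 / (\<eta> * x)\<^sup>2 - k * \<sigma>2 / x\<^sup>2)" "\<lambda>i. prob (?F i)"] pF
    by simp
  also have "\<dots> = prob (\<Union>i<k. ?F i)"
  proof (rule finite_measure_finite_Union[symmetric])
    show "disjoint_family_on ?F {..<k}"
      unfolding disjoint_family_on_def by auto
  qed auto
  also have "\<dots> \<le> \<P>(\<omega> in M. x \<le> Sm k \<omega>)"
  proof (rule finite_measure_mono)
    show "(\<Union>i<k. ?F i) \<subseteq> {\<omega>\<in>space M. x \<le> Sm k \<omega>}"
    proof
      fix \<omega> assume "\<omega> \<in> (\<Union>i<k. ?F i)"
      then obtain i where i: "i < k" "\<omega> \<in> space M" "u \<le> Y i \<omega>"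
        "- (\<eta> * x) \<le> (\<Sum>j\<in>{..<k}-{i}. Y j \<omega>)" by auto
      have "Sm k \<omega> = Y i \<omega> + (\<Sum>j\<in>{..<k}-{i}. Y j \<omega>)"
        unfolding Sm_def using i by (simp add: sum.remove)
      then show "\<omega> \<in> {\<omega>\<in>space M. x \<le> Sm k \<omega>}" using i by (simp add: u_def algebra_simps)
    qed
  qed measurable
  finally show ?thesis unfolding u_def by (simp add: mult.assoc)
qed

text \<open>Negating the steps turns the closed upper tail of the walk into a distribution function,
  to which the central limit theorem and \<open>polya_uniform\<close> apply.\<close>

lemma uniform_clt:
  assumes e: "0 < e"
  shows "\<forall>\<^sub>F k in sequentially. \<forall>x.
    \<bar>\<P>(\<omega> in M. x * sqrt (k * \<sigma>2) \<le> Sm k \<omega>) - cdf std_normal_distribution (- x)\<bar> \<le> e"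
proof -
  define T where "T n \<omega> = (\<Sum>i<n. - Y i \<omega>) / sqrt (n * (sqrt \<sigma>2)\<^sup>2)" for n \<omega>
  have [measurable]: "T n \<in> borel_measurable M" for n unfolding T_def by measurable
  interpret N: real_distribution std_normal_distribution by (rule real_dist_normal_dist)
  interpret D: real_distribution "distr M borel (T n)" for n by (rule real_distribution_distr) simp
  have wc: "weak_conv_m (\<lambda>n. distr M borel (T n)) std_normal_distribution"
    unfolding T_def
  proof (rule central_limit_theorem_zero_mean[where \<mu>="distr M borel (\<lambda>\<omega>. - Y 0 \<omega>)"])
    show "indep_vars (\<lambda>i. borel) (\<lambda>i \<omega>. - Y i \<omega>) UNIV"
      by (rule indep_vars_compose2[OF indep]) auto
    show "0 < sqrt \<sigma>2" using \<sigma>2_gt0 by simp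
    show "expectation (\<lambda>\<omega>. - Y n \<omega>) = 0" for n using Y_mean by simp
    show "integrable M (\<lambda>\<omega>. (- Y n \<omega>)\<^sup>2)" for n using Y_sq_int by simp
    show "variance (\<lambda>\<omega>. - Y n \<omega>) = (sqrt \<sigma>2)\<^sup>2" for n
      using Y_mean Y_sq \<sigma>2_gt0 by simp
    show "distr M borel (\<lambda>\<omega>. - Y n \<omega>) = distr M borel (\<lambda>\<omega>. - Y 0 \<omega>)" for n
    proof -
      have "distr (distr M borel (Y n)) borel uminus = distr (distr M borel (Y 0)) borel uminus"
        by (simp only: ident[of n])
      then show ?thesis by (simp add: distr_distr comp_def)
    qed
  qed
  have cont: "isCont (cdf std_normal_distribution) x" for x
  proof -
    have "emeasure std_normal_distribution {x} = 0"
      by (subst emeasure_density) (auto simp: nn_integral_indicator_singleton' max_def)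
    then show ?thesis by (subst N.isCont_cdf) (simp add: measure_def)
  qed
  have "\<forall>\<^sub>F k in sequentially. \<forall>x. \<bar>cdf (distr M borel (T k)) x - cdf std_normal_distribution x\<bar> \<le> 2 * (e / 2)"
  proof (rule polya_uniform)
    show "cdf (distr M borel (T n)) x \<le> cdf (distr M borel (T n)) y" if "x \<le> y" for n x y
      using that by (rule D.cdf_nondecreasing)
    show "0 \<le> cdf (distr M borel (T n)) x \<and> cdf (distr M borel (T n)) x \<le> 1" for n x
      using D.cdf_nonneg D.cdf_bounded_prob by auto
    show "cdf std_normal_distribution x \<le> cdf std_normal_distribution y" if "x \<le> y" for x y
      using that by (rule N.cdf_nondecreasing)
    show "0 \<le> cdf std_normal_distribution x \<and> cdf std_normal_distribution x \<le> 1" for x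
      using N.cdf_nonneg N.cdf_bounded_prob by auto
    show "continuous_on UNIV (cdf std_normal_distribution)"
      using cont by (simp add: continuous_on_eq_continuous_at)
    show "(\<lambda>n. cdf (distr M borel (T n)) x) \<longlonglongrightarrow> cdf std_normal_distribution x" for x
      using wc cont unfolding weak_conv_m_def weak_conv_def by auto
  qed (use e N.cdf_lim_at_bot N.cdf_lim_at_top_prob in auto)
  then show ?thesis
    using eventually_gt_at_top[of 0]
  proof eventually_elim
    case (elim k)
    have s: "0 < sqrt (k * \<sigma>2)" using elim \<sigma>2_gt0 by simp
    have "cdf (distr M borel (T k)) (- x) = \<P>(\<omega> in M. x * sqrt (k * \<sigma>2) \<le> Sm k \<omega>)" for x
    proof -
      have "T k \<omega> \<le> - x \<longleftrightarrow> x * sqrt (k * \<sigma>2) \<le> Sm k \<omega>" for \<omega>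
      proof -
        have "T k \<omega> = - Sm k \<omega> / sqrt (k * \<sigma>2)" using \<sigma>2_gt0 by (simp add: T_def Sm_def sum_negf)
        then show ?thesis using s by (simp add: pos_divide_le_eq pos_le_divide_eq minus_le_iff neg_le_iff_le)
      qed
      then show ?thesis
        by (simp add: cdf_def measure_distr vimage_def Int_def conj_commute)
    qed
    moreover have "\<bar>cdf (distr M borel (T k)) (- x) - cdf std_normal_distribution (- x)\<bar> \<le> e" for x
      using elim(1) by simp
    ultimately show ?case by simp
  qed
qed

end

section \<open>Probability generating functions\<close>

text \<open>Polymorphic, because the iterates act both on the real interval (Laplace transforms,
  extinction) and on the complex disc (Fourier transforms).\<close>

definition pgf :: "nat pmf \<Rightarrow> 'a::{real_normed_field,banach} \<Rightarrow> 'a" where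
  "pgf p z = (\<Sum>k. of_real (pmf p k) * z ^ k)"

definition dpgf :: "nat pmf \<Rightarrow> 'a::{real_normed_field,banach} \<Rightarrow> 'a" where
  "dpgf p z = (\<Sum>k. diffs (\<lambda>k. of_real (pmf p k)) k * z ^ k)"

abbreviation pgf_iter :: "nat pmf \<Rightarrow> nat \<Rightarrow> 'a::{real_normed_field,banach} \<Rightarrow> 'a" where
  "pgf_iter p n \<equiv> pgf p ^^ n"

lemma offspring_gf_eq_pgf: "offspring_gf p = pgf p"
  by (simp add: fun_eq_iff offspring_gf_def pgf_def)

lemma pmf_nat_sums_integral:
  fixes g :: "nat \<Rightarrow> 'b::{banach, second_countable_topology}"
  assumes "integrable (measure_pmf p) g"
  shows "(\<lambda>k. pmf p k *\<^sub>R g k) sums measure_pmf.expectation p g"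
    and "summable (\<lambda>k. norm (pmf p k *\<^sub>R g k))"
proof -
  have i: "integrable (count_space UNIV) (\<lambda>k. pmf p k *\<^sub>R g k)"
    using assms unfolding measure_pmf_eq_density by (simp add: integrable_density)
  have e: "measure_pmf.expectation p g = integral\<^sup>L (count_space UNIV) (\<lambda>k. pmf p k *\<^sub>R g k)"
    unfolding measure_pmf_eq_density by (simp add: integral_density)
  show "(\<lambda>k. pmf p k *\<^sub>R g k) sums measure_pmf.expectation p g"
    unfolding e by (rule sums_integral_count_space_nat[OF i])
  show "summable (\<lambda>k. norm (pmf p k *\<^sub>R g k))"
    using i by (simp add: integrable_count_space_nat_iff)
qed

lemma pmf_nat_sums: "pmf (p :: nat pmf) sums 1"
  using pmf_nat_sums_integral(1)[of p "\<lambda>_. 1::real"] by simp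

lemma summable_norm_pgf:
  fixes z :: "'a::{real_normed_field,banach}"
  assumes "norm z \<le> 1"
  shows "summable (\<lambda>k. norm (of_real (pmf p k) * z ^ k))"
proof (rule summable_comparison_test'[OF sums_summable[OF pmf_nat_sums[of p]]])
  show "norm (norm (of_real (pmf p k) * z ^ k)) \<le> pmf p k" for k
    using assms by (auto simp: norm_mult norm_power intro!: mult_left_le power_le_one)
qed

lemma summable_pgf:
  fixes z :: "'a::{real_normed_field,banach}"
  shows "norm z \<le> 1 \<Longrightarrow> summable (\<lambda>k. of_real (pmf p k) * z ^ k)"
  by (rule summable_norm_cancel[OF summable_norm_pgf])

lemma pgf_1 [simp]: "pgf p 1 = 1"
proof -
  have "(\<lambda>k. of_real (pmf p k) :: 'a) sums of_real 1"
    by (rule sums_of_real[OF pmf_nat_sums])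
  then show ?thesis by (simp add: pgf_def sums_iff)
qed

lemma pgf_of_real:
  assumes "\<bar>x\<bar> \<le> 1"
  shows "pgf p (of_real x :: 'a::{real_normed_field,banach}) = of_real (pgf p x)"
proof -
  have "(\<lambda>k. of_real (of_real (pmf p k) * x ^ k) :: 'a) sums of_real (pgf p x)"
    unfolding pgf_def by (rule sums_of_real[OF summable_sums[OF summable_pgf]]) (use assms in simp)
  then show ?thesis by (simp add: pgf_def sums_iff)
qed

lemma norm_pgf_le:
  fixes z :: "'a::{real_normed_field,banach}"
  assumes "norm z \<le> r" "r \<le> 1"
  shows "norm (pgf p z) \<le> pgf p r"
proof -
  have r: "0 \<le> r" using assms(1) norm_ge_zero[of z] by linarith
  have "norm (pgf p z) \<le> (\<Sum>k. norm (of_real (pmf p k) * z ^ k))"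
    unfolding pgf_def by (rule summable_norm[OF summable_norm_pgf]) (use assms in linarith)
  also have "\<dots> \<le> (\<Sum>k. of_real (pmf p k) * r ^ k)"
  proof (rule suminf_le)
    show "norm (of_real (pmf p k) * z ^ k) \<le> of_real (pmf p k) * r ^ k" for k
      using assms by (auto simp: norm_mult norm_power intro!: mult_left_mono power_mono)
    show "summable (\<lambda>k. norm (of_real (pmf p k) * z ^ k))"
      by (rule summable_norm_pgf) (use assms in linarith)
    show "summable (\<lambda>k. of_real (pmf p k) * r ^ k)"
      by (rule summable_pgf) (use assms r in auto)
  qed
  finally show ?thesis by (simp add: pgf_def)
qed

lemma pgf_nonneg: "0 \<le> s \<Longrightarrow> s \<le> 1 \<Longrightarrow> 0 \<le> pgf p (s::real)"
  unfolding pgf_def by (intro suminf_nonneg summable_pgf) auto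

lemma pgf_mono: "0 \<le> s \<Longrightarrow> s \<le> t \<Longrightarrow> t \<le> 1 \<Longrightarrow> pgf p s \<le> pgf p (t::real)"
  using norm_pgf_le[of s t p] by simp

lemma pgf_le_1: "0 \<le> s \<Longrightarrow> s \<le> 1 \<Longrightarrow> pgf p s \<le> (1::real)"
  using pgf_mono[of s 1 p] by simp

lemma has_derivative_pgf:
  fixes z :: "'a::{real_normed_field,banach}"
  assumes "norm z < 1"
  shows "(pgf p has_field_derivative dpgf p z) (at z within S)"
proof -
  have "DERIV (\<lambda>x. \<Sum>k. of_real (pmf p k) * x ^ k) z :> (\<Sum>k. diffs (\<lambda>k. of_real (pmf p k)) k * z ^ k)"
    by (rule termdiffs_strong[of _ 1]) (use assms summable_pgf[of 1] in auto)
  then show ?thesis unfolding pgf_def[abs_def] dpgf_def by (rule has_field_derivative_at_within)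
qed

lemma summable_norm_dpgf:
  fixes z :: "'a::{real_normed_field,banach}"
  assumes "norm z < 1"
  shows "summable (\<lambda>k. norm (diffs (\<lambda>k. of_real (pmf p k)) k * z ^ k))"
proof -
  have "summable (\<lambda>k. diffs (\<lambda>k. pmf p k) k * norm z ^ k)"
    by (rule termdiff_converges[of "norm z" 1])
       (use assms summable_pgf[where 'a = real and p = p] in auto)
  then show ?thesis by (simp add: diffs_def norm_mult norm_power del: of_nat_Suc)
qed

lemma norm_dpgf_le:
  fixes z :: "'a::{real_normed_field,banach}"
  assumes "norm z \<le> r" "r < 1"
  shows "norm (dpgf p z) \<le> dpgf p r"
proof -
  have r: "0 \<le> r" using assms(1) norm_ge_zero[of z] by linarith
  have "norm (dpgf p z) \<le> (\<Sum>k. norm (diffs (\<lambda>k. of_real (pmf p k)) k * z ^ k))"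
    unfolding dpgf_def by (rule summable_norm[OF summable_norm_dpgf]) (use assms in linarith)
  also have "\<dots> \<le> (\<Sum>k. diffs (\<lambda>k. of_real (pmf p k)) k * r ^ k)"
  proof (rule suminf_le)
    show "norm (diffs (\<lambda>k. of_real (pmf p k)) k * z ^ k) \<le> diffs (\<lambda>k. of_real (pmf p k)) k * r ^ k" for k
      using assms by (auto simp: norm_mult norm_power diffs_def simp del: of_nat_Suc
        intro!: mult_left_mono power_mono)
    show "summable (\<lambda>k. norm (diffs (\<lambda>k. of_real (pmf p k)) k * z ^ k))"
      by (rule summable_norm_dpgf) (use assms in linarith)
    show "summable (\<lambda>k. diffs (\<lambda>k. of_real (pmf p k)) k * r ^ k)"
      by (rule summable_norm_cancel[OF summable_norm_dpgf]) (use assms r in auto)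
  qed
  finally show ?thesis by (simp add: dpgf_def)
qed

lemma dpgf_nonneg: "0 \<le> s \<Longrightarrow> s < 1 \<Longrightarrow> 0 \<le> dpgf p (s::real)"
  using order_trans[OF norm_ge_zero norm_dpgf_le[of s s p]] by simp

lemma pgf_lipschitz:
  fixes z w :: "'a::{real_normed_field,banach}"
  assumes "norm z \<le> r" "norm w \<le> r" "r < 1"
  shows "norm (pgf p z - pgf p w) \<le> dpgf p r * norm (z - w)"
proof (rule field_differentiable_bound[of "cball 0 r"])
  show "(pgf p has_field_derivative dpgf p x) (at x within cball 0 r)" if "x \<in> cball 0 r" for x :: 'a
    by (rule has_derivative_pgf) (use that assms in auto)
  show "norm (dpgf p x) \<le> dpgf p r" if "x \<in> cball 0 r" for x :: 'a
    by (rule norm_dpgf_le) (use that assms in auto)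
qed (use assms in auto)

text \<open>The second derivative is a power series with nonnegative coefficients, so its value at
  \<open>R < 1\<close> bounds it on the whole interval. The linear error term is what makes products
  of derivatives along an orbit comparable to a pure power.\<close>

lemma dpgf_lipschitz:
  assumes "0 \<le> q" "q < 1" "q \<le> R" "R < 1"
  shows "\<exists>L\<ge>0. \<forall>r\<in>{q..R}. dpgf p r \<le> dpgf p q + L * (r - (q::real))"
proof -
  let ?c = "diffs (pmf p)"
  define K where "K = (R + 1) / 2"
  have K: "0 < K" "R < K" "K < 1" using assms by (auto simp: K_def)
  have sK: "summable (\<lambda>k. ?c k * K ^ k)"
    using summable_norm_cancel[OF summable_norm_dpgf[of K p]] K by simp
  have der: "DERIV (\<lambda>x. \<Sum>k. ?c k * x ^ k) x :> (\<Sum>k. diffs ?c k * x ^ k)"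
    if "x \<in> {q..R}" for x
    by (rule termdiffs_strong[OF sK]) (use that K assms in auto)
  define L where "L = (\<Sum>k. diffs ?c k * R ^ k)"
  have dd0: "0 \<le> diffs ?c k" for k by (simp add: diffs_def)
  have sd: "summable (\<lambda>k. diffs ?c k * x ^ k)" if "x \<in> {q..R}" for x
    by (rule termdiff_converges[of x K])
       (use that K assms in \<open>auto intro: powser_inside[OF sK]\<close>)
  have Lx: "(\<Sum>k. diffs ?c k * x ^ k) \<le> L" if "x \<in> {q..R}" for x
    unfolding L_def by (rule suminf_le) (use that assms sd in \<open>auto intro!: mult_left_mono power_mono dd0\<close>)
  have L0: "0 \<le> L"
    unfolding L_def by (rule suminf_nonneg) (use assms sd[of R] dd0 in auto)
  show ?thesis
  proof (intro exI[of _ L] conjI ballI L0)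
    fix r assume r: "r \<in> {q..R}"
    have eq: "dpgf p x = (\<Sum>k. ?c k * x ^ k)" for x :: real by (simp add: dpgf_def)
    show "dpgf p r \<le> dpgf p q + L * (r - q)"
    proof (cases "q = r")
      case False
      then have "q < r" using r by auto
      then obtain x where x: "q < x" "x < r"
        "(\<Sum>k. ?c k * r ^ k) - (\<Sum>k. ?c k * q ^ k) = (r - q) * (\<Sum>k. diffs ?c k * x ^ k)"
        using MVT2[of q r "\<lambda>x. \<Sum>k. ?c k * x ^ k" "\<lambda>x. \<Sum>k. diffs ?c k * x ^ k"] der r by auto
      have "(r - q) * (\<Sum>k. diffs ?c k * x ^ k) \<le> (r - q) * L"
        using x r \<open>q < r\<close> by (intro mult_left_mono Lx) auto
      then show ?thesis using x(3) by (simp add: eq mult.commute)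
    qed simp
  qed
qed

lemma pgf_iter_range: "0 \<le> s \<Longrightarrow> s \<le> 1 \<Longrightarrow> 0 \<le> pgf_iter p n s \<and> pgf_iter p n s \<le> (1::real)"
  by (induction n) (auto simp: pgf_nonneg pgf_le_1)

lemma norm_pgf_iter_le:
  fixes z :: "'a::{real_normed_field,banach}"
  assumes "norm z \<le> r" "r \<le> 1"
  shows "norm (pgf_iter p n z) \<le> pgf_iter p n r"
proof (induction n)
  case (Suc n)
  have "0 \<le> r" using assms(1) norm_ge_zero[of z] by linarith
  then show ?case using Suc pgf_iter_range[of r n p] assms by (auto intro: norm_pgf_le)
qed (use assms in simp)

lemma pgf_iter_mono: "0 \<le> s \<Longrightarrow> s \<le> t \<Longrightarrow> t \<le> 1 \<Longrightarrow> pgf_iter p n s \<le> pgf_iter p n (t::real)"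
  using norm_pgf_iter_le[of s t n p] by simp

lemma pgf_iter_of_real:
  assumes "0 \<le> x" "x \<le> 1"
  shows "pgf_iter p n (of_real x :: 'a::{real_normed_field,banach}) = of_real (pgf_iter p n x)"
proof (induction n)
  case (Suc n)
  then show ?case using pgf_iter_range[OF assms, of n p] by (simp add: pgf_of_real)
qed simp

text \<open>Convexity: at \<open>s\<close> the power lies below its chord through \<open>t\<close>
  and 1. Denominators are cleared so that the inequality can be summed over
  \<open>k\<close>.\<close>

lemma power_chord_le:
  fixes s t :: real
  assumes "0 \<le> t" "t \<le> s" "s \<le> 1"
  shows "s ^ k * (1 - t) \<le> t ^ k * (1 - s) + (s - t)"
proof (induction k)
  case (Suc k)
  have "s * (s ^ k * (1 - t)) \<le> s * (t ^ k * (1 - s) + (s - t))"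
    using Suc assms by (intro mult_left_mono) auto
  moreover have "0 \<le> (s - t) * (1 - s) * (1 - t ^ k)"
    using assms by (intro mult_nonneg_nonneg) (auto intro: power_le_one)
  ultimately show ?case by (simp add: algebra_simps)
qed simp

lemma pgf_chord_le:
  fixes s t :: real
  assumes "0 \<le> t" "t \<le> s" "s \<le> 1"
  shows "pgf p s * (1 - t) \<le> pgf p t * (1 - s) + (s - t)"
proof -
  have sm: "(\<lambda>k. pmf p k * x ^ k) sums pgf p x" if "0 \<le> x" "x \<le> 1" for x :: real
    using summable_sums[OF summable_pgf[of x p]] that by (simp add: pgf_def)
  have 1: "(\<lambda>k. pmf p k * s ^ k * (1 - t)) sums (pgf p s * (1 - t))"
    using assms by (intro sums_mult2 sm) auto
  have 2: "(\<lambda>k. pmf p k * t ^ k * (1 - s) + pmf p k * (s - t)) sums (pgf p t * (1 - s) + 1 * (s - t))"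
    using assms by (intro sums_add sums_mult2 sm pmf_nat_sums) auto
  have "pmf p k * s ^ k * (1 - t) \<le> pmf p k * t ^ k * (1 - s) + pmf p k * (s - t)" for k
    using mult_left_mono[OF power_chord_le[OF assms, of k], of "pmf p k"] by (simp add: algebra_simps)
  from sums_le[OF this 1 2] show ?thesis by simp
qed

locale pgf_fixpoint =
  fixes p :: "nat pmf" and q :: real
  assumes q_fix: "pgf p q = q" and q_range: "0 \<le> q" "q < 1"
    and dpgf_q: "0 < dpgf p q" "dpgf p q < 1"
begin

text \<open>The slope at \<open>q\<close> is below 1, so the graph falls below the diagonal just to
  the right of \<open>q\<close>; convexity, used as a chord ending at (1, 1), keeps it there up to
  1.\<close>

lemma pgf_less_self:
  assumes "q < s" "s < 1"
  shows "pgf p s < s"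
proof -
  have "((\<lambda>x. pgf p x - x) has_real_derivative (dpgf p q - 1)) (at q)"
    by (intro derivative_intros has_derivative_pgf) (use q_range in auto)
  then obtain d where d: "0 < d" "\<And>h. 0 < h \<Longrightarrow> h < d \<Longrightarrow> pgf p (q + h) - (q + h) < pgf p q - q"
    using DERIV_neg_dec_right[of "\<lambda>x. pgf p x - x" "dpgf p q - 1" q] dpgf_q by auto
  define t where "t = q + min (d / 2) ((s - q) / 2)"
  have t: "q < t" "t < s" using d(1) assms by (auto simp: t_def min_def field_simps)
  have ft: "pgf p t < t" using d(2)[of "t - q"] d(1) t assms q_fix by (auto simp: t_def min_def field_simps split: if_splits)
  have "pgf p s * (1 - t) \<le> pgf p t * (1 - s) + (s - t)"
    by (rule pgf_chord_le) (use t q_range assms in auto)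
  also have "\<dots> < t * (1 - s) + (s - t)" using ft assms by simp
  also have "\<dots> = s * (1 - t)" by (simp add: algebra_simps)
  finally show ?thesis using t assms by simp
qed

lemma fixpoint_unique: "q \<le> s \<Longrightarrow> s < 1 \<Longrightarrow> pgf p s = s \<Longrightarrow> s = q"
  using pgf_less_self[of s] by (cases "s = q") auto

lemma pgf_iter_q: "pgf_iter p n q = q"
  by (induction n) (auto simp: q_fix)

lemma pgf_iter_bounds:
  assumes "q \<le> r" "r < 1"
  shows "q \<le> pgf_iter p n r \<and> pgf_iter p n r \<le> r"
proof (induction n)
  case (Suc n)
  then have "pgf p q \<le> pgf p (pgf_iter p n r)" using q_range assms by (intro pgf_mono) auto
  moreover have "pgf p (pgf_iter p n r) \<le> pgf_iter p n r"
    using Suc pgf_less_self[of "pgf_iter p n r"] q_fix assms by (cases "pgf_iter p n r = q") auto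
  ultimately show ?case using Suc q_fix by auto
qed (use assms in auto)

lemma pgf_iter_tendsto_q:
  assumes "q \<le> r" "r < 1"
  shows "(\<lambda>n. pgf_iter p n r) \<longlonglongrightarrow> q"
proof -
  have dec: "decseq (\<lambda>n. pgf_iter p n r)"
  proof (rule decseq_SucI)
    fix n show "pgf_iter p (Suc n) r \<le> pgf_iter p n r"
      using pgf_less_self[of "pgf_iter p n r"] pgf_iter_bounds[OF assms, of n] assms q_fix
      by (cases "pgf_iter p n r = q") auto
  qed
  then obtain l where l: "(\<lambda>n. pgf_iter p n r) \<longlonglongrightarrow> l"
    using decseq_convergent[of "\<lambda>n. pgf_iter p n r" q] pgf_iter_bounds[OF assms] by blast
  have lb: "q \<le> l" "l \<le> r"
    using LIMSEQ_le_const[OF l] LIMSEQ_le_const2[OF l] pgf_iter_bounds[OF assms] by auto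
  have "isCont (pgf p) l"
    by (rule DERIV_isCont[OF has_derivative_pgf]) (use lb assms q_range in auto)
  then have "(\<lambda>n. pgf p (pgf_iter p n r)) \<longlonglongrightarrow> pgf p l" using l by (rule isCont_tendsto_compose)
  moreover have "(\<lambda>n. pgf p (pgf_iter p n r)) \<longlonglongrightarrow> l" using LIMSEQ_Suc[OF l] by simp
  ultimately have "pgf p l = l" by (rule LIMSEQ_unique)
  then show ?thesis using fixpoint_unique[of l] lb assms l by auto
qed

text \<open>The distances of the orbit of \<open>r\<close> to \<open>q\<close> are summable by the
  ratio test, and the derivative along the orbit exceeds \<open>dpgf p q\<close> by at most a
  multiple of them. The product therefore differs from the pure power by a bounded factor. A rate
  slightly worse than \<open>dpgf p q\<close> would lose the exact exponent
  \<open>\<alpha>\<close>.\<close>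

lemma prod_dpgf_bound:
  assumes r: "q \<le> r" "r < 1"
  shows "\<exists>C>0. \<forall>n. (\<Prod>i<n. dpgf p (pgf_iter p i r)) \<le> C * dpgf p q ^ n"
proof -
  define \<gamma> where "\<gamma> = dpgf p q"
  have \<gamma>: "0 < \<gamma>" "\<gamma> < 1" using dpgf_q by (auto simp: \<gamma>_def)
  define a where "a i = pgf_iter p i r - q" for i
  have a0: "0 \<le> a i" for i using pgf_iter_bounds[OF r, of i] by (simp add: a_def)
  obtain L where L: "0 \<le> L" "\<And>x. x \<in> {q..r} \<Longrightarrow> dpgf p x \<le> \<gamma> + L * (x - q)"
    using dpgf_lipschitz[OF q_range r] unfolding \<gamma>_def by blast
  have da: "dpgf p (pgf_iter p i r) \<le> \<gamma> + L * a i" for i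
    using L(2)[of "pgf_iter p i r"] pgf_iter_bounds[OF r, of i] by (auto simp: a_def)
  have d0: "0 \<le> dpgf p (pgf_iter p i r)" for i
    using pgf_iter_bounds[OF r, of i] q_range r by (intro dpgf_nonneg) auto
  have a_lim: "a \<longlonglongrightarrow> 0"
    unfolding a_def using tendsto_diff[OF pgf_iter_tendsto_q[OF r] tendsto_const[of q]] by simp
  have "(\<lambda>i. \<gamma> + L * a i) \<longlonglongrightarrow> \<gamma> + L * 0" by (intro tendsto_intros a_lim)
  then have "\<forall>\<^sub>F i in sequentially. \<gamma> + L * a i < (1 + \<gamma>) / 2"
    by (rule order_tendstoD) (use \<gamma> in auto)
  then obtain N where N: "\<And>i. N \<le> i \<Longrightarrow> \<gamma> + L * a i < (1 + \<gamma>) / 2"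
    by (auto simp: eventually_sequentially)
  have "summable a"
  proof (rule summable_ratio_test[of "(1 + \<gamma>) / 2" N])
    show "norm (a (Suc n)) \<le> (1 + \<gamma>) / 2 * norm (a n)" if "N \<le> n" for n
    proof -
      let ?x = "pgf_iter p n r"
      have "norm (pgf p ?x - pgf p q) \<le> dpgf p ?x * norm (?x - q)"
        by (rule pgf_lipschitz) (use pgf_iter_bounds[OF r, of n] q_range r in auto)
      then have "norm (a (Suc n)) \<le> dpgf p ?x * norm (a n)" by (simp add: a_def q_fix)
      also have "\<dots> \<le> (1 + \<gamma>) / 2 * norm (a n)"
        using da[of n] N[OF that] by (intro mult_right_mono) auto
      finally show ?thesis .
    qed
  qed (use \<gamma> in auto)
  then have Sa: "(\<Sum>i<n. a i) \<le> suminf a" for n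
    by (intro sum_le_suminf) (use a0 in auto)
  show ?thesis
  proof (intro exI[of _ "exp (L / \<gamma> * suminf a)"] conjI allI)
    fix n
    have "(\<Prod>i<n. dpgf p (pgf_iter p i r)) \<le> (\<Prod>i<n. \<gamma> * exp (L / \<gamma> * a i))"
    proof (rule prod_mono)
      fix i
      have "dpgf p (pgf_iter p i r) \<le> \<gamma> * (1 + L / \<gamma> * a i)"
        using da[of i] \<gamma> by (simp add: algebra_simps)
      also have "\<dots> \<le> \<gamma> * exp (L / \<gamma> * a i)" using \<gamma> by (intro mult_left_mono exp_ge_add_one_self) auto
      finally show "0 \<le> dpgf p (pgf_iter p i r) \<and> dpgf p (pgf_iter p i r) \<le> \<gamma> * exp (L / \<gamma> * a i)"
        using d0 by auto
    qed
    also have "\<dots> = \<gamma> ^ n * exp (L / \<gamma> * (\<Sum>i<n. a i))"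
      by (simp add: prod.distrib exp_sum sum_distrib_left)
    also have "\<dots> \<le> \<gamma> ^ n * exp (L / \<gamma> * suminf a)"
      using \<gamma> L Sa by (intro mult_left_mono iffD2[OF exp_le_cancel_iff] mult_left_mono) auto
    finally show "(\<Prod>i<n. dpgf p (pgf_iter p i r)) \<le> exp (L / \<gamma> * suminf a) * dpgf p q ^ n"
      by (simp add: \<gamma>_def mult.commute)
  qed simp
qed

text \<open>Iterates of complex points of modulus at most \<open>R\<close> are dominated by the real
  orbit of \<open>R\<close>, so the product of derivatives along that orbit is a Lipschitz constant
  on the whole disc.\<close>

lemma pgf_iter_lipschitz:
  assumes r1: "r < 1"
  shows "\<exists>C>0. \<forall>n. \<forall>z w :: 'a::{real_normed_field,banach}. norm z \<le> r \<longrightarrow> norm w \<le> r \<longrightarrow>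
    norm (pgf_iter p n z - pgf_iter p n w) \<le> C * dpgf p q ^ n * norm (z - w)"
proof -
  \<comment> \<open>The real orbit has to start at or above \<open>q\<close>, where it decreases to
    \<open>q\<close>.\<close>
  define R where "R = max r q"
  have R: "q \<le> R" "R < 1" using r1 q_range by (auto simp: R_def)
  obtain C where C: "0 < C" "\<And>n. (\<Prod>i<n. dpgf p (pgf_iter p i R)) \<le> C * dpgf p q ^ n"
    using prod_dpgf_bound[OF R] by blast
  have main: "norm (pgf_iter p n z - pgf_iter p n w) \<le> (\<Prod>i<n. dpgf p (pgf_iter p i R)) * norm (z - w)"
    if "norm z \<le> R" "norm w \<le> R" for n and z w :: 'a
  proof (induction n)
    case (Suc n)
    let ?R = "pgf_iter p n R"
    have b: "?R < 1" "0 \<le> ?R" using pgf_iter_bounds[OF R, of n] R q_range by auto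
    have "norm (pgf_iter p (Suc n) z - pgf_iter p (Suc n) w) \<le> dpgf p ?R * norm (pgf_iter p n z - pgf_iter p n w)"
      unfolding funpow.simps comp_def
      by (rule pgf_lipschitz) (use b R that in \<open>auto intro!: norm_pgf_iter_le\<close>)
    also have "\<dots> \<le> dpgf p ?R * ((\<Prod>i<n. dpgf p (pgf_iter p i R)) * norm (z - w))"
      using Suc b by (intro mult_left_mono dpgf_nonneg) auto
    finally show ?case by (simp add: mult_ac)
  qed simp
  show ?thesis
  proof (intro exI[of _ C] conjI allI impI C(1))
    fix n and z w :: 'a assume zw: "norm z \<le> r" "norm w \<le> r"
    have "norm (pgf_iter p n z - pgf_iter p n w) \<le> (\<Prod>i<n. dpgf p (pgf_iter p i R)) * norm (z - w)"
      by (rule main) (use zw in \<open>auto simp: R_def\<close>)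
    also have "\<dots> \<le> C * dpgf p q ^ n * norm (z - w)"
      by (intro mult_right_mono C(2)) auto
    finally show "norm (pgf_iter p n z - pgf_iter p n w) \<le> C * dpgf p q ^ n * norm (z - w)" .
  qed
qed

end

section \<open>The defect of the mean and the condition on \<open>k ln k\<close>\<close>

definition pgf_defect :: "nat pmf \<Rightarrow> real \<Rightarrow> real" where
  "pgf_defect p s = (\<Sum>k. pmf p k * (\<Sum>j<k. 1 - s ^ j))"

locale supercritical_pgf =
  fixes p :: "nat pmf" and m :: real
  assumes mean_int: "integrable (measure_pmf p) real"
    and m_eq: "m = measure_pmf.expectation p real" and m_gt_1: "1 < m"
    and xlogx: "integrable (measure_pmf p) (\<lambda>k. real k * ln (real k))"
begin

lemma mean_sums: "(\<lambda>k. pmf p k * real k) sums m"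
  using pmf_nat_sums_integral(1)[OF mean_int] by (simp add: m_eq)

lemma defect_term_le: "0 \<le> s \<Longrightarrow> s \<le> 1 \<Longrightarrow> 0 \<le> (\<Sum>j<k. 1 - s ^ j) \<and> (\<Sum>j<k. 1 - s ^ j) \<le> real k" for s :: real
  using sum_bounded_above[of "{..<k}" "\<lambda>j. 1 - s ^ j" 1]
  by (auto intro!: sum_nonneg power_le_one)

lemma summable_defect:
  assumes "0 \<le> s" "s \<le> 1"
  shows "summable (\<lambda>k. pmf p k * (\<Sum>j<k. 1 - s ^ j))"
  using defect_term_le[OF assms]
  by (intro summable_comparison_test'[OF sums_summable[OF mean_sums], of 0])
     (auto intro!: mult_left_mono)

lemma defect_nonneg: "0 \<le> s \<Longrightarrow> s \<le> 1 \<Longrightarrow> 0 \<le> pgf_defect p s"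
  unfolding pgf_defect_def using defect_term_le[of s] summable_defect[of s] by (intro suminf_nonneg) auto

lemma defect_le_m: "0 \<le> s \<Longrightarrow> s \<le> 1 \<Longrightarrow> pgf_defect p s \<le> m"
  unfolding pgf_defect_def using defect_term_le[of s] summable_defect[of s]
  by (subst sums_unique[OF mean_sums], intro suminf_le mult_left_mono sums_summable[OF mean_sums]) auto

lemma defect_antimono: "0 \<le> s \<Longrightarrow> s \<le> t \<Longrightarrow> t \<le> 1 \<Longrightarrow> pgf_defect p t \<le> pgf_defect p s"
  unfolding pgf_defect_def using summable_defect[of s] summable_defect[of t]
  by (intro suminf_le mult_left_mono sum_mono diff_left_mono power_mono) auto

text \<open>The origin of \<open>pgf_defect\<close>: factoring \<open>1 - s\<close> out of each
  \<open>1 - s ^ k\<close> shows by how much the slope of the chord from \<open>s\<close> to 1 falls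
  short of the mean.\<close>

lemma one_minus_pgf:
  assumes "0 \<le> s" "s \<le> 1"
  shows "1 - pgf p s = (1 - s) * (m - pgf_defect p s)"
proof -
  have 1: "(\<lambda>k. pmf p k - pmf p k * s ^ k) sums (1 - pgf p s)"
    using assms summable_sums[OF summable_pgf[of s p]]
    by (intro sums_diff pmf_nat_sums) (simp add: pgf_def)
  have 2: "(\<lambda>k. (1 - s) * (pmf p k * real k - pmf p k * (\<Sum>j<k. 1 - s ^ j))) sums ((1 - s) * (m - pgf_defect p s))"
    unfolding pgf_defect_def
    by (intro sums_mult sums_diff mean_sums summable_sums summable_defect assms)
  have "pmf p k - pmf p k * s ^ k = (1 - s) * (pmf p k * real k - pmf p k * (\<Sum>j<k. 1 - s ^ j))" for k
  proof -
    have "1 - s ^ k = (1 - s) * (\<Sum>j<k. s ^ j)" by (rule one_diff_power_eq)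
    moreover have "(\<Sum>j<k. 1 - s ^ j) = real k - (\<Sum>j<k. s ^ j)" by (simp add: sum_subtractf)
    ultimately have "(1 - s) * (real k - (\<Sum>j<k. 1 - s ^ j)) = 1 - s ^ k" by simp
    then have "pmf p k * ((1 - s) * (real k - (\<Sum>j<k. 1 - s ^ j))) = pmf p k * (1 - s ^ k)" by simp
    then show ?thesis by (simp add: algebra_simps)
  qed
  then show ?thesis using sums_unique2[OF 1] 2 by simp
qed

text \<open>Jensen's inequality, from the tangent of the exponential at the mean. It is the reason
  why \<open>lap n h\<close> increases with \<open>n\<close>.\<close>

lemma pgf_ge_powr:
  assumes "0 \<le> h"
  shows "exp (- m * h) \<le> pgf p (exp (- h))"
proof -
  have 1: "(\<lambda>k. pmf p k * exp (- h) ^ k) sums pgf p (exp (- h))"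
    using assms summable_sums[OF summable_pgf[of "exp (-h)" p]] by (simp add: pgf_def)
  have 2: "(\<lambda>k. exp (- m * h) * ((1 + m * h) * pmf p k - h * (pmf p k * real k))) sums
      (exp (- m * h) * ((1 + m * h) * 1 - h * m))"
    by (intro sums_mult sums_diff pmf_nat_sums mean_sums)
  have "exp (- m * h) * ((1 + m * h) * pmf p k - h * (pmf p k * real k)) \<le> pmf p k * exp (- h) ^ k" for k
  proof -
    have "exp (- m * h) * (1 + (m * h - h * real k)) \<le> exp (- m * h) * exp (m * h - h * real k)"
      by (intro mult_left_mono exp_ge_add_one_self) auto
    also have "\<dots> = exp (- h) ^ k"
      by (simp add: exp_add[symmetric] exp_of_nat_mult[symmetric] mult.commute)
    finally show ?thesis
      using mult_left_mono[of _ _ "pmf p k"] by (fastforce simp: algebra_simps)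
  qed
  from sums_le[OF this 2 1] show ?thesis by simp
qed

text \<open>The Laplace transform of \<open>Z n / m ^ n\<close>, written with iterates so that its
  limit can be studied without a probability space.\<close>

definition lap :: "nat \<Rightarrow> real \<Rightarrow> real" where
  "lap n h = pgf_iter p n (exp (- h / m ^ n))"

lemma lap_0: "lap 0 h = exp (- h)" by (simp add: lap_def)

lemma lap_Suc: "lap (Suc n) h = pgf p (lap n (h / m))"
  by (simp add: lap_def mult.commute)

lemma lap_range: "0 \<le> h \<Longrightarrow> 0 \<le> lap n h \<and> lap n h \<le> 1"
  unfolding lap_def using m_gt_1 by (intro pgf_iter_range) auto

lemma lap_mono: "0 \<le> h \<Longrightarrow> lap n h \<le> lap (Suc n) h"
proof -
  assume h: "0 \<le> h"
  have "exp (- h / m ^ n) = exp (- m * (h / m ^ Suc n))" using m_gt_1 by simp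
  also have "\<dots> \<le> pgf p (exp (- (h / m ^ Suc n)))" using h m_gt_1 by (intro pgf_ge_powr) auto
  finally have "pgf_iter p n (exp (- h / m ^ n)) \<le> pgf_iter p n (pgf p (exp (- (h / m ^ Suc n))))"
    using h m_gt_1 by (intro pgf_iter_mono) (auto intro!: pgf_le_1)
  then show ?thesis by (simp add: lap_def funpow_swap1)
qed

lemma lap_incseq: "0 \<le> h \<Longrightarrow> incseq (\<lambda>n. lap n h)"
  by (intro incseq_SucI lap_mono)

lemma lap_ge_exp: "0 \<le> h \<Longrightarrow> exp (- h) \<le> lap n h"
  using incseqD[OF lap_incseq, of h 0 n] by (simp add: lap_0)

text \<open>Each generation multiplies the distance to 1 by \<open>m\<close> minus a defect. The
  defect is antitone, so its argument may be replaced by the smaller \<open>exp (- h / m)\<close>;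
  the product of the losses is bounded by their sum through
  \<open>(1 - x) * (1 - a) \<ge> 1 - (a + x)\<close>.\<close>

lemma one_minus_lap_ge:
  "0 \<le> h \<Longrightarrow> m ^ n * (1 - exp (- h / m ^ n)) * (1 - (\<Sum>i<n. pgf_defect p (exp (- h / m ^ Suc i)) / m)) \<le> 1 - lap n h"
proof (induction n arbitrary: h)
  case (Suc n)
  define x where "x = (\<Sum>i<n. pgf_defect p (exp (- (h / m) / m ^ Suc i)) / m)"
  define a where "a = pgf_defect p (exp (- h / m)) / m"
  define b where "b = m ^ n * (1 - exp (- (h / m) / m ^ n))"
  have hm: "0 \<le> h / m" using Suc.prems m_gt_1 by simp
  have e1: "exp (- h / m ^ Suc i) \<le> 1" for i using Suc.prems m_gt_1 by simp
  have a: "0 \<le> a" "a \<le> 1"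
    unfolding a_def using Suc.prems m_gt_1 by (auto intro!: divide_nonneg_pos defect_nonneg defect_le_m simp: divide_le_eq_1)
  have x: "0 \<le> x"
    unfolding x_def using Suc.prems m_gt_1 by (intro sum_nonneg divide_nonneg_pos defect_nonneg) auto
  have b: "0 \<le> b" unfolding b_def using Suc.prems m_gt_1 by (intro mult_nonneg_nonneg) auto
  have "1 - lap (Suc n) h = (1 - lap n (h / m)) * (m - pgf_defect p (lap n (h / m)))"
    unfolding lap_Suc using lap_range[OF hm] by (intro one_minus_pgf) auto
  moreover have "(1 - lap n (h / m)) * (m - pgf_defect p (lap n (h / m))) \<ge> (1 - lap n (h / m)) * (m * (1 - a))"
  proof (intro mult_left_mono)
    have "pgf_defect p (lap n (h / m)) \<le> pgf_defect p (exp (- (h / m)))"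
      using hm lap_ge_exp[OF hm] lap_range[OF hm] by (intro defect_antimono) auto
    then show "m * (1 - a) \<le> m - pgf_defect p (lap n (h / m))"
      using m_gt_1 by (simp add: a_def algebra_simps)
  qed (use lap_range[OF hm] in auto)
  moreover have "(1 - lap n (h / m)) * (m * (1 - a)) \<ge> b * (1 - x) * (m * (1 - a))"
    using Suc.IH[OF hm] a m_gt_1 unfolding b_def x_def by (intro mult_right_mono) auto
  moreover have "b * (1 - x) * (m * (1 - a)) \<ge> b * m * (1 - (a + x))"
  proof -
    have "b * m * (1 - (a + x)) \<le> b * m * ((1 - x) * (1 - a))"
      using b m_gt_1 a x by (intro mult_left_mono) (auto simp: algebra_simps)
    then show ?thesis by (simp add: mult_ac)
  qed
  ultimately have main: "b * m * (1 - (a + x)) \<le> 1 - lap (Suc n) h" by linarith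
  have S: "(\<Sum>i<Suc n. pgf_defect p (exp (- h / m ^ Suc i)) / m) = a + x"
    unfolding sum.lessThan_Suc_shift by (simp add: a_def x_def)
  have T: "m ^ Suc n * (1 - exp (- h / m ^ Suc n)) = b * m" by (simp add: b_def mult_ac)
  show ?case unfolding S T by (rule main)
qed (simp add: lap_0)

text \<open>The place where the \<open>k ln k\<close> moment enters. A family of size
  \<open>k\<close> contributes at most \<open>k\<close> for each of the roughly
  \<open>ln k / ln m\<close> indices with \<open>m ^ i < k\<close>, and a multiple of
  \<open>k\<close> in total for the remaining ones, whose contributions decay geometrically.\<close>

lemma summable_defect_geometric: "summable (\<lambda>i. pgf_defect p (exp (- 1 / m ^ i)))"
proof (rule bounded_imp_summable)
  have B1: "(\<Sum>i\<le>n. min 1 (real k / m ^ i)) \<le> ln (real k) / ln m + (1 + m / (m - 1))" if "0 < k" for k n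
  proof -
    \<comment> \<open>From index \<open>i0\<close> on, \<open>m ^ i\<close> is at least
      \<open>k\<close> and the terms decay geometrically.\<close>
    define i0 where "i0 = nat \<lceil>ln (real k) / ln m\<rceil>"
    have l0: "0 \<le> ln (real k) / ln m" using that m_gt_1 by simp
    have i0: "ln (real k) / ln m \<le> real i0" "real i0 \<le> ln (real k) / ln m + 1"
      unfolding i0_def using l0 by linarith+
    have k_le: "real k \<le> m ^ i0"
    proof -
      have "ln (real k) \<le> real i0 * ln m" using i0(1) m_gt_1 by (simp add: divide_le_eq)
      then have "ln (real k) \<le> ln (m ^ i0)" using m_gt_1 by (simp add: ln_realpow)
      then show ?thesis using that m_gt_1 by simp
    qed
    have "(\<Sum>i\<le>n. min 1 (real k / m ^ i)) \<le> (\<Sum>i<i0 + Suc n. min 1 (real k / m ^ i))"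
      using m_gt_1 by (intro sum_mono2) auto
    also have "\<dots> = (\<Sum>i<i0. min 1 (real k / m ^ i)) + (\<Sum>i<Suc n. min 1 (real k / m ^ (i0 + i)))"
      using sum.atLeastLessThan_concat[of 0 i0 "i0 + Suc n" "\<lambda>i. min 1 (real k / m ^ i)"]
        sum.shift_bounds_nat_ivl[of "\<lambda>i. min 1 (real k / m ^ i)" 0 i0 "Suc n"]
      by (simp add: lessThan_atLeast0 add.commute)
    also have "(\<Sum>i<i0. min 1 (real k / m ^ i)) \<le> (\<Sum>i<i0. 1)" by (intro sum_mono) auto
    also have "(\<Sum>i<Suc n. min 1 (real k / m ^ (i0 + i))) \<le> (\<Sum>i<Suc n. (1 / m) ^ i)"
    proof (intro sum_mono)
      fix i
      have "real k / m ^ (i0 + i) \<le> m ^ i0 / m ^ (i0 + i)" using k_le m_gt_1 by (intro divide_right_mono) auto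
      also have "\<dots> = (1 / m) ^ i" using m_gt_1 by (simp add: power_add power_one_over)
      finally show "min 1 (real k / m ^ (i0 + i)) \<le> (1 / m) ^ i" by simp
    qed
    also have "(\<Sum>i<Suc n. (1 / m) ^ i) \<le> (\<Sum>i. (1 / m) ^ i)"
      using m_gt_1 by (intro sum_le_suminf summable_geometric) auto
    also have "\<dots> = m / (m - 1)" using m_gt_1 by (subst suminf_geometric) (auto simp: field_simps)
    finally show ?thesis using i0(2) by simp
  qed
  define B where "B = measure_pmf.expectation p (\<lambda>k. real k * ln (real k)) / ln m + (1 + m / (m - 1)) * m"
  have Bs: "(\<lambda>k. pmf p k * (real k * ln (real k)) / ln m + (1 + m / (m - 1)) * (pmf p k * real k)) sums B"
    unfolding B_def using pmf_nat_sums_integral(1)[OF xlogx]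
    by (intro sums_add sums_divide sums_mult mean_sums) simp
  fix n
  have er: "0 \<le> exp (- 1 / m ^ i)" "exp (- 1 / m ^ i) \<le> 1" for i using m_gt_1 by auto
  have "(\<Sum>i\<le>n. pgf_defect p (exp (- 1 / m ^ i))) = (\<Sum>k. \<Sum>i\<le>n. pmf p k * (\<Sum>j<k. 1 - exp (- 1 / m ^ i) ^ j))"
    unfolding pgf_defect_def by (rule suminf_sum[symmetric]) (intro summable_defect er)
  also have "\<dots> \<le> B"
  proof (rule sums_le[OF _ summable_sums Bs])
    show "summable (\<lambda>k. \<Sum>i\<le>n. pmf p k * (\<Sum>j<k. 1 - exp (- 1 / m ^ i) ^ j))"
      by (intro summable_sum summable_defect er)
    fix k
    have t: "(\<Sum>j<k. 1 - exp (- 1 / m ^ i) ^ j) \<le> real k * min 1 (real k / m ^ i)" for i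
    proof -
      have "1 - exp (- 1 / m ^ i) ^ j \<le> min 1 (real k / m ^ i)" if "j < k" for j
      proof -
        have "exp (- 1 / m ^ i) ^ j = exp (- (real j / m ^ i))" by (simp add: exp_of_nat_mult[symmetric])
        moreover have "1 - real j / m ^ i \<le> exp (- (real j / m ^ i))"
          using exp_ge_add_one_self[of "- (real j / m ^ i)"] by simp
        moreover have "real j / m ^ i \<le> real k / m ^ i" using that m_gt_1 by (intro divide_right_mono) auto
        moreover have "0 \<le> exp (- 1 / m ^ i) ^ j" by simp
        ultimately show ?thesis by linarith
      qed
      then show ?thesis using sum_bounded_above[of "{..<k}" "\<lambda>j. 1 - exp (- 1 / m ^ i) ^ j" "min 1 (real k / m ^ i)"] by simp
    qed
    show "(\<Sum>i\<le>n. pmf p k * (\<Sum>j<k. 1 - exp (- 1 / m ^ i) ^ j))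
      \<le> pmf p k * (real k * ln (real k)) / ln m + (1 + m / (m - 1)) * (pmf p k * real k)"
    proof (cases "k = 0")
      case False
      have "(\<Sum>i\<le>n. pmf p k * (\<Sum>j<k. 1 - exp (- 1 / m ^ i) ^ j)) \<le> (\<Sum>i\<le>n. pmf p k * (real k * min 1 (real k / m ^ i)))"
        by (intro sum_mono mult_left_mono t) auto
      also have "\<dots> = pmf p k * (real k * (\<Sum>i\<le>n. min 1 (real k / m ^ i)))"
        by (simp add: sum_distrib_left)
      also have "\<dots> \<le> pmf p k * (real k * (ln (real k) / ln m + (1 + m / (m - 1))))"
        using False by (intro mult_left_mono B1) auto
      finally show ?thesis by (simp add: algebra_simps)
    qed simp
  qed
  finally show "(\<Sum>i\<le>n. pgf_defect p (exp (- 1 / m ^ i))) \<le> B" .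
qed (use m_gt_1 in \<open>auto intro!: defect_nonneg\<close>)

text \<open>Dividing \<open>h\<close> by \<open>m ^ K\<close> shifts the summation index of the
  defects by \<open>K\<close>. The loss in \<open>one_minus_lap_ge\<close> is then a tail of a
  convergent series, whatever \<open>n\<close> is.\<close>

lemma one_minus_lap_uniform:
  assumes "0 < \<delta>"
  shows "\<exists>h0>0. \<forall>h n. 0 \<le> h \<longrightarrow> h \<le> h0 \<longrightarrow> (1 - \<delta>) * (m ^ n * (1 - exp (- h / m ^ n))) \<le> 1 - lap n h"
proof -
  let ?d = "\<lambda>i. pgf_defect p (exp (- 1 / m ^ i))"
  have "\<forall>\<^sub>F K in sequentially. norm ((\<Sum>i. ?d (i + K))) < \<delta>"
    using suminf_exist_split2[OF summable_defect_geometric] assms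
    by (auto simp: tendsto_iff)
  then obtain K where K: "norm (\<Sum>i. ?d (i + K)) < \<delta>" by (auto dest: eventually_happens)
  show ?thesis
  proof (intro exI[of _ "1 / m ^ K"] conjI allI impI)
    fix h n assume h: "0 \<le> h" "h \<le> 1 / m ^ K"
    have sm: "summable (\<lambda>i. ?d (i + K))" by (subst summable_iff_shift) (rule summable_defect_geometric)
    have d0: "0 \<le> ?d i" for i using m_gt_1 by (intro defect_nonneg) auto
    have "(\<Sum>i<n. pgf_defect p (exp (- h / m ^ Suc i)) / m) \<le> (\<Sum>i<n. ?d (i + K))"
    proof (rule sum_mono)
      fix i
      have mp: "0 < m ^ j" for j using m_gt_1 by simp
      have "h / m ^ Suc i \<le> 1 / m ^ (i + K)"
      proof -
        have "h / m ^ Suc i \<le> (1 / m ^ K) / m ^ Suc i"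
          using h less_imp_le[OF mp[of "Suc i"]] by (intro divide_right_mono)
        also have "\<dots> = 1 / m ^ (i + K) / m" by (simp add: power_add mult_ac)
        also have "\<dots> \<le> 1 / m ^ (i + K)" using m_gt_1 mp[of "i+K"] by (simp add: divide_le_eq mult_le_cancel_left1)
        finally show ?thesis .
      qed
      then have "pgf_defect p (exp (- h / m ^ Suc i)) \<le> ?d (i + K)"
        using h m_gt_1 by (intro defect_antimono) auto
      moreover have "pgf_defect p (exp (- h / m ^ Suc i)) / m \<le> pgf_defect p (exp (- h / m ^ Suc i))"
        using defect_nonneg[of "exp (- h / m ^ Suc i)"] h m_gt_1 by (simp add: divide_le_eq mult_le_cancel_left1)
      ultimately show "pgf_defect p (exp (- h / m ^ Suc i)) / m \<le> ?d (i + K)" by linarith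
    qed
    also have "\<dots> \<le> (\<Sum>i. ?d (i + K))" by (intro sum_le_suminf sm) (use d0 in auto)
    also have "\<dots> \<le> \<delta>" using K by simp
    finally have S: "(\<Sum>i<n. pgf_defect p (exp (- h / m ^ Suc i)) / m) \<le> \<delta>" .
    have "(1 - \<delta>) * (m ^ n * (1 - exp (- h / m ^ n)))
      \<le> m ^ n * (1 - exp (- h / m ^ n)) * (1 - (\<Sum>i<n. pgf_defect p (exp (- h / m ^ Suc i)) / m))"
      using S h m_gt_1 by (subst mult.commute, intro mult_left_mono mult_nonneg_nonneg) auto
    also have "\<dots> \<le> 1 - lap n h" by (rule one_minus_lap_ge[OF h(1)])
    finally show "(1 - \<delta>) * (m ^ n * (1 - exp (- h / m ^ n))) \<le> 1 - lap n h" .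
  qed (use m_gt_1 in simp)
qed

text \<open>From above, the limit dominates \<open>exp (- h)\<close>. From below, the uniform bound
  passes to the limit, since \<open>m ^ n * (1 - exp (- h / m ^ n))\<close> tends to
  \<open>h\<close>. In probabilistic terms, the limit law keeps mean 1.\<close>

lemma lap_tendsto_range:
  assumes lim: "\<And>h. 0 \<le> h \<Longrightarrow> (\<lambda>n. lap n h) \<longlonglongrightarrow> \<phi> h"
  shows "((\<lambda>h. (1 - \<phi> h) / h) \<longlongrightarrow> 1) (at_right 0)"
proof (rule tendstoI)
  fix e :: real assume e: "0 < e"
  obtain h0 where h0: "0 < h0" "\<And>h n. 0 \<le> h \<Longrightarrow> h \<le> h0 \<Longrightarrow>
      (1 - e/2) * (m ^ n * (1 - exp (- h / m ^ n))) \<le> 1 - lap n h"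
    using one_minus_lap_uniform[of "e/2"] e by auto
  have "\<forall>\<^sub>F h in at_right 0. 0 < h \<and> h < h0"
    using h0(1) by (intro eventually_at_rightI[of 0 h0]) auto
  then show "\<forall>\<^sub>F h in at_right 0. dist ((1 - \<phi> h) / h) 1 < e"
  proof eventually_elim
    case (elim h)
    have "((\<lambda>x::real. (exp x - 1) / x) \<longlongrightarrow> 1) (at 0)"
      using DERIV_exp[of 0] by (simp add: has_field_derivative_iff)
    moreover have "filterlim (\<lambda>n. - h / m ^ n) (at 0) sequentially"
    proof (rule filterlim_atI)
      have "(\<lambda>n. - h * (1 / m) ^ n) \<longlonglongrightarrow> - h * 0"
        using m_gt_1 by (intro tendsto_mult tendsto_const LIMSEQ_realpow_zero) auto
      then show "(\<lambda>n. - h / m ^ n) \<longlonglongrightarrow> 0" by (simp add: power_one_over)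
      show "\<forall>\<^sub>F n in sequentially. - h / m ^ n \<noteq> 0" using elim m_gt_1 by simp
    qed
    ultimately have "(\<lambda>n. (exp (- h / m ^ n) - 1) / (- h / m ^ n)) \<longlonglongrightarrow> 1"
      by (rule filterlim_compose)
    then have "(\<lambda>n. (1 - e/2) * (h * ((exp (- h / m ^ n) - 1) / (- h / m ^ n)))) \<longlonglongrightarrow> (1 - e/2) * (h * 1)"
      by (intro tendsto_mult tendsto_const)
    moreover have "(1 - e/2) * (h * ((exp (- h / m ^ n) - 1) / (- h / m ^ n))) \<le> 1 - lap n h" for n
    proof -
      have "h * ((exp (- h / m ^ n) - 1) / (- h / m ^ n)) = m ^ n * (1 - exp (- h / m ^ n))"
        using elim m_gt_1 by (simp add: field_simps)
      then show ?thesis using h0(2)[of h n] elim by simp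
    qed
    moreover have "(\<lambda>n. 1 - lap n h) \<longlonglongrightarrow> 1 - \<phi> h" using elim by (intro tendsto_intros lim) auto
    ultimately have lower: "(1 - e/2) * (h * 1) \<le> 1 - \<phi> h"
      using LIMSEQ_le by blast
    have "exp (- h) \<le> \<phi> h" using elim lap_ge_exp[of h] by (intro LIMSEQ_le_const[OF lim]) auto
    then have upper: "1 - \<phi> h \<le> h" using exp_ge_add_one_self[of "-h"] by linarith
    have "(1 - e/2) \<le> (1 - \<phi> h) / h" "(1 - \<phi> h) / h \<le> 1"
      using lower upper elim by (auto simp: le_divide_eq divide_le_eq)
    then show ?case using e by (auto simp: dist_real_def)
  qed
qed

end

section \<open>The Galton-Watson process and its limit\<close>

lemma (in prob_space) integral_indicator_scaleR:
  fixes c :: "'b::{banach, second_countable_topology}"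
  assumes "A \<in> sets M"
  shows "(\<integral>\<omega>. indicator A \<omega> *\<^sub>R c \<partial>M) = prob A *\<^sub>R c"
proof -
  have "integrable M (indicator A :: 'a \<Rightarrow> real)"
    by (rule integrable_const_bound[where B=1]) (use assms in \<open>auto simp: indicator_def\<close>)
  then show ?thesis using assms by (subst integral_scaleR_left) (auto simp: sets.sets_into_space Int_absorb2)
qed

lemma (in prob_space) sums_integral_nat_partition:
  fixes F :: "'a \<Rightarrow> 'b::{banach, second_countable_topology}"
  assumes F: "integrable M F" and N [measurable]: "N \<in> measurable M (count_space (UNIV :: nat set))"
  shows "(\<lambda>l. \<integral>\<omega>. indicator {\<omega>\<in>space M. N \<omega> = l} \<omega> *\<^sub>R F \<omega> \<partial>M) sums (\<integral>\<omega>. F \<omega> \<partial>M)"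
proof -
  have int: "integrable M (\<lambda>\<omega>. indicator {\<omega>\<in>space M. N \<omega> = l} \<omega> *\<^sub>R F \<omega>)" for l
    by (rule integrable_mult_indicator[OF _ F]) simp
  have part: "(\<Sum>l<n. indicator {\<omega>\<in>space M. N \<omega> = l} \<omega> *\<^sub>R F \<omega>) = (if N \<omega> < n then F \<omega> else 0)"
    if "\<omega> \<in> space M" for n \<omega>
  proof -
    have "(\<Sum>l<n. indicator {\<omega>\<in>space M. N \<omega> = l} \<omega> *\<^sub>R F \<omega>) = (\<Sum>l<n. if l = N \<omega> then F \<omega> else 0)"
      using that by (intro sum.cong) auto
    then show ?thesis by (simp add: sum.delta)
  qed
  have "(\<lambda>n. \<integral>\<omega>. (\<Sum>l<n. indicator {\<omega>\<in>space M. N \<omega> = l} \<omega> *\<^sub>R F \<omega>) \<partial>M) \<longlonglongrightarrow> (\<integral>\<omega>. F \<omega> \<partial>M)"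
  proof (rule integral_dominated_convergence)
    show "integrable M (\<lambda>\<omega>. norm (F \<omega>))" using F by simp
    show "AE \<omega> in M. (\<lambda>n. \<Sum>l<n. indicator {\<omega>\<in>space M. N \<omega> = l} \<omega> *\<^sub>R F \<omega>) \<longlonglongrightarrow> F \<omega>"
    proof (rule AE_I2)
      fix \<omega> assume w: "\<omega> \<in> space M"
      have "\<forall>\<^sub>F n in sequentially. (\<Sum>l<n. indicator {\<omega>\<in>space M. N \<omega> = l} \<omega> *\<^sub>R F \<omega>) = F \<omega>"
        using eventually_gt_at_top[of "N \<omega>"] by eventually_elim (simp add: part[OF w])
      then show "(\<lambda>n. \<Sum>l<n. indicator {\<omega>\<in>space M. N \<omega> = l} \<omega> *\<^sub>R F \<omega>) \<longlonglongrightarrow> F \<omega>"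
        by (rule tendsto_eventually)
    qed
    show "AE \<omega> in M. norm (\<Sum>l<n. indicator {\<omega>\<in>space M. N \<omega> = l} \<omega> *\<^sub>R F \<omega>) \<le> norm (F \<omega>)" for n
    proof (rule AE_I2)
      fix \<omega> assume "\<omega> \<in> space M"
      from part[OF this, of n]
      show "norm (\<Sum>l<n. indicator {\<omega>\<in>space M. N \<omega> = l} \<omega> *\<^sub>R F \<omega>) \<le> norm (F \<omega>)"
        by (simp only: norm_zero norm_ge_zero split: if_split) simp
    qed
    show "(\<lambda>\<omega>. \<Sum>l<n. indicator {\<omega>\<in>space M. N \<omega> = l} \<omega> *\<^sub>R F \<omega>) \<in> borel_measurable M" for n
      using int by (intro borel_measurable_sum) (auto dest: borel_measurable_integrable)
  qed (use F in auto)
  then show ?thesis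
    unfolding sums_def by (subst (asm) Bochner_Integration.integral_sum) (rule int)
qed

lemma (in prob_space) expectation_nat_sums:
  fixes g :: "nat \<Rightarrow> 'b::{banach, second_countable_topology}"
  assumes [measurable]: "N \<in> measurable M (count_space (UNIV :: nat set))" and A: "A \<in> sets M"
    and B: "\<And>k. norm (g k) \<le> B"
  shows "(\<lambda>k. prob {\<omega>\<in>A. N \<omega> = k} *\<^sub>R g k) sums (\<integral>\<omega>. indicator A \<omega> *\<^sub>R g (N \<omega>) \<partial>M)"
proof -
  have gN: "integrable M (\<lambda>\<omega>. g (N \<omega>))"
    by (rule integrable_const_bound[where B=B]) (use B in \<open>auto intro: measurable_compose[of N]\<close>)
  have "integrable M (\<lambda>\<omega>. indicator A \<omega> *\<^sub>R g (N \<omega>))"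
    by (rule integrable_mult_indicator[OF A gN])
  from sums_integral_nat_partition[OF this assms(1)]
  have "(\<lambda>l. \<integral>\<omega>. indicator {\<omega>\<in>space M. N \<omega> = l} \<omega> *\<^sub>R indicator A \<omega> *\<^sub>R g (N \<omega>) \<partial>M) sums
    (\<integral>\<omega>. indicator A \<omega> *\<^sub>R g (N \<omega>) \<partial>M)" .
  moreover have "(\<integral>\<omega>. indicator {\<omega>\<in>space M. N \<omega> = l} \<omega> *\<^sub>R indicator A \<omega> *\<^sub>R g (N \<omega>) \<partial>M)
      = prob {\<omega>\<in>A. N \<omega> = l} *\<^sub>R g l" for l
  proof -
    have s: "{\<omega>\<in>A. N \<omega> = l} \<in> sets M"
    proof -
      have "{\<omega>\<in>A. N \<omega> = l} = A \<inter> {\<omega>\<in>space M. N \<omega> = l}" using sets.sets_into_space[OF A] by auto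
      then show ?thesis using A by simp
    qed
    have "(\<integral>\<omega>. indicator {\<omega>\<in>space M. N \<omega> = l} \<omega> *\<^sub>R indicator A \<omega> *\<^sub>R g (N \<omega>) \<partial>M)
        = (\<integral>\<omega>. indicator {\<omega>\<in>A. N \<omega> = l} \<omega> *\<^sub>R g l \<partial>M)"
      using sets.sets_into_space[OF A] by (intro Bochner_Integration.integral_cong) (auto simp: indicator_def)
    also have "\<dots> = prob {\<omega>\<in>A. N \<omega> = l} *\<^sub>R g l"
      by (rule integral_indicator_scaleR[OF s])
    finally show ?thesis .
  qed
  ultimately show ?thesis by simp
qed

text \<open>The process as a function of the coordinates of the whole independent family, so that
  independence of disjoint blocks of coordinates can be applied to it. The floor undoes the
  embedding of the offspring numbers into the reals made in \<open>gw_setup\<close>.\<close>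

primrec gw_of_family :: "nat \<Rightarrow> ((nat \<times> nat) + nat \<Rightarrow> real) \<Rightarrow> nat" where
  "gw_of_family 0 x = 1"
| "gw_of_family (Suc n) x = (\<Sum>i<gw_of_family n x. nat \<lfloor>x (Inl (n, i))\<rfloor>)"

lemma gw_of_family_cong:
  assumes "\<And>j i. j < n \<Longrightarrow> x (Inl (j, i)) = y (Inl (j, i))"
  shows "gw_of_family n x = gw_of_family n y"
  using assms by (induction n) auto

lemma measurable_sum_nat_count_space:
  fixes k :: nat
  assumes "\<And>i. i < k \<Longrightarrow> f i \<in> measurable N (count_space (UNIV :: nat set))"
  shows "(\<lambda>x. \<Sum>i<k. f i x) \<in> measurable N (count_space (UNIV :: nat set))"
  using assms
proof (induction k)
  case (Suc k)
  show ?case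
    unfolding sum.lessThan_Suc
  proof (rule measurable_compose_countable[where f="\<lambda>a x. a + f k x"])
    show "(\<lambda>x. a + f k x) \<in> measurable N (count_space UNIV)" for a
      by (rule measurable_compose[OF Suc.prems[of k]]) auto
  qed (use Suc in auto)
qed simp

lemma measurable_gw_of_family:
  assumes "Inl ` ({..<n} \<times> UNIV) \<subseteq> A"
  shows "gw_of_family n \<in> measurable (PiM A (\<lambda>_. borel)) (count_space UNIV)"
  using assms
proof (induction n)
  case 0
  have "gw_of_family 0 = (\<lambda>_. 1)" by (auto simp: fun_eq_iff)
  then show ?case by simp
next
  case (Suc n)
  have sub: "Inl ` ({..<n} \<times> UNIV) \<subseteq> A" using Suc.prems by auto
  have eq: "gw_of_family (Suc n) = (\<lambda>x. (\<lambda>k x. \<Sum>i<k. nat \<lfloor>x (Inl (n, i))\<rfloor>) (gw_of_family n x) x)"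
    by (auto simp: fun_eq_iff)
  show ?case
    unfolding eq
  proof (rule measurable_compose_countable[OF _ Suc.IH[OF sub]], rule measurable_sum_nat_count_space)
    fix k i :: nat
    have "Inl (n, i) \<in> A" using Suc.prems by auto
    then have "(\<lambda>x. x (Inl (n, i))) \<in> borel_measurable (PiM A (\<lambda>_. borel :: real measure))"
      by (rule measurable_component_singleton)
    moreover have "(\<lambda>y::real. nat \<lfloor>y\<rfloor>) \<in> measurable borel (count_space UNIV)" by measurable
    ultimately show "(\<lambda>x. nat \<lfloor>x (Inl (n, i))\<rfloor>) \<in> measurable (PiM A (\<lambda>_. borel :: real measure)) (count_space UNIV)"
      by (rule measurable_compose)
  qed
qed

locale gw_family =
  fixes M :: "'a measure" and p :: "nat pmf" and \<xi> :: "nat \<Rightarrow> nat \<Rightarrow> 'a \<Rightarrow> nat"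
    and Z :: "nat \<Rightarrow> 'a \<Rightarrow> nat" and X :: "nat \<Rightarrow> 'a \<Rightarrow> real"
  assumes gw_ax: "gw_setup M p \<xi> Z X"
begin

sublocale prob_space M using gw_ax by (simp add: gw_setup_def)

abbreviation prob_Z_le :: "nat \<Rightarrow> real \<Rightarrow> real" where
  "prob_Z_le n x \<equiv> \<P>(\<omega> in M. 0 < Z n \<omega> \<and> real (Z n \<omega>) \<le> x)"

abbreviation V :: "(nat \<times> nat) + nat \<Rightarrow> 'a \<Rightarrow> real" where
  "V \<equiv> case_sum (\<lambda>(n, i) \<omega>. real (\<xi> n i \<omega>)) X"

abbreviation J :: "((nat \<times> nat) + nat) set" where
  "J \<equiv> range Inl \<union> Inr ` {1..}"

lemma xi_meas [measurable]: "\<xi> n i \<in> measurable M (count_space UNIV)"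
  and xi_distr: "distr M (count_space UNIV) (\<xi> n i) = measure_pmf p"
  and V_indep: "indep_vars (\<lambda>_. borel) V J"
  and X_distr: "1 \<le> k \<Longrightarrow> distr M borel (X k) = distr M borel (X 1)"
  and Z_0: "Z 0 \<omega> = 1" and Z_Suc: "Z (Suc n) \<omega> = (\<Sum>i<Z n \<omega>. \<xi> n i \<omega>)"
  using gw_ax unfolding gw_setup_def by blast+

lemma Z_eq_family:
  assumes "Inl ` ({..<n} \<times> UNIV) \<subseteq> A"
  shows "Z n \<omega> = gw_of_family n (restrict (\<lambda>i. V i \<omega>) A)"
proof -
  have "Z n \<omega> = gw_of_family n (\<lambda>i. V i \<omega>)"
    by (induction n) (auto simp: Z_0 Z_Suc)
  also have "\<dots> = gw_of_family n (restrict (\<lambda>i. V i \<omega>) A)"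
    using assms by (intro gw_of_family_cong) auto
  finally show ?thesis .
qed

lemma Z_meas [measurable]: "Z n \<in> measurable M (count_space UNIV)"
proof (induction n)
  case 0
  have "Z 0 = (\<lambda>_. 1)" by (auto simp: Z_0)
  then show ?case by simp
next
  case (Suc n)
  have "Z (Suc n) = (\<lambda>\<omega>. (\<lambda>k \<omega>. \<Sum>i<k. \<xi> n i \<omega>) (Z n \<omega>) \<omega>)" by (auto simp: Z_Suc)
  also have "\<dots> \<in> measurable M (count_space UNIV)"
    by (rule measurable_compose_countable[OF _ Suc], rule measurable_sum_nat_count_space) simp
  finally show ?case .
qed

lemma indep_split:
  assumes "A \<inter> B = {}" "A \<subseteq> J" "B \<subseteq> J"
    and "g \<in> measurable (PiM A (\<lambda>_. borel)) N1" "h \<in> measurable (PiM B (\<lambda>_. borel)) N2"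
  shows "indep_var N1 (\<lambda>\<omega>. g (restrict (\<lambda>i. V i \<omega>) A)) N2 (\<lambda>\<omega>. h (restrict (\<lambda>i. V i \<omega>) B))"
  using indep_var_compose[OF indep_var_restrict[OF V_indep assms(1-3)] assms(4,5)]
  by (simp add: comp_def)

lemma expectation_xi:
  fixes z :: complex
  assumes "norm z \<le> 1"
  shows "expectation (\<lambda>\<omega>. z ^ \<xi> n i \<omega>) = pgf p z"
proof -
  have "expectation (\<lambda>\<omega>. z ^ \<xi> n i \<omega>) = integral\<^sup>L (distr M (count_space UNIV) (\<xi> n i)) (\<lambda>k. z ^ k)"
    by (subst integral_distr) auto
  also have "\<dots> = measure_pmf.expectation p (\<lambda>k. z ^ k)" by (simp add: xi_distr)
  also have "\<dots> = pgf p z"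
  proof -
    have "integrable (measure_pmf p) (\<lambda>k. z ^ k)"
      by (rule measure_pmf.integrable_const_bound[where B=1])
         (use assms in \<open>auto simp: norm_power power_le_one\<close>)
    from sums_unique[OF pmf_nat_sums_integral(1)[OF this]] show ?thesis
      by (simp add: pgf_def scaleR_conv_of_real)
  qed
  finally show ?thesis .
qed

text \<open>The offspring numbers of generation \<open>N\<close> are independent of all earlier
  ones. The second event, on an earlier generation \<open>n\<close>, is carried along for the
  induction that yields the Markov property.\<close>

lemma indicator_pow_step:
  fixes z :: complex
  assumes z: "norm z \<le> 1" and nN: "n \<le> N"
  shows "(\<integral>\<omega>. indicator {\<omega>\<in>space M. Z n \<omega> = k \<and> Z N \<omega> = l} \<omega> *\<^sub>R z ^ Z (Suc N) \<omega> \<partial>M)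
    = \<P>(\<omega> in M. Z n \<omega> = k \<and> Z N \<omega> = l) *\<^sub>R pgf p z ^ l"
proof -
  define A :: "((nat \<times> nat) + nat) set" where "A = Inl ` ({..<N} \<times> UNIV)"
  \<comment> \<open>On the event \<open>Z N = l\<close> only the first \<open>l\<close> individuals
    have children, so a finite block of coordinates suffices.\<close>
  define B :: "((nat \<times> nat) + nat) set" where "B = (\<lambda>j. Inl (N, j)) ` {..<l}"
  define g where "g x = (if gw_of_family n x = k \<and> gw_of_family N x = l then 1 else 0 :: complex)" for x
  define h where "h x = (\<Prod>b\<in>B. z ^ nat \<lfloor>x b\<rfloor>)" for x :: "(nat \<times> nat) + nat \<Rightarrow> real"
  have sub: "Inl ` ({..<n} \<times> UNIV) \<subseteq> A" "Inl ` ({..<N} \<times> UNIV) \<subseteq> A"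
    using nN by (auto simp: A_def)
  have [measurable]: "gw_of_family n \<in> measurable (PiM A (\<lambda>_. borel)) (count_space UNIV)"
    "gw_of_family N \<in> measurable (PiM A (\<lambda>_. borel)) (count_space UNIV)"
    using measurable_gw_of_family sub by blast+
  have gm: "g \<in> borel_measurable (PiM A (\<lambda>_. borel))" unfolding g_def by measurable
  have pm: "(\<lambda>y::real. z ^ nat \<lfloor>y\<rfloor>) \<in> borel_measurable borel" by measurable
  have hm: "h \<in> borel_measurable (PiM B (\<lambda>_. borel))"
    unfolding h_def
  proof (rule borel_measurable_prod)
    fix b assume b: "b \<in> B"
    have "(\<lambda>x. x b) \<in> measurable (PiM B (\<lambda>_. borel)) (borel :: real measure)"
      using b by (rule measurable_component_singleton)
    from measurable_compose[OF this pm]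
    show "(\<lambda>x. z ^ nat \<lfloor>x b :: real\<rfloor>) \<in> borel_measurable (PiM B (\<lambda>_. borel))" .
  qed
  have ind: "indep_var borel (\<lambda>\<omega>. g (restrict (\<lambda>i. V i \<omega>) A)) borel (\<lambda>\<omega>. h (restrict (\<lambda>i. V i \<omega>) B))"
    by (rule indep_split[OF _ _ _ gm hm]) (auto simp: A_def B_def)
  have gV: "g (restrict (\<lambda>i. V i \<omega>) A) = (if Z n \<omega> = k \<and> Z N \<omega> = l then 1 else 0)" for \<omega>
    unfolding g_def using Z_eq_family[OF sub(1), of \<omega>] Z_eq_family[OF sub(2), of \<omega>] by simp
  have hV: "h (restrict (\<lambda>i. V i \<omega>) B) = (\<Prod>b\<in>B. z ^ nat \<lfloor>V b \<omega>\<rfloor>)" for \<omega>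
    unfolding h_def by (intro prod.cong) auto
  have finB: "finite B" by (simp add: B_def)
  have indB: "indep_vars (\<lambda>_. borel) (\<lambda>b \<omega>. z ^ nat \<lfloor>V b \<omega>\<rfloor>) B"
    by (rule indep_vars_compose2[OF indep_vars_subset[OF V_indep]]) (auto simp: B_def pm)
  have Vb: "z ^ nat \<lfloor>V b \<omega>\<rfloor> = z ^ \<xi> N (snd (projl b)) \<omega>" if "b \<in> B" for b \<omega>
    using that by (auto simp: B_def)
  have intb: "integrable M (\<lambda>\<omega>. z ^ \<xi> N i \<omega>)" for i
    by (rule integrable_const_bound[where B=1]) (use z in \<open>auto simp: norm_power power_le_one\<close>)
  have intB: "integrable M (\<lambda>\<omega>. z ^ nat \<lfloor>V b \<omega>\<rfloor>)" if "b \<in> B" for b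
    using intb that by (simp add: Vb[OF that])
  have hint: "integrable M (\<lambda>\<omega>. h (restrict (\<lambda>i. V i \<omega>) B))"
    unfolding hV by (rule indep_vars_integrable[OF finB indB intB])
  have Eh: "expectation (\<lambda>\<omega>. h (restrict (\<lambda>i. V i \<omega>) B)) = pgf p z ^ l"
  proof -
    have "expectation (\<lambda>\<omega>. h (restrict (\<lambda>i. V i \<omega>) B)) = (\<Prod>b\<in>B. expectation (\<lambda>\<omega>. z ^ nat \<lfloor>V b \<omega>\<rfloor>))"
      unfolding hV by (rule indep_vars_lebesgue_integral[OF finB indB intB])
    also have "\<dots> = (\<Prod>b\<in>B. pgf p z)"
      by (intro prod.cong refl) (simp add: Vb expectation_xi[OF z])
    also have "\<dots> = pgf p z ^ l" by (simp add: B_def card_image inj_on_def)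
    finally show ?thesis .
  qed
  have gint: "integrable M (\<lambda>\<omega>. g (restrict (\<lambda>i. V i \<omega>) A))"
    unfolding gV by (rule integrable_const_bound[where B=1]) auto
  have Eg: "expectation (\<lambda>\<omega>. g (restrict (\<lambda>i. V i \<omega>) A)) = of_real (\<P>(\<omega> in M. Z n \<omega> = k \<and> Z N \<omega> = l))"
  proof -
    have "expectation (\<lambda>\<omega>. g (restrict (\<lambda>i. V i \<omega>) A)) =
        (\<integral>\<omega>. indicator {\<omega>\<in>space M. Z n \<omega> = k \<and> Z N \<omega> = l} \<omega> *\<^sub>R (1::complex) \<partial>M)"
      unfolding gV by (intro Bochner_Integration.integral_cong) auto
    then show ?thesis by (subst (asm) integral_indicator_scaleR) (auto simp: scaleR_conv_of_real)
  qed
  have "(\<integral>\<omega>. indicator {\<omega>\<in>space M. Z n \<omega> = k \<and> Z N \<omega> = l} \<omega> *\<^sub>R z ^ Z (Suc N) \<omega> \<partial>M)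
    = expectation (\<lambda>\<omega>. g (restrict (\<lambda>i. V i \<omega>) A) * h (restrict (\<lambda>i. V i \<omega>) B))"
  proof (intro Bochner_Integration.integral_cong refl)
    fix \<omega> assume w: "\<omega> \<in> space M"
    have "h (restrict (\<lambda>i. V i \<omega>) B) = (\<Prod>j<l. z ^ \<xi> N j \<omega>)"
      unfolding hV by (simp add: B_def prod.reindex inj_on_def)
    also have "\<dots> = z ^ (\<Sum>j<l. \<xi> N j \<omega>)" by (simp add: power_sum)
    finally show "indicator {\<omega>\<in>space M. Z n \<omega> = k \<and> Z N \<omega> = l} \<omega> *\<^sub>R z ^ Z (Suc N) \<omega>
      = g (restrict (\<lambda>i. V i \<omega>) A) * h (restrict (\<lambda>i. V i \<omega>) B)"
      using w by (auto simp: gV Z_Suc indicator_def)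
  qed
  also have "\<dots> = \<P>(\<omega> in M. Z n \<omega> = k \<and> Z N \<omega> = l) *\<^sub>R pgf p z ^ l"
    by (subst indep_var_lebesgue_integral[OF ind gint hint]) (simp add: Eg Eh scaleR_conv_of_real)
  finally show ?thesis .
qed

lemma norm_pgf_le_1: "norm (z::complex) \<le> 1 \<Longrightarrow> norm (pgf p z) \<le> 1"
  using norm_pgf_le[of z 1 p] by simp

text \<open>The branching property without conditional expectations. The induction peels off the
  last generation, which replaces \<open>z\<close> by \<open>pgf p z\<close>; hence \<open>z\<close>
  is kept arbitrary.\<close>

lemma markov_pgf:
  fixes z :: complex
  assumes "norm z \<le> 1"
  shows "(\<integral>\<omega>. indicator {\<omega>\<in>space M. Z n \<omega> = k} \<omega> *\<^sub>R z ^ Z (n + i) \<omega> \<partial>M)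
    = \<P>(\<omega> in M. Z n \<omega> = k) *\<^sub>R pgf_iter p i z ^ k"
  using assms
proof (induction i arbitrary: z)
  case 0
  have "(\<integral>\<omega>. indicator {\<omega>\<in>space M. Z n \<omega> = k} \<omega> *\<^sub>R z ^ Z n \<omega> \<partial>M)
    = (\<integral>\<omega>. indicator {\<omega>\<in>space M. Z n \<omega> = k} \<omega> *\<^sub>R z ^ k \<partial>M)"
    by (intro Bochner_Integration.integral_cong) (auto simp: indicator_def)
  also have "\<dots> = \<P>(\<omega> in M. Z n \<omega> = k) *\<^sub>R z ^ k"
    by (rule integral_indicator_scaleR) measurable
  finally show ?case by simp
next
  case (Suc i)
  define A where "A = {\<omega>\<in>space M. Z n \<omega> = k}"
  have A: "A \<in> sets M" unfolding A_def by measurable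
  have int: "integrable M (\<lambda>\<omega>. indicator A \<omega> *\<^sub>R z ^ Z (Suc (n + i)) \<omega>)"
    by (rule integrable_mult_indicator[OF A], rule integrable_const_bound[where B=1])
       (use Suc.prems in \<open>auto simp: norm_power power_le_one\<close>)
  have "(\<lambda>l. \<integral>\<omega>. indicator {\<omega>\<in>space M. Z (n + i) \<omega> = l} \<omega> *\<^sub>R indicator A \<omega> *\<^sub>R z ^ Z (Suc (n + i)) \<omega> \<partial>M)
    sums (\<integral>\<omega>. indicator A \<omega> *\<^sub>R z ^ Z (Suc (n + i)) \<omega> \<partial>M)"
    by (rule sums_integral_nat_partition[OF int]) measurable
  also have "(\<lambda>l. \<integral>\<omega>. indicator {\<omega>\<in>space M. Z (n + i) \<omega> = l} \<omega> *\<^sub>R indicator A \<omega> *\<^sub>R z ^ Z (Suc (n + i)) \<omega> \<partial>M)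
      = (\<lambda>l. prob {\<omega>\<in>A. Z (n + i) \<omega> = l} *\<^sub>R pgf p z ^ l)"
  proof
    fix l
    have "(\<integral>\<omega>. indicator {\<omega>\<in>space M. Z (n + i) \<omega> = l} \<omega> *\<^sub>R indicator A \<omega> *\<^sub>R z ^ Z (Suc (n + i)) \<omega> \<partial>M)
      = (\<integral>\<omega>. indicator {\<omega>\<in>space M. Z n \<omega> = k \<and> Z (n + i) \<omega> = l} \<omega> *\<^sub>R z ^ Z (Suc (n + i)) \<omega> \<partial>M)"
      by (intro Bochner_Integration.integral_cong) (auto simp: A_def indicator_def)
    also have "\<dots> = \<P>(\<omega> in M. Z n \<omega> = k \<and> Z (n + i) \<omega> = l) *\<^sub>R pgf p z ^ l"
      by (rule indicator_pow_step[OF Suc.prems]) simp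
    finally show "(\<integral>\<omega>. indicator {\<omega>\<in>space M. Z (n + i) \<omega> = l} \<omega> *\<^sub>R indicator A \<omega> *\<^sub>R z ^ Z (Suc (n + i)) \<omega> \<partial>M)
      = prob {\<omega>\<in>A. Z (n + i) \<omega> = l} *\<^sub>R pgf p z ^ l" by (simp add: A_def conj_ac)
  qed
  finally have 1: "(\<lambda>l. prob {\<omega>\<in>A. Z (n + i) \<omega> = l} *\<^sub>R pgf p z ^ l) sums
    (\<integral>\<omega>. indicator A \<omega> *\<^sub>R z ^ Z (Suc (n + i)) \<omega> \<partial>M)" .
  have 2: "(\<lambda>l. prob {\<omega>\<in>A. Z (n + i) \<omega> = l} *\<^sub>R pgf p z ^ l) sums
    (\<integral>\<omega>. indicator A \<omega> *\<^sub>R pgf p z ^ Z (n + i) \<omega> \<partial>M)"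
    by (rule expectation_nat_sums[where B=1, OF _ A])
       (use norm_pgf_le_1[OF Suc.prems] in \<open>auto simp: norm_power power_le_one\<close>)
  show ?case
    using sums_unique2[OF 1 2] Suc.IH[OF norm_pgf_le_1[OF Suc.prems]]
    unfolding A_def by (simp add: funpow_swap1)
qed

lemma expectation_pow_Z:
  fixes z :: complex
  assumes "norm z \<le> 1"
  shows "expectation (\<lambda>\<omega>. z ^ Z n \<omega>) = pgf_iter p n z"
  using markov_pgf[OF assms, of 0 1 n] by (simp add: Z_0 prob_space cong: Bochner_Integration.integral_cong)

lemma X_meas [measurable]: "X (Suc k) \<in> borel_measurable M"
proof -
  have "Inr (Suc k) \<in> J" by auto
  then have "V (Inr (Suc k)) \<in> borel_measurable M" using V_indep unfolding indep_vars_def2 by blast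
  then show ?thesis by simp
qed

lemma X_indep: "indep_vars (\<lambda>_. borel) (\<lambda>i. X (Suc i)) UNIV"
proof -
  have "indep_vars (\<lambda>j. PiM {Inr (Suc j)} (\<lambda>_. borel)) (\<lambda>j \<omega>. restrict (\<lambda>i. V i \<omega>) {Inr (Suc j)}) UNIV"
    by (rule indep_vars_restrict[OF V_indep]) (auto simp: disjoint_family_on_def)
  from indep_vars_compose2[OF this, of "\<lambda>j x. x (Inr (Suc j))" "\<lambda>_. borel"]
  show ?thesis by simp
qed

text \<open>The walk is independent of the population, so \<open>Z n\<close> may be frozen while the
  probability of the walk is taken over a second sample point.\<close>

lemma prob_R_ge_eq:
  "prob_R_ge M Z X n e = expectation (\<lambda>\<omega>. if Z n \<omega> = 0 then 0 else
     prob {\<omega>'\<in>space M. e * real (Z n \<omega>) \<le> (\<Sum>i<Z n \<omega>. X (Suc i) \<omega>')})"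
proof -
  have psum: "psum X k \<omega> = (\<Sum>i<k. X (Suc i) \<omega>)" for k \<omega>
    unfolding psum_def by (rule sum.reindex_bij_witness[of _ Suc "\<lambda>i. i - 1"]) auto
  define H where "H k = (if k = 0 then 0 else prob {\<omega>'\<in>space M. e * real k \<le> (\<Sum>i<k. X (Suc i) \<omega>')})" for k
  define D where "D = {\<omega>\<in>space M. 0 < Z n \<omega> \<and> e \<le> (\<Sum>i<Z n \<omega>. X (Suc i) \<omega>) / real (Z n \<omega>)}"
  have Dm [measurable]: "D \<in> sets M"
  proof -
    have "(\<lambda>\<omega>. (\<lambda>k \<omega>. \<Sum>i<k. X (Suc i) \<omega>) (Z n \<omega>) \<omega>) \<in> borel_measurable M"
      by (rule measurable_compose_countable[OF _ Z_meas]) measurable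
    then have [measurable]: "(\<lambda>\<omega>. \<Sum>i<Z n \<omega>. X (Suc i) \<omega>) \<in> borel_measurable M" by simp
    show ?thesis unfolding D_def by measurable
  qed
  have pk: "prob {\<omega>\<in>D. Z n \<omega> = k} = \<P>(\<omega> in M. Z n \<omega> = k) * H k" for k
  proof (cases "k = 0")
    case False
    define A :: "((nat \<times> nat) + nat) set" where "A = range Inl"
    define B :: "((nat \<times> nat) + nat) set" where "B = Inr ` (Suc ` {..<k})"
    have sub: "Inl ` ({..<n} \<times> UNIV) \<subseteq> A" by (auto simp: A_def)
    define h where "h x = (\<Sum>i<k. x (Inr (Suc i)))" for x :: "(nat \<times> nat) + nat \<Rightarrow> real"
    have sm: "h \<in> borel_measurable (PiM B (\<lambda>_. borel))"
      unfolding h_def by (intro borel_measurable_sum measurable_component_singleton) (auto simp: B_def)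
    define g where "g x = real (gw_of_family n x)" for x
    have gm: "g \<in> borel_measurable (PiM A (\<lambda>_. borel))"
      unfolding g_def by (rule measurable_compose[OF measurable_gw_of_family[OF sub]]) simp
    have ind: "indep_var borel (\<lambda>\<omega>. g (restrict (\<lambda>i. V i \<omega>) A))
        borel (\<lambda>\<omega>. h (restrict (\<lambda>i. V i \<omega>) B))"
      by (rule indep_split[OF _ _ _ gm sm]) (auto simp: A_def B_def)
    have e1: "g (restrict (\<lambda>i. V i \<omega>) A) = real (Z n \<omega>)" for \<omega>
      unfolding g_def using Z_eq_family[OF sub, of \<omega>] by simp
    have e2: "h (restrict (\<lambda>i. V i \<omega>) B) = (\<Sum>i<k. X (Suc i) \<omega>)" for \<omega>
      unfolding h_def by (intro sum.cong) (auto simp: B_def)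
    have "prob {\<omega>\<in>D. Z n \<omega> = k} = \<P>(\<omega> in M. Z n \<omega> = k \<and> e * real k \<le> (\<Sum>i<k. X (Suc i) \<omega>))"
      by (rule arg_cong[where f=prob]) (use False in \<open>auto simp: D_def le_divide_eq\<close>)
    also have "\<dots> = \<P>(\<omega> in M. Z n \<omega> = k) * \<P>(\<omega> in M. e * real k \<le> (\<Sum>i<k. X (Suc i) \<omega>))"
      using indep_varD[OF ind, of "{real k}" "{e * real k..}"] unfolding e1 e2
      by (simp add: vimage_def Int_def conj_commute conj_ac)
    finally show ?thesis using False by (simp add: H_def)
  next
    case True
    then have "{\<omega>\<in>D. Z n \<omega> = k} = {}" by (auto simp: D_def)
    then show ?thesis using True by (simp only: H_def measure_empty) simp
  qed
  have "(\<lambda>k. prob {\<omega>\<in>D. Z n \<omega> = k} *\<^sub>R (1::real)) sums (\<integral>\<omega>. indicator D \<omega> *\<^sub>R 1 \<partial>M)"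
    by (rule expectation_nat_sums[where B=1]) auto
  moreover have "(\<lambda>k. \<P>(\<omega> in M. Z n \<omega> = k) *\<^sub>R H k) sums (\<integral>\<omega>. indicator (space M) \<omega> *\<^sub>R H (Z n \<omega>) \<partial>M)"
    by (rule expectation_nat_sums[where B=1]) (auto simp: H_def)
  moreover have "(\<integral>\<omega>. indicator (space M) \<omega> *\<^sub>R H (Z n \<omega>) \<partial>M) = expectation (\<lambda>\<omega>. H (Z n \<omega>))"
    by (intro Bochner_Integration.integral_cong) auto
  ultimately have "prob D = expectation (\<lambda>\<omega>. H (Z n \<omega>))"
    by (simp add: pk sums_unique2)
  then show ?thesis unfolding prob_R_ge_def psum D_def H_def by simp
qed

end

section \<open>The limit \<open>W\<close>, its transforms and its atom at 0\<close>

locale gw_limit = gw_family M p \<xi> Z X + supercritical_pgf p m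
  for M :: "'a measure" and p \<xi> Z X m +
  fixes W :: "'a \<Rightarrow> real" and q \<alpha> :: real
  assumes q_eq: "q = measure M {\<omega>\<in>space M. \<exists>n. Z n \<omega> = 0}"
    and schroeder_eq: "deriv (offspring_gf p) q = m powr (- \<alpha>)"
    and alpha_gt_1: "1 < \<alpha>"
    and W_meas [measurable]: "W \<in> borel_measurable M"
    and W_lim: "AE \<omega> in M. (\<lambda>n. real (Z n \<omega>) / m ^ n) \<longlonglongrightarrow> W \<omega>"
begin

abbreviation prob_W_le :: "real \<Rightarrow> real" where
  "prob_W_le u \<equiv> \<P>(\<omega> in M. 0 < W \<omega> \<and> W \<omega> \<le> u)"

lemma m_pos: "0 < m" using m_gt_1 by simp

lemma W_nonneg: "AE \<omega> in M. 0 \<le> W \<omega>"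
  using W_lim
proof eventually_elim
  case (elim \<omega>)
  then show ?case by (rule LIMSEQ_le_const) (use m_pos in auto)
qed

text \<open>On the closed left half plane one function plays three roles: the Laplace transform on
  the negative reals, the characteristic function on the imaginary axis, and the Fourier transform
  of the exponentially tilted law on the line \<open>Re z = -1\<close>.\<close>

definition Psi :: "complex \<Rightarrow> complex" where
  "Psi z = expectation (\<lambda>\<omega>. exp (z * of_real (W \<omega>)))"

definition Phi :: "real \<Rightarrow> real" where
  "Phi h = expectation (\<lambda>\<omega>. exp (- h * W \<omega>))"

lemma norm_exp_le_1: "Re z \<le> 0 \<Longrightarrow> 0 \<le> x \<Longrightarrow> norm (exp (z * of_real x)) \<le> 1"
  by (simp add: mult_nonpos_nonneg)

lemma exp_W_int: "Re z \<le> 0 \<Longrightarrow> integrable M (\<lambda>\<omega>. exp (z * of_real (W \<omega>)))"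
  by (rule integrable_const_bound[where B=1])
     (use W_nonneg in \<open>auto elim!: eventually_mono simp del: norm_exp_eq_Re intro: norm_exp_le_1\<close>)

lemma norm_Psi_le_1: "Re z \<le> 0 \<Longrightarrow> norm (Psi z) \<le> 1"
proof -
  assume z: "Re z \<le> 0"
  have "norm (Psi z) \<le> expectation (\<lambda>\<omega>. norm (exp (z * of_real (W \<omega>))))"
    unfolding Psi_def by (rule integral_norm_bound)
  also have "\<dots> \<le> expectation (\<lambda>_. 1)"
    by (rule integral_mono_AE)
       (use exp_W_int[OF z] W_nonneg z in \<open>auto elim!: eventually_mono simp del: norm_exp_eq_Re intro: norm_exp_le_1\<close>)
  finally show ?thesis by (simp add: prob_space)
qed

lemma exp_pow_eq: "exp ((z::complex) / of_real (m ^ i)) ^ k = exp (z * of_real (real k / m ^ i))"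
proof -
  have "z * of_real (real k / m ^ i) = of_nat k * (z / of_real (m ^ i))" by simp
  then show ?thesis by (simp only: exp_of_nat_mult)
qed

lemma norm_exp_div_le_1: "Re z \<le> 0 \<Longrightarrow> norm (exp (z / of_real (m ^ i))) \<le> 1"
  using norm_exp_le_1[of z "1 / m ^ i"] m_pos by (simp add: divide_inverse)

lemma tendsto_exp_W:
  assumes z: "Re z \<le> 0" and A: "A \<in> sets M"
  shows "(\<lambda>i. \<integral>\<omega>. indicator A \<omega> *\<^sub>R exp (z / of_real (m ^ i)) ^ Z (n + i) \<omega> \<partial>M)
    \<longlonglongrightarrow> (\<integral>\<omega>. indicator A \<omega> *\<^sub>R exp (z * of_real (m ^ n) * of_real (W \<omega>)) \<partial>M)"
proof (rule integral_dominated_convergence[where w="\<lambda>_. 1"])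
  show "AE \<omega> in M. (\<lambda>i. indicator A \<omega> *\<^sub>R exp (z / of_real (m ^ i)) ^ Z (n + i) \<omega>)
      \<longlonglongrightarrow> indicator A \<omega> *\<^sub>R exp (z * of_real (m ^ n) * of_real (W \<omega>))"
    using W_lim
  proof eventually_elim
    case (elim \<omega>)
    have "(\<lambda>i. m ^ n * (real (Z (n + i) \<omega>) / m ^ (n + i))) \<longlonglongrightarrow> m ^ n * W \<omega>"
      using LIMSEQ_ignore_initial_segment[OF elim, of n] by (intro tendsto_intros) (simp add: add.commute)
    then have "(\<lambda>i. real (Z (n + i) \<omega>) / m ^ i) \<longlonglongrightarrow> m ^ n * W \<omega>"
      using m_pos by (simp add: power_add)
    then have E: "(\<lambda>i. exp (z * of_real (real (Z (n + i) \<omega>) / m ^ i))) \<longlonglongrightarrow> exp (z * of_real (m ^ n * W \<omega>))"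
      by (intro tendsto_intros)
    have "(\<lambda>i. indicator A \<omega> *\<^sub>R exp (z / of_real (m ^ i)) ^ Z (n + i) \<omega>)
      \<longlonglongrightarrow> indicator A \<omega> *\<^sub>R exp (z * of_real (m ^ n * W \<omega>))"
      unfolding exp_pow_eq by (rule tendsto_scaleR[OF tendsto_const E])
    then show ?case by (simp add: mult.assoc)
  qed
  show "AE \<omega> in M. norm (indicator A \<omega> *\<^sub>R exp (z / of_real (m ^ i)) ^ Z (n + i) \<omega>) \<le> 1" for i
    using norm_exp_div_le_1[OF z, of i] by (auto simp: indicator_def norm_power power_le_one simp del: norm_exp_eq_Re)
qed (use A in \<open>auto intro!: borel_measurable_scaleR\<close>)

lemma pgf_iter_tendsto_Psi:
  assumes z: "Re z \<le> 0"
  shows "(\<lambda>i. pgf_iter p i (exp (z / of_real (m ^ i)))) \<longlonglongrightarrow> Psi z"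
proof -
  have "(\<integral>\<omega>. indicator (space M) \<omega> *\<^sub>R exp (z / of_real (m ^ i)) ^ Z (0 + i) \<omega> \<partial>M) = pgf_iter p i (exp (z / of_real (m ^ i)))" for i
    using expectation_pow_Z[OF norm_exp_div_le_1[OF z, of i], of i] by (simp cong: Bochner_Integration.integral_cong)
  moreover have "(\<integral>\<omega>. indicator (space M) \<omega> *\<^sub>R exp (z * of_real (m ^ 0) * of_real (W \<omega>)) \<partial>M) = Psi z"
    unfolding Psi_def by (intro Bochner_Integration.integral_cong) auto
  ultimately show ?thesis using tendsto_exp_W[OF z, of "space M" 0] by simp
qed

text \<open>The limit of \<open>markov_pgf\<close> as the number of further generations grows: given
  \<open>Z n = k\<close>, the variable \<open>m ^ n * W\<close> is distributed as a sum of
  \<open>k\<close> independent copies of \<open>W\<close>.\<close>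

lemma Psi_markov:
  assumes z: "Re z \<le> 0"
  shows "(\<integral>\<omega>. indicator {\<omega>\<in>space M. Z n \<omega> = k} \<omega> *\<^sub>R exp (z * of_real (m ^ n) * of_real (W \<omega>)) \<partial>M)
    = \<P>(\<omega> in M. Z n \<omega> = k) *\<^sub>R Psi z ^ k"
proof (rule LIMSEQ_unique)
  show "(\<lambda>i. \<integral>\<omega>. indicator {\<omega>\<in>space M. Z n \<omega> = k} \<omega> *\<^sub>R exp (z / of_real (m ^ i)) ^ Z (n + i) \<omega> \<partial>M)
    \<longlonglongrightarrow> (\<integral>\<omega>. indicator {\<omega>\<in>space M. Z n \<omega> = k} \<omega> *\<^sub>R exp (z * of_real (m ^ n) * of_real (W \<omega>)) \<partial>M)"
    by (rule tendsto_exp_W[OF z]) measurable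
  show "(\<lambda>i. \<integral>\<omega>. indicator {\<omega>\<in>space M. Z n \<omega> = k} \<omega> *\<^sub>R exp (z / of_real (m ^ i)) ^ Z (n + i) \<omega> \<partial>M)
    \<longlonglongrightarrow> \<P>(\<omega> in M. Z n \<omega> = k) *\<^sub>R Psi z ^ k"
    unfolding markov_pgf[OF norm_exp_div_le_1[OF z]] by (intro tendsto_intros pgf_iter_tendsto_Psi z)
qed

text \<open>Poincare's functional equation, obtained by summing \<open>Psi_markov\<close> over the
  values of \<open>Z n\<close>. It moves every frequency into one fundamental domain for
  multiplication by \<open>m\<close>.\<close>

lemma Psi_iter:
  assumes z: "Re z \<le> 0"
  shows "Psi (z * of_real (m ^ n)) = pgf_iter p n (Psi z)"
proof -
  have z': "Re (z * of_real (m ^ n)) \<le> 0" using z m_pos by (simp add: mult_nonpos_nonneg)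
  have "(\<lambda>k. \<integral>\<omega>. indicator {\<omega>\<in>space M. Z n \<omega> = k} \<omega> *\<^sub>R exp (z * of_real (m ^ n) * of_real (W \<omega>)) \<partial>M)
    sums Psi (z * of_real (m ^ n))"
    unfolding Psi_def by (rule sums_integral_nat_partition[OF exp_W_int[OF z']]) measurable
  then have 1: "(\<lambda>k. \<P>(\<omega> in M. Z n \<omega> = k) *\<^sub>R Psi z ^ k) sums Psi (z * of_real (m ^ n))"
    unfolding Psi_markov[OF z] .
  have "(\<lambda>k. \<P>(\<omega> in M. Z n \<omega> = k) *\<^sub>R Psi z ^ k) sums (\<integral>\<omega>. indicator (space M) \<omega> *\<^sub>R Psi z ^ Z n \<omega> \<partial>M)"
    by (rule expectation_nat_sums[where B=1]) (use norm_Psi_le_1[OF z] in \<open>auto simp: norm_power power_le_one\<close>)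
  moreover have "(\<integral>\<omega>. indicator (space M) \<omega> *\<^sub>R Psi z ^ Z n \<omega> \<partial>M) = pgf_iter p n (Psi z)"
    using expectation_pow_Z[OF norm_Psi_le_1[OF z], of n] by (simp cong: Bochner_Integration.integral_cong)
  ultimately show ?thesis using sums_unique2[OF 1] by simp
qed

lemma Psi_real: "Psi (of_real (- h)) = of_real (Phi h)"
proof -
  have "exp (of_real (- h) * of_real (W \<omega>) :: complex) = of_real (exp (- h * W \<omega>))" for \<omega>
    by (simp only: of_real_mult[symmetric] exp_of_real)
  then show ?thesis unfolding Psi_def Phi_def by (simp only: integral_complex_of_real)
qed

lemma Phi_int: "0 \<le> h \<Longrightarrow> integrable M (\<lambda>\<omega>. exp (- h * W \<omega>))"
  by (rule integrable_const_bound[where B=1]) (use W_nonneg in \<open>auto elim!: eventually_mono\<close>)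

lemma Phi_range: "0 \<le> h \<Longrightarrow> 0 \<le> Phi h \<and> Phi h \<le> 1"
proof
  assume h: "0 \<le> h"
  show "0 \<le> Phi h" unfolding Phi_def by (intro Bochner_Integration.integral_nonneg) auto
  show "Phi h \<le> 1" using norm_Psi_le_1[of "of_real (- h)"] h unfolding Psi_real by simp
qed

lemma lap_tendsto_Phi:
  assumes h: "0 \<le> h"
  shows "(\<lambda>n. lap n h) \<longlonglongrightarrow> Phi h"
proof -
  have "(\<lambda>i. pgf_iter p i (exp (of_real (- h) / of_real (m ^ i))) :: complex) \<longlonglongrightarrow> of_real (Phi h)"
    using pgf_iter_tendsto_Psi[of "of_real (- h)"] h unfolding Psi_real by simp
  moreover have *: "pgf_iter p i (exp (of_real (- h) / of_real (m ^ i)) :: complex) = of_real (lap i h)" for i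
  proof -
    have "exp (of_real (- h) / of_real (m ^ i) :: complex) = of_real (exp (- h / m ^ i))"
      by (simp only: of_real_divide[symmetric] exp_of_real)
    then show ?thesis unfolding lap_def using h m_pos by (subst pgf_iter_of_real[symmetric]) auto
  qed
  ultimately have "(\<lambda>i. of_real (lap i h) :: complex) \<longlonglongrightarrow> of_real (Phi h)" by (simp only: *)
  then show ?thesis by (simp only: tendsto_of_real_iff)
qed

lemma lap_le_Phi: "0 \<le> h \<Longrightarrow> lap n h \<le> Phi h"
  by (rule incseq_le[OF lap_incseq lap_tendsto_Phi])

lemma Phi_deriv_0: "((\<lambda>h. (1 - Phi h) / h) \<longlongrightarrow> 1) (at_right 0)"
  by (rule lap_tendsto_range) (rule lap_tendsto_Phi)

lemma Phi_iter: "0 \<le> h \<Longrightarrow> Phi (h * m ^ n) = pgf_iter p n (Phi h)"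
proof -
  assume h: "0 \<le> h"
  have "of_real (Phi (h * m ^ n)) = Psi (of_real (- h) * of_real (m ^ n))"
    using Psi_real[of "h * m ^ n"] by simp
  also have "\<dots> = pgf_iter p n (Psi (of_real (- h)))" using h by (intro Psi_iter) simp
  also have "\<dots> = of_real (pgf_iter p n (Phi h))"
    unfolding Psi_real using Phi_range[OF h] by (intro pgf_iter_of_real) auto
  finally have "of_real (Phi (h * m ^ n)) = (of_real (pgf_iter p n (Phi h)) :: complex)" .
  then show ?thesis by (simp only: of_real_eq_iff)
qed

lemma Phi_markov:
  assumes h: "0 \<le> h"
  shows "(\<integral>\<omega>. indicator {\<omega>\<in>space M. Z n \<omega> = k} \<omega> * exp (- h * m ^ n * W \<omega>) \<partial>M)
    = \<P>(\<omega> in M. Z n \<omega> = k) * Phi h ^ k"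
proof -
  have "(\<integral>\<omega>. of_real (indicator {\<omega>\<in>space M. Z n \<omega> = k} \<omega> * exp (- h * m ^ n * W \<omega>)) \<partial>M)
    = (of_real (\<P>(\<omega> in M. Z n \<omega> = k) * Phi h ^ k) :: complex)"
    using Psi_markov[of "of_real (- h)" n k] h
    by (simp add: Psi_real scaleR_conv_of_real exp_of_real[symmetric] del: exp_of_real of_real_minus) 
       (simp add: mult_ac)
  then show ?thesis by (simp only: integral_complex_of_real of_real_eq_iff)
qed

lemma expectation_real_pow_Z:
  fixes s :: real
  assumes "0 \<le> s" "s \<le> 1"
  shows "expectation (\<lambda>\<omega>. s ^ Z n \<omega>) = pgf_iter p n s"
proof -
  have "expectation (\<lambda>\<omega>. of_real (s ^ Z n \<omega>)) = (of_real (pgf_iter p n s) :: complex)"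
    using expectation_pow_Z[of "of_real s" n] assms by (simp add: pgf_iter_of_real)
  then show ?thesis by (simp only: integral_complex_of_real of_real_eq_iff)
qed

lemma prob_Z_0: "\<P>(\<omega> in M. Z n \<omega> = 0) = pgf_iter p n 0"
proof -
  have "expectation (\<lambda>\<omega>. (0::real) ^ Z n \<omega>) = expectation (\<lambda>\<omega>. indicator {\<omega>\<in>space M. Z n \<omega> = 0} \<omega> *\<^sub>R (1::real))"
    by (intro Bochner_Integration.integral_cong) (auto simp: indicator_def)
  also have "\<dots> = \<P>(\<omega> in M. Z n \<omega> = 0)" by (subst integral_indicator_scaleR) auto
  finally show ?thesis using expectation_real_pow_Z[of 0 n] by simp
qed

lemma pow_Z_int: "0 \<le> s \<Longrightarrow> s \<le> 1 \<Longrightarrow> integrable M (\<lambda>\<omega>. s ^ Z n \<omega>)" for s :: real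
  by (rule integrable_const_bound[where B=1]) (auto simp: power_le_one)

lemma Z_absorb: "Z n \<omega> = 0 \<Longrightarrow> n \<le> k \<Longrightarrow> Z k \<omega> = 0"
proof (induction k)
  case (Suc k) then show ?case by (cases "n \<le> k") (auto simp: Z_Suc le_Suc_eq)
qed simp

lemma prob_Z_0_tendsto: "(\<lambda>n. pgf_iter p n 0) \<longlonglongrightarrow> q"
proof -
  have "(\<lambda>n. \<P>(\<omega> in M. Z n \<omega> = 0)) \<longlonglongrightarrow> prob (\<Union>n. {\<omega>\<in>space M. Z n \<omega> = 0})"
    by (rule finite_Lim_measure_incseq) (auto simp: incseq_def dest: Z_absorb)
  also have "(\<Union>n. {\<omega>\<in>space M. Z n \<omega> = 0}) = {\<omega>\<in>space M. \<exists>n. Z n \<omega> = 0}" by auto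
  finally show ?thesis by (simp add: prob_Z_0 q_eq)
qed

lemma extinct_W: "AE \<omega> in M. (\<exists>n. Z n \<omega> = 0) \<longrightarrow> W \<omega> = 0"
  using W_lim
proof eventually_elim
  case (elim \<omega>)
  show ?case
  proof
    assume "\<exists>n. Z n \<omega> = 0"
    then obtain n where n: "Z n \<omega> = 0" by auto
    have "\<forall>\<^sub>F k in sequentially. real (Z k \<omega>) / m ^ k = 0"
      using eventually_ge_at_top[of n] by eventually_elim (simp add: Z_absorb[OF n])
    then have "(\<lambda>k. real (Z k \<omega>) / m ^ k) \<longlonglongrightarrow> 0" by (rule tendsto_eventually)
    with elim show "W \<omega> = 0" by (rule LIMSEQ_unique)
  qed
qed

abbreviation q0 :: real where "q0 \<equiv> \<P>(\<omega> in M. W \<omega> = 0)"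

text \<open>The slope of \<open>Phi\<close> at the origin excludes that \<open>W\<close> vanishes
  almost surely; afterwards \<open>Phi h = 1\<close> would force exactly that.\<close>

lemma Phi_less_1: "0 < h \<Longrightarrow> Phi h < 1" and q0_less_1: "q0 < 1"
proof -
  have "\<forall>\<^sub>F h in at_right 0. (1 - Phi h) / h > 1/2"
    using Phi_deriv_0 by (rule order_tendstoD) simp
  moreover have "\<forall>\<^sub>F h in at_right 0. (0::real) < h" by (simp add: eventually_at_right_less)
  ultimately have "\<forall>\<^sub>F h in at_right 0. 0 < h \<and> (1 - Phi h) / h > 1/2" by eventually_elim auto
  then obtain h where h: "0 < h" "(1 - Phi h) / h > 1/2"
    by (auto dest: eventually_happens simp: trivial_limit_at_right_real)
  have *: "Phi h < 1"
  proof (rule ccontr)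
    assume "\<not> Phi h < 1"
    then have "(1 - Phi h) / h \<le> 0" using h(1) by (simp add: divide_nonpos_pos)
    then show False using h(2) by simp
  qed
  show q01: "q0 < 1"
  proof (rule ccontr)
    assume "\<not> q0 < 1"
    then have "q0 = 1" using prob_le_1 by (simp add: order_antisym)
    then have "AE \<omega> in M. \<omega> \<in> {\<omega>\<in>space M. W \<omega> = 0}" by (intro AE_prob_1)
    then have "Phi h = expectation (\<lambda>_. 1)"
      unfolding Phi_def by (intro integral_cong_AE) auto
    then show False using * by (simp add: prob_space)
  qed
  show "0 < h \<Longrightarrow> Phi h < 1" for h
  proof (rule ccontr)
    assume h: "0 < h" "\<not> Phi h < 1"
    then have "Phi h = 1" using Phi_range[of h] by auto
    then have "expectation (\<lambda>\<omega>. 1 - exp (- h * W \<omega>)) = 0"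
      using Phi_int[of h] h by (simp add: Phi_def prob_space)
    moreover have "AE \<omega> in M. 0 \<le> 1 - exp (- h * W \<omega>)"
      using W_nonneg by eventually_elim (use h in auto)
    ultimately have "AE \<omega> in M. 1 - exp (- h * W \<omega>) = 0"
      using integral_nonneg_eq_0_iff_AE[of M "\<lambda>\<omega>. 1 - exp (- h * W \<omega>)"] Phi_int[of h] h by auto
    then have "AE \<omega> in M. W \<omega> = 0" by eventually_elim (use h in auto)
    then have "q0 = 1" by (subst prob_Collect_eq_1) auto
    then show False using q01 by simp
  qed
qed

lemma q_le_q0: "q \<le> q0"
  unfolding q_eq
proof (rule finite_measure_mono_AE)
  show "AE \<omega> in M. \<omega> \<in> {\<omega>\<in>space M. \<exists>n. Z n \<omega> = 0} \<longrightarrow> \<omega> \<in> {\<omega>\<in>space M. W \<omega> = 0}"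
    using extinct_W by eventually_elim auto
qed measurable

lemma q_fixed: "pgf p q = q" and q_bounds: "0 \<le> q" "q < 1"
proof -
  show b: "0 \<le> q" "q < 1" using q_le_q0 q0_less_1 by (auto simp: q_eq)
  have "isCont (pgf p) q"
    by (rule DERIV_isCont[OF has_derivative_pgf]) (use b in auto)
  then have "(\<lambda>n. pgf p (pgf_iter p n 0)) \<longlonglongrightarrow> pgf p q" using prob_Z_0_tendsto by (rule isCont_tendsto_compose)
  moreover have "(\<lambda>n. pgf p (pgf_iter p n 0)) \<longlonglongrightarrow> q" using LIMSEQ_Suc[OF prob_Z_0_tendsto] by simp
  ultimately show "pgf p q = q" by (rule LIMSEQ_unique)
qed

lemma dpgf_q_eq: "dpgf p q = m powr (- \<alpha>)"
  using schroeder_eq DERIV_imp_deriv[OF has_derivative_pgf[of q p UNIV]] q_bounds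
  by (simp add: offspring_gf_eq_pgf)

sublocale pgf_fixpoint p q
proof
  show "0 < dpgf p q" using m_pos by (simp add: dpgf_q_eq)
  show "dpgf p q < 1" using m_gt_1 alpha_gt_1 powr_less_mono[of "-\<alpha>" 0 m] by (simp add: dpgf_q_eq)
qed (use q_fixed q_bounds in auto)

lemma gamma_pow: "dpgf p q ^ n = m powr (- \<alpha> * real n)"
  using m_pos by (simp add: dpgf_q_eq powr_powr powr_realpow[symmetric])

lemma Phi_pow_at_top: "(\<lambda>n. Phi (m ^ n)) \<longlonglongrightarrow> q0"
proof -
  have gen: "(\<lambda>n. Phi (c n)) \<longlonglongrightarrow> q0" if c: "filterlim c at_top sequentially" and c0: "\<And>n. 0 \<le> c n" for c :: "nat \<Rightarrow> real"
  proof -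
    have "(\<lambda>n. expectation (\<lambda>\<omega>. exp (- c n * W \<omega>))) \<longlonglongrightarrow> expectation (\<lambda>\<omega>. indicator {\<omega>\<in>space M. W \<omega> = 0} \<omega> *\<^sub>R 1)"
    proof (rule integral_dominated_convergence[where w="\<lambda>_. 1"])
      show "AE \<omega> in M. (\<lambda>n. exp (- c n * W \<omega>)) \<longlonglongrightarrow> indicator {\<omega>\<in>space M. W \<omega> = 0} \<omega> *\<^sub>R 1"
        using W_nonneg AE_space
      proof eventually_elim
        case (elim \<omega>)
        show ?case
        proof (cases "W \<omega> = 0")
          case False
          then have "0 < W \<omega>" using elim by simp
          have "filterlim (\<lambda>n. c n * W \<omega>) at_top sequentially"
            using filterlim_tendsto_pos_mult_at_top[OF tendsto_const \<open>0 < W \<omega>\<close> c] by (simp add: mult.commute)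
          then have "filterlim (\<lambda>n. - (c n * W \<omega>)) at_bot sequentially"
            by (simp add: filterlim_uminus_at_bot)
          then have "(\<lambda>n. exp (- (c n * W \<omega>))) \<longlonglongrightarrow> 0" by (rule filterlim_compose[OF exp_at_bot])
          then show ?thesis using False elim by simp
        qed (use elim in simp)
      qed
      show "AE \<omega> in M. norm (exp (- c n * W \<omega>)) \<le> 1" for n
        using W_nonneg by eventually_elim (use c0 in auto)
    qed auto
    then show ?thesis unfolding Phi_def by (subst (asm) integral_indicator_scaleR) auto
  qed
  show "(\<lambda>n. Phi (m ^ n)) \<longlonglongrightarrow> q0"
  proof (rule gen)
    have "filterlim (\<lambda>n. m ^ n) at_infinity sequentially"
      using m_gt_1 by (intro filterlim_realpow_sequentially_gt1) simp
    then show "filterlim (\<lambda>n. m ^ n) at_top sequentially"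
      by (rule filterlim_at_infinity_imp_filterlim_at_top) (use m_pos in simp)
  qed (use m_pos in simp)
qed

text \<open>The probability of \<open>W = 0\<close> is the limit of the iterates of
  \<open>Phi 1\<close>. Since \<open>Phi 1 < 1\<close>, these lie below an orbit that converges to
  \<open>q\<close>; the other inequality holds because extinction forces
  \<open>W = 0\<close>.\<close>

lemma prob_W_0: "q0 = q"
proof -
  have "(\<lambda>n. pgf_iter p n (Phi 1)) \<longlonglongrightarrow> q0" using Phi_pow_at_top Phi_iter[of 1] by simp
  moreover have "pgf_iter p n (Phi 1) \<le> pgf_iter p n (max (Phi 1) q)" for n
    using Phi_range[of 1] q_bounds by (intro pgf_iter_mono) auto
  moreover have "(\<lambda>n. pgf_iter p n (max (Phi 1) q)) \<longlonglongrightarrow> q"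
    by (rule pgf_iter_tendsto_q) (use Phi_less_1[of 1] q_bounds in auto)
  ultimately have "q0 \<le> q" by (intro LIMSEQ_le[of "\<lambda>n. pgf_iter p n (Phi 1)"]) auto
  then show ?thesis using q_le_q0 by simp
qed

text \<open>Removing the event \<open>Z n = 0\<close> turns the generating function into a
  difference of two iterates, at \<open>t\<close> and at 0. After \<open>N\<close> generations both
  lie in the interval up to \<open>r\<close>, and each of the remaining \<open>n - N\<close>
  generations contracts by \<open>m powr (- \<alpha>)\<close>.\<close>

lemma pow_Z_pos_bound:
  assumes "0 \<le> r" "r < 1"
  shows "\<exists>C>0. \<forall>n N t. N \<le> n \<longrightarrow> 0 \<le> t \<longrightarrow> t \<le> 1 \<longrightarrow> pgf_iter p N t \<le> r \<longrightarrow>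
     expectation (\<lambda>\<omega>. if Z n \<omega> = 0 then 0 else t ^ Z n \<omega>) \<le> C * m powr (- \<alpha> * real (n - N))"
proof -
  obtain C where C: "0 < C" "\<And>n (z::real) w. norm z \<le> r \<Longrightarrow> norm w \<le> r \<Longrightarrow>
      norm (pgf_iter p n z - pgf_iter p n w) \<le> C * dpgf p q ^ n * norm (z - w)"
    using pgf_iter_lipschitz[OF assms(2), where 'a=real] by blast
  show ?thesis
  proof (intro exI[of _ C] conjI allI impI C(1))
    fix n N and t :: real assume N: "N \<le> n" and t: "0 \<le> t" "t \<le> 1" "pgf_iter p N t \<le> r"
    have e: "(if Z n \<omega> = 0 then 0 else t ^ Z n \<omega>) = t ^ Z n \<omega> - 0 ^ Z n \<omega>" for \<omega>
      by (simp add: power_0_left)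
    have "expectation (\<lambda>\<omega>. if Z n \<omega> = 0 then 0 else t ^ Z n \<omega>) = pgf_iter p n t - pgf_iter p n 0"
      unfolding e using pow_Z_int[of t n] pow_Z_int[of 0 n] t
      by (simp add: expectation_real_pow_Z del: power_0_left)
    also have "\<dots> = pgf_iter p (n - N) (pgf_iter p N t) - pgf_iter p (n - N) (pgf_iter p N 0)"
      using N by (simp add: funpow_add[symmetric, THEN fun_cong, unfolded comp_def])
    also have "\<dots> \<le> C * dpgf p q ^ (n - N) * norm (pgf_iter p N t - pgf_iter p N 0)"
    proof -
      have r0: "0 \<le> pgf_iter p N (0::real)" "0 \<le> pgf_iter p N t" using pgf_iter_range[of 0 N p] pgf_iter_range[of t N p] t by auto
      have "pgf_iter p N 0 \<le> pgf_iter p N t" using t by (intro pgf_iter_mono) auto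
      then show ?thesis using C(2)[of "pgf_iter p N t" "pgf_iter p N 0" "n - N"] t r0 by auto
    qed
    also have "\<dots> \<le> C * dpgf p q ^ (n - N) * 1"
    proof (intro mult_left_mono)
      show "norm (pgf_iter p N t - pgf_iter p N 0) \<le> 1"
        using pgf_iter_range[of 0 N p] pgf_iter_range[of t N p] t by (auto simp: abs_le_iff)
    qed (use C(1) dpgf_q in auto)
    finally show "expectation (\<lambda>\<omega>. if Z n \<omega> = 0 then 0 else t ^ Z n \<omega>) \<le> C * m powr (- \<alpha> * real (n - N))"
      by (simp add: gamma_pow)
  qed
qed



text \<open>For \<open>x\<close> between 1 and \<open>m ^ n\<close>, let \<open>N\<close> be the
  generation at which \<open>m ^ N\<close> reaches \<open>x\<close>. With
  \<open>t = exp (- 1 / m ^ N)\<close>, the variable \<open>t ^ Z n\<close> is at least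
  \<open>exp (- 1)\<close> on the event, while \<open>N\<close> iterations bring \<open>t\<close>
  down to at most \<open>Phi 1\<close>. The remaining generations supply the power of
  \<open>x / m ^ n\<close>.\<close>

lemma small_Z_bound:
  "\<exists>C>0. \<forall>n x. 0 < x \<longrightarrow> prob_Z_le n x \<le> C * (x / m ^ n) powr \<alpha>"
proof -
  obtain C0 where C0: "0 < C0" "\<And>n N t. N \<le> n \<Longrightarrow> 0 \<le> t \<Longrightarrow> t \<le> 1 \<Longrightarrow> pgf_iter p N t \<le> Phi 1 \<Longrightarrow>
     expectation (\<lambda>\<omega>. if Z n \<omega> = 0 then 0 else t ^ Z n \<omega>) \<le> C0 * m powr (- \<alpha> * real (n - N))"
    using pow_Z_pos_bound[of "Phi 1"] Phi_range[of 1] Phi_less_1[of 1] by auto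
  define C where "C = max 1 (exp 1 * C0 * m powr \<alpha>)"
  show ?thesis
  proof (intro exI[of _ C] conjI allI impI)
    fix n and x :: real assume x0: "0 < x"
    let ?P = "prob_Z_le n x"
    consider "x < 1" | "m ^ n \<le> x" | "1 \<le> x" "x < m ^ n" by linarith
    then show "?P \<le> C * (x / m ^ n) powr \<alpha>"
    proof cases
      case 1
      then have "{\<omega>\<in>space M. 0 < Z n \<omega> \<and> real (Z n \<omega>) \<le> x} = {}" by auto
      then show ?thesis by (simp only: measure_empty) (auto simp: C_def)
    next
      case 2
      then have "1 \<le> x / m ^ n" using m_pos by simp
      then have "1 \<le> (x / m ^ n) powr \<alpha>" using alpha_gt_1 by (simp add: ge_one_powr_ge_zero)
      then have "1 * 1 \<le> C * (x / m ^ n) powr \<alpha>" by (intro mult_mono) (auto simp: C_def)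
      then show ?thesis using prob_le_1[of "{\<omega>\<in>space M. 0 < Z n \<omega> \<and> real (Z n \<omega>) \<le> x}"] by linarith
    next
      case 3
      define N where "N = (LEAST N. x \<le> m ^ N)"
      have xN: "x \<le> m ^ N" unfolding N_def by (rule LeastI[of _ n]) (use 3 in auto)
      have Nn: "N \<le> n" unfolding N_def by (rule Least_le) (use 3 in auto)
      have mN: "m ^ N \<le> m * x"
      proof (cases N)
        case 0
        then show ?thesis using 3 m_gt_1 mult_mono[of 1 m 1 x] by simp
      next
        case (Suc k)
        then have "\<not> x \<le> m ^ k" unfolding N_def by (intro not_less_Least) auto
        then show ?thesis using Suc m_pos by simp
      qed
      define t where "t = exp (- 1 / m ^ N)"
      have t: "0 \<le> t" "t \<le> 1" using m_pos by (auto simp: t_def)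
      have "pgf_iter p N t \<le> Phi 1" using lap_le_Phi[of 1 N] by (simp add: lap_def t_def)
      note E = C0(2)[OF Nn t this]
      have "?P = expectation (\<lambda>\<omega>. indicator {\<omega>\<in>space M. 0 < Z n \<omega> \<and> real (Z n \<omega>) \<le> x} \<omega> *\<^sub>R (1::real))"
        by (subst integral_indicator_scaleR) auto
      also have "\<dots> \<le> expectation (\<lambda>\<omega>. exp 1 * (if Z n \<omega> = 0 then 0 else t ^ Z n \<omega>))"
      proof (rule integral_mono)
        show "integrable M (\<lambda>\<omega>. exp 1 * (if Z n \<omega> = 0 then 0 else t ^ Z n \<omega>))"
          by (rule integrable_const_bound[where B="exp 1"]) (use t in \<open>auto simp: power_le_one\<close>)
        show "integrable M (\<lambda>\<omega>. indicator {\<omega>\<in>space M. 0 < Z n \<omega> \<and> real (Z n \<omega>) \<le> x} \<omega> *\<^sub>R (1::real))"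
          by (rule integrable_const_bound[where B=1]) (auto simp: indicator_def)
        fix \<omega>
        show "indicator {\<omega>\<in>space M. 0 < Z n \<omega> \<and> real (Z n \<omega>) \<le> x} \<omega> *\<^sub>R (1::real) \<le> exp 1 * (if Z n \<omega> = 0 then 0 else t ^ Z n \<omega>)"
        proof (cases "0 < Z n \<omega> \<and> real (Z n \<omega>) \<le> x")
          case True
          have "real (Z n \<omega>) / m ^ N \<le> 1" using True xN m_pos by (simp add: divide_le_eq)
          then have "1 \<le> exp (1 + - (real (Z n \<omega>) / m ^ N))" by simp
          also have "\<dots> = exp 1 * t ^ Z n \<omega>"
            unfolding t_def exp_add by (simp add: exp_of_nat_mult[symmetric])
          finally show ?thesis using True by (auto simp: indicator_def)
        qed (use t in \<open>auto simp: indicator_def\<close>)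
      qed
      also have "\<dots> \<le> exp 1 * (C0 * m powr (- \<alpha> * real (n - N)))" using E by simp
      also have "m powr (- \<alpha> * real (n - N)) = (m ^ N / m ^ n) powr \<alpha>"
      proof -
        have "m ^ N / m ^ n = m powr (- real (n - N))"
          using Nn m_pos by (simp add: of_nat_diff powr_diff powr_realpow)
        then show ?thesis using m_pos by (simp add: powr_powr mult.commute)
      qed
      also have "(m ^ N / m ^ n) powr \<alpha> \<le> (m * (x / m ^ n)) powr \<alpha>"
        using mN m_pos alpha_gt_1 by (intro powr_mono2) (auto simp: divide_right_mono)
      also have "\<dots> = m powr \<alpha> * (x / m ^ n) powr \<alpha>" by (rule powr_mult)
      also have "exp 1 * (C0 * (m powr \<alpha> * (x / m ^ n) powr \<alpha>)) \<le> C * (x / m ^ n) powr \<alpha>"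
      proof -
        have "exp 1 * C0 * m powr \<alpha> * (x / m ^ n) powr \<alpha> \<le> C * (x / m ^ n) powr \<alpha>"
          by (intro mult_right_mono) (auto simp: C_def)
        then show ?thesis by (simp add: mult_ac)
      qed
      finally show ?thesis using C0(1) by (simp add: mult_left_mono)
    qed
  qed (simp add: C_def)
qed

section \<open>Transfer of the lower tail from \<open>W\<close> to \<open>Z n\<close>\<close>

lemma Phi_markov_fun:
  fixes g :: "nat \<Rightarrow> real"
  assumes h: "0 \<le> h" and g: "\<And>k. \<bar>g k\<bar> \<le> B"
  shows "expectation (\<lambda>\<omega>. g (Z n \<omega>) * exp (- h * m ^ n * W \<omega>)) = expectation (\<lambda>\<omega>. g (Z n \<omega>) * Phi h ^ Z n \<omega>)"
proof -
  have B0: "0 \<le> B" using g[of 0] by linarith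
  have int: "integrable M (\<lambda>\<omega>. g (Z n \<omega>) * exp (- h * m ^ n * W \<omega>))"
  proof (rule integrable_const_bound[where B=B])
    show "AE \<omega> in M. norm (g (Z n \<omega>) * exp (- h * m ^ n * W \<omega>)) \<le> B"
      using W_nonneg
    proof eventually_elim
      case (elim \<omega>)
      have "\<bar>g (Z n \<omega>)\<bar> * exp (- h * m ^ n * W \<omega>) \<le> B * 1"
        using elim h m_pos B0 by (intro mult_mono g) auto
      then show ?case by (simp add: abs_mult)
    qed
  qed measurable
  have 1: "(\<lambda>k. \<integral>\<omega>. indicator {\<omega>\<in>space M. Z n \<omega> = k} \<omega> *\<^sub>R (g (Z n \<omega>) * exp (- h * m ^ n * W \<omega>)) \<partial>M)
      sums expectation (\<lambda>\<omega>. g (Z n \<omega>) * exp (- h * m ^ n * W \<omega>))"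
    by (rule sums_integral_nat_partition[OF int]) measurable
  have 2: "(\<integral>\<omega>. indicator {\<omega>\<in>space M. Z n \<omega> = k} \<omega> *\<^sub>R (g (Z n \<omega>) * exp (- h * m ^ n * W \<omega>)) \<partial>M)
      = \<P>(\<omega> in M. Z n \<omega> = k) *\<^sub>R (g k * Phi h ^ k)" for k
  proof -
    have "(\<integral>\<omega>. indicator {\<omega>\<in>space M. Z n \<omega> = k} \<omega> *\<^sub>R (g (Z n \<omega>) * exp (- h * m ^ n * W \<omega>)) \<partial>M)
      = (\<integral>\<omega>. g k * (indicator {\<omega>\<in>space M. Z n \<omega> = k} \<omega> * exp (- h * m ^ n * W \<omega>)) \<partial>M)"
      by (intro Bochner_Integration.integral_cong) (auto simp: indicator_def)
    then show ?thesis using Phi_markov[OF h, of n k] by simp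
  qed
  have 3: "(\<lambda>k. \<P>(\<omega> in M. Z n \<omega> = k) *\<^sub>R (g k * Phi h ^ k)) sums
      (\<integral>\<omega>. indicator (space M) \<omega> *\<^sub>R (g (Z n \<omega>) * Phi h ^ Z n \<omega>) \<partial>M)"
  proof (rule expectation_nat_sums[where B=B])
    show "norm (g k * Phi h ^ k) \<le> B" for k
    proof -
      have "\<bar>g k\<bar> * Phi h ^ k \<le> B * 1"
        using Phi_range[OF h] B0 by (intro mult_mono g power_le_one) auto
      then show ?thesis using Phi_range[OF h] by (simp add: abs_mult)
    qed
  qed auto
  have 4: "(\<integral>\<omega>. indicator (space M) \<omega> *\<^sub>R (g (Z n \<omega>) * Phi h ^ Z n \<omega>) \<partial>M)
      = expectation (\<lambda>\<omega>. g (Z n \<omega>) * Phi h ^ Z n \<omega>)"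
    by (intro Bochner_Integration.integral_cong) auto
  show ?thesis using sums_unique2[OF 1[unfolded 2] 3[unfolded 4]] .
qed

lemma Phi_ge_exp: "0 \<le> h \<Longrightarrow> exp (- h) \<le> Phi h"
  using lap_ge_exp[of h] lap_le_Phi[of h] order_trans by blast

text \<open>The weak law of large numbers for independent copies of \<open>W\<close>, whose mean is
  1, in terms of Laplace transforms. The lower bound is \<open>Phi_ge_exp\<close>, the upper one
  follows from the slope of \<open>Phi\<close> at 0.\<close>

lemma Phi_power_tendsto:
  assumes h: "0 < h"
  shows "(\<lambda>k. Phi (h / real k) ^ k) \<longlonglongrightarrow> exp (- h)"
proof (rule tendsto_sandwich[where f="\<lambda>_. exp (- h)"
    and h="\<lambda>k. exp (- h * ((1 - Phi (h / real k)) / (h / real k)))"])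
  have fl: "filterlim (\<lambda>k. h / real k) (at_right 0) sequentially"
    unfolding filterlim_at
  proof
    show "(\<lambda>k. h / real k) \<longlonglongrightarrow> 0" by (rule lim_const_over_n)
    show "\<forall>\<^sub>F k in sequentially. h / real k \<in> {0<..} \<and> h / real k \<noteq> 0"
      using eventually_gt_at_top[of 0] by eventually_elim (use h in auto)
  qed
  have "(\<lambda>k. exp (- h * ((1 - Phi (h / real k)) / (h / real k)))) \<longlonglongrightarrow> exp (- h * 1)"
    by (intro tendsto_intros filterlim_compose[OF Phi_deriv_0 fl])
  then show "(\<lambda>k. exp (- h * ((1 - Phi (h / real k)) / (h / real k)))) \<longlonglongrightarrow> exp (- h)" by simp
  show "\<forall>\<^sub>F k in sequentially. Phi (h / real k) ^ k \<le> exp (- h * ((1 - Phi (h / real k)) / (h / real k)))"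
    using eventually_gt_at_top[of 0]
  proof eventually_elim
    case (elim k)
    have "Phi (h / real k) ^ k \<le> exp (- (1 - Phi (h / real k))) ^ k"
      using Phi_range[of "h / real k"] h exp_ge_add_one_self[of "- (1 - Phi (h / real k))"]
      by (intro power_mono) auto
    also have "\<dots> = exp (- h * ((1 - Phi (h / real k)) / (h / real k)))"
    proof -
      have "real k * - (1 - y) = - h * ((1 - y) / (h / real k))" for y
        using h elim by (simp add: field_simps)
      then show ?thesis by (simp only: exp_of_nat_mult[symmetric])
    qed
    finally show ?case .
  qed
  show "\<forall>\<^sub>F k in sequentially. exp (- h) \<le> Phi (h / real k) ^ k"
    using eventually_gt_at_top[of 0]
  proof eventually_elim
    case (elim k)
    have "exp (- h) = exp (- (h / real k)) ^ k" using elim by (simp add: exp_of_nat_mult[symmetric])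
    also have "\<dots> \<le> Phi (h / real k) ^ k" using h by (intro power_mono Phi_ge_exp) auto
    finally show ?case .
  qed
qed simp

lemma prob_finite_values:
  assumes "finite K" and [measurable]: "Measurable.pred M Q"
  shows "\<P>(\<omega> in M. Z n \<omega> \<in> K \<and> Q \<omega>) = (\<Sum>k\<in>K. \<P>(\<omega> in M. Z n \<omega> = k \<and> Q \<omega>))"
proof -
  have "{\<omega>\<in>space M. Z n \<omega> \<in> K \<and> Q \<omega>} = (\<Union>k\<in>K. {\<omega>\<in>space M. Z n \<omega> = k \<and> Q \<omega>})" by auto
  also have "prob \<dots> = (\<Sum>k\<in>K. \<P>(\<omega> in M. Z n \<omega> = k \<and> Q \<omega>))"
    using assms(1) by (intro finite_measure_finite_Union) (auto simp: disjoint_family_on_def)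
  finally show ?thesis .
qed

text \<open>Chebyshev's inequality applied to exp(-m^n W / k), whose first two moments given Z n = k
  are powers of the Laplace transform.\<close>

lemma prob_W_near_Z:
  assumes s: "0 < s" "s < 1"
  shows "\<exists>k0>0. \<forall>n k u. k0 < k \<longrightarrow> real k \<le> (1 - s) * (u * m ^ n) \<longrightarrow>
    (1 - s) * \<P>(\<omega> in M. Z n \<omega> = k) \<le> \<P>(\<omega> in M. Z n \<omega> = k \<and> (0 < W \<omega> \<and> W \<omega> \<le> u))"
proof -
  \<comment> \<open>A lower bound for the distance of \<open>exp (- y)\<close> to
    \<open>exp (- 1)\<close> when \<open>y = 0\<close> or \<open>y > 1 / (1 - s)\<close>. With
    \<open>y = m ^ n * W / k\<close> these are the cases in which \<open>W\<close> vanishes or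
    exceeds \<open>u\<close>.\<close>
  define c where "c = min (1 - exp (- 1)) (exp (- 1) - exp (- (1 / (1 - s)))) "
  have s1: "1 < 1 / (1 - s)" using s by simp
  have c: "0 < c" using s1 by (simp add: c_def)
  \<comment> \<open>The conditional mean of \<open>Y\<close> below given \<open>Z n = k\<close>,
    with the square expanded.\<close>
  define e where "e k = Phi (2 / real k) ^ k - 2 * exp (- 1) * Phi (1 / real k) ^ k + exp (- 2)" for k
  have "e \<longlonglongrightarrow> exp (- 2) - 2 * exp (- 1) * exp (- 1) + exp (- 2)"
    unfolding e_def by (intro tendsto_intros Phi_power_tendsto) auto
  also have "exp (- 2) - 2 * exp (- 1) * exp (- 1) + exp (- 2) = (0::real)"
    by (simp add: mult.assoc exp_add[symmetric])
  finally have "\<forall>\<^sub>F k in sequentially. e k < s * c\<^sup>2"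
    using s c by (intro order_tendstoD(2)) auto
  then obtain k1 where k1: "\<And>k. k1 \<le> k \<Longrightarrow> e k < s * c\<^sup>2" by (auto simp: eventually_sequentially)
  show ?thesis
  proof (intro exI[of _ "Suc k1"] conjI allI impI)
    fix n k u assume k: "Suc k1 < k" and u: "real k \<le> (1 - s) * (u * m ^ n)"
    have kp: "0 < k" using k by simp
    let ?A = "{\<omega>\<in>space M. Z n \<omega> = k}"
    let ?G = "{\<omega>\<in>space M. Z n \<omega> = k \<and> (0 < W \<omega> \<and> W \<omega> \<le> u)}"
    let ?B = "{\<omega>\<in>space M. Z n \<omega> = k \<and> \<not> (0 < W \<omega> \<and> W \<omega> \<le> u)}"
    define Y where "Y \<omega> = (exp (- (1 / real k) * m ^ n * W \<omega>) - exp (- 1))\<^sup>2" for \<omega>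
    have Y_eq: "indicator ?A \<omega> * Y \<omega> = indicator ?A \<omega> * exp (- (2 / real k) * m ^ n * W \<omega>)
        - 2 * exp (- 1) * (indicator ?A \<omega> * exp (- (1 / real k) * m ^ n * W \<omega>)) + indicator ?A \<omega> * exp (- 2)" for \<omega>
    proof -
      have "exp (- (2 / real k) * m ^ n * W \<omega>) = (exp (- (1 / real k) * m ^ n * W \<omega>))\<^sup>2"
        by (simp add: power2_eq_square exp_add[symmetric])
      moreover have "exp (- 2) = (exp (- 1 :: real))\<^sup>2" by (simp add: power2_eq_square exp_add[symmetric])
      ultimately show ?thesis unfolding Y_def power2_diff by (simp add: algebra_simps)
    qed
    have i: "integrable M (\<lambda>\<omega>. indicator ?A \<omega> * exp (- h * m ^ n * W \<omega>))" if "0 \<le> h" for h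
      by (rule integrable_const_bound[where B=1])
         (use W_nonneg that m_pos in \<open>auto elim!: eventually_mono simp: indicator_def\<close>)
    have i0: "integrable M (\<lambda>\<omega>. indicator ?A \<omega> * exp (- 2 :: real))"
      by (rule integrable_const_bound[where B=1]) (auto simp: indicator_def)
    have EY: "expectation (\<lambda>\<omega>. indicator ?A \<omega> * Y \<omega>) = prob ?A * e k"
    proof -
      have "expectation (\<lambda>\<omega>. indicator ?A \<omega> * Y \<omega>) = prob ?A * Phi (2 / real k) ^ k
          - 2 * exp (- 1) * (prob ?A * Phi (1 / real k) ^ k) + expectation (\<lambda>\<omega>. indicator ?A \<omega> *\<^sub>R exp (- 2 :: real))"
        unfolding Y_eq using i[of "2 / real k"] i[of "1 / real k"] i0 Phi_markov[of "2 / real k" n k] Phi_markov[of "1 / real k" n k]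
        by simp
      also have "expectation (\<lambda>\<omega>. indicator ?A \<omega> *\<^sub>R exp (- 2 :: real)) = prob ?A * exp (- 2)"
        by (subst integral_indicator_scaleR) auto
      finally show ?thesis by (simp add: e_def algebra_simps)
    qed
    have iY: "integrable M (\<lambda>\<omega>. indicator ?A \<omega> * Y \<omega>)"
      unfolding Y_eq using i[of "2 / real k"] i[of "1 / real k"] i0 by (intro Bochner_Integration.integrable_add Bochner_Integration.integrable_diff Bochner_Integration.integrable_mult_right) auto
    have "c\<^sup>2 * prob ?B = expectation (\<lambda>\<omega>. indicator ?B \<omega> *\<^sub>R c\<^sup>2)"
      by (subst integral_indicator_scaleR) auto
    also have "\<dots> \<le> expectation (\<lambda>\<omega>. indicator ?A \<omega> * Y \<omega>)"
    proof (rule integral_mono_AE[OF _ iY])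
      show "integrable M (\<lambda>\<omega>. indicator ?B \<omega> *\<^sub>R c\<^sup>2)"
        by (rule integrable_const_bound[where B="c\<^sup>2"]) (auto simp: indicator_def)
      show "AE \<omega> in M. indicator ?B \<omega> *\<^sub>R c\<^sup>2 \<le> indicator ?A \<omega> * Y \<omega>"
        using W_nonneg AE_space
      proof eventually_elim
        case (elim \<omega>)
        show ?case
        proof (cases "\<omega> \<in> ?B")
          case True
          let ?y = "1 / real k * m ^ n * W \<omega>"
          have "c \<le> \<bar>exp (- (1 / real k) * m ^ n * W \<omega>) - exp (- 1)\<bar>"
          proof (cases "W \<omega> = 0")
            case False
            then have "u < W \<omega>" using True elim by auto
            then have "(1 - s) * (u * m ^ n) < (1 - s) * (W \<omega> * m ^ n)" using s m_pos by simp
            then have "real k < (1 - s) * (W \<omega> * m ^ n)" using u by linarith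
            then have "1 / (1 - s) < ?y" using s kp by (simp add: field_simps)
            then have "exp (- (1 / real k) * m ^ n * W \<omega>) \<le> exp (- (1 / (1 - s)))" by simp
            moreover have "c \<le> exp (- 1) - exp (- (1 / (1 - s)))" by (simp add: c_def)
            ultimately show ?thesis by linarith
          qed (simp add: c_def)
          then have "c\<^sup>2 \<le> \<bar>exp (- (1 / real k) * m ^ n * W \<omega>) - exp (- 1)\<bar>\<^sup>2"
            using c by (intro power_mono) auto
          then show ?thesis using True by (simp add: Y_def)
        qed (simp add: Y_def)
      qed
    qed
    also have "\<dots> \<le> prob ?A * (s * c\<^sup>2)"
      unfolding EY using k1[of k] k by (intro mult_left_mono) auto
    finally have "c\<^sup>2 * prob ?B \<le> c\<^sup>2 * (s * prob ?A)" by (simp add: mult_ac)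
    then have B: "prob ?B \<le> s * prob ?A" using c by simp
    have "prob ?A \<le> prob (?G \<union> ?B)" by (intro finite_measure_mono) auto
    also have "\<dots> \<le> prob ?G + prob ?B" by (intro measure_Un_le) auto
    finally show "(1 - s) * prob ?A \<le> prob ?G" using B by (simp add: algebra_simps)
  qed simp
qed

text \<open>Given \<open>Z n = k \<le> x n\<close> with \<open>k > k0\<close>, the variable
  \<open>W\<close> is positive and at most \<open>x n / m ^ n / (1 - s)\<close> with probability at
  least \<open>1 - s\<close>. Populations up to \<open>k0\<close> are negligible by
  \<open>small_Z_bound\<close>, because \<open>x n\<close> tends to infinity. Finally
  \<open>s\<close> is small.\<close>

lemma Z_lower_tail_upper:
  assumes x_top: "filterlim x at_top sequentially" and x_small: "(\<lambda>n. x n / m ^ n) \<longlonglongrightarrow> 0"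
    and v: "\<forall>\<^sub>F u in at_right 0. prob_W_le u \<le> v * u powr \<alpha>"
    and v': "v < v'"
  shows "\<forall>\<^sub>F n in sequentially. prob_Z_le n (x n) \<le> v' * (x n / m ^ n) powr \<alpha>"
proof -
  have "((\<lambda>s. s + v * (1 / (1 - s)) powr \<alpha> / (1 - s)) \<longlongrightarrow> 0 + v * (1 / (1 - 0)) powr \<alpha> / (1 - 0)) (at_right 0)"
    by (intro tendsto_intros) auto
  then have "\<forall>\<^sub>F s in at_right 0. s + v * (1 / (1 - s)) powr \<alpha> / (1 - s) < v'"
    by (rule order_tendstoD(2)) (use v' in simp)
  moreover have "\<forall>\<^sub>F s in at_right 0. (0::real) < s \<and> s < 1"
    by (intro eventually_at_rightI[of 0 1]) auto
  ultimately have "\<forall>\<^sub>F s in at_right 0. s + v * (1 / (1 - s)) powr \<alpha> / (1 - s) < v' \<and> 0 < s \<and> s < 1"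
    by eventually_elim auto
  then obtain s where s: "s + v * (1 / (1 - s)) powr \<alpha> / (1 - s) < v'" "0 < s" "s < 1"
    by (auto dest: eventually_happens simp: trivial_limit_at_right_real)
  obtain k0 where k0: "0 < k0" "\<And>n k u. k0 < k \<Longrightarrow> real k \<le> (1 - s) * (u * m ^ n) \<Longrightarrow>
    (1 - s) * \<P>(\<omega> in M. Z n \<omega> = k) \<le> \<P>(\<omega> in M. Z n \<omega> = k \<and> (0 < W \<omega> \<and> W \<omega> \<le> u))"
    using prob_W_near_Z[OF s(2,3)] by blast
  obtain C where C: "0 < C" "\<And>n x. 0 < x \<Longrightarrow> prob_Z_le n x \<le> C * (x / m ^ n) powr \<alpha>"
    using small_Z_bound by blast
  have xpos: "\<forall>\<^sub>F n in sequentially. 0 < x n" using x_top by (simp add: filterlim_at_top_dense)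
  have "filterlim (\<lambda>n. x n / m ^ n * (1 / (1 - s))) (at_right 0) sequentially"
    unfolding filterlim_at
  proof
    show "(\<lambda>n. x n / m ^ n * (1 / (1 - s))) \<longlonglongrightarrow> 0" using x_small by (rule tendsto_mult_left_zero)
    show "\<forall>\<^sub>F n in sequentially. x n / m ^ n * (1 / (1 - s)) \<in> {0<..} \<and> x n / m ^ n * (1 / (1 - s)) \<noteq> 0"
      using xpos by eventually_elim (use s m_pos in auto)
  qed
  from eventually_compose_filterlim[OF v this]
  have ev1: "\<forall>\<^sub>F n in sequentially. prob_W_le (x n / m ^ n * (1 / (1 - s)))
      \<le> v * (x n / m ^ n * (1 / (1 - s))) powr \<alpha>" .
  have "((\<lambda>n. C * (real k0 / x n) powr \<alpha>) \<longlongrightarrow> C * 0 powr \<alpha>) sequentially"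
    using alpha_gt_1 xpos
    by (intro tendsto_intros tendsto_powr' real_tendsto_divide_at_top[OF tendsto_const x_top])
       (auto elim!: eventually_mono)
  then have "\<forall>\<^sub>F n in sequentially. C * (real k0 / x n) powr \<alpha> < s"
    by (rule order_tendstoD(2)) (use s alpha_gt_1 in simp)
  then show ?thesis
    using ev1 xpos
  proof eventually_elim
    case (elim n)
    define u where "u = x n / m ^ n * (1 / (1 - s))"
    define K where "K = {k. k0 < k \<and> real k \<le> x n}"
    have finK: "finite K"
      by (rule finite_subset[of _ "{..nat \<lfloor>x n\<rfloor>}"]) (auto simp: K_def le_nat_floor)
    have um: "(1 - s) * (u * m ^ n) = x n" using s m_pos by (simp add: u_def)
    let ?P = "prob_Z_le n (x n)"
    have "?P \<le> prob ({\<omega>\<in>space M. 0 < Z n \<omega> \<and> real (Z n \<omega>) \<le> real k0} \<union> {\<omega>\<in>space M. Z n \<omega> \<in> K \<and> True})"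
      by (intro finite_measure_mono) (auto simp: K_def)
    also have "\<dots> \<le> prob_Z_le n (real k0) + \<P>(\<omega> in M. Z n \<omega> \<in> K \<and> True)"
      by (intro measure_Un_le) auto
    also have "prob_Z_le n (real k0) \<le> C * (real k0 / m ^ n) powr \<alpha>"
      using k0(1) by (intro C(2)) simp
    also have "(real k0 / m ^ n) = (real k0 / x n) * (x n / m ^ n)" using elim by simp
    also have "C * (\<dots>) powr \<alpha> = (C * (real k0 / x n) powr \<alpha>) * (x n / m ^ n) powr \<alpha>"
      using elim m_pos k0(1) by (subst powr_mult) auto
    also have "\<dots> \<le> s * (x n / m ^ n) powr \<alpha>" using elim by (intro mult_right_mono) auto
    also have "\<P>(\<omega> in M. Z n \<omega> \<in> K \<and> True) \<le> v * (1 / (1 - s)) powr \<alpha> / (1 - s) * (x n / m ^ n) powr \<alpha>"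
    proof -
      have "(1 - s) * \<P>(\<omega> in M. Z n \<omega> \<in> K \<and> True) = (\<Sum>k\<in>K. (1 - s) * \<P>(\<omega> in M. Z n \<omega> = k))"
        by (subst prob_finite_values[OF finK]) (auto simp: sum_distrib_left)
      also have "\<dots> \<le> (\<Sum>k\<in>K. \<P>(\<omega> in M. Z n \<omega> = k \<and> (0 < W \<omega> \<and> W \<omega> \<le> u)))"
        by (intro sum_mono k0(2)) (auto simp: K_def um)
      also have "\<dots> = \<P>(\<omega> in M. Z n \<omega> \<in> K \<and> (0 < W \<omega> \<and> W \<omega> \<le> u))"
        by (subst prob_finite_values[OF finK]) auto
      also have "\<dots> \<le> prob_W_le u" by (intro finite_measure_mono) auto
      also have "\<dots> \<le> v * u powr \<alpha>" using elim by (simp add: u_def)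
      also have "u powr \<alpha> = (x n / m ^ n) powr \<alpha> * (1 / (1 - s)) powr \<alpha>"
        unfolding u_def by (rule powr_mult)
      finally show ?thesis using s by (simp add: field_simps)
    qed
    finally have "?P \<le> (s + v * (1 / (1 - s)) powr \<alpha> / (1 - s)) * (x n / m ^ n) powr \<alpha>"
      by (simp add: algebra_simps)
    also have "\<dots> \<le> v' * (x n / m ^ n) powr \<alpha>" using s(1) by (intro mult_right_mono) auto
    finally show ?case .
  qed
qed

text \<open>The loss is the event that \<open>W \<le> u\<close> although \<open>Z n > x n\<close>,
  where \<open>x n = (1 + s) * (m ^ n * u)\<close>. Exponential Markov with a suitable tilt
  \<open>h\<close> costs a factor \<open>b < 1\<close> per individual there, because
  \<open>Phi h < exp (- (h / (1 + s)))\<close>.\<close>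

lemma Z_lower_tail_lower:
  assumes x_top: "filterlim x at_top sequentially" and x_small: "(\<lambda>n. x n / m ^ n) \<longlonglongrightarrow> 0"
    and v: "\<forall>\<^sub>F u in at_right 0. v * u powr \<alpha> \<le> prob_W_le u"
    and v': "v' < v"
  shows "\<forall>\<^sub>F n in sequentially. v' * (x n / m ^ n) powr \<alpha> \<le> prob_Z_le n (x n)"
proof -
  have "((\<lambda>s. v * (1 / (1 + s)) powr \<alpha> - s) \<longlongrightarrow> v * (1 / (1 + 0)) powr \<alpha> - 0) (at_right 0)"
    by (intro tendsto_intros) auto
  then have "\<forall>\<^sub>F s in at_right 0. v * (1 / (1 + s)) powr \<alpha> - s > v'"
    by (rule order_tendstoD(1)) (use v' in simp)
  moreover have "\<forall>\<^sub>F s in at_right 0. (0::real) < s" by (simp add: eventually_at_right_less)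
  ultimately have "\<forall>\<^sub>F s in at_right 0. v * (1 / (1 + s)) powr \<alpha> - s > v' \<and> 0 < s"
    by eventually_elim auto
  then obtain s where s: "v' < v * (1 / (1 + s)) powr \<alpha> - s" "0 < s"
    by (auto dest: eventually_happens simp: trivial_limit_at_right_real)
  obtain h where h: "0 < h" "Phi h < exp (- (h / (1 + s)))"
  proof -
    have "\<forall>\<^sub>F h in at_right 0. (1 - Phi h) / h > 1 / (1 + s)"
      using Phi_deriv_0 by (rule order_tendstoD) (use s in simp)
    moreover have "\<forall>\<^sub>F h in at_right 0. (0::real) < h" by (simp add: eventually_at_right_less)
    ultimately have "\<forall>\<^sub>F h in at_right 0. (1 - Phi h) / h > 1 / (1 + s) \<and> 0 < h" by eventually_elim auto
    then obtain h where h: "(1 - Phi h) / h > 1 / (1 + s)" "0 < h"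
      by (auto dest: eventually_happens simp: trivial_limit_at_right_real)
    have "1 / (1 + s) * h < 1 - Phi h" using h by (simp add: pos_less_divide_eq)
    then have "Phi h < 1 - h / (1 + s)" by simp
    also have "\<dots> \<le> exp (- (h / (1 + s)))" using exp_ge_add_one_self[of "- (h / (1 + s))"] by simp
    finally show ?thesis using that h by auto
  qed
  define b where "b = exp (h / (1 + s)) * Phi h"
  have b0: "0 \<le> b" using Phi_range[of h] h by (simp add: b_def)
  have b1: "b < 1"
  proof -
    have "b < exp (h / (1 + s)) * exp (- (h / (1 + s)))" unfolding b_def using h by simp
    then show ?thesis by (simp add: exp_minus)
  qed
  \<comment> \<open>The factor \<open>b\<close> is shared between two powers of \<open>r\<close>:
    one gives \<open>r powr x n\<close>, which tends to 0, the other gives the order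
    \<open>m powr (- \<alpha> * n)\<close> through \<open>pow_Z_pos_bound\<close>. The maximum with
    1/2 keeps \<open>r\<close> positive for the logarithm.\<close>
  define r where "r = max (sqrt b) (1/2)"
  have r: "0 < r" "r < 1" "b \<le> r * r"
  proof -
    show "0 < r" "r < 1" using b1 by (auto simp: r_def)
    have "sqrt b * sqrt b \<le> r * r" using b0 by (intro mult_mono) (auto simp: r_def)
    then show "b \<le> r * r" using b0 by simp
  qed
  obtain C where C: "0 < C" "\<And>n N t. N \<le> n \<Longrightarrow> 0 \<le> t \<Longrightarrow> t \<le> 1 \<Longrightarrow> pgf_iter p N t \<le> r \<Longrightarrow>
     expectation (\<lambda>\<omega>. if Z n \<omega> = 0 then 0 else t ^ Z n \<omega>) \<le> C * m powr (- \<alpha> * real (n - N))"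
    using pow_Z_pos_bound[of r] r by auto
  have x1: "\<forall>\<^sub>F n in sequentially. 1 \<le> x n" using x_top by (simp add: filterlim_at_top)
  have "filterlim (\<lambda>n. x n / m ^ n * (1 / (1 + s))) (at_right 0) sequentially"
    unfolding filterlim_at
  proof
    show "(\<lambda>n. x n / m ^ n * (1 / (1 + s))) \<longlonglongrightarrow> 0" using x_small by (rule tendsto_mult_left_zero)
    show "\<forall>\<^sub>F n in sequentially. x n / m ^ n * (1 / (1 + s)) \<in> {0<..} \<and> x n / m ^ n * (1 / (1 + s)) \<noteq> 0"
      using x1 by eventually_elim (use s m_pos in auto)
  qed
  from eventually_compose_filterlim[OF v this]
  have ev1: "\<forall>\<^sub>F n in sequentially. v * (x n / m ^ n * (1 / (1 + s))) powr \<alpha> \<le>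
    prob_W_le (x n / m ^ n * (1 / (1 + s)))" .
  have "((\<lambda>n. C * exp (ln r * x n)) \<longlongrightarrow> C * 0) sequentially"
  proof (intro tendsto_intros filterlim_compose[OF exp_at_bot])
    show "filterlim (\<lambda>n. ln r * x n) at_bot sequentially"
      by (rule filterlim_tendsto_neg_mult_at_bot[OF tendsto_const _ x_top]) (use r in simp)
  qed
  then have "\<forall>\<^sub>F n in sequentially. C * exp (ln r * x n) < s"
    by (rule order_tendstoD(2)) (use s in simp)
  then show ?thesis
    using ev1 x1
  proof eventually_elim
    case (elim n)
    define u where "u = x n / m ^ n * (1 / (1 + s))"
    have um: "m ^ n * u = x n / (1 + s)" using s m_pos by (simp add: u_def)
    let ?P = "prob_Z_le n (x n)"
    let ?B = "{\<omega>\<in>space M. x n < real (Z n \<omega>) \<and> W \<omega> \<le> u}"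
    have "prob_W_le u \<le> prob ({\<omega>\<in>space M. 0 < Z n \<omega> \<and> real (Z n \<omega>) \<le> x n} \<union> ?B)"
    proof (rule finite_measure_mono_AE)
      show "AE \<omega> in M. \<omega> \<in> {\<omega>\<in>space M. 0 < W \<omega> \<and> W \<omega> \<le> u} \<longrightarrow>
        \<omega> \<in> {\<omega>\<in>space M. 0 < Z n \<omega> \<and> real (Z n \<omega>) \<le> x n} \<union> ?B"
        using extinct_W by eventually_elim force
    qed measurable
    also have "\<dots> \<le> ?P + prob ?B" by (intro measure_Un_le) auto
    also have "prob ?B \<le> s * (x n / m ^ n) powr \<alpha>"
    proof -
      define g where "g k = (if x n < real k then exp (h * (m ^ n * u)) else 0)" for k :: nat
      have gb: "\<bar>g k\<bar> \<le> exp (h * (m ^ n * u))" for k by (simp add: g_def)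
      have iB: "integrable M (\<lambda>\<omega>. g (Z n \<omega>) * exp (- h * m ^ n * W \<omega>))"
      proof (rule integrable_const_bound[where B="exp (h * (m ^ n * u))"])
        show "AE \<omega> in M. norm (g (Z n \<omega>) * exp (- h * m ^ n * W \<omega>)) \<le> exp (h * (m ^ n * u))"
          using W_nonneg
        proof eventually_elim
          case (elim \<omega>)
          have "\<bar>g (Z n \<omega>)\<bar> * exp (- h * m ^ n * W \<omega>) \<le> exp (h * (m ^ n * u)) * 1"
            using elim h m_pos by (intro mult_mono gb) auto
          then show ?case by (simp add: abs_mult)
        qed
      qed measurable
      have "prob ?B = expectation (\<lambda>\<omega>. indicator ?B \<omega> *\<^sub>R (1::real))"
        by (subst integral_indicator_scaleR) auto
      also have "\<dots> \<le> expectation (\<lambda>\<omega>. g (Z n \<omega>) * exp (- h * m ^ n * W \<omega>))"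
      proof (rule integral_mono[OF _ iB])
        show "integrable M (\<lambda>\<omega>. indicator ?B \<omega> *\<^sub>R (1::real))"
          by (rule integrable_const_bound[where B=1]) (auto simp: indicator_def)
        fix \<omega>
        show "indicator ?B \<omega> *\<^sub>R (1::real) \<le> g (Z n \<omega>) * exp (- h * m ^ n * W \<omega>)"
        proof (cases "\<omega> \<in> ?B")
          case True
          then have "m ^ n * W \<omega> \<le> m ^ n * u" using m_pos by simp
          then have "h * (m ^ n * W \<omega>) \<le> h * (m ^ n * u)" using h by simp
          then have "1 \<le> exp (h * (m ^ n * u) + - h * m ^ n * W \<omega>)" by (simp add: mult.assoc)
          then show ?thesis using True unfolding exp_add by (simp add: g_def)
        qed (simp add: g_def)
      qed
      also have "\<dots> = expectation (\<lambda>\<omega>. g (Z n \<omega>) * Phi h ^ Z n \<omega>)"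
        by (rule Phi_markov_fun[OF _ gb]) (use h in simp)
      also have "\<dots> \<le> expectation (\<lambda>\<omega>. exp (ln r * x n) * (if Z n \<omega> = 0 then 0 else r ^ Z n \<omega>))"
      proof (rule integral_mono)
        show "integrable M (\<lambda>\<omega>. g (Z n \<omega>) * Phi h ^ Z n \<omega>)"
        proof (rule integrable_const_bound[where B="exp (h * (m ^ n * u))"])
          show "AE \<omega> in M. norm (g (Z n \<omega>) * Phi h ^ Z n \<omega>) \<le> exp (h * (m ^ n * u))"
          proof (rule AE_I2)
            fix \<omega>
            have "\<bar>g (Z n \<omega>)\<bar> * Phi h ^ Z n \<omega> \<le> exp (h * (m ^ n * u)) * 1"
              using Phi_range[of h] h by (intro mult_mono gb power_le_one) auto
            then show "norm (g (Z n \<omega>) * Phi h ^ Z n \<omega>) \<le> exp (h * (m ^ n * u))"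
              using Phi_range[of h] h by (simp add: abs_mult)
          qed
        qed measurable
        show "integrable M (\<lambda>\<omega>. exp (ln r * x n) * (if Z n \<omega> = 0 then 0 else r ^ Z n \<omega>))"
          by (intro integrable_mult_right integrable_const_bound[where B=1])
             (use r in \<open>auto simp: power_le_one\<close>)
        fix \<omega>
        show "g (Z n \<omega>) * Phi h ^ Z n \<omega> \<le> exp (ln r * x n) * (if Z n \<omega> = 0 then 0 else r ^ Z n \<omega>)"
        proof (cases "x n < real (Z n \<omega>)")
          case True
          let ?k = "Z n \<omega>"
          have "h * (m ^ n * u) = x n * (h / (1 + s))" by (simp add: um)
          also have "\<dots> \<le> real ?k * (h / (1 + s))" using True h s by (intro mult_right_mono) auto
          finally have "exp (h * (m ^ n * u)) * Phi h ^ ?k \<le> exp (real ?k * (h / (1 + s))) * Phi h ^ ?k"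
            using Phi_range[of h] h by (intro mult_right_mono) auto
          also have "\<dots> = b ^ ?k" unfolding b_def by (simp only: exp_of_nat_mult power_mult_distrib)
          also have "\<dots> \<le> (r * r) ^ ?k" using b0 r by (intro power_mono) auto
          also have "\<dots> = r ^ ?k * r ^ ?k" by (simp add: power_mult_distrib)
          also have "\<dots> \<le> exp (ln r * x n) * r ^ ?k"
          proof (intro mult_right_mono)
            have "r ^ ?k = exp (real ?k * ln r)" using r by (simp add: exp_of_nat_mult)
            also have "\<dots> \<le> exp (ln r * x n)" using True r by (simp add: mult.commute[of "ln r"] mult_le_cancel_right)
            finally show "r ^ ?k \<le> exp (ln r * x n)" .
          qed (use r in simp)
          finally have "exp (h * (m ^ n * u)) * Phi h ^ ?k \<le> exp (ln r * x n) * r ^ ?k" .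
          then show ?thesis using True elim(3) by (auto simp: g_def)
        qed (use r in \<open>auto simp: g_def\<close>)
      qed
      also have "\<dots> = exp (ln r * x n) * expectation (\<lambda>\<omega>. if Z n \<omega> = 0 then 0 else r ^ Z n \<omega>)"
        by simp
      also have "\<dots> \<le> exp (ln r * x n) * (C * m powr (- \<alpha> * real (n - 0)))"
        using r by (intro mult_left_mono C(2)) auto
      also have "\<dots> \<le> s * m powr (- \<alpha> * real n)"
      proof -
        have "C * exp (ln r * x n) * m powr (- \<alpha> * real n) \<le> s * m powr (- \<alpha> * real n)"
          using elim(1) by (intro mult_right_mono) auto
        then show ?thesis by (simp add: mult_ac)
      qed
      also have "m powr (- \<alpha> * real n) = (1 / m ^ n) powr \<alpha>"
        using m_pos by (simp add: powr_divide powr_realpow[symmetric] powr_powr powr_minus_divide mult.commute)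
      also have "\<dots> \<le> (x n / m ^ n) powr \<alpha>"
        using elim(3) alpha_gt_1 m_pos by (intro powr_mono2 divide_right_mono) auto
      finally show ?thesis using s by simp
    qed
    finally have "v * u powr \<alpha> \<le> ?P + s * (x n / m ^ n) powr \<alpha>" using elim(2) by (simp add: u_def)
    moreover have "u powr \<alpha> = (x n / m ^ n) powr \<alpha> * (1 / (1 + s)) powr \<alpha>"
      unfolding u_def by (rule powr_mult)
    ultimately have "(v * (1 / (1 + s)) powr \<alpha> - s) * (x n / m ^ n) powr \<alpha> \<le> ?P"
      by (simp add: algebra_simps)
    moreover have "v' * (x n / m ^ n) powr \<alpha> \<le> (v * (1 / (1 + s)) powr \<alpha> - s) * (x n / m ^ n) powr \<alpha>"
      using s(1) by (intro mult_right_mono) auto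
    ultimately show ?case by linarith
  qed
qed

end

section \<open>The density of the limit near the origin\<close>

lemma powr_antideriv_has_integral:
  fixes c u \<alpha> v :: real
  assumes "0 < c" "c \<le> u" "\<alpha> \<noteq> 0"
  shows "((\<lambda>x. v * x powr (\<alpha> - 1)) has_integral (v / \<alpha> * (u powr \<alpha> - c powr \<alpha>))) {c..u}"
proof -
  have "((\<lambda>x. v * x powr (\<alpha> - 1)) has_integral (v / \<alpha> * u powr \<alpha> - v / \<alpha> * c powr \<alpha>)) {c..u}"
  proof (rule fundamental_theorem_of_calculus)
    fix x assume x: "x \<in> {c..u}"
    have "((\<lambda>x. v / \<alpha> * x powr \<alpha>) has_real_derivative (v / \<alpha> * (\<alpha> * x powr (\<alpha> - 1)))) (at x within {c..u})"
      using x assms by (intro DERIV_cmult has_real_derivative_powr[THEN has_field_derivative_at_within]) auto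
    then show "((\<lambda>x. v / \<alpha> * x powr \<alpha>) has_vector_derivative v * x powr (\<alpha> - 1)) (at x within {c..u})"
      using assms by (simp add: has_real_derivative_iff_has_vector_derivative)
  qed (use assms in auto)
  then show ?thesis by (simp add: right_diff_distrib)
qed

lemma ex_power_bracket:
  fixes b t :: real
  assumes b: "1 < b" and t: "1 \<le> t"
  shows "\<exists>j. b ^ j \<le> t \<and> t < b ^ Suc j"
proof -
  obtain n where n: "t < b ^ n" using real_arch_pow[OF b] by blast
  define k where "k = (LEAST k. t < b ^ k)"
  have k: "t < b ^ k" unfolding k_def by (rule LeastI[of _ n]) (rule n)
  have "k \<noteq> 0" using k t by (intro notI) simp
  then obtain j where j: "k = Suc j" by (cases k) auto
  have "\<not> t < b ^ j" unfolding k_def by (rule not_less_Least) (use j in \<open>simp add: k_def\<close>)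
  then show ?thesis using k j by (intro exI[of _ j]) auto
qed

locale gw_density = gw_limit M p \<xi> Z X m W q \<alpha>
  for M :: "'a measure" and p \<xi> Z X m W q \<alpha> +
  fixes w :: "real \<Rightarrow> real"
  assumes w_cont: "continuous_on {0<..} w" and w_nonneg: "\<And>u. 0 < u \<Longrightarrow> 0 \<le> w u"
    and w_density: "\<And>c d. 0 < c \<Longrightarrow> c \<le> d \<Longrightarrow>
         measure M {\<omega>\<in>space M. W \<omega> \<in> {c..d}} = (LBINT u:{c..d}. w u)"
begin

lemma prob_W_integral:
  assumes "0 < c" "c \<le> d"
  shows "\<P>(\<omega> in M. c \<le> W \<omega> \<and> W \<omega> \<le> d) = integral {c..d} w" and "w integrable_on {c..d}"
proof -
  have "continuous_on {c..d} w" by (rule continuous_on_subset[OF w_cont]) (use assms in auto)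
  then have s: "set_integrable lborel {c..d} w" by (rule borel_integrable_atLeastAtMost')
  show "w integrable_on {c..d}" by (rule set_borel_integral_eq_integral(1)[OF s])
  show "\<P>(\<omega> in M. c \<le> W \<omega> \<and> W \<omega> \<le> d) = integral {c..d} w"
    using w_density[OF assms] set_borel_integral_eq_integral(2)[OF s] by simp
qed

lemma prob_W_point: "0 < u \<Longrightarrow> \<P>(\<omega> in M. W \<omega> = u) = 0"
proof -
  assume u: "0 < u"
  have "{\<omega>\<in>space M. W \<omega> = u} = {\<omega>\<in>space M. u \<le> W \<omega> \<and> W \<omega> \<le> u}" by auto
  then have "\<P>(\<omega> in M. W \<omega> = u) = integral {u..u} w" using prob_W_integral(1)[of u u] u by simp
  also have "{u..u} = cbox u u" by simp
  finally show ?thesis using integral_null[of u u w] by simp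
qed

text \<open>Continuity makes \<open>w u\<close> a limit of probabilities of short windows. Pointwise
  bounds on the density are obtained from window bounds in this way.\<close>

lemma density_ratio_tendsto:
  assumes u: "0 < u"
  shows "((\<lambda>h. \<P>(\<omega> in M. u \<le> W \<omega> \<and> W \<omega> \<le> u + h) / h) \<longlongrightarrow> w u) (at_right 0)"
proof -
  have "continuous_on {u..u+1} w" by (rule continuous_on_subset[OF w_cont]) (use u in auto)
  then have "((\<lambda>x. integral {u..x} w) has_real_derivative w u) (at u within {u..u+1})"
    by (rule integral_has_real_derivative) auto
  then have "((\<lambda>x. (integral {u..x} w - integral {u..u} w) / (x - u)) \<longlongrightarrow> w u) (at u within {u..u+1})"
    by (simp add: has_field_derivative_iff)
  then have "((\<lambda>x. integral {u..x} w / (x - u)) \<longlongrightarrow> w u) (at_right u)"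
    by (simp add: at_within_Icc_at_right)
  then have "((\<lambda>h. integral {u..h + u} w / (h + u - u)) \<longlongrightarrow> w u) (at_right 0)"
    by (subst (asm) at_right_to_0) (simp add: filterlim_filtermap)
  moreover have "\<forall>\<^sub>F h in at_right 0. integral {u..h + u} w / (h + u - u) =
      \<P>(\<omega> in M. u \<le> W \<omega> \<and> W \<omega> \<le> u + h) / h"
    using eventually_at_right_less[of 0]
    by eventually_elim (use u in \<open>simp add: prob_W_integral(1) add.commute\<close>)
  ultimately show ?thesis by (rule Lim_transform_eventually)
qed

lemma density_le:
  assumes u: "0 < u" and B: "\<forall>\<^sub>F h in at_right 0. \<P>(\<omega> in M. u \<le> W \<omega> \<and> W \<omega> \<le> u + h) \<le> B * h"
  shows "w u \<le> B"
proof (rule tendsto_upperbound[OF density_ratio_tendsto[OF u]])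
  show "\<forall>\<^sub>F h in at_right 0. \<P>(\<omega> in M. u \<le> W \<omega> \<and> W \<omega> \<le> u + h) / h \<le> B"
    using B eventually_at_right_less[of 0] by eventually_elim (simp add: divide_le_eq)
qed (simp add: trivial_limit_at_right_real)

lemma density_ge:
  assumes u: "0 < u" and B: "\<forall>\<^sub>F h in at_right 0. B * h \<le> \<P>(\<omega> in M. u \<le> W \<omega> \<and> W \<omega> \<le> u + h)"
  shows "B \<le> w u"
proof (rule tendsto_lowerbound[OF density_ratio_tendsto[OF u]])
  show "\<forall>\<^sub>F h in at_right 0. B \<le> \<P>(\<omega> in M. u \<le> W \<omega> \<and> W \<omega> \<le> u + h) / h"
    using B eventually_at_right_less[of 0] by eventually_elim (simp add: le_divide_eq)
qed (simp add: trivial_limit_at_right_real)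

text \<open>The density describes only intervals bounded away from 0, so the lower tail is exhausted
  by such intervals.\<close>

lemma prob_W_lower_tail_tendsto:
  assumes u: "0 < u"
  shows "(\<lambda>n. \<P>(\<omega> in M. u / real (Suc n) \<le> W \<omega> \<and> W \<omega> \<le> u)) \<longlonglongrightarrow> prob_W_le u"
proof -
  have "(\<lambda>n. \<P>(\<omega> in M. u / real (Suc n) \<le> W \<omega> \<and> W \<omega> \<le> u)) \<longlonglongrightarrow>
      prob (\<Union>n. {\<omega>\<in>space M. u / real (Suc n) \<le> W \<omega> \<and> W \<omega> \<le> u})"
  proof (rule finite_Lim_measure_incseq)
    have "u / real (Suc b) \<le> u / real (Suc a)" if "a \<le> b" for a b
      using u that by (intro divide_left_mono) auto
    then show "incseq (\<lambda>n. {\<omega>\<in>space M. u / real (Suc n) \<le> W \<omega> \<and> W \<omega> \<le> u})"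
      unfolding incseq_def using order_trans by blast
  qed auto
  also have "(\<Union>n. {\<omega>\<in>space M. u / real (Suc n) \<le> W \<omega> \<and> W \<omega> \<le> u}) = {\<omega>\<in>space M. 0 < W \<omega> \<and> W \<omega> \<le> u}"
  proof safe
    fix \<omega> n assume "u / real (Suc n) \<le> W \<omega>"
    moreover have "0 < u / real (Suc n)" using u by simp
    ultimately show "0 < W \<omega>" by linarith
  next
    fix \<omega> assume w: "\<omega> \<in> space M" "0 < W \<omega>" "W \<omega> \<le> u"
    obtain n where "u / W \<omega> < real n" using reals_Archimedean2 by blast
    then have "u / W \<omega> < real (Suc n)" by simp
    then have "u / real (Suc n) \<le> W \<omega>" using w u by (simp add: field_simps)
    then show "\<omega> \<in> (\<Union>n. {\<omega>\<in>space M. u / real (Suc n) \<le> W \<omega> \<and> W \<omega> \<le> u})" using w by blast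
  qed
  finally show ?thesis .
qed

lemma powr_lower_tail_tendsto:
  "0 < u \<Longrightarrow> (\<lambda>n. v / \<alpha> * (u powr \<alpha> - (u / real (Suc n)) powr \<alpha>)) \<longlonglongrightarrow> v / \<alpha> * u powr \<alpha>"
proof -
  assume u: "0 < u"
  have "(\<lambda>n. u / real (Suc n)) \<longlonglongrightarrow> 0" by (rule LIMSEQ_Suc[OF lim_const_over_n])
  then have "(\<lambda>n. (u / real (Suc n)) powr \<alpha>) \<longlonglongrightarrow> 0 powr \<alpha>"
    by (rule tendsto_powr'[OF _ tendsto_const]) (use u alpha_gt_1 in auto)
  then have "(\<lambda>n. v / \<alpha> * (u powr \<alpha> - (u / real (Suc n)) powr \<alpha>)) \<longlonglongrightarrow> v / \<alpha> * (u powr \<alpha> - 0 powr \<alpha>)"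
    by (intro tendsto_mult[OF tendsto_const] tendsto_diff[OF tendsto_const])
  then show ?thesis by simp
qed

lemma W_lower_tail_le:
  assumes "\<forall>\<^sub>F x in at_right 0. w x \<le> v * x powr (\<alpha> - 1)"
  shows "\<forall>\<^sub>F u in at_right 0. prob_W_le u \<le> v / \<alpha> * u powr \<alpha>"
proof -
  obtain b where b: "0 < b" "\<And>x. 0 < x \<Longrightarrow> x < b \<Longrightarrow> w x \<le> v * x powr (\<alpha> - 1)"
    using assms by (auto simp: eventually_at_right_field)
  have "prob_W_le u \<le> v / \<alpha> * u powr \<alpha>" if u: "0 < u" "u < b" for u
  proof (rule LIMSEQ_le[OF prob_W_lower_tail_tendsto[OF u(1)] powr_lower_tail_tendsto[OF u(1)]])
    have "\<P>(\<omega> in M. u / real (Suc n) \<le> W \<omega> \<and> W \<omega> \<le> u) \<le> v / \<alpha> * (u powr \<alpha> - (u / real (Suc n)) powr \<alpha>)" for n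
    proof -
      let ?c = "u / real (Suc n)"
      have c: "0 < ?c" "?c \<le> u" using u mult_left_mono[of 1 "real (Suc n)" u] by (auto simp: divide_le_eq)
      have le: "w x \<le> v * x powr (\<alpha> - 1)" if "x \<in> {?c..u}" for x
      proof (rule b(2))
        have "?c \<le> x" using that by auto
        then show "0 < x" using c(1) by linarith
      qed (use that u in auto)
      have "integral {?c..u} w \<le> v / \<alpha> * (u powr \<alpha> - ?c powr \<alpha>)"
        by (rule has_integral_le[OF integrable_integral[OF prob_W_integral(2)[OF c]] powr_antideriv_has_integral[OF c]])
           (use le alpha_gt_1 in auto)
      then show ?thesis using prob_W_integral(1)[OF c] by simp
    qed
    then show "\<exists>N. \<forall>n\<ge>N. \<P>(\<omega> in M. u / real (Suc n) \<le> W \<omega> \<and> W \<omega> \<le> u) \<le> v / \<alpha> * (u powr \<alpha> - (u / real (Suc n)) powr \<alpha>)"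
      by blast
  qed
  then show ?thesis using b(1) by (intro eventually_at_rightI[of 0 b]) auto
qed

lemma W_lower_tail_ge:
  assumes "\<forall>\<^sub>F x in at_right 0. v * x powr (\<alpha> - 1) \<le> w x"
  shows "\<forall>\<^sub>F u in at_right 0. v / \<alpha> * u powr \<alpha> \<le> prob_W_le u"
proof -
  obtain b where b: "0 < b" "\<And>x. 0 < x \<Longrightarrow> x < b \<Longrightarrow> v * x powr (\<alpha> - 1) \<le> w x"
    using assms by (auto simp: eventually_at_right_field)
  have "v / \<alpha> * u powr \<alpha> \<le> prob_W_le u" if u: "0 < u" "u < b" for u
  proof (rule LIMSEQ_le[OF powr_lower_tail_tendsto[OF u(1)] prob_W_lower_tail_tendsto[OF u(1)]])
    have "v / \<alpha> * (u powr \<alpha> - (u / real (Suc n)) powr \<alpha>) \<le> \<P>(\<omega> in M. u / real (Suc n) \<le> W \<omega> \<and> W \<omega> \<le> u)" for n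
    proof -
      let ?c = "u / real (Suc n)"
      have c: "0 < ?c" "?c \<le> u" using u mult_left_mono[of 1 "real (Suc n)" u] by (auto simp: divide_le_eq)
      have le: "v * x powr (\<alpha> - 1) \<le> w x" if "x \<in> {?c..u}" for x
      proof (rule b(2))
        have "?c \<le> x" using that by auto
        then show "0 < x" using c(1) by linarith
      qed (use that u in auto)
      have "v / \<alpha> * (u powr \<alpha> - ?c powr \<alpha>) \<le> integral {?c..u} w"
        by (rule has_integral_le[OF powr_antideriv_has_integral[OF c] integrable_integral[OF prob_W_integral(2)[OF c]]])
           (use le alpha_gt_1 in auto)
      then show ?thesis using prob_W_integral(1)[OF c] by simp
    qed
    then show "\<exists>N. \<forall>n\<ge>N. v / \<alpha> * (u powr \<alpha> - (u / real (Suc n)) powr \<alpha>) \<le> \<P>(\<omega> in M. u / real (Suc n) \<le> W \<omega> \<and> W \<omega> \<le> u)"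
      by blast
  qed
  then show ?thesis using b(1) by (intro eventually_at_rightI[of 0 b]) auto
qed

lemma AE_W_notin_countable:
  assumes "countable S" "S \<subseteq> {0<..}"
  shows "AE \<omega> in M. W \<omega> \<notin> S"
proof -
  have "AE \<omega> in M. \<forall>y\<in>S. W \<omega> \<noteq> y"
  proof (subst AE_ball_countable[OF assms(1)], rule ballI)
    fix y assume "y \<in> S"
    then have "\<P>(\<omega> in M. W \<omega> = y) = 0" using assms(2) by (intro prob_W_point) auto
    then show "AE \<omega> in M. W \<omega> \<noteq> y" by (subst (asm) prob_Collect_eq_0) auto
  qed
  then show ?thesis by eventually_elim auto
qed

text \<open>The law of W is not lattice, so its characteristic function has modulus below 1 off the origin.\<close>

lemma norm_Psi_imaginary_less_1:
  assumes s: "s \<noteq> 0"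
  shows "norm (Psi (\<i> * of_real s)) < 1"
proof (rule ccontr)
  define c where "c = Psi (\<i> * of_real s)"
  assume "\<not> norm (Psi (\<i> * of_real s)) < 1"
  then have nc: "norm c = 1" using norm_Psi_le_1[of "\<i> * of_real s"] by (simp add: c_def)
  \<comment> \<open>Rotating by the conjugate of its mean gives a variable of modulus 1 with mean 1,
    hence almost surely equal to 1.\<close>
  let ?f = "\<lambda>\<omega>. cnj c * exp (\<i> * of_real s * of_real (W \<omega>))"
  have nf: "norm (?f \<omega>) = 1" for \<omega> using nc by (simp add: norm_mult)
  have fi: "integrable M ?f" by (intro integrable_mult_right exp_W_int) simp
  have "expectation ?f = cnj c * c" by (simp add: c_def Psi_def)
  also have "\<dots> = 1" using nc complex_norm_square[of c] by (simp add: mult.commute)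
  finally have "Re (expectation ?f) = 1" by simp
  then have "expectation (\<lambda>\<omega>. Re (?f \<omega>)) = 1" using fi by (simp only: integral_Re)
  then have "expectation (\<lambda>\<omega>. 1 - Re (?f \<omega>)) = 0"
    using integrable_Re[OF fi] by (subst Bochner_Integration.integral_diff) (auto simp: prob_space)
  moreover have "AE \<omega> in M. 0 \<le> 1 - Re (?f \<omega>)"
  proof (rule AE_I2)
    fix \<omega>
    show "0 \<le> 1 - Re (?f \<omega>)" using complex_Re_le_cmod[of "?f \<omega>"] nf[of \<omega>] by linarith
  qed
  moreover have "integrable M (\<lambda>\<omega>. 1 - Re (?f \<omega>))" using integrable_Re[OF fi] by simp
  ultimately have "AE \<omega> in M. 1 - Re (?f \<omega>) = 0"
    using integral_nonneg_eq_0_iff_AE[of M "\<lambda>\<omega>. 1 - Re (?f \<omega>)"] by simp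
  then have AE_c: "AE \<omega> in M. exp (\<i> * of_real (s * W \<omega>)) = c"
  proof eventually_elim
    case (elim \<omega>)
    have "Re (?f \<omega>) = 1" using elim by simp
    moreover have "(Re (?f \<omega>))\<^sup>2 + (Im (?f \<omega>))\<^sup>2 = 1" using nf[of \<omega>] by (simp add: cmod_def)
    ultimately have "?f \<omega> = 1" by (simp add: complex_eq_iff)
    then have "c * ?f \<omega> = c" by simp
    moreover have "c * cnj c = 1" using nc complex_norm_square[of c] by simp
    ultimately show ?case by (simp add: mult.assoc[symmetric])
  qed
  \<comment> \<open>The positive solutions lie in an arithmetic progression, a null set for
    \<open>W\<close>. Only \<open>W = 0\<close> would be left, contradicting
    \<open>q0 < 1\<close>.\<close>
  define S where "S = {x::real. 0 < x \<and> exp (\<i> * of_real (s * x)) = c}"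
  have cS: "countable S"
  proof (cases "S = {}")
    case False
    then obtain x0 where x0: "x0 \<in> S" by auto
    have "S \<subseteq> range (\<lambda>n::int. x0 + of_int (2 * n) * pi / s)"
    proof
      fix x assume "x \<in> S"
      then have "exp (\<i> * of_real (s * x)) = exp (\<i> * of_real (s * x0))" using x0 by (simp add: S_def)
      then obtain n :: int where "\<i> * of_real (s * x) = \<i> * of_real (s * x0) + (of_int (2 * n) * pi) * \<i>"
        by (auto simp: exp_eq)
      then have "Im (\<i> * of_real (s * x)) = Im (\<i> * of_real (s * x0) + (of_int (2 * n) * pi) * \<i>)" by simp
      then have "s * x = s * x0 + of_int (2 * n) * pi" by simp
      then have "x = x0 + of_int (2 * n) * pi / s" using s by (simp add: field_simps)
      then show "x \<in> range (\<lambda>n::int. x0 + of_int (2 * n) * pi / s)" by blast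
    qed
    then show ?thesis by (rule countable_subset) simp
  qed simp
  have "AE \<omega> in M. W \<omega> \<notin> S" by (rule AE_W_notin_countable[OF cS]) (auto simp: S_def)
  then have "AE \<omega> in M. W \<omega> = 0"
    using AE_c W_nonneg by eventually_elim (auto simp: S_def)
  then have "q0 = 1" by (subst prob_Collect_eq_1) auto
  then show False using q0_less_1 by simp
qed

lemma norm_Psi_le_Phi: "Re z \<le> 0 \<Longrightarrow> norm (Psi z) \<le> Phi (- Re z)"
proof -
  assume z: "Re z \<le> 0"
  have "norm (Psi z) \<le> expectation (\<lambda>\<omega>. norm (exp (z * of_real (W \<omega>))))"
    unfolding Psi_def by (rule integral_norm_bound)
  then show ?thesis by (simp add: Phi_def)
qed

lemma continuous_Psi: "continuous_on {z. Re z \<le> 0} Psi"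
  unfolding continuous_on_sequentially
proof (intro allI ballI impI, elim conjE)
  fix x a assume a: "a \<in> {z. Re z \<le> 0}" and x: "\<forall>n. x n \<in> {z. Re z \<le> 0}" and lim: "x \<longlonglongrightarrow> a"
  show "(Psi \<circ> x) \<longlonglongrightarrow> Psi a"
    unfolding comp_def Psi_def
  proof (rule integral_dominated_convergence[where w="\<lambda>_. 1"])
    show "AE \<omega> in M. (\<lambda>n. exp (x n * of_real (W \<omega>))) \<longlonglongrightarrow> exp (a * of_real (W \<omega>))"
      by (intro AE_I2 tendsto_intros lim)
    show "AE \<omega> in M. norm (exp (x n * of_real (W \<omega>))) \<le> 1" for n
      using W_nonneg by eventually_elim (use x norm_exp_le_1 in auto)
  qed auto
qed

text \<open>Compactness and continuity reduce this to a strict pointwise bound: on the imaginary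
  axis the law is not lattice, to its left \<open>Phi\<close> is below 1. The range of imaginary
  parts from 1 to \<open>m\<close> is a fundamental domain for multiplication by
  \<open>m\<close>.\<close>

lemma norm_Psi_strip: "\<exists>r<1. \<forall>z. -1 \<le> Re z \<longrightarrow> Re z \<le> 0 \<longrightarrow> 1 \<le> \<bar>Im z\<bar> \<longrightarrow> \<bar>Im z\<bar> \<le> m \<longrightarrow> norm (Psi z) \<le> r"
proof -
  define K where "K = {z. -1 \<le> Re z \<and> Re z \<le> 0 \<and> 1 \<le> \<bar>Im z\<bar> \<and> \<bar>Im z\<bar> \<le> m}"
  have "closed K" unfolding K_def by (intro closed_Collect_conj closed_Collect_le continuous_intros)
  moreover have "bounded K"
  proof (rule boundedI)
    fix z assume "z \<in> K"
    then show "norm z \<le> 1 + m" using cmod_le[of z] by (auto simp: K_def)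
  qed
  ultimately have "compact K" by (simp add: compact_eq_bounded_closed)
  moreover have "continuous_on K (\<lambda>z. norm (Psi z))"
    by (intro continuous_on_norm continuous_on_subset[OF continuous_Psi]) (auto simp: K_def)
  moreover have "\<i> \<in> K" using m_gt_1 by (simp add: K_def)
  ultimately obtain z0 where z0: "z0 \<in> K" "\<And>z. z \<in> K \<Longrightarrow> norm (Psi z) \<le> norm (Psi z0)"
    using continuous_attains_sup[of K "\<lambda>z. norm (Psi z)"] by blast
  have "norm (Psi z0) < 1"
  proof (cases "Re z0 = 0")
    case True
    then have "z0 = \<i> * of_real (Im z0)" by (simp add: complex_eq_iff)
    moreover have "Im z0 \<noteq> 0" using z0(1) by (auto simp: K_def)
    ultimately show ?thesis using norm_Psi_imaginary_less_1 by metis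
  next
    case False
    then have "0 < - Re z0" using z0(1) by (auto simp: K_def)
    then show ?thesis using norm_Psi_le_Phi[of z0] Phi_less_1[of "- Re z0"] z0(1) by (auto simp: K_def)
  qed
  then show ?thesis using z0(2) by (intro exI[of _ "norm (Psi z0)"]) (auto simp: K_def)
qed

text \<open>Division by \<open>m ^ j\<close> brings the frequency into the compact strip, and
  \<open>Psi_iter\<close> returns to it by \<open>j\<close> iterations, which contract towards the
  fixed point \<open>q\<close>. The limit is \<open>q\<close> rather than 0 because of the atom of
  \<open>W\<close> at 0.\<close>

lemma Psi_decay:
  "\<exists>C>0. \<forall>t j. (j = 0 \<or> m ^ j \<le> \<bar>t\<bar>) \<longrightarrow> \<bar>t\<bar> < m ^ Suc j \<longrightarrow> norm (Psi (Complex (- 1) t) - of_real q) \<le> C * dpgf p q ^ j"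
proof -
  obtain r0 where r0: "r0 < 1" "\<And>z. -1 \<le> Re z \<Longrightarrow> Re z \<le> 0 \<Longrightarrow> 1 \<le> \<bar>Im z\<bar> \<Longrightarrow> \<bar>Im z\<bar> \<le> m \<Longrightarrow> norm (Psi z) \<le> r0"
    using norm_Psi_strip by blast
  define r where "r = max r0 q"
  have r: "r < 1" using r0 q_bounds by (simp add: r_def)
  obtain C where C: "0 < C" "\<And>n (z::complex) w. norm z \<le> r \<Longrightarrow> norm w \<le> r \<Longrightarrow>
      norm (pgf_iter p n z - pgf_iter p n w) \<le> C * dpgf p q ^ n * norm (z - w)"
    using pgf_iter_lipschitz[OF r, where 'a=complex] by blast
  have n2: "norm (Psi z - of_real q) \<le> 2" if "Re z \<le> 0" for z
    using norm_triangle_ineq4[of "Psi z" "of_real q"] norm_Psi_le_1[OF that] q_bounds by simp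
  show ?thesis
  proof (intro exI[of _ "max 2 (2 * C)"] conjI allI impI)
    fix t and j :: nat assume j: "j = 0 \<or> m ^ j \<le> \<bar>t\<bar>" "\<bar>t\<bar> < m ^ Suc j"
    show "norm (Psi (Complex (- 1) t) - of_real q) \<le> max 2 (2 * C) * dpgf p q ^ j"
    proof (cases "j = 0")
      case True
      then show ?thesis using n2[of "Complex (-1) t"] by simp
    next
      case False
      have mj: "0 < m ^ j" using m_pos by simp
      define z where "z = Complex (- 1 / m ^ j) (t / m ^ j)"
      have zm: "z * of_real (m ^ j) = Complex (- 1) t" using m_pos by (simp add: z_def complex_eq_iff del: of_real_power)
      have "1 \<le> \<bar>t / m ^ j\<bar>" "\<bar>t / m ^ j\<bar> \<le> m"
        using j False mj by (auto simp: abs_divide le_divide_eq divide_le_eq)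
      moreover have "1 \<le> m ^ j" using m_gt_1 by simp
      ultimately have z: "norm (Psi z) \<le> r" "Re z \<le> 0" using r0(2)[of z] mj by (auto simp: z_def r_def)
      have "Psi (Complex (- 1) t) = pgf_iter p j (Psi z)" using Psi_iter[OF z(2), of j] zm by simp
      moreover have "of_real q = (pgf_iter p j (of_real q) :: complex)"
        using pgf_iter_of_real[of q j p, where 'a=complex] q_bounds pgf_iter_q by simp
      ultimately have "norm (Psi (Complex (- 1) t) - of_real q) \<le> C * dpgf p q ^ j * norm (Psi z - of_real q)"
        using C(2)[of "Psi z" "of_real q" j] z q_bounds by (simp add: r_def)
      also have "\<dots> \<le> C * dpgf p q ^ j * 2" using n2[OF z(2)] C(1) dpgf_q by (intro mult_left_mono) auto
      also have "\<dots> \<le> max 2 (2 * C) * dpgf p q ^ j"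
        using dpgf_q mult_right_mono[of "2 * C" "max 2 (2 * C)" "dpgf p q ^ j"] by (simp add: mult_ac)
      finally show ?thesis .
    qed
  qed simp
qed

lemma std_normal_interval_le:
  assumes "0 \<le> a"
  shows "emeasure std_normal_distribution {x. \<bar>x\<bar> \<le> a} \<le> ennreal a"
proof -
  have le: "normal_density 0 1 x \<le> 1 / 2" for x
  proof -
    have "2 = sqrt 4" by simp
    also have "sqrt 4 \<le> sqrt (2 * pi)" using pi_ge_two by (intro real_sqrt_le_mono) simp
    finally have "2 \<le> sqrt (2 * pi)" .
    then have "1 / sqrt (2 * pi) \<le> 1 / 2" by (intro divide_left_mono) auto
    moreover have "exp (- x\<^sup>2 / 2) \<le> 1" by simp
    ultimately have "1 / sqrt (2 * pi) * exp (- x\<^sup>2 / 2) \<le> 1 / 2 * 1" by (intro mult_mono) auto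
    then show ?thesis by (simp add: normal_density_def)
  qed
  have "{x::real. \<bar>x\<bar> \<le> a} = {-a..a}" by auto
  then have "emeasure std_normal_distribution {x. \<bar>x\<bar> \<le> a} = (\<integral>\<^sup>+x. ennreal (normal_density 0 1 x) * indicator {-a..a} x \<partial>lborel)"
    by (simp add: emeasure_density)
  also have "\<dots> \<le> (\<integral>\<^sup>+x. ennreal (1/2) * indicator {-a..a} x \<partial>lborel)"
    using le by (intro nn_integral_mono mult_right_mono ennreal_leI) auto
  also have "\<dots> = ennreal (1/2) * ennreal (2 * a)"
    using assms by (subst nn_integral_cmult_indicator) auto
  also have "\<dots> = ennreal a" using assms by (subst ennreal_mult[symmetric]) auto
  finally show ?thesis .
qed

text \<open>Split the frequencies into shells of ratio \<open>m\<close>: the shell of index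
  \<open>j\<close> has Gaussian mass at most \<open>\<delta> * m ^ Suc j\<close> and carries at most
  a multiple of \<open>dpgf p q ^ j\<close>.\<close>

lemma Psi_decay_gaussian_average:
  "\<exists>C>0. \<forall>\<delta>>0. (\<integral>x. norm (Psi (Complex (- 1) (x / \<delta>)) - of_real q) \<partial>std_normal_distribution) \<le> C * \<delta>"
proof -
  let ?N = std_normal_distribution
  interpret N: real_distribution ?N by (rule real_dist_normal_dist)
  obtain C where C: "0 < C" "\<And>t j. j = 0 \<or> m ^ j \<le> \<bar>t\<bar> \<Longrightarrow> \<bar>t\<bar> < m ^ Suc j \<Longrightarrow>
      norm (Psi (Complex (- 1) t) - of_real q) \<le> C * dpgf p q ^ j"
    using Psi_decay by blast
  \<comment> \<open>The ratio of the shell sums is \<open>m powr (1 - \<alpha>)\<close>; the sum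
    over shells converges because \<open>1 < \<alpha>\<close>.\<close>
  define \<rho> where "\<rho> = dpgf p q * m"
  have \<rho>: "0 < \<rho>" "\<rho> < 1"
  proof -
    show "0 < \<rho>" using dpgf_q m_pos by (simp add: \<rho>_def)
    have "\<rho> = m powr (- \<alpha> + 1)" using m_pos powr_add[of m "- \<alpha>" 1] by (simp add: \<rho>_def dpgf_q_eq)
    also have "\<dots> < m powr 0" using m_gt_1 alpha_gt_1 by (intro powr_less_mono) auto
    finally show "\<rho> < 1" using m_pos by simp
  qed
  define S where "S = (\<Sum>j. \<rho> ^ j)"
  have S: "0 < S" unfolding S_def using \<rho> by (subst suminf_geometric) auto
  have cont: "continuous_on UNIV (\<lambda>x::real. Psi (Complex (- 1) (x / d)))" for d
  proof (rule continuous_on_compose2[OF continuous_Psi])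
    have "(\<lambda>x. Complex (- 1) (x / d)) = (\<lambda>x. - 1 + \<i> * of_real (x / d))"
      by (auto simp: fun_eq_iff complex_eq_iff)
    then show "continuous_on UNIV (\<lambda>x. Complex (- 1) (x / d))"
      by (simp only:) (cases "d = 0"; auto intro!: continuous_intros simp del: of_real_divide)
  qed auto
  show ?thesis
  proof (intro exI[of _ "C * m * S"] conjI allI impI)
    fix \<delta> :: real assume d: "0 < \<delta>"
    let ?G = "\<lambda>x. norm (Psi (Complex (- 1) (x / \<delta>)) - of_real q)"
    have Gm [measurable]: "?G \<in> borel_measurable borel"
      by (intro borel_measurable_continuous_onI continuous_intros cont)
    have pt: "ennreal (?G x) \<le> (\<Sum>j. ennreal (C * dpgf p q ^ j) * indicator {x. \<bar>x\<bar> \<le> \<delta> * m ^ Suc j} x)" for x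
    proof -
      obtain j where j: "j = 0 \<or> m ^ j \<le> \<bar>x / \<delta>\<bar>" "\<bar>x / \<delta>\<bar> < m ^ Suc j"
      proof (cases "\<bar>x / \<delta>\<bar> < 1")
        case True
        then have "\<bar>x / \<delta>\<bar> < m ^ Suc 0" using m_gt_1 by simp
        then show ?thesis using that[of 0] by simp
      next
        case False
        then show ?thesis using ex_power_bracket[OF m_gt_1, of "\<bar>x / \<delta>\<bar>"] that by auto
      qed
      have "\<bar>x\<bar> \<le> \<delta> * m ^ Suc j" using j(2) d by (simp add: abs_divide divide_less_eq mult.commute)
      then have "ennreal (?G x) \<le> ennreal (C * dpgf p q ^ j) * indicator {x. \<bar>x\<bar> \<le> \<delta> * m ^ Suc j} x"
        using C(2)[OF j] by (simp add: ennreal_leI del: power_Suc)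
      also have "\<dots> \<le> (\<Sum>j. ennreal (C * dpgf p q ^ j) * indicator {x. \<bar>x\<bar> \<le> \<delta> * m ^ Suc j} x)"
      proof -
        define f where "f j = ennreal (C * dpgf p q ^ j) * indicator {x. \<bar>x\<bar> \<le> \<delta> * m ^ Suc j} x" for j
        have "(\<Sum>i\<in>{j}. f i) \<le> suminf f" by (intro sum_le_suminf) auto
        then have "f j \<le> suminf f" by simp
        then show ?thesis by (simp only: f_def[abs_def])
      qed
      finally show ?thesis .
    qed
    have "(\<integral>\<^sup>+x. ennreal (?G x) \<partial>?N) \<le> (\<integral>\<^sup>+x. (\<Sum>j. ennreal (C * dpgf p q ^ j) * indicator {x. \<bar>x\<bar> \<le> \<delta> * m ^ Suc j} x) \<partial>?N)"
      by (intro nn_integral_mono pt)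
    also have "\<dots> = (\<Sum>j. \<integral>\<^sup>+x. ennreal (C * dpgf p q ^ j) * indicator {x. \<bar>x\<bar> \<le> \<delta> * m ^ Suc j} x \<partial>?N)"
      by (intro nn_integral_suminf) measurable
    also have "\<dots> = (\<Sum>j. ennreal (C * dpgf p q ^ j) * emeasure ?N {x. \<bar>x\<bar> \<le> \<delta> * m ^ Suc j})"
      by (intro suminf_cong nn_integral_cmult_indicator) measurable
    also have "\<dots> \<le> (\<Sum>j. ennreal (C * m * \<delta> * \<rho> ^ j))"
    proof (intro suminf_le)
      fix j
      have "ennreal (C * dpgf p q ^ j) * emeasure ?N {x. \<bar>x\<bar> \<le> \<delta> * m ^ Suc j} \<le> ennreal (C * dpgf p q ^ j) * ennreal (\<delta> * m ^ Suc j)"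
        using d m_pos by (intro mult_left_mono std_normal_interval_le) auto
      also have "\<dots> = ennreal (C * m * \<delta> * \<rho> ^ j)"
        using C(1) dpgf_q d m_pos by (subst ennreal_mult[symmetric]) (auto simp: \<rho>_def power_mult_distrib mult_ac)
      finally show "ennreal (C * dpgf p q ^ j) * emeasure ?N {x. \<bar>x\<bar> \<le> \<delta> * m ^ Suc j} \<le> ennreal (C * m * \<delta> * \<rho> ^ j)" .
    qed auto
    also have "\<dots> = ennreal (\<Sum>j. C * m * \<delta> * \<rho> ^ j)"
      using C(1) d m_pos \<rho> by (intro suminf_ennreal2 summable_mult summable_geometric) auto
    also have "(\<Sum>j. C * m * \<delta> * \<rho> ^ j) = C * m * S * \<delta>"
      unfolding S_def using \<rho> by (subst suminf_mult) (auto intro!: summable_geometric)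
    finally have le: "(\<integral>\<^sup>+x. ennreal (?G x) \<partial>?N) \<le> ennreal (C * m * S * \<delta>)" .
    have int: "integrable ?N ?G"
    proof (rule integrableI_bounded)
      show "?G \<in> borel_measurable ?N" using Gm by simp
      show "(\<integral>\<^sup>+x. ennreal (norm (?G x)) \<partial>?N) < \<infinity>" using le by (simp add: le_less_trans)
    qed
    have "ennreal (\<integral>x. ?G x \<partial>?N) = (\<integral>\<^sup>+x. ennreal (?G x) \<partial>?N)"
      by (subst nn_integral_eq_integral[OF int]) auto
    with le have "ennreal (\<integral>x. ?G x \<partial>?N) \<le> ennreal (C * m * S * \<delta>)" by simp
    then show "(\<integral>x. ?G x \<partial>?N) \<le> C * m * S * \<delta>"
      using C(1) m_pos S d by (subst (asm) ennreal_le_iff) auto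
  qed (use C(1) m_pos S in auto)
qed

text \<open>Fourier inversion, smoothed by the Gaussian kernel and exponentially tilted.\<close>

lemma prob_W_window_le:
  "\<exists>C>0. \<forall>n y \<delta>. 0 < \<delta> \<longrightarrow> \<delta> \<le> 1 \<longrightarrow> 0 < y \<longrightarrow> y \<le> m \<longrightarrow>
     \<P>(\<omega> in M. y \<le> m ^ n * W \<omega> \<and> m ^ n * W \<omega> \<le> y + \<delta>) \<le> C * dpgf p q ^ n * \<delta>"
proof -
  let ?N = std_normal_distribution
  interpret N: real_distribution ?N by (rule real_dist_normal_dist)
  interpret P: pair_prob_space M ?N ..
  obtain C1 where C1: "0 < C1" "\<And>\<delta>. 0 < \<delta> \<Longrightarrow> (\<integral>x. norm (Psi (Complex (- 1) (x / \<delta>)) - of_real q) \<partial>?N) \<le> C1 * \<delta>"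
    using Psi_decay_gaussian_average by blast
  define r where "r = max (Phi 1) q"
  have r: "r < 1" using Phi_less_1[of 1] q_bounds by (simp add: r_def)
  obtain C where C: "0 < C" "\<And>n (z::complex) w. norm z \<le> r \<Longrightarrow> norm w \<le> r \<Longrightarrow>
      norm (pgf_iter p n z - pgf_iter p n w) \<le> C * dpgf p q ^ n * norm (z - w)"
    using pgf_iter_lipschitz[OF r, where 'a=complex] by blast
  \<comment> \<open>On the window the tilt exponent is at most
    \<open>y + \<delta> \<le> m + 1\<close> and the Gaussian exponent at most 1/2, so
    \<open>K\<close> outweighs both.\<close>
  define K where "K = exp (m + 2)"
  show ?thesis
  proof (intro exI[of _ "K * (C * C1)"] conjI allI impI)
    fix n y \<delta> assume d: "0 < (\<delta>::real)" "\<delta> \<le> 1" and y: "0 < y" "y \<le> m"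
    define A where "A = {\<omega>\<in>space M. 0 < W \<omega>}"
    have A [measurable]: "A \<in> sets M" unfolding A_def by measurable
    let ?Y = "\<lambda>\<omega>. m ^ n * W \<omega>"
    let ?E = "{\<omega>\<in>space M. y \<le> ?Y \<omega> \<and> ?Y \<omega> \<le> y + \<delta>}"
    \<comment> \<open>A smooth majorant of the window, up to the factor \<open>K\<close>. Its
      Gaussian factor is the characteristic function of the standard normal law at
      \<open>(m ^ n * W - y) / \<delta>\<close>, which opens the way to Fubini.\<close>
    define F where "F \<omega> = indicator A \<omega> * exp (- ?Y \<omega>) * exp (- ((?Y \<omega> - y) / \<delta>)\<^sup>2 / 2)" for \<omega>
    define H where "H \<omega> s = indicator A \<omega> *\<^sub>R (exp (- of_real (?Y \<omega>)) * exp (\<i> * of_real (s * ((?Y \<omega> - y) / \<delta>))) :: complex)" for \<omega> s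
    have Wpos: "\<omega> \<in> A \<Longrightarrow> 0 < ?Y \<omega>" for \<omega> using m_pos by (simp add: A_def)
    have normH: "norm (H \<omega> s) \<le> 1" for \<omega> s
      using Wpos[of \<omega>] by (auto simp: H_def norm_mult indicator_def)
    have normF: "norm (F \<omega>) \<le> 1" for \<omega>
      using Wpos[of \<omega>] by (auto simp: F_def indicator_def abs_mult intro!: mult_le_one)
    have Fint: "integrable M F"
      by (rule integrable_const_bound[where B=1]) (use normF in \<open>auto simp: F_def[abs_def]\<close>)
    have Hint: "integrable (M \<Otimes>\<^sub>M ?N) (case_prod H)"
    proof (rule P.integrable_const_bound[where B=1])
      show "case_prod H \<in> borel_measurable (M \<Otimes>\<^sub>M ?N)"
        unfolding H_def[abs_def] by measurable
    qed (use normH in auto)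
    have HF: "(\<integral>s. H \<omega> s \<partial>?N) = of_real (F \<omega>)" for \<omega>
    proof -
      have "(\<integral>s. H \<omega> s \<partial>?N) = indicator A \<omega> *\<^sub>R (exp (- of_real (?Y \<omega>)) * char ?N ((?Y \<omega> - y) / \<delta>))"
        unfolding H_def char_def by (simp add: mult.commute)
      also have "\<dots> = of_real (F \<omega>)"
        unfolding char_std_normal_distribution F_def by (simp add: scaleR_conv_of_real exp_of_real[symmetric])
      finally show ?thesis .
    qed
    \<comment> \<open>Integrating over the sample point first yields the tilted transform minus the
      atom. Both are written as n-th iterates, so that their difference carries the factor
      \<open>dpgf p q ^ n\<close>.\<close>
    have inner: "(\<integral>\<omega>. H \<omega> s \<partial>M) = exp (- \<i> * of_real (s * y / \<delta>)) *
        (pgf_iter p n (Psi (Complex (- 1) (s / \<delta>))) - pgf_iter p n (of_real q))" for s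
    proof -
      let ?z = "Complex (- 1) (s / \<delta>)"
      have z: "Re ?z \<le> 0" "Re (?z * of_real (m ^ n)) \<le> 0" using m_pos by auto
      have eq: "AE \<omega> in M. H \<omega> s = exp (- \<i> * of_real (s * y / \<delta>)) *
          (exp (?z * of_real (m ^ n) * of_real (W \<omega>)) - indicator {\<omega>\<in>space M. W \<omega> = 0} \<omega> *\<^sub>R 1)"
        using W_nonneg AE_space
      proof eventually_elim
        case (elim \<omega>)
        show ?case
        proof (cases "W \<omega> = 0")
          case True
          then show ?thesis using elim by (simp add: H_def A_def)
        next
          case False
          have "- of_real (?Y \<omega>) + \<i> * of_real (s * ((?Y \<omega> - y) / \<delta>)) =
              - \<i> * of_real (s * y / \<delta>) + ?z * of_real (m ^ n) * of_real (W \<omega>)"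
            using d by (simp add: complex_eq_iff field_simps)
          then have "exp (- of_real (?Y \<omega>)) * exp (\<i> * of_real (s * ((?Y \<omega> - y) / \<delta>))) =
              exp (- \<i> * of_real (s * y / \<delta>)) * exp (?z * of_real (m ^ n) * of_real (W \<omega>))"
            by (simp only: exp_add[symmetric])
          then show ?thesis using elim False by (simp add: H_def A_def)
        qed
      qed
      have i1: "integrable M (\<lambda>\<omega>. exp (?z * of_real (m ^ n) * of_real (W \<omega>)))" by (rule exp_W_int[OF z(2)])
      have i2: "integrable M (\<lambda>\<omega>. indicator {\<omega>\<in>space M. W \<omega> = 0} \<omega> *\<^sub>R (1::complex))"
        by (rule integrable_const_bound[where B=1]) (auto simp: indicator_def)
      have "(\<integral>\<omega>. H \<omega> s \<partial>M) = (\<integral>\<omega>. exp (- \<i> * of_real (s * y / \<delta>)) *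
          (exp (?z * of_real (m ^ n) * of_real (W \<omega>)) - indicator {\<omega>\<in>space M. W \<omega> = 0} \<omega> *\<^sub>R 1) \<partial>M)"
        by (rule integral_cong_AE[OF _ _ eq]) (unfold H_def, measurable)
      also have "\<dots> = exp (- \<i> * of_real (s * y / \<delta>)) * (Psi (?z * of_real (m ^ n)) - q0 *\<^sub>R 1)"
      proof -
        have "(\<integral>\<omega>. indicator {\<omega>\<in>space M. W \<omega> = 0} \<omega> *\<^sub>R (1::complex) \<partial>M) = q0 *\<^sub>R 1"
          by (rule integral_indicator_scaleR) measurable
        then show ?thesis unfolding Psi_def
          by (simp only: integral_mult_right_zero Bochner_Integration.integral_diff[OF i1 i2])
      qed
      also have "Psi (?z * of_real (m ^ n)) = pgf_iter p n (Psi ?z)" by (rule Psi_iter[OF z(1)])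
      also have "q0 *\<^sub>R 1 = (pgf_iter p n (of_real q) :: complex)"
        using pgf_iter_of_real[of q n p, where 'a=complex] q_bounds pgf_iter_q
        by (simp add: prob_W_0 scaleR_conv_of_real)
      finally show ?thesis .
    qed
    have "of_real (expectation F) = (\<integral>\<omega>. (\<integral>s. H \<omega> s \<partial>?N) \<partial>M)"
      unfolding HF by (simp only: integral_complex_of_real)
    also have "\<dots> = (\<integral>s. (\<integral>\<omega>. H \<omega> s \<partial>M) \<partial>?N)"
      by (rule P.Fubini_integral[symmetric, OF Hint])
    finally have EF: "of_real (expectation F) = (\<integral>s. (\<integral>\<omega>. H \<omega> s \<partial>M) \<partial>?N)" .
    have G_int: "integrable ?N (\<lambda>s. norm (Psi (Complex (- 1) (s / \<delta>)) - of_real q))"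
    proof (rule N.integrable_const_bound[where B=2])
      show "AE s in ?N. norm (norm (Psi (Complex (- 1) (s / \<delta>)) - of_real q)) \<le> 2"
      proof (rule AE_I2)
        fix s
        show "norm (norm (Psi (Complex (- 1) (s / \<delta>)) - of_real q)) \<le> 2"
          using norm_triangle_ineq4[of "Psi (Complex (- 1) (s / \<delta>))" "of_real q"] norm_Psi_le_1[of "Complex (- 1) (s / \<delta>)"] q_bounds by simp
      qed
      have "continuous_on UNIV (\<lambda>x::real. Psi (Complex (- 1) (x / \<delta>)))"
      proof (rule continuous_on_compose2[OF continuous_Psi])
        have "(\<lambda>x. Complex (- 1) (x / \<delta>)) = (\<lambda>x. - 1 + \<i> * of_real (x / \<delta>))"
          by (auto simp: fun_eq_iff complex_eq_iff)
        then show "continuous_on UNIV (\<lambda>x. Complex (- 1) (x / \<delta>))"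
          using d by (simp only:) (auto intro!: continuous_intros simp del: of_real_divide)
      qed auto
      then have "(\<lambda>s. norm (Psi (Complex (- 1) (s / \<delta>)) - of_real q)) \<in> borel_measurable borel"
        by (intro borel_measurable_continuous_onI continuous_intros)
      then show "(\<lambda>s. norm (Psi (Complex (- 1) (s / \<delta>)) - of_real q)) \<in> borel_measurable ?N" by simp
    qed
    have "expectation F \<le> norm (of_real (expectation F) :: complex)" by simp
    also have "\<dots> \<le> (\<integral>s. norm (\<integral>\<omega>. H \<omega> s \<partial>M) \<partial>?N)"
      unfolding EF by (rule integral_norm_bound)
    also have "\<dots> \<le> (\<integral>s. C * dpgf p q ^ n * norm (Psi (Complex (- 1) (s / \<delta>)) - of_real q) \<partial>?N)"
    proof (rule integral_mono)
      show "integrable ?N (\<lambda>s. norm (\<integral>\<omega>. H \<omega> s \<partial>M))"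
        by (intro integrable_norm P.integrable_snd[OF Hint])
      show "integrable ?N (\<lambda>s. C * dpgf p q ^ n * norm (Psi (Complex (- 1) (s / \<delta>)) - of_real q))"
        using G_int by simp
      fix s
      have "norm (Psi (Complex (- 1) (s / \<delta>))) \<le> r"
        using norm_Psi_le_Phi[of "Complex (- 1) (s / \<delta>)"] by (simp add: r_def)
      then show "norm (\<integral>\<omega>. H \<omega> s \<partial>M) \<le> C * dpgf p q ^ n * norm (Psi (Complex (- 1) (s / \<delta>)) - of_real q)"
        unfolding inner norm_mult using C(2)[of "Psi (Complex (- 1) (s / \<delta>))" "of_real q" n] q_bounds
        by (simp add: r_def)
    qed
    also have "\<dots> = C * dpgf p q ^ n * (\<integral>s. norm (Psi (Complex (- 1) (s / \<delta>)) - of_real q) \<partial>?N)" by simp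
    also have "\<dots> \<le> C * dpgf p q ^ n * (C1 * \<delta>)"
      using C(1) dpgf_q d by (intro mult_left_mono C1(2)) auto
    finally have EFle: "expectation F \<le> C * dpgf p q ^ n * (C1 * \<delta>)" .
    have "prob ?E = expectation (\<lambda>\<omega>. indicator ?E \<omega> *\<^sub>R (1::real))" by (subst integral_indicator_scaleR) auto
    also have "\<dots> \<le> expectation (\<lambda>\<omega>. K * F \<omega>)"
    proof (rule integral_mono)
      show "integrable M (\<lambda>\<omega>. indicator ?E \<omega> *\<^sub>R (1::real))"
        by (rule integrable_const_bound[where B=1]) (auto simp: indicator_def)
      show "integrable M (\<lambda>\<omega>. K * F \<omega>)" using Fint by simp
      fix \<omega>
      show "indicator ?E \<omega> *\<^sub>R (1::real) \<le> K * F \<omega>"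
      proof (cases "\<omega> \<in> ?E")
        case True
        have Ypos: "0 < m ^ n * W \<omega>" using True y by auto
        then have inA: "\<omega> \<in> A" using m_pos True by (auto simp: A_def zero_less_mult_iff)
        have "\<bar>(?Y \<omega> - y) / \<delta>\<bar> \<le> 1" using True d by (simp add: abs_divide)
        then have "((?Y \<omega> - y) / \<delta>)\<^sup>2 \<le> 1" by (simp add: abs_square_le_1)
        then have "0 \<le> (m + 2) + (- ?Y \<omega>) + (- ((?Y \<omega> - y) / \<delta>)\<^sup>2 / 2)"
          using True y d by auto
        then have "1 \<le> exp ((m + 2) + (- ?Y \<omega>) + (- ((?Y \<omega> - y) / \<delta>)\<^sup>2 / 2))" by simp
        then show ?thesis using True inA unfolding exp_add by (simp add: F_def K_def exp_add mult.assoc)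
      next
        case False
        then show ?thesis by (simp add: F_def K_def)
      qed
    qed
    also have "\<dots> \<le> K * (C * dpgf p q ^ n * (C1 * \<delta>))" using EFle by (simp add: K_def)
    finally show "prob ?E \<le> K * (C * C1) * dpgf p q ^ n * \<delta>" by (simp add: mult_ac)
  qed (use C(1) C1(1) in \<open>simp add: K_def\<close>)
qed

text \<open>Choose \<open>n\<close> so that \<open>m ^ n * u\<close> lies between 1 and
  \<open>m\<close>. A window at \<open>u\<close> becomes a window at unit scale, of length
  multiplied by \<open>m ^ n\<close> and probability of order \<open>dpgf p q ^ n\<close>.\<close>

lemma density_upper_bound: "\<exists>C>0. \<forall>u. 0 < u \<longrightarrow> u < 1 \<longrightarrow> w u \<le> C * u powr (\<alpha> - 1)"
proof -
  obtain C where C: "0 < C" "\<And>n y \<delta>. 0 < \<delta> \<Longrightarrow> \<delta> \<le> 1 \<Longrightarrow> 0 < y \<Longrightarrow> y \<le> m \<Longrightarrow>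
     \<P>(\<omega> in M. y \<le> m ^ n * W \<omega> \<and> m ^ n * W \<omega> \<le> y + \<delta>) \<le> C * dpgf p q ^ n * \<delta>"
    using prob_W_window_le by blast
  show ?thesis
  proof (intro exI[of _ C] conjI allI impI C(1))
    fix u :: real assume u: "0 < u" "u < 1"
    obtain j where j: "m ^ j \<le> 1 / u" "1 / u < m ^ Suc j" using ex_power_bracket[OF m_gt_1, of "1 / u"] u by auto
    define n where "n = Suc j"
    have mn: "0 < m ^ n" using m_pos by simp
    have y: "0 < m ^ n * u" "m ^ n * u \<le> m" "1 \<le> m ^ n * u"
      using j u m_pos by (auto simp: n_def field_simps)
    have "w u \<le> C * dpgf p q ^ n * m ^ n"
    proof (rule density_le[OF u(1)])
      have "\<forall>\<^sub>F h in at_right 0. (0::real) < h \<and> h < 1 / m ^ n"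
        using mn by (intro eventually_at_rightI[of 0 "1 / m ^ n"]) auto
      then show "\<forall>\<^sub>F h in at_right 0. \<P>(\<omega> in M. u \<le> W \<omega> \<and> W \<omega> \<le> u + h) \<le> C * dpgf p q ^ n * m ^ n * h"
      proof eventually_elim
        case (elim h)
        have "\<P>(\<omega> in M. u \<le> W \<omega> \<and> W \<omega> \<le> u + h) =
            \<P>(\<omega> in M. m ^ n * u \<le> m ^ n * W \<omega> \<and> m ^ n * W \<omega> \<le> m ^ n * u + m ^ n * h)"
          using mn by (simp add: distrib_left[symmetric] del: distrib_left)
        also have "\<dots> \<le> C * dpgf p q ^ n * (m ^ n * h)"
          using elim mn y by (intro C(2)) (auto simp: field_simps)
        finally show ?case by (simp add: mult_ac)
      qed
    qed
    also have "C * dpgf p q ^ n * m ^ n = C * (m ^ n) powr (1 - \<alpha>)"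
      using m_pos by (simp add: gamma_pow powr_realpow[symmetric] powr_powr powr_add[symmetric] algebra_simps)
    also have "\<dots> \<le> C * (1 / u) powr (1 - \<alpha>)"
      using C(1) alpha_gt_1 y u by (intro mult_left_mono powr_mono2') (auto simp: field_simps)
    also have "(1 / u) powr (1 - \<alpha>) = u powr (\<alpha> - 1)"
      using u by (simp add: powr_divide powr_minus_divide[symmetric])
    finally show "w u \<le> C * u powr (\<alpha> - 1)" .
  qed
qed

end

section \<open>Convolution powers of a law on the real line\<close>

primrec conv_power :: "real measure \<Rightarrow> nat \<Rightarrow> real measure" where
  "conv_power \<mu> 0 = return borel 0"
| "conv_power \<mu> (Suc l) = convolution \<mu> (conv_power \<mu> l)"

lemma real_distribution_conv_power:
  assumes "real_distribution \<mu>"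
  shows "real_distribution (conv_power \<mu> l)"
proof (induction l)
  case 0
  have "prob_space (return borel (0::real))" by (rule prob_space_return) simp
  then show ?case by (auto simp: real_distribution_def real_distribution_axioms_def)
next
  case (Suc l)
  interpret \<mu>: real_distribution \<mu> by fact
  interpret \<nu>: real_distribution "conv_power \<mu> l" by fact
  interpret P: pair_prob_space \<mu> "conv_power \<mu> l" ..
  have "prob_space (distr (\<mu> \<Otimes>\<^sub>M conv_power \<mu> l) borel (\<lambda>(x, y). x + y))"
    by (rule P.prob_space_distr) measurable
  then show ?case by (auto simp: real_distribution_def real_distribution_axioms_def convolution_def)
qed

lemma char_conv_power:
  assumes "real_distribution \<mu>"
  shows "char (conv_power \<mu> l) t = char \<mu> t ^ l"
proof (induction l)
  case 0
  then show ?case by (simp add: char_def integral_return)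
next
  case (Suc l)
  interpret \<mu>: real_distribution \<mu> by fact
  interpret \<nu>: real_distribution "conv_power \<mu> l" by (rule real_distribution_conv_power[OF assms])
  interpret P: pair_prob_space \<mu> "conv_power \<mu> l" ..
  have int: "integrable (\<mu> \<Otimes>\<^sub>M conv_power \<mu> l) (\<lambda>(x, y). iexp (t * (x + y)))"
    by (rule P.integrable_const_bound[where B=1]) auto
  have "char (conv_power \<mu> (Suc l)) t = (\<integral>z. (case z of (x, y) \<Rightarrow> iexp (t * (x + y))) \<partial>(\<mu> \<Otimes>\<^sub>M conv_power \<mu> l))"
    unfolding char_def conv_power.simps convolution_def
    by (subst integral_distr) (auto simp: case_prod_unfold)
  also have "\<dots> = (\<integral>x. (\<integral>y. iexp (t * (x + y)) \<partial>conv_power \<mu> l) \<partial>\<mu>)"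
    using P.integral_fst[OF int] by simp
  also have "\<dots> = (\<integral>x. iexp (t * x) * char (conv_power \<mu> l) t \<partial>\<mu>)"
  proof (intro Bochner_Integration.integral_cong refl)
    fix x
    have "iexp (t * (x + y)) = iexp (t * x) * iexp (t * y)" for y
      by (simp add: exp_add[symmetric] algebra_simps)
    then show "(\<integral>y. iexp (t * (x + y)) \<partial>conv_power \<mu> l) = iexp (t * x) * char (conv_power \<mu> l) t"
      unfolding char_def by (simp only: integral_mult_right_zero)
  qed
  also have "\<dots> = char \<mu> t * char (conv_power \<mu> l) t" unfolding char_def by simp
  finally show ?case using Suc by simp
qed

lemma emeasure_conv_power_Suc:
  assumes \<mu>: "real_distribution \<mu>" and A: "A \<in> sets borel"
  shows "emeasure (conv_power \<mu> (Suc l)) A = (\<integral>\<^sup>+x. emeasure (conv_power \<mu> l) {a. a + x \<in> A} \<partial>\<mu>)"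
proof -
  interpret \<mu>: real_distribution \<mu> by fact
  interpret \<nu>: real_distribution "conv_power \<mu> l" by (rule real_distribution_conv_power[OF \<mu>])
  show ?thesis
    unfolding conv_power.simps
    by (rule convolution_emeasure[OF A]) (auto simp: \<mu>.finite_measure_axioms \<nu>.finite_measure_axioms)
qed

text \<open>Among \<open>l\<close> independent summands let exactly one fall into \<open>B\<close>
  and the others vanish. Since 0 is not in \<open>B\<close>, the \<open>l\<close> choices of the
  exceptional summand are disjoint.\<close>

lemma conv_power_ge:
  assumes \<mu>: "real_distribution \<mu>"
  shows "ennreal (measure \<mu> {0} ^ l) \<le> emeasure (conv_power \<mu> l) {0}"
    and "B \<in> sets borel \<Longrightarrow> 0 \<notin> B \<Longrightarrow>
      ennreal (real l * measure \<mu> {0} ^ (l - 1)) * emeasure \<mu> B \<le> emeasure (conv_power \<mu> l) B"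
proof -
  interpret \<mu>: real_distribution \<mu> by fact
  let ?q = "measure \<mu> {0}"
  have q: "0 \<le> ?q" by simp
  have zero: "ennreal (?q ^ l) \<le> emeasure (conv_power \<mu> l) {0}" for l
  proof (induction l)
    case (Suc l)
    have "ennreal (?q ^ Suc l) = ennreal (?q ^ l) * emeasure \<mu> {0}"
      by (simp add: \<mu>.emeasure_eq_measure ennreal_mult mult.commute)
    also have "\<dots> = (\<integral>\<^sup>+x. ennreal (?q ^ l) * indicator {0} x \<partial>\<mu>)"
      by (subst nn_integral_cmult_indicator) auto
    also have "\<dots> \<le> (\<integral>\<^sup>+x. emeasure (conv_power \<mu> l) {a. a + x \<in> {0}} \<partial>\<mu>)"
      using Suc by (intro nn_integral_mono) (auto simp: indicator_def)
    finally show ?case by (subst emeasure_conv_power_Suc[OF \<mu>]) auto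
  qed simp
  then show "ennreal (?q ^ l) \<le> emeasure (conv_power \<mu> l) {0}" .
  assume B: "B \<in> sets borel" "0 \<notin> B"
  show "ennreal (real l * ?q ^ (l - 1)) * emeasure \<mu> B \<le> emeasure (conv_power \<mu> l) B"
  proof (induction l)
    case (Suc l)
    interpret \<nu>: real_distribution "conv_power \<mu> l" by (rule real_distribution_conv_power[OF \<mu>])
    have e: "ennreal (real (Suc l) * ?q ^ (Suc l - 1)) * emeasure \<mu> B =
        ennreal (real l * ?q ^ (l - 1)) * emeasure \<mu> B * emeasure \<mu> {0} + ennreal (?q ^ l) * emeasure \<mu> B"
    proof -
      have "real (Suc l) * ?q ^ (Suc l - 1) * measure \<mu> B =
          real l * ?q ^ (l - 1) * measure \<mu> B * ?q + ?q ^ l * measure \<mu> B"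
        by (cases l) (auto simp: algebra_simps)
      then show ?thesis
        by (simp add: \<mu>.emeasure_eq_measure ennreal_mult[symmetric] ennreal_plus[symmetric] del: ennreal_plus)
    qed
    have "ennreal (real l * ?q ^ (l - 1)) * emeasure \<mu> B * emeasure \<mu> {0} + ennreal (?q ^ l) * emeasure \<mu> B
        \<le> emeasure (conv_power \<mu> l) B * emeasure \<mu> {0} + emeasure (conv_power \<mu> l) {0} * emeasure \<mu> B"
      by (intro add_mono mult_right_mono Suc zero) auto
    also have "\<dots> = (\<integral>\<^sup>+x. emeasure (conv_power \<mu> l) B * indicator {0} x + emeasure (conv_power \<mu> l) {0} * indicator B x \<partial>\<mu>)"
      using B by (subst nn_integral_add) (auto simp: nn_integral_cmult_indicator)
    also have "\<dots> \<le> (\<integral>\<^sup>+x. emeasure (conv_power \<mu> l) {a. a + x \<in> B} \<partial>\<mu>)"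
    proof (rule nn_integral_mono)
      fix x :: real
      have m: "{a. a + x \<in> B} \<in> sets borel"
        using measurable_sets[of "\<lambda>a. a + x" borel borel B] B by (simp add: vimage_def)
      show "emeasure (conv_power \<mu> l) B * indicator {0} x + emeasure (conv_power \<mu> l) {0} * indicator B x
        \<le> emeasure (conv_power \<mu> l) {a. a + x \<in> B}"
      proof (cases "x = 0")
        case True
        then show ?thesis using B by simp
      next
        case False
        show ?thesis
        proof (cases "x \<in> B")
          case True
          have "emeasure (conv_power \<mu> l) {0} \<le> emeasure (conv_power \<mu> l) {a. a + x \<in> B}"
            using True m by (intro emeasure_mono) auto
          then show ?thesis using True False by simp
        qed (use False in simp)
      qed
    qed
    also have "\<dots> = emeasure (conv_power \<mu> (Suc l)) B"
      using B by (subst emeasure_conv_power_Suc[OF \<mu>]) auto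
    finally show ?case unfolding e .
  qed simp
qed

text \<open>A local lower bound by Lebesgue measure. It is expressed through intervals because the
  measures concerned may have an atom at 0 and are not given by a density.\<close>

definition dense_at :: "real measure \<Rightarrow> real \<Rightarrow> bool" where
  "dense_at \<nu> y \<longleftrightarrow> (\<exists>c>0. \<exists>d>0. \<forall>s t. y - d \<le> s \<longrightarrow> s \<le> t \<longrightarrow> t \<le> y + d \<longrightarrow> ennreal (c * (t - s)) \<le> emeasure \<nu> {s..t})"

text \<open>Condition on the last summand lying close to \<open>u l\<close>: the sum of the others
  then has to hit a shifted interval, which is still near the sum of their points.\<close>

lemma dense_at_conv_power:
  assumes \<mu>: "real_distribution \<mu>" and u: "\<And>i. i < l \<Longrightarrow> dense_at \<mu> (u i)" and l: "0 < l"
  shows "dense_at (conv_power \<mu> l) (\<Sum>i<l. u i)"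
  using u l
proof (induction l)
  case (Suc l)
  interpret \<mu>: real_distribution \<mu> by fact
  show ?case
  proof (cases "l = 0")
    case True
    have "emeasure (conv_power \<mu> (Suc 0)) A = emeasure \<mu> A" if A: "A \<in> sets borel" for A
    proof -
      have "emeasure (conv_power \<mu> (Suc 0)) A = (\<integral>\<^sup>+x. indicator A x \<partial>\<mu>)"
        unfolding emeasure_conv_power_Suc[OF \<mu> A]
      proof (intro nn_integral_cong)
        fix x :: real
        have m: "{a. a + x \<in> A} \<in> sets borel"
          using measurable_sets[of "\<lambda>a. a + x" borel borel A] A by (simp add: vimage_def)
        show "emeasure (conv_power \<mu> 0) {a. a + x \<in> A} = indicator A x"
          using m by (simp add: emeasure_return indicator_def)
      qed
      then show ?thesis using A by simp
    qed
    then have "emeasure (conv_power \<mu> (Suc 0)) {s..t} = emeasure \<mu> {s..t}" for s t by simp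
    then show ?thesis using Suc.prems(1)[of 0] True unfolding dense_at_def by simp
  next
    case False
    define y where "y = (\<Sum>i<l. u i)"
    have "dense_at (conv_power \<mu> l) y" unfolding y_def using Suc False by auto
    then obtain c d where c: "0 < c" and d: "0 < d" and
      cd: "\<And>s t. y - d \<le> s \<Longrightarrow> s \<le> t \<Longrightarrow> t \<le> y + d \<Longrightarrow> ennreal (c * (t - s)) \<le> emeasure (conv_power \<mu> l) {s..t}"
      unfolding dense_at_def by blast
    have "dense_at \<mu> (u l)" using Suc.prems(1)[of l] by simp
    then obtain c' d' where c': "0 < c'" and d': "0 < d'" and
      cd': "\<And>s t. u l - d' \<le> s \<Longrightarrow> s \<le> t \<Longrightarrow> t \<le> u l + d' \<Longrightarrow> ennreal (c' * (t - s)) \<le> emeasure \<mu> {s..t}"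
      unfolding dense_at_def by blast
    \<comment> \<open>A shift by at most \<open>d / 2\<close> keeps an interval of the smaller
      neighbourhood inside the one of radius \<open>d\<close> given by induction.\<close>
    define e where "e = min (d / 2) d'"
    have e: "0 < e" "e \<le> d'" "e \<le> d / 2" using d d' by (auto simp: e_def)
    have "dense_at (conv_power \<mu> (Suc l)) (y + u l)"
      unfolding dense_at_def
    proof (rule exI[of _ "c * (c' * (2 * e))"], rule conjI[rotated], rule exI[of _ "d / 2"], intro conjI allI impI)
      fix s t assume st: "y + u l - d / 2 \<le> s" "s \<le> t" "t \<le> y + u l + d / 2"
      have "ennreal (c * (c' * (2 * e)) * (t - s)) = ennreal (c * (t - s)) * ennreal (c' * (u l + e - (u l - e)))"
        using c c' e st by (subst ennreal_mult[symmetric]) (auto simp: mult_ac)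
      also have "\<dots> \<le> ennreal (c * (t - s)) * emeasure \<mu> {u l - e..u l + e}"
        using e by (intro mult_left_mono cd') auto
      also have "\<dots> = (\<integral>\<^sup>+x. ennreal (c * (t - s)) * indicator {u l - e..u l + e} x \<partial>\<mu>)"
        by (subst nn_integral_cmult_indicator) auto
      also have "\<dots> \<le> (\<integral>\<^sup>+x. emeasure (conv_power \<mu> l) {a. a + x \<in> {s..t}} \<partial>\<mu>)"
      proof (rule nn_integral_mono)
        fix x :: real
        have set_eq: "{a. a + x \<in> {s..t}} = {s - x..t - x}" by auto
        show "ennreal (c * (t - s)) * indicator {u l - e..u l + e} x \<le> emeasure (conv_power \<mu> l) {a. a + x \<in> {s..t}}"
        proof (cases "x \<in> {u l - e..u l + e}")
          case True
          have "ennreal (c * ((t - x) - (s - x))) \<le> emeasure (conv_power \<mu> l) {s - x..t - x}"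
            using True st e by (intro cd) auto
          then show ?thesis using True unfolding set_eq by simp
        qed simp
      qed
      also have "\<dots> = emeasure (conv_power \<mu> (Suc l)) {s..t}"
        by (subst emeasure_conv_power_Suc[OF \<mu>]) auto
      finally show "ennreal (c * (c' * (2 * e)) * (t - s)) \<le> emeasure (conv_power \<mu> (Suc l)) {s..t}" .
    qed (use c c' e d in auto)
    then show ?thesis by (simp add: y_def)
  qed
qed simp

section \<open>Decomposition at the first generation and lower bounds on the density\<close>

context gw_density
begin

abbreviation lawW :: "real measure" where "lawW \<equiv> distr M borel W"

lemma lawW: "real_distribution lawW" by (rule real_distribution_distr) simp

lemma prob_Z1: "\<P>(\<omega> in M. Z 1 \<omega> = l) = pmf p l"
proof -
  have "Z 1 \<omega> = \<xi> 0 0 \<omega>" for \<omega> using Z_Suc[of 0 \<omega>] Z_0[of \<omega>] by simp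
  then have "\<P>(\<omega> in M. Z 1 \<omega> = l) = measure (distr M (count_space UNIV) (\<xi> 0 0)) {l}"
    by (subst measure_distr) (auto simp: vimage_def Int_def conj_commute)
  then show ?thesis by (simp add: xi_distr measure_pmf_single)
qed

lemma sets_mW:
  assumes "B \<in> sets borel"
  shows "{\<omega>\<in>space M. m * W \<omega> \<in> B} \<in> sets M"
proof -
  have "(\<lambda>\<omega>. m * W \<omega>) -` B \<inter> space M \<in> sets M" by (rule measurable_sets[OF _ assms]) measurable
  also have "(\<lambda>\<omega>. m * W \<omega>) -` B \<inter> space M = {\<omega>\<in>space M. m * W \<omega> \<in> B}" by auto
  finally show ?thesis .
qed

text \<open>Under the law conditioned on \<open>Z 1 = l\<close>, the characteristic function of
  \<open>m * W\<close> is a power by \<open>Psi_markov\<close>; Levy's uniqueness theorem identifies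
  the law. A value \<open>l\<close> of probability 0 is treated apart, as conditioning is then
  impossible.\<close>

lemma prob_mW_given_Z1:
  assumes B: "B \<in> sets borel"
  shows "\<P>(\<omega> in M. Z 1 \<omega> = l \<and> m * W \<omega> \<in> B) = pmf p l * measure (conv_power lawW l) B"
proof (cases "pmf p l = 0")
  case True
  have "\<P>(\<omega> in M. Z 1 \<omega> = l \<and> m * W \<omega> \<in> B) \<le> \<P>(\<omega> in M. Z 1 \<omega> = l)"
    by (rule finite_measure_mono) auto
  then have "\<P>(\<omega> in M. Z 1 \<omega> = l \<and> m * W \<omega> \<in> B) \<le> 0" unfolding prob_Z1 using True by simp
  then have "\<P>(\<omega> in M. Z 1 \<omega> = l \<and> m * W \<omega> \<in> B) = 0" by (intro antisym) auto
  then show ?thesis using True by simp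
next
  case False
  define A where "A = {\<omega>\<in>space M. Z 1 \<omega> = l}"
  have A [measurable]: "A \<in> sets M" unfolding A_def by measurable
  have pA: "prob A = pmf p l" unfolding A_def by (rule prob_Z1)
  have pA0: "0 < prob A" using False by (simp add: pA order_less_le)
  have eA: "emeasure M A \<noteq> 0" "emeasure M A \<noteq> \<infinity>" using pA0 by (auto simp: emeasure_eq_measure)
  interpret U: prob_space "uniform_measure M A" by (rule prob_space_uniform_measure[OF eA])
  have Wm: "(\<lambda>\<omega>. m * W \<omega>) \<in> borel_measurable (uniform_measure M A)" by simp
  have D: "real_distribution (distr (uniform_measure M A) borel (\<lambda>\<omega>. m * W \<omega>))"
    by (rule U.real_distribution_distr[OF Wm])
  have "distr (uniform_measure M A) borel (\<lambda>\<omega>. m * W \<omega>) = conv_power lawW l"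
  proof (rule Levy_uniqueness[OF D real_distribution_conv_power[OF lawW]], rule ext)
    fix t
    have "char (distr (uniform_measure M A) borel (\<lambda>\<omega>. m * W \<omega>)) t = (\<integral>\<omega>. iexp (t * (m * W \<omega>)) \<partial>uniform_measure M A)"
      unfolding char_def by (subst integral_distr) auto
    also have "\<dots> = (\<integral>\<omega>. (indicator A \<omega> / prob A) *\<^sub>R iexp (t * (m * W \<omega>)) \<partial>M)"
    proof -
      have "uniform_measure M A = density M (\<lambda>\<omega>. ennreal (indicator A \<omega> / prob A))"
      unfolding uniform_measure_def using pA0
      by (intro arg_cong[where f="density M"] ext) (auto simp: emeasure_eq_measure indicator_def divide_ennreal ennreal_1[symmetric] simp del: ennreal_1)
      then show ?thesis by (simp only:) (subst integral_density; simp)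
    qed
    also have "\<dots> = (\<integral>\<omega>. (1 / prob A) *\<^sub>R (indicator A \<omega> *\<^sub>R exp (\<i> * of_real t * of_real (m ^ 1) * of_real (W \<omega>))) \<partial>M)"
      by (intro Bochner_Integration.integral_cong) (auto simp: mult_ac)
    also have "\<dots> = (1 / prob A) *\<^sub>R (\<integral>\<omega>. indicator A \<omega> *\<^sub>R exp (\<i> * of_real t * of_real (m ^ 1) * of_real (W \<omega>)) \<partial>M)"
      by (rule integral_scaleR_right)
    also have "\<dots> = (1 / prob A) *\<^sub>R (prob A *\<^sub>R Psi (\<i> * of_real t) ^ l)"
      using Psi_markov[of "\<i> * of_real t" 1 l] unfolding A_def by simp
    also have "\<dots> = Psi (\<i> * of_real t) ^ l" using pA0 by simp
    also have "Psi (\<i> * of_real t) = char lawW t"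
      unfolding Psi_def char_def by (subst integral_distr) (auto simp: mult.assoc)
    finally show "char (distr (uniform_measure M A) borel (\<lambda>\<omega>. m * W \<omega>)) t = char (conv_power lawW l) t"
      by (simp add: char_conv_power[OF lawW])
  qed
  then have "measure (conv_power lawW l) B = measure (distr (uniform_measure M A) borel (\<lambda>\<omega>. m * W \<omega>)) B" by simp
  also have "\<dots> = measure (uniform_measure M A) {\<omega>\<in>space M. m * W \<omega> \<in> B}"
    using B Wm by (subst measure_distr) (auto simp: vimage_def Int_def conj_commute)
  also have "\<dots> = prob (A \<inter> {\<omega>\<in>space M. m * W \<omega> \<in> B}) / prob A"
    by (rule measure_uniform_measure[OF eA sets_mW[OF B]])
  also have "A \<inter> {\<omega>\<in>space M. m * W \<omega> \<in> B} = {\<omega>\<in>space M. Z 1 \<omega> = l \<and> m * W \<omega> \<in> B}" by (auto simp: A_def)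
  finally show ?thesis using pA0 by (simp add: pA)
qed

lemma prob_mW_sums:
  assumes B: "B \<in> sets borel"
  shows "(\<lambda>l. pmf p l * measure (conv_power lawW l) B) sums \<P>(\<omega> in M. m * W \<omega> \<in> B)"
proof -
  have mB: "{\<omega>\<in>space M. m * W \<omega> \<in> B} \<in> sets M"
    by (rule sets_mW[OF B])
  have "(\<lambda>l. prob {\<omega>\<in>{\<omega>\<in>space M. m * W \<omega> \<in> B}. Z 1 \<omega> = l} *\<^sub>R (1::real)) sums
      (\<integral>\<omega>. indicator {\<omega>\<in>space M. m * W \<omega> \<in> B} \<omega> *\<^sub>R 1 \<partial>M)"
    by (rule expectation_nat_sums[where B=1, OF _ mB]) auto
  moreover have "(\<integral>\<omega>. indicator {\<omega>\<in>space M. m * W \<omega> \<in> B} \<omega> *\<^sub>R (1::real) \<partial>M) = \<P>(\<omega> in M. m * W \<omega> \<in> B)"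
    by (subst integral_indicator_scaleR[OF mB]) simp
  moreover have "prob {\<omega>\<in>{\<omega>\<in>space M. m * W \<omega> \<in> B}. Z 1 \<omega> = l} *\<^sub>R 1 = pmf p l * measure (conv_power lawW l) B" for l
    using prob_mW_given_Z1[OF B, of l] by (simp add: conj_ac)
  ultimately show ?thesis by simp
qed

lemma dpgf_sums: "0 \<le> s \<Longrightarrow> s < 1 \<Longrightarrow> (\<lambda>l. pmf p l * (real l * s ^ (l - 1))) sums dpgf p (s::real)"
proof -
  assume s: "0 \<le> s" "s < 1"
  have "(\<lambda>k. diffs (pmf p) k * s ^ k) sums dpgf p s"
    using summable_sums[OF summable_norm_cancel[OF summable_norm_dpgf[of s p]]] s by (simp add: dpgf_def)
  then have "(\<lambda>k. pmf p (Suc k) * (real (Suc k) * s ^ (Suc k - 1))) sums dpgf p s"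
    by (simp add: diffs_def mult_ac)
  from sums_Suc[OF this] show ?thesis by simp
qed

text \<open>Keep only the case that exactly one child has a line of descent with a nonzero limit.
  Its weight, the sum of \<open>pmf p l * l * q ^ (l - 1)\<close>, is the derivative at
  \<open>q\<close>, that is \<open>m powr (- \<alpha>)\<close>.\<close>

lemma prob_mW_ge:
  assumes y: "0 < y"
  shows "m powr (- \<alpha>) * \<P>(\<omega> in M. y \<le> W \<omega> \<and> W \<omega> \<le> y + h) \<le>
    \<P>(\<omega> in M. y \<le> m * W \<omega> \<and> m * W \<omega> \<le> y + h)"
proof -
  let ?B = "{y..y + h}"
  interpret D: real_distribution lawW by (rule lawW)
  have mB: "measure lawW ?B = \<P>(\<omega> in M. y \<le> W \<omega> \<and> W \<omega> \<le> y + h)"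
    by (subst measure_distr) (auto simp: vimage_def Int_def conj_commute conj_ac)
  have m0: "measure lawW {0} = q"
  proof -
    have "W -` {0} \<inter> space M = {\<omega>\<in>space M. W \<omega> = 0}" by auto
    then show ?thesis using prob_W_0 by (subst measure_distr) auto
  qed
  have "dpgf p q * measure lawW ?B \<le> \<P>(\<omega> in M. m * W \<omega> \<in> ?B)"
  proof (rule sums_le[OF _ sums_mult2[OF dpgf_sums[OF q_bounds]] prob_mW_sums])
    fix l
    interpret \<nu>: real_distribution "conv_power lawW l" by (rule real_distribution_conv_power[OF lawW])
    have "ennreal (real l * q ^ (l - 1)) * emeasure lawW ?B \<le> emeasure (conv_power lawW l) ?B"
      using conv_power_ge(2)[OF lawW, of ?B l] y unfolding m0 by simp
    then have "ennreal (real l * q ^ (l - 1) * measure lawW ?B) \<le> ennreal (measure (conv_power lawW l) ?B)"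
      using q_bounds by (simp add: D.emeasure_eq_measure \<nu>.emeasure_eq_measure ennreal_mult)
    then have "real l * q ^ (l - 1) * measure lawW ?B \<le> measure (conv_power lawW l) ?B"
      by (subst (asm) ennreal_le_iff) auto
    then show "pmf p l * (real l * q ^ (l - 1)) * measure lawW ?B \<le> pmf p l * measure (conv_power lawW l) ?B"
      using mult_left_mono[of _ _ "pmf p l"] by (simp add: mult.assoc)
  qed simp
  then show ?thesis by (simp add: mB dpgf_q_eq)
qed

lemma prob_W_rescale:
  "\<P>(\<omega> in M. u \<le> W \<omega> \<and> W \<omega> \<le> u + h) = \<P>(\<omega> in M. u * m \<le> m * W \<omega> \<and> m * W \<omega> \<le> u * m + m * h)"
proof -
  have "(u * m \<le> m * W \<omega> \<and> m * W \<omega> \<le> u * m + m * h) \<longleftrightarrow> (u \<le> W \<omega> \<and> W \<omega> \<le> u + h)" for \<omega>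
  proof -
    have "u * m + m * h = m * (u + h)" "u * m = m * u" by (auto simp: algebra_simps)
    then show ?thesis using m_pos by (simp only: mult_le_cancel_left_pos)
  qed
  then show ?thesis by simp
qed

lemma density_rescale_ge:
  assumes u: "0 < u"
  shows "m powr (1 - \<alpha>) * w (m * u) \<le> w u"
proof -
  have mu: "0 < m * u" using u m_pos by simp
  have fl: "filterlim (\<lambda>h. m * h) (at_right 0) (at_right 0)"
    unfolding filterlim_at
  proof
    show "((\<lambda>h. m * h) \<longlongrightarrow> 0) (at_right 0)" by (rule tendsto_eq_intros | simp)+
    show "\<forall>\<^sub>F h in at_right 0. m * h \<in> {0<..} \<and> m * h \<noteq> 0"
      using eventually_at_right_less[of 0] by eventually_elim (use m_pos in auto)
  qed
  have L: "((\<lambda>h. m powr (1 - \<alpha>) * (\<P>(\<omega> in M. m * u \<le> W \<omega> \<and> W \<omega> \<le> m * u + m * h) / (m * h))) \<longlongrightarrow>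
     m powr (1 - \<alpha>) * w (m * u)) (at_right 0)"
    by (intro tendsto_mult[OF tendsto_const] filterlim_compose[OF density_ratio_tendsto[OF mu] fl])
  show ?thesis
  proof (rule tendsto_le[OF _ density_ratio_tendsto[OF u] L])
    show "\<forall>\<^sub>F h in at_right 0. m powr (1 - \<alpha>) * (\<P>(\<omega> in M. m * u \<le> W \<omega> \<and> W \<omega> \<le> m * u + m * h) / (m * h))
      \<le> \<P>(\<omega> in M. u \<le> W \<omega> \<and> W \<omega> \<le> u + h) / h"
      using eventually_at_right_less[of 0]
    proof eventually_elim
      case (elim h)
      have "m powr (1 - \<alpha>) * (\<P>(\<omega> in M. m * u \<le> W \<omega> \<and> W \<omega> \<le> m * u + m * h) / (m * h)) =
          m powr (- \<alpha>) * \<P>(\<omega> in M. m * u \<le> W \<omega> \<and> W \<omega> \<le> m * u + m * h) / h"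
        using m_pos by (simp add: powr_diff powr_minus field_simps)
      also have "\<dots> \<le> \<P>(\<omega> in M. m * u \<le> m * W \<omega> \<and> m * W \<omega> \<le> m * u + m * h) / h"
        using elim by (intro divide_right_mono prob_mW_ge mu) auto
      also have "\<dots> = \<P>(\<omega> in M. u \<le> W \<omega> \<and> W \<omega> \<le> u + h) / h"
        using prob_W_rescale[of u h] by (simp add: mult.commute)
      finally show ?case .
    qed
  qed (simp add: trivial_limit_at_right_real)
qed

lemma density_pow_rescale_ge: "0 < u \<Longrightarrow> (m ^ n) powr (1 - \<alpha>) * w (m ^ n * u) \<le> w u"
proof (induction n arbitrary: u)
  case (Suc n)
  have "(m ^ Suc n) powr (1 - \<alpha>) * w (m ^ Suc n * u) = m powr (1 - \<alpha>) * ((m ^ n) powr (1 - \<alpha>) * w (m ^ n * (m * u)))"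
    using m_pos by (simp add: powr_mult mult_ac)
  also have "\<dots> \<le> m powr (1 - \<alpha>) * w (m * u)" using Suc m_pos by (intro mult_left_mono) auto
  also have "\<dots> \<le> w u" by (rule density_rescale_ge[OF Suc.prems])
  finally show ?case .
qed simp

lemma w_locally_ge:
  assumes "0 < u" "0 < w u"
  shows "\<exists>d>0. d < u \<and> (\<forall>x. u - d \<le> x \<longrightarrow> x \<le> u + d \<longrightarrow> w u / 2 < w x)"
proof -
  have "isCont w u" using w_cont assms(1) by (simp add: continuous_on_eq_continuous_at)
  then have "\<forall>\<^sub>F x in nhds u. w u / 2 < w x"
    using order_tendstoD(1)[of w "w u" "nhds u" "w u / 2"] assms(2)
    by (simp add: isCont_def tendsto_at_iff_tendsto_nhds)
  then obtain e where e: "0 < e" "\<And>x. dist x u < e \<Longrightarrow> w u / 2 < w x"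
    by (auto simp: eventually_nhds_metric)
  show ?thesis
    using e assms(1) by (intro exI[of _ "min (e / 2) (u / 2)"]) (auto simp: dist_real_def)
qed

lemma dense_at_lawW:
  assumes u: "0 < u" "0 < w u"
  shows "dense_at lawW u"
proof -
  obtain d where d: "0 < d" "d < u" "\<And>x. u - d \<le> x \<Longrightarrow> x \<le> u + d \<Longrightarrow> w u / 2 < w x"
    using w_locally_ge[OF u] by blast
  interpret D: real_distribution lawW by (rule lawW)
  show ?thesis
    unfolding dense_at_def
  proof (rule exI[of _ "w u / 2"], rule conjI[rotated], rule exI[of _ d], intro conjI allI impI)
    fix s t assume st: "u - d \<le> s" "s \<le> t" "t \<le> u + d"
    have s0: "0 < s" using st d by linarith
    have "integral {s..t} (\<lambda>_. w u / 2) \<le> integral {s..t} w"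
      using prob_W_integral(2)[OF s0 st(2)] st d(3) by (intro integral_le) (auto intro: less_imp_le)
    then have "w u / 2 * (t - s) \<le> \<P>(\<omega> in M. s \<le> W \<omega> \<and> W \<omega> \<le> t)"
      using prob_W_integral(1)[OF s0 st(2)] st by (simp add: mult.commute)
    also have "\<dots> = measure lawW {s..t}"
      by (subst measure_distr) (auto simp: vimage_def Int_def conj_commute conj_ac)
    finally show "ennreal (w u / 2 * (t - s)) \<le> emeasure lawW {s..t}"
      by (simp add: D.emeasure_eq_measure ennreal_leI)
  qed (use u d in auto)
qed

text \<open>With positive probability there are \<open>l\<close> children, and the limits of their
  lines of descent may lie near the points \<open>u i\<close>; then \<open>m * W\<close> lies near
  the sum.\<close>

lemma w_pos_sum:
  assumes l: "0 < l" "pmf p l \<noteq> 0" and u: "\<And>i. i < l \<Longrightarrow> 0 < u i \<and> 0 < w (u i)"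
  shows "0 < w ((\<Sum>i<l. u i) / m)"
proof -
  define y where "y = (\<Sum>i<l. u i)"
  have y: "0 < y" unfolding y_def using u l by (intro sum_pos) auto
  interpret \<nu>: real_distribution "conv_power lawW l" by (rule real_distribution_conv_power[OF lawW])
  have "dense_at (conv_power lawW l) y"
    unfolding y_def using u l by (intro dense_at_conv_power[OF lawW] dense_at_lawW) auto
  then obtain c d where cd: "0 < c" "0 < d"
    "\<And>s t. y - d \<le> s \<Longrightarrow> s \<le> t \<Longrightarrow> t \<le> y + d \<Longrightarrow> ennreal (c * (t - s)) \<le> emeasure (conv_power lawW l) {s..t}"
    unfolding dense_at_def by blast
  have ym: "0 < y / m" using y m_pos by simp
  have "pmf p l * c * m \<le> w (y / m)"
  proof (rule density_ge[OF ym])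
    have "\<forall>\<^sub>F h in at_right 0. (0::real) < h \<and> h < d / m"
      using cd m_pos by (intro eventually_at_rightI[of 0 "d / m"]) auto
    then show "\<forall>\<^sub>F h in at_right 0. pmf p l * c * m * h \<le> \<P>(\<omega> in M. y / m \<le> W \<omega> \<and> W \<omega> \<le> y / m + h)"
    proof eventually_elim
      case (elim h)
      have "ennreal (c * ((y + m * h) - y)) \<le> emeasure (conv_power lawW l) {y..y + m * h}"
        using elim cd m_pos by (intro cd(3)) (auto simp: field_simps)
      then have "c * (m * h) \<le> measure (conv_power lawW l) {y..y + m * h}"
        unfolding \<nu>.emeasure_eq_measure by (subst (asm) ennreal_le_iff) auto
      then have "pmf p l * (c * (m * h)) \<le> pmf p l * measure (conv_power lawW l) {y..y + m * h}"
        by (intro mult_left_mono) auto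
      also have "\<dots> = \<P>(\<omega> in M. Z 1 \<omega> = l \<and> m * W \<omega> \<in> {y..y + m * h})"
        by (rule prob_mW_given_Z1[symmetric]) simp
      also have "\<dots> \<le> \<P>(\<omega> in M. y \<le> m * W \<omega> \<and> m * W \<omega> \<le> y + m * h)"
        by (rule finite_measure_mono) auto
      also have "\<dots> = \<P>(\<omega> in M. y / m \<le> W \<omega> \<and> W \<omega> \<le> y / m + h)"
        using prob_W_rescale[of "y / m" h] m_pos by simp
      finally show ?case by (simp add: mult_ac)
    qed
  qed
  moreover have "0 < pmf p l * c * m" using pmf_positive[of l p] l cd m_pos by (simp add: set_pmf_iff)
  ultimately show ?thesis by (simp add: y_def)
qed

lemma w_pos_pow_sum:
  assumes l: "0 < l" "pmf p l \<noteq> 0"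
  shows "(\<And>i. i < l ^ k \<Longrightarrow> 0 < u i \<and> 0 < w (u i)) \<Longrightarrow> 0 < w ((\<Sum>i<l ^ k. u i) / m ^ k)"
proof (induction k arbitrary: u)
  case (Suc k)
  \<comment> \<open>The summands are cut into \<open>l\<close> consecutive blocks of length
    \<open>l ^ k\<close>, one for each child.\<close>
  define v where "v j = (\<Sum>i<l ^ k. u (j * l ^ k + i)) / m ^ k" for j
  have idx: "j * l ^ k + i < l ^ Suc k" if "j < l" "i < l ^ k" for i j
  proof -
    have "j * l ^ k + i < j * l ^ k + l ^ k" using that by simp
    also have "\<dots> = Suc j * l ^ k" by simp
    also have "\<dots> \<le> l * l ^ k" using that by (intro mult_right_mono) auto
    finally show ?thesis by simp
  qed
  have v: "0 < v j \<and> 0 < w (v j)" if "j < l" for j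
  proof
    show "0 < w (v j)" unfolding v_def using idx[OF that] Suc.prems by (intro Suc.IH) auto
    have "{..<l ^ k} \<noteq> {}" using l(1) by (auto simp: lessThan_empty_iff)
    then show "0 < v j" unfolding v_def using idx[OF that] Suc.prems m_pos
      by (intro divide_pos_pos sum_pos) auto
  qed
  have "0 < w ((\<Sum>j<l. v j) / m)" by (rule w_pos_sum[OF l v])
  moreover have "(\<Sum>j<l. v j) / m = (\<Sum>i<l ^ Suc k. u i) / m ^ Suc k"
  proof -
    have "(\<Sum>i<l ^ k. u (j * l ^ k + i)) = sum u {j * l ^ k..<j * l ^ k + l ^ k}" for j
      using sum.shift_bounds_nat_ivl[of u 0 "j * l ^ k" "l ^ k"] by (simp add: lessThan_atLeast0 add.commute)
    then have "(\<Sum>j<l. v j) = (\<Sum>j<l. sum u {j * l ^ k..<j * l ^ k + l ^ k}) / m ^ k"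
      unfolding v_def by (simp only: sum_divide_distrib)
    also have "(\<Sum>j<l. sum u {j * l ^ k..<j * l ^ k + l ^ k}) = sum u {..<l * l ^ k}" by (rule sum.nat_group)
    finally show ?thesis by (simp add: mult.commute)
  qed
  ultimately show ?case by simp
qed simp

lemma ex_branching: "\<exists>l\<ge>2. pmf p l \<noteq> 0"
proof (rule ccontr)
  assume *: "\<not> (\<exists>l\<ge>2. pmf p l \<noteq> 0)"
  have "pmf p k * real k \<le> pmf p k" for k
  proof (cases "k \<ge> 2")
    case False
    then have "k = 0 \<or> k = 1" by auto
    then show ?thesis by auto
  qed (use * in auto)
  then have "m \<le> 1" by (rule sums_le[OF _ mean_sums pmf_nat_sums])
  then show False using m_gt_1 by simp
qed

lemma ex_w_pos: "\<exists>u>0. 0 < w u"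
proof (rule ccontr)
  assume "\<not> (\<exists>u>0. 0 < w u)"
  then have w0: "w u = 0" if "0 < u" for u using that w_nonneg[OF that] by force
  have "prob_W_le (real (Suc k)) = 0" for k
  proof -
    have zero: "\<P>(\<omega> in M. c \<le> W \<omega> \<and> W \<omega> \<le> d) = 0" if "0 < c" "c \<le> d" for c d
    proof -
      have "integral {c..d} w = integral {c..d} (\<lambda>_. 0)" using that w0 by (intro integral_cong) auto
      then show ?thesis using prob_W_integral(1)[OF that] by simp
    qed
    have "(\<lambda>n. \<P>(\<omega> in M. real (Suc k) / real (Suc n) \<le> W \<omega> \<and> W \<omega> \<le> real (Suc k))) = (\<lambda>n. 0)"
    proof (intro ext)
      fix n
      have "real (Suc k) / real (Suc n) \<le> real (Suc k) / 1" by (intro divide_left_mono) auto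
      then show "\<P>(\<omega> in M. real (Suc k) / real (Suc n) \<le> W \<omega> \<and> W \<omega> \<le> real (Suc k)) = 0"
        using zero[of "real (Suc k) / real (Suc n)" "real (Suc k)"]
        by (simp del: of_nat_Suc)
    qed
    then have "(\<lambda>n. 0) \<longlonglongrightarrow> prob_W_le (real (Suc k))"
      using prob_W_lower_tail_tendsto[of "real (Suc k)"] by (simp only:)
    then show ?thesis by (rule LIMSEQ_unique[OF _ tendsto_const])
  qed
  then have "AE \<omega> in M. \<not> (0 < W \<omega> \<and> W \<omega> \<le> real (Suc k))" for k
    by (subst prob_Collect_eq_0[symmetric]) auto
  then have "AE \<omega> in M. \<forall>k. \<not> (0 < W \<omega> \<and> W \<omega> \<le> real (Suc k))" by (simp only: AE_all_countable) simp
  then have "AE \<omega> in M. W \<omega> = 0"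
    using W_nonneg
  proof eventually_elim
    case (elim \<omega>)
    obtain k where "W \<omega> < real k" using reals_Archimedean2 by blast
    then have "W \<omega> \<le> real (Suc k)" by simp
    then show ?case using elim by force
  qed
  then have "q0 = 1" by (subst prob_Collect_eq_1) auto
  then show False using q0_less_1 by simp
qed

text \<open>The positivity set of w is closed under division by m and under l-fold sums divided by m;
  large sumsets of an interval together with its m-th part contain a full fundamental domain.\<close>

lemma w_pos_fundamental_domain: "\<exists>c>0. \<forall>y\<in>{c..c * m}. 0 < w y"
proof -
  obtain u0 where u0: "0 < u0" "0 < w u0" using ex_w_pos by blast
  obtain d where d: "0 < d" "d < u0" "\<And>x. u0 - d \<le> x \<Longrightarrow> x \<le> u0 + d \<Longrightarrow> w u0 / 2 < w x"
    using w_locally_ge[OF u0] by blast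
  define a b where "a = u0 - d" and "b = u0 + d"
  have ab: "0 < a" "a < b" using d by (auto simp: a_def b_def)
  have wab: "0 < w x" if "a \<le> x" "x \<le> b" for x using d(3)[of x] that u0 by (auto simp: a_def b_def)
  have wabm: "0 < w (x / m)" if "a \<le> x" "x \<le> b" for x
  proof -
    have "0 < m powr (1 - \<alpha>) * w (m * (x / m))" using wab[OF that] m_pos by simp
    also have "\<dots> \<le> w (x / m)" using that ab m_pos by (intro density_rescale_ge) auto
    finally show ?thesis .
  qed
  obtain l where l: "2 \<le> l" "pmf p l \<noteq> 0" using ex_branching by blast
  have l0: "0 < l" using l by simp
  \<comment> \<open>The number \<open>L\<close> of summands must be large for the ranges of the sums
    used below to overlap.\<close>
  obtain k where k: "m / (1 - a / b) < real l ^ k" using real_arch_pow[of "real l" "m / (1 - a / b)"] l by auto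
  define L where "L = l ^ k"
  have L: "m / (1 - a / b) < real L" using k by (simp add: L_def)
  have ab1: "0 < 1 - a / b" using ab by simp
  have L0: "0 < real L" using L ab1 m_pos by (meson divide_pos_pos less_trans)
  \<comment> \<open>The midpoint of \<open>a\<close> and \<open>b\<close> leaves strict room on both
    sides: after multiplication by \<open>m ^ k\<close> the whole domain lies strictly between
    \<open>L * a / m\<close> and \<open>L * b\<close>.\<close>
  define c where "c = real L * ((a + b) / 2) / m ^ Suc k"
  have c0: "0 < c" unfolding c_def using L0 ab m_pos by simp
  show ?thesis
  proof (intro exI[of _ c] conjI ballI c0)
    fix y assume y: "y \<in> {c..c * m}"
    define Y where "Y = y * m ^ k"
    have mk: "0 < m ^ k" using m_pos by simp
    have "c * m ^ k \<le> Y" "Y \<le> c * m * m ^ k" using y mk by (auto simp: Y_def)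
    moreover have "c * m ^ k = real L * ((a + b) / 2) / m" "c * m * m ^ k = real L * ((a + b) / 2)"
      using m_pos by (auto simp: c_def)
    moreover have "real L * a / m < real L * ((a + b) / 2) / m" "real L * ((a + b) / 2) < real L * b"
      using ab L0 m_pos by (auto intro!: divide_strict_right_mono mult_strict_left_mono simp del: times_divide_eq_right)
    ultimately have Y: "real L * a / m < Y" "Y < real L * b" by linarith+
    \<comment> \<open>If \<open>j\<close> of the \<open>L\<close> equal summands \<open>x\<close>
      are divided by \<open>m\<close>, the sum is \<open>\<kappa> j * x\<close>. As \<open>x\<close>
      runs through \<open>{a..b}\<close> and \<open>j\<close> from 0 to \<open>L\<close>, these
      ranges overlap and cover every required \<open>Y\<close>.\<close>
    define \<kappa> where "\<kappa> j = real (L - j) + real j / m" for j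
    have "\<kappa> L < Y / a" using Y(1) ab m_pos by (simp add: \<kappa>_def field_simps)
    define j where "j = (LEAST j. \<kappa> j < Y / a)"
    have j1: "\<kappa> j < Y / a" unfolding j_def by (rule LeastI[of _ L]) fact
    have jL: "j \<le> L" unfolding j_def by (rule Least_le) fact
    have j2: "Y / b < \<kappa> j"
    proof (cases j)
      case 0
      then show ?thesis using Y(2) ab by (simp add: \<kappa>_def field_simps)
    next
      case (Suc i)
      have "\<not> \<kappa> i < Y / a" unfolding j_def by (rule not_less_Least) (use Suc in \<open>simp add: j_def\<close>)
      then have "Y / a \<le> \<kappa> i" by simp
      moreover have "\<kappa> i - 1 \<le> \<kappa> j"
        using Suc jL m_pos by (simp add: \<kappa>_def of_nat_diff field_simps)
      moreover have "Y / b < Y / a - 1"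
      proof -
        have "1 < real L / m * (1 - a / b)" using L ab1 m_pos by (simp add: field_simps)
        also have "\<dots> = real L * a / m * ((1 - a / b) / a)" using ab by simp
        also have "\<dots> < Y * ((1 - a / b) / a)" using Y(1) ab1 ab by (intro mult_strict_right_mono) auto
        also have "\<dots> = Y / a - Y / b" using ab by (simp add: field_simps)
        finally show ?thesis by simp
      qed
      ultimately show ?thesis by linarith
    qed
    have Y0: "0 < Y" using Y(1) L0 ab m_pos by (meson divide_pos_pos less_trans mult_pos_pos)
    have \<kappa>0: "0 < \<kappa> j" using j2 Y0 ab by (meson divide_pos_pos less_trans)
    define x where "x = Y / \<kappa> j"
    have x: "a \<le> x" "x \<le> b" using j1 j2 \<kappa>0 ab by (auto simp: x_def field_simps)
    have x0: "0 < x" using x ab by simp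
    define u where "u i = (if i < j then x / m else x)" for i
    have "0 < w ((\<Sum>i<l ^ k. u i) / m ^ k)"
      by (rule w_pos_pow_sum[OF l0 l(2)]) (use wab[OF x] wabm[OF x] x0 m_pos in \<open>auto simp: u_def\<close>)
    moreover have "(\<Sum>i<l ^ k. u i) = Y"
    proof -
      have "(\<Sum>i<L. u i) = (\<Sum>i<j. u i) + (\<Sum>i\<in>{j..<L}. u i)"
        using jL by (simp add: lessThan_atLeast0 sum.atLeastLessThan_concat)
      also have "\<dots> = real j * (x / m) + real (L - j) * x" by (simp add: u_def)
      also have "\<dots> = \<kappa> j * x" by (simp add: \<kappa>_def algebra_simps)
      also have "\<dots> = Y" using \<kappa>0 by (simp add: x_def)
      finally show ?thesis by (simp add: L_def)
    qed
    ultimately show "0 < w y" using m_pos by (simp add: Y_def)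
  qed
qed

lemma density_lower_bound: "\<exists>C>0. \<exists>c>0. \<forall>u. 0 < u \<longrightarrow> u < c \<longrightarrow> C * u powr (\<alpha> - 1) \<le> w u"
proof -
  obtain c where c: "0 < c" "\<And>y. y \<in> {c..c * m} \<Longrightarrow> 0 < w y" using w_pos_fundamental_domain by blast
  have "compact {c..c * m}" by simp
  moreover have "{c..c * m} \<noteq> {}" using c(1) m_gt_1 by auto
  moreover have "continuous_on {c..c * m} w" by (rule continuous_on_subset[OF w_cont]) (use c in auto)
  ultimately obtain y0 where y0: "y0 \<in> {c..c * m}" "\<And>y. y \<in> {c..c * m} \<Longrightarrow> w y0 \<le> w y"
    using continuous_attains_inf[of "{c..c * m}" w] by blast
  define C where "C = w y0 * (c * m) powr (1 - \<alpha>)"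
  have C0: "0 < C" using c(2)[OF y0(1)] c(1) m_pos by (simp add: C_def)
  show ?thesis
  proof (rule exI[of _ C], rule conjI[OF C0], rule exI[of _ c], intro conjI allI impI c(1))
    fix u assume u: "0 < u" "u < c"
    obtain j where j: "m ^ j \<le> c / u" "c / u < m ^ Suc j" using ex_power_bracket[OF m_gt_1, of "c / u"] u by auto
    define n where "n = Suc j"
    have n: "c \<le> m ^ n * u" "m ^ n * u \<le> c * m" using j u m_pos by (auto simp: n_def field_simps)
    have "C * u powr (\<alpha> - 1) = (c * m / u) powr (1 - \<alpha>) * w y0"
      using u c(1) m_pos powr_minus_divide[of u "1 - \<alpha>"] by (simp add: C_def powr_divide)
    also have "\<dots> \<le> (m ^ n) powr (1 - \<alpha>) * w (m ^ n * u)"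
    proof (intro mult_mono y0(2))
      show "(c * m / u) powr (1 - \<alpha>) \<le> (m ^ n) powr (1 - \<alpha>)"
        using n u m_pos alpha_gt_1 by (intro powr_mono2') (auto simp: field_simps)
      show "0 \<le> w y0" using c(2)[OF y0(1)] by simp
    qed (use n in auto)
    also have "\<dots> \<le> w u" by (rule density_pow_rescale_ge[OF u(1)])
    finally show "C * u powr (\<alpha> - 1) \<le> w u" .
  qed
qed

end

section \<open>Truncated and negative moments\<close>

text \<open>The substitution \<open>t = x\<^sup>2 / 2\<close> leads to the Gamma integral. It is
  carried out on bounded intervals and followed by monotone convergence.\<close>

lemma gaussian_positive_moment:
  fixes \<alpha> :: real
  assumes \<alpha>: "0 < \<alpha>"
  shows "(\<integral>\<^sup>+x. ennreal (indicator {0..} x * x powr (2 * \<alpha>) * exp (- x\<^sup>2 / 2)) \<partial>lborel)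
    = ennreal (2 powr (\<alpha> - 1/2) * Gamma (\<alpha> + 1/2))"
proof -
  define f where "f t = t powr (\<alpha> - 1/2) / exp t" for t :: real
  have fm [measurable]: "f \<in> borel_measurable borel" unfolding f_def by measurable
  have f0: "0 \<le> f t" for t by (simp add: f_def)
  have sub: "(\<integral>\<^sup>+t. ennreal (f t * indicator {0..(real n)\<^sup>2 / 2} t) \<partial>lborel) =
      (\<integral>\<^sup>+x. ennreal (f (x\<^sup>2 / 2) * x * indicator {0..real n} x) \<partial>lborel)" for n
  proof -
    have "((\<lambda>x::real. x\<^sup>2 / 2) has_real_derivative x) (at x)" for x
      by (auto intro!: derivative_eq_intros)
    then show ?thesis
      using nn_integral_substitution[where g="\<lambda>x::real. x\<^sup>2 / 2" and g'="\<lambda>x. x" and a=0 and b="real n" and f=f]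
      by (simp add: set_borel_measurable_def)
  qed
  have "(\<lambda>n. \<integral>\<^sup>+t. ennreal (f t * indicator {0..(real n)\<^sup>2 / 2} t) \<partial>lborel) \<longlonglongrightarrow>
      (\<integral>\<^sup>+t. ennreal (f t * indicator {0..} t) \<partial>lborel)"
  proof (rule nn_integral_LIMSEQ)
    show "incseq (\<lambda>n t. ennreal (f t * indicator {0..(real n)\<^sup>2 / 2} t))"
    proof (intro incseq_SucI le_funI ennreal_leI mult_left_mono f0)
      fix n and t :: real
      have "(real n)\<^sup>2 / 2 \<le> (real (Suc n))\<^sup>2 / 2" by (intro divide_right_mono power_mono) auto
      then have "{0..(real n)\<^sup>2 / 2} \<subseteq> {0..(real (Suc n))\<^sup>2 / 2}" by auto
      then show "indicator {0..(real n)\<^sup>2 / 2} t \<le> (indicator {0..(real (Suc n))\<^sup>2 / 2} t :: real)"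
        by (auto simp only: indicator_def of_bool_less_eq_iff)
    qed
    fix t :: real
    have "\<forall>\<^sub>F n in sequentially. ennreal (f t * indicator {0..(real n)\<^sup>2 / 2} t) = ennreal (f t * indicator {0..} t)"
    proof -
      obtain N :: nat where N: "2 * \<bar>t\<bar> + 1 \<le> real N" using real_arch_simple by blast
      have le: "t \<le> (real n)\<^sup>2 / 2" if "N \<le> n" for n
      proof -
        have "2 * \<bar>t\<bar> + 1 \<le> real n" using N that by linarith
        then have "(2 * \<bar>t\<bar> + 1) * 1 \<le> real n * real n" by (intro mult_mono) auto
        then show ?thesis by (auto simp: power2_eq_square)
      qed
      show ?thesis using eventually_ge_at_top[of N]
      proof eventually_elim
        case (elim n)
        then show ?case using le[OF elim] by (simp add: indicator_def)
      qed
    qed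
    then show "(\<lambda>n. ennreal (f t * indicator {0..(real n)\<^sup>2 / 2} t)) \<longlonglongrightarrow> ennreal (f t * indicator {0..} t)"
      by (rule tendsto_eventually)
  qed measurable
  moreover have "(\<lambda>n. \<integral>\<^sup>+x. ennreal (f (x\<^sup>2 / 2) * x * indicator {0..real n} x) \<partial>lborel) \<longlonglongrightarrow>
      (\<integral>\<^sup>+x. ennreal (f (x\<^sup>2 / 2) * x * indicator {0..} x) \<partial>lborel)"
  proof (rule nn_integral_LIMSEQ)
    show "incseq (\<lambda>n x. ennreal (f (x\<^sup>2 / 2) * x * indicator {0..real n} x))"
      by (intro incseq_SucI le_funI ennreal_leI) (auto simp: indicator_def f0)
    fix x :: real
    have "\<forall>\<^sub>F n in sequentially. ennreal (f (x\<^sup>2 / 2) * x * indicator {0..real n} x) = ennreal (f (x\<^sup>2 / 2) * x * indicator {0..} x)"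
    proof -
      obtain N :: nat where N: "x \<le> real N" using real_arch_simple by blast
      show ?thesis using eventually_ge_at_top[of N]
      proof eventually_elim
        case (elim n)
        then have "x \<le> real n" using N by linarith
        then show ?case by (simp add: indicator_def)
      qed
    qed
    then show "(\<lambda>n. ennreal (f (x\<^sup>2 / 2) * x * indicator {0..real n} x)) \<longlonglongrightarrow> ennreal (f (x\<^sup>2 / 2) * x * indicator {0..} x)"
      by (rule tendsto_eventually)
  qed measurable
  ultimately have eq: "(\<integral>\<^sup>+t. ennreal (f t * indicator {0..} t) \<partial>lborel) = (\<integral>\<^sup>+x. ennreal (f (x\<^sup>2 / 2) * x * indicator {0..} x) \<partial>lborel)"
    unfolding sub by (rule LIMSEQ_unique)
  have "(f has_integral Gamma (\<alpha> + 1/2)) {0..}"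
    using Gamma_integral_real[of "\<alpha> + 1/2"] \<alpha> unfolding f_def by (simp add: algebra_simps)
  then have "((\<lambda>t. if t \<in> {0..} then f t else 0) has_integral Gamma (\<alpha> + 1/2)) UNIV"
    by (simp only: has_integral_restrict_UNIV)
  also have "(\<lambda>t. if t \<in> {0..} then f t else 0) = (\<lambda>t. indicator {0..} t * f t)" by (auto simp: fun_eq_iff)
  finally have "(\<integral>\<^sup>+t. ennreal (indicator {0..} t * f t) \<partial>lborel) = ennreal (Gamma (\<alpha> + 1/2))"
    by (rule nn_integral_has_integral_lborel[rotated 2]) (use f0 in auto)
  then have G: "(\<integral>\<^sup>+x. ennreal (f (x\<^sup>2 / 2) * x * indicator {0..} x) \<partial>lborel) = ennreal (Gamma (\<alpha> + 1/2))"
    using eq by (simp add: mult.commute)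
  have pt: "indicator {0..} x * x powr (2 * \<alpha>) * exp (- x\<^sup>2 / 2) =
      2 powr (\<alpha> - 1/2) * (f (x\<^sup>2 / 2) * x * indicator {0..} x)" for x :: real
  proof (cases "0 < x")
    case True
    have x2: "x\<^sup>2 = x powr 2" using True by (simp add: powr_numeral)
    have "(x\<^sup>2 / 2) powr (\<alpha> - 1/2) = x powr (2 * \<alpha> - 1) / 2 powr (\<alpha> - 1/2)"
      unfolding x2 by (simp add: powr_divide powr_powr right_diff_distrib del: powr_numeral)
    moreover have "x powr (2 * \<alpha> - 1) * x = x powr (2 * \<alpha>)"
      using True powr_add[of x "2 * \<alpha> - 1" 1] by simp
    ultimately show ?thesis using True by (simp add: f_def exp_minus field_simps)
  next
    case False
    then show ?thesis using \<alpha> by (cases "x = 0") (auto simp: f_def)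
  qed
  have "(\<integral>\<^sup>+x. ennreal (indicator {0..} x * x powr (2 * \<alpha>) * exp (- x\<^sup>2 / 2)) \<partial>lborel) =
      (\<integral>\<^sup>+x. ennreal (2 powr (\<alpha> - 1/2)) * ennreal (f (x\<^sup>2 / 2) * x * indicator {0..} x) \<partial>lborel)"
    unfolding pt by (intro nn_integral_cong ennreal_mult) (auto simp: f0 indicator_def)
  also have "\<dots> = ennreal (2 powr (\<alpha> - 1/2)) * ennreal (Gamma (\<alpha> + 1/2))"
    unfolding G[symmetric] by (intro nn_integral_cmult) measurable
  also have "\<dots> = ennreal (2 powr (\<alpha> - 1/2) * Gamma (\<alpha> + 1/2))"
    using \<alpha> by (intro ennreal_mult[symmetric]) (auto intro!: Gamma_real_nonneg)
  finally show ?thesis .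
qed

text \<open>The negative half line appears because the tail of the walk is a normal distribution
  function at a negative argument; a reflection reduces it to the positive one.\<close>

lemma gaussian_half_moment:
  fixes \<alpha> s :: real
  assumes \<alpha>: "0 < \<alpha>" and s: "0 < s"
  shows "integrable std_normal_distribution (\<lambda>x. indicator {..0} x * (s * x\<^sup>2) powr \<alpha>)" (is ?int)
    and "(\<integral>x. indicator {..0} x * (s * x\<^sup>2) powr \<alpha> \<partial>std_normal_distribution)
      = 2 powr (\<alpha> - 1) * Gamma (\<alpha> + 1/2) / sqrt pi * s powr \<alpha>" (is ?eq)
proof -
  let ?c = "2 powr (\<alpha> - 1) * Gamma (\<alpha> + 1/2) / sqrt pi * s powr \<alpha>"
  have c0: "0 \<le> ?c" using \<alpha> by (intro mult_nonneg_nonneg divide_nonneg_nonneg) (auto intro!: Gamma_real_nonneg)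
  let ?h = "\<lambda>x::real. indicator {..0} x * (s * x\<^sup>2) powr \<alpha> :: real"
  let ?g = "\<lambda>x::real. indicator {0..} x * x powr (2 * \<alpha>) * exp (- x\<^sup>2 / 2) :: real"
  have "(\<integral>\<^sup>+x. ennreal (?h x) \<partial>std_normal_distribution) = (\<integral>\<^sup>+x. ennreal (normal_density 0 1 x) * ennreal (?h x) \<partial>lborel)"
    by (subst nn_integral_density) auto
  also have "\<dots> = (\<integral>\<^sup>+x. ennreal (normal_density 0 1 (0 + (-1) * x)) * ennreal (?h (0 + (-1) * x)) \<partial>lborel)"
    by (subst nn_integral_real_affine[where c="-1" and t=0]) auto
  also have "\<dots> = (\<integral>\<^sup>+x. ennreal (s powr \<alpha> / sqrt (2 * pi)) * ennreal (?g x) \<partial>lborel)"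
  proof (intro nn_integral_cong)
    fix x :: real
    have "normal_density 0 1 (0 + (-1) * x) * ?h (0 + (-1) * x) = s powr \<alpha> / sqrt (2 * pi) * ?g x"
    proof (cases "0 < x")
      case True
      have x2: "x\<^sup>2 = x powr 2" using True by (simp add: powr_numeral)
      have "(s * x\<^sup>2) powr \<alpha> = s powr \<alpha> * x powr (2 * \<alpha>)"
        unfolding x2 by (simp add: powr_mult powr_powr del: powr_numeral)
      then show ?thesis using True by (simp add: normal_density_def field_simps)
    next
      case False
      then show ?thesis using \<alpha> by (cases "x = 0") (auto simp: indicator_def)
    qed
    then show "ennreal (normal_density 0 1 (0 + (-1) * x)) * ennreal (?h (0 + (-1) * x)) =
        ennreal (s powr \<alpha> / sqrt (2 * pi)) * ennreal (?g x)"
      by (simp only: ennreal_mult[symmetric] normal_density_nonneg mult_nonneg_nonneg indicator_pos_le powr_ge_zero exp_ge_zero divide_nonneg_nonneg real_sqrt_ge_0_iff mult_nonneg_nonneg pi_ge_zero zero_le_numeral)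
  qed
  also have "\<dots> = ennreal (s powr \<alpha> / sqrt (2 * pi)) * ennreal (2 powr (\<alpha> - 1/2) * Gamma (\<alpha> + 1/2))"
    unfolding gaussian_positive_moment[OF \<alpha>, symmetric] by (intro nn_integral_cmult) measurable
  also have "\<dots> = ennreal (s powr \<alpha> / sqrt (2 * pi) * (2 powr (\<alpha> - 1/2) * Gamma (\<alpha> + 1/2)))"
    using \<alpha> by (intro ennreal_mult[symmetric]) (auto intro!: mult_nonneg_nonneg Gamma_real_nonneg)
  also have "s powr \<alpha> / sqrt (2 * pi) * (2 powr (\<alpha> - 1/2) * Gamma (\<alpha> + 1/2)) = ?c"
  proof -
    have "(2::real) powr (\<alpha> - 1/2) = 2 powr (\<alpha> - 1) * sqrt 2"
      using powr_add[of "2::real" "\<alpha> - 1" "1/2"] by (simp add: powr_half_sqrt)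
    then show ?thesis by (simp add: real_sqrt_mult)
  qed
  finally have nn: "(\<integral>\<^sup>+x. ennreal (?h x) \<partial>std_normal_distribution) = ennreal ?c" .
  show ?int
    by (rule integrableI_nonneg) (auto simp: nn)
  show ?eq
    using c0 nn by (intro integral_eq_nn_integral[THEN trans]) auto
qed

section \<open>Moments of the population and of its limit\<close>

context gw_limit
begin

text \<open>A layer estimate: \<open>f\<close> is dominated by the sum of the constants
  \<open>c i\<close> over the layers of \<open>k\<close> up to \<open>b i\<close>, and each layer
  has probability of order \<open>(b i / m ^ n) powr \<alpha>\<close>.\<close>

lemma dyadic_moment_bound:
  assumes f: "\<And>k. 0 < k \<Longrightarrow> 0 \<le> f k" and cov: "\<And>k. 0 < k \<Longrightarrow> f k \<noteq> 0 \<Longrightarrow> \<exists>i. f k \<le> c i \<and> real k \<le> b i"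
    and c: "\<And>i. 0 \<le> c i" and b: "\<And>i. 0 < b i" and sm: "summable (\<lambda>i. c i * b i powr \<alpha>)"
    and C: "0 < C" "\<And>n x. 0 < x \<Longrightarrow> prob_Z_le n x \<le> C * (x / m ^ n) powr \<alpha>"
    and bd: "\<And>k. 0 < k \<Longrightarrow> f k \<le> B"
  shows "expectation (\<lambda>\<omega>. if Z n \<omega> = 0 then 0 else f (Z n \<omega>)) \<le> C * (\<Sum>i. c i * b i powr \<alpha>) * m powr (- \<alpha> * real n)"
proof -
  let ?F = "\<lambda>\<omega>. if Z n \<omega> = 0 then 0 else f (Z n \<omega>)"
  have F0: "0 \<le> ?F \<omega>" for \<omega> using f by auto
  have int: "integrable M ?F"
    by (rule integrable_const_bound[where B="max 0 B"]) (use f bd in \<open>auto simp: le_max_iff_disj\<close>)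
  let ?E = "\<lambda>i. {\<omega>\<in>space M. 0 < Z n \<omega> \<and> real (Z n \<omega>) \<le> b i}"
  have pt: "ennreal (?F \<omega>) \<le> (\<Sum>i. ennreal (c i) * indicator (?E i) \<omega>)" if w: "\<omega> \<in> space M" for \<omega>
  proof (cases "?F \<omega> = 0")
    case False
    then have z: "0 < Z n \<omega>" "f (Z n \<omega>) \<noteq> 0" by (auto split: if_splits)
    obtain i where i: "f (Z n \<omega>) \<le> c i" "real (Z n \<omega>) \<le> b i" using cov[OF z] by blast
    define g where "g i = ennreal (c i) * indicator (?E i) \<omega>" for i
    have "ennreal (?F \<omega>) \<le> g i" using i z w by (simp add: g_def ennreal_leI)
    also have "g i = (\<Sum>j\<in>{i}. g j)" by simp
    also have "\<dots> \<le> suminf g" by (intro sum_le_suminf) auto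
    finally show ?thesis by (simp only: g_def[abs_def])
  next
    case True
    then show ?thesis by (simp only: ennreal_0 zero_le)
  qed
  have mb: "(b i / m ^ n) powr \<alpha> = b i powr \<alpha> * m powr (- \<alpha> * real n)" for i
    using b[of i] m_pos by (simp add: powr_divide powr_realpow[symmetric] powr_powr powr_minus_divide mult.commute)
  have "ennreal (expectation ?F) = (\<integral>\<^sup>+\<omega>. ennreal (?F \<omega>) \<partial>M)"
    by (rule nn_integral_eq_integral[symmetric, OF int]) (use F0 in auto)
  also have "\<dots> \<le> (\<integral>\<^sup>+\<omega>. (\<Sum>i. ennreal (c i) * indicator (?E i) \<omega>) \<partial>M)" by (intro nn_integral_mono pt)
  also have "\<dots> = (\<Sum>i. \<integral>\<^sup>+\<omega>. ennreal (c i) * indicator (?E i) \<omega> \<partial>M)" by (intro nn_integral_suminf) measurable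
  also have "\<dots> = (\<Sum>i. ennreal (c i) * emeasure M (?E i))"
    by (intro suminf_cong nn_integral_cmult_indicator) measurable
  also have "\<dots> \<le> (\<Sum>i. ennreal (C * m powr (- \<alpha> * real n) * (c i * b i powr \<alpha>)))"
  proof (intro suminf_le)
    fix i
    have "c i * prob (?E i) \<le> c i * (C * (b i powr \<alpha> * m powr (- \<alpha> * real n)))"
      unfolding mb[symmetric] by (intro mult_left_mono C(2) b c)
    then show "ennreal (c i) * emeasure M (?E i) \<le> ennreal (C * m powr (- \<alpha> * real n) * (c i * b i powr \<alpha>))"
      using c[of i] by (simp add: emeasure_eq_measure ennreal_mult[symmetric] ennreal_leI mult_ac)
  qed auto
  also have "\<dots> = ennreal (\<Sum>i. C * m powr (- \<alpha> * real n) * (c i * b i powr \<alpha>))"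
    using C(1) c by (intro suminf_ennreal2 summable_mult sm) auto
  also have "(\<Sum>i. C * m powr (- \<alpha> * real n) * (c i * b i powr \<alpha>)) = C * (\<Sum>i. c i * b i powr \<alpha>) * m powr (- \<alpha> * real n)"
    by (subst suminf_mult[OF sm]) (simp add: mult_ac)
  finally show ?thesis
    using C(1) c sm by (subst (asm) ennreal_le_iff) (auto intro!: mult_nonneg_nonneg suminf_nonneg)
qed

text \<open>Layers descend from \<open>x\<close> by factors of 2. The geometric series converges
  because \<open>\<beta> < \<alpha>\<close>, so the top layer dominates.\<close>

lemma small_Z_moment_bound:
  assumes \<beta>: "0 < \<beta>" "\<beta> < \<alpha>"
  shows "\<exists>C>0. \<forall>n x. 0 < x \<longrightarrow> expectation (\<lambda>\<omega>. if Z n \<omega> = 0 then 0 else if real (Z n \<omega>) \<le> x then real (Z n \<omega>) powr (- \<beta>) else 0)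
    \<le> C * x powr (\<alpha> - \<beta>) * m powr (- \<alpha> * real n)"
proof -
  obtain C where C: "0 < C" "\<And>n x. 0 < x \<Longrightarrow> prob_Z_le n x \<le> C * (x / m ^ n) powr \<alpha>"
    using small_Z_bound by blast
  define r where "r = 2 powr (- (\<alpha> - \<beta>))"
  have r: "0 < r" "r < 1" using \<beta> powr_less_mono[of "- (\<alpha> - \<beta>)" 0 "2::real"] by (auto simp: r_def)
  define S where "S = (\<Sum>i. r ^ i)"
  have S: "0 < S" unfolding S_def using r by (subst suminf_geometric) auto
  show ?thesis
  proof (intro exI[of _ "C * (2 powr \<beta> * S)"] conjI allI impI)
    fix n and x :: real assume x: "0 < x"
    let ?c = "\<lambda>i::nat. (x / 2 ^ Suc i) powr (- \<beta>)" and ?b = "\<lambda>i::nat. x / 2 ^ i"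
    have cb: "?c i * ?b i powr \<alpha> = 2 powr \<beta> * x powr (\<alpha> - \<beta>) * r ^ i" for i
    proof -
      have p2: "(2::real) ^ i = 2 powr (real i)" "(2::real) ^ Suc i = 2 powr (real i + 1)"
        by (simp_all add: powr_realpow powr_add)
      have ri: "r ^ i = 2 powr (- (\<alpha> - \<beta>) * real i)" by (simp add: r_def powr_powr powr_realpow[symmetric])
      show ?thesis unfolding p2 ri using x
        by (simp add: powr_divide powr_powr powr_diff[symmetric] powr_add[symmetric] powr_minus_divide divide_simps)
           (simp add: powr_add[symmetric] powr_minus powr_diff field_simps)
    qed
    have sm: "summable (\<lambda>i. ?c i * ?b i powr \<alpha>)"
      unfolding cb using r by (intro summable_mult summable_geometric) auto
    have sum: "(\<Sum>i. ?c i * ?b i powr \<alpha>) = 2 powr \<beta> * x powr (\<alpha> - \<beta>) * S"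
      unfolding cb S_def using r by (intro suminf_mult summable_geometric) auto
    let ?f = "\<lambda>k::nat. if real k \<le> x then real k powr (- \<beta>) else 0"
    have "expectation (\<lambda>\<omega>. if Z n \<omega> = 0 then 0 else ?f (Z n \<omega>)) \<le> C * (\<Sum>i. ?c i * ?b i powr \<alpha>) * m powr (- \<alpha> * real n)"
    proof (rule dyadic_moment_bound[OF _ _ _ _ sm C, where B=1])
      fix k :: nat assume k: "0 < k"
      show "?f k \<le> 1" using k \<beta> by (auto simp: powr_le_one_le powr_minus_divide ge_one_powr_ge_zero divide_le_eq_1)
      assume "?f k \<noteq> 0"
      then have kx: "real k \<le> x" by (auto split: if_splits)
      then obtain i where i: "2 ^ i \<le> x / real k" "x / real k < 2 ^ Suc i"
        using ex_power_bracket[of 2 "x / real k"] k by auto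
      have "real k \<le> ?b i" using i(1) k by (simp add: field_simps)
      moreover have "x / 2 ^ Suc i \<le> real k" using i(2) k by (simp add: field_simps)
      then have "real k powr (- \<beta>) \<le> ?c i" using x \<beta> by (intro powr_mono2') auto
      ultimately show "\<exists>i. ?f k \<le> ?c i \<and> real k \<le> ?b i" using kx by auto
    qed (use x in auto)
    then show "expectation (\<lambda>\<omega>. if Z n \<omega> = 0 then 0 else ?f (Z n \<omega>)) \<le> C * (2 powr \<beta> * S) * x powr (\<alpha> - \<beta>) * m powr (- \<alpha> * real n)"
      unfolding sum by (simp add: mult_ac)
  qed (use C S in auto)
qed

text \<open>Layers ascend from \<open>y\<close>; with \<open>L > \<alpha>\<close> the lowest one
  dominates. This serves the Fuk-Nagaev term, with \<open>L = 1 / \<eta>\<close>.\<close>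

lemma large_Z_moment_bound:
  assumes L: "\<alpha> < L"
  shows "\<exists>C>0. \<forall>n y. 0 < y \<longrightarrow> expectation (\<lambda>\<omega>. if Z n \<omega> = 0 then 0 else if y < real (Z n \<omega>) then real (Z n \<omega>) powr (- L) else 0)
    \<le> C * y powr (\<alpha> - L) * m powr (- \<alpha> * real n)"
proof -
  obtain C where C: "0 < C" "\<And>n x. 0 < x \<Longrightarrow> prob_Z_le n x \<le> C * (x / m ^ n) powr \<alpha>"
    using small_Z_bound by blast
  define r where "r = 2 powr (- (L - \<alpha>))"
  have r: "0 < r" "r < 1" using L powr_less_mono[of "- (L - \<alpha>)" 0 "2::real"] by (auto simp: r_def)
  define S where "S = (\<Sum>i. r ^ i)"
  have S: "0 < S" unfolding S_def using r by (subst suminf_geometric) auto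
  show ?thesis
  proof (intro exI[of _ "C * (2 powr \<alpha> * S)"] conjI allI impI)
    fix n and y :: real assume y: "0 < y"
    let ?c = "\<lambda>i::nat. (y * 2 ^ i) powr (- L)" and ?b = "\<lambda>i::nat. y * 2 ^ Suc i"
    have cb: "?c i * ?b i powr \<alpha> = 2 powr \<alpha> * y powr (\<alpha> - L) * r ^ i" for i
    proof -
      have p2: "(2::real) ^ i = 2 powr (real i)" "(2::real) ^ Suc i = 2 powr (real i + 1)"
        by (simp_all add: powr_realpow powr_add)
      have ri: "r ^ i = 2 powr (- (L - \<alpha>) * real i)" by (simp add: r_def powr_powr powr_realpow[symmetric])
      show ?thesis unfolding p2 ri using y
        by (simp add: powr_mult powr_powr powr_add[symmetric] mult_ac)
           (simp add: powr_add[symmetric] powr_minus powr_diff field_simps)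
    qed
    have sm: "summable (\<lambda>i. ?c i * ?b i powr \<alpha>)"
      unfolding cb using r by (intro summable_mult summable_geometric) auto
    have sum: "(\<Sum>i. ?c i * ?b i powr \<alpha>) = 2 powr \<alpha> * y powr (\<alpha> - L) * S"
      unfolding cb S_def using r by (intro suminf_mult summable_geometric) auto
    let ?f = "\<lambda>k::nat. if y < real k then real k powr (- L) else 0"
    have "expectation (\<lambda>\<omega>. if Z n \<omega> = 0 then 0 else ?f (Z n \<omega>)) \<le> C * (\<Sum>i. ?c i * ?b i powr \<alpha>) * m powr (- \<alpha> * real n)"
    proof (rule dyadic_moment_bound[OF _ _ _ _ sm C, where B=1])
      fix k :: nat assume k: "0 < k"
      show "?f k \<le> 1" using k L alpha_gt_1 by (auto simp: powr_minus_divide ge_one_powr_ge_zero divide_le_eq_1)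
      assume "?f k \<noteq> 0"
      then have ky: "y < real k" by (auto split: if_splits)
      then obtain i where i: "2 ^ i \<le> real k / y" "real k / y < 2 ^ Suc i"
        using ex_power_bracket[of 2 "real k / y"] y by auto
      have "real k \<le> ?b i" using i(2) y by (simp add: field_simps)
      moreover have "y * 2 ^ i \<le> real k" using i(1) y by (simp add: field_simps)
      then have "real k powr (- L) \<le> ?c i" using y L alpha_gt_1 by (intro powr_mono2') auto
      ultimately show "\<exists>i. ?f k \<le> ?c i \<and> real k \<le> ?b i" using ky by auto
    qed (use y in auto)
    then show "expectation (\<lambda>\<omega>. if Z n \<omega> = 0 then 0 else ?f (Z n \<omega>)) \<le> C * (2 powr \<alpha> * S) * y powr (\<alpha> - L) * m powr (- \<alpha> * real n)"
      unfolding sum by (simp add: mult_ac)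
  qed (use C S in auto)
qed

text \<open>Split at \<open>m ^ n\<close>: below it \<open>small_Z_moment_bound\<close> applies,
  above it the integrand is at most \<open>(m ^ n) powr (- \<beta>)\<close>. Both parts have the
  same order.\<close>

lemma Z_neg_moment_bound:
  assumes \<beta>: "0 < \<beta>" "\<beta> < \<alpha>"
  shows "\<exists>C>0. \<forall>n. expectation (\<lambda>\<omega>. if Z n \<omega> = 0 then 0 else real (Z n \<omega>) powr (- \<beta>)) \<le> C * m powr (- \<beta> * real n)"
proof -
  obtain C where C: "0 < C" "\<And>n x. 0 < x \<Longrightarrow> expectation (\<lambda>\<omega>. if Z n \<omega> = 0 then 0 else if real (Z n \<omega>) \<le> x then real (Z n \<omega>) powr (- \<beta>) else 0)
    \<le> C * x powr (\<alpha> - \<beta>) * m powr (- \<alpha> * real n)"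
    using small_Z_moment_bound[OF \<beta>] by blast
  show ?thesis
  proof (intro exI[of _ "C + 1"] conjI allI)
    fix n
    have b1: "real k powr (- \<beta>) \<le> 1" if "0 < k" for k :: nat
      using that \<beta> by (auto simp: powr_minus_divide ge_one_powr_ge_zero divide_le_eq_1)
    have mn: "m powr (- \<beta> * real n) = (m ^ n) powr (- \<beta>)"
      using m_pos by (simp add: powr_realpow[symmetric] powr_powr mult.commute)
    have "expectation (\<lambda>\<omega>. if Z n \<omega> = 0 then 0 else real (Z n \<omega>) powr (- \<beta>)) \<le>
      expectation (\<lambda>\<omega>. (if Z n \<omega> = 0 then 0 else if real (Z n \<omega>) \<le> m ^ n then real (Z n \<omega>) powr (- \<beta>) else 0) + m powr (- \<beta> * real n))"
    proof (rule integral_mono)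
      show "integrable M (\<lambda>\<omega>. if Z n \<omega> = 0 then 0 else real (Z n \<omega>) powr (- \<beta>))"
        by (rule integrable_const_bound[where B=1]) (use b1 in auto)
      show "integrable M (\<lambda>\<omega>. (if Z n \<omega> = 0 then 0 else if real (Z n \<omega>) \<le> m ^ n then real (Z n \<omega>) powr (- \<beta>) else 0) + m powr (- \<beta> * real n))"
        by (intro Bochner_Integration.integrable_add[OF integrable_const_bound[where B=1] integrable_const]) (use b1 in auto)
      fix \<omega>
      show "(if Z n \<omega> = 0 then 0 else real (Z n \<omega>) powr (- \<beta>)) \<le>
        (if Z n \<omega> = 0 then 0 else if real (Z n \<omega>) \<le> m ^ n then real (Z n \<omega>) powr (- \<beta>) else 0) + m powr (- \<beta> * real n)"
        unfolding mn using \<beta> m_pos by (auto intro!: powr_mono2')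
    qed
    also have "\<dots> = expectation (\<lambda>\<omega>. if Z n \<omega> = 0 then 0 else if real (Z n \<omega>) \<le> m ^ n then real (Z n \<omega>) powr (- \<beta>) else 0) + m powr (- \<beta> * real n)"
      by (subst Bochner_Integration.integral_add)
         (use b1 in \<open>auto intro!: integrable_const_bound[where B=1] simp: prob_space\<close>)
    also have "\<dots> \<le> C * (m ^ n) powr (\<alpha> - \<beta>) * m powr (- \<alpha> * real n) + m powr (- \<beta> * real n)"
      using C(2)[of "m ^ n" n] m_pos by simp
    also have "C * (m ^ n) powr (\<alpha> - \<beta>) * m powr (- \<alpha> * real n) = C * m powr (- \<beta> * real n)"
      using m_pos by (simp add: powr_realpow[symmetric] powr_powr powr_add[symmetric] mult.assoc) (simp add: algebra_simps)
    finally show "expectation (\<lambda>\<omega>. if Z n \<omega> = 0 then 0 else real (Z n \<omega>) powr (- \<beta>)) \<le> (C + 1) * m powr (- \<beta> * real n)"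
      by (simp add: algebra_simps)
  qed (use C in simp)
qed

lemma laplace_power_integral:
  assumes "0 < \<beta>" "0 < x"
  shows "(\<integral>\<^sup>+v. ennreal (indicator {0<..} v * (exp (- v * x) * v powr (\<beta> - 1))) \<partial>lborel) = ennreal (Gamma \<beta> * x powr (- \<beta>))"
proof -
  define f where "f v = indicator {0..} v * (v powr (\<beta> - 1) / exp v)" for v :: real
  have fm [measurable]: "f \<in> borel_measurable borel" unfolding f_def by measurable
  have "(\<integral>\<^sup>+v. ennreal (f v) \<partial>lborel) = ennreal (Gamma \<beta>)"
  proof (rule nn_integral_has_integral_lborel[OF fm])
    have "((\<lambda>v. if v \<in> {0..} then v powr (\<beta> - 1) / exp v else 0) has_integral Gamma \<beta>) UNIV"
      using Gamma_integral_real[OF assms(1)] by (simp only: has_integral_restrict_UNIV)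
    also have "(\<lambda>v. if v \<in> {0..} then v powr (\<beta> - 1) / exp v else 0) = f" by (auto simp: f_def fun_eq_iff)
    finally show "(f has_integral Gamma \<beta>) UNIV" .
  qed (simp add: f_def)
  then have "ennreal (Gamma \<beta>) = ennreal \<bar>x\<bar> * (\<integral>\<^sup>+v. ennreal (f (0 + x * v)) \<partial>lborel)"
    using nn_integral_real_affine[of "\<lambda>v. ennreal (f v)" x 0] assms by simp
  also have "(\<integral>\<^sup>+v. ennreal (f (0 + x * v)) \<partial>lborel) =
      (\<integral>\<^sup>+v. ennreal (x powr (\<beta> - 1)) * ennreal (indicator {0<..} v * (exp (- v * x) * v powr (\<beta> - 1))) \<partial>lborel)"
  proof (intro nn_integral_cong_AE AE_I[where N="{0}"])
    show "{v \<in> space lborel. \<not> ennreal (f (0 + x * v)) = ennreal (x powr (\<beta> - 1)) * ennreal (indicator {0<..} v * (exp (- v * x) * v powr (\<beta> - 1)))} \<subseteq> {0}"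
    proof safe
      fix v :: real assume v: "ennreal (f (0 + x * v)) \<noteq> ennreal (x powr (\<beta> - 1)) * ennreal (indicator {0<..} v * (exp (- v * x) * v powr (\<beta> - 1)))"
      show "v = 0"
      proof (rule ccontr)
        assume "v \<noteq> 0"
        then have "f (0 + x * v) = x powr (\<beta> - 1) * (indicator {0<..} v * (exp (- v * x) * v powr (\<beta> - 1)))"
          using assms by (cases "0 < v") (auto simp: f_def powr_mult exp_minus field_simps indicator_def zero_le_mult_iff)
        then show False using v by (simp add: ennreal_mult[symmetric])
      qed
    qed
  qed auto
  also have "\<dots> = ennreal (x powr (\<beta> - 1)) * (\<integral>\<^sup>+v. ennreal (indicator {0<..} v * (exp (- v * x) * v powr (\<beta> - 1))) \<partial>lborel)"
    by (intro nn_integral_cmult) measurable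
  also have "ennreal \<bar>x\<bar> * (ennreal (x powr (\<beta> - 1)) * (\<integral>\<^sup>+v. ennreal (indicator {0<..} v * (exp (- v * x) * v powr (\<beta> - 1))) \<partial>lborel))
      = ennreal (x powr \<beta>) * (\<integral>\<^sup>+v. ennreal (indicator {0<..} v * (exp (- v * x) * v powr (\<beta> - 1))) \<partial>lborel)"
  proof -
    have "ennreal \<bar>x\<bar> * ennreal (x powr (\<beta> - 1)) = ennreal (x powr \<beta>)"
      using assms powr_add[of x 1 "\<beta> - 1"] by (simp add: ennreal_mult[symmetric])
    then show ?thesis by (simp only: mult.assoc[symmetric])
  qed
  finally have e: "ennreal (Gamma \<beta>) = ennreal (x powr \<beta>) * (\<integral>\<^sup>+v. ennreal (indicator {0<..} v * (exp (- v * x) * v powr (\<beta> - 1))) \<partial>lborel)" .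
  have "ennreal (x powr (- \<beta>)) * ennreal (Gamma \<beta>) = (ennreal (x powr (- \<beta>)) * ennreal (x powr \<beta>)) * (\<integral>\<^sup>+v. ennreal (indicator {0<..} v * (exp (- v * x) * v powr (\<beta> - 1))) \<partial>lborel)"
    unfolding e by (simp add: mult.assoc)
  also have "ennreal (x powr (- \<beta>)) * ennreal (x powr \<beta>) = 1"
    using assms by (simp add: ennreal_mult[symmetric] powr_add[symmetric])
  finally show ?thesis
    using assms Gamma_real_pos[of \<beta>] by (simp add: ennreal_mult[symmetric] mult.commute)
qed

text \<open>Tonelli applied to the Gamma integral for a negative power of \<open>W\<close>. An atom
  at 0 would make the integral over \<open>v\<close> infinite, so integrability also forces
  \<open>W > 0\<close> almost surely. This matters because \<open>0 powr (- \<beta>)\<close> has the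
  default value 0 and would hide the atom.\<close>

lemma neg_moment_W:
  assumes \<beta>: "1 < \<beta>" and int: "set_integrable lborel {0<..} (\<lambda>v. Phi v * v powr (\<beta> - 1))"
  shows "q = 0" and "integrable M (\<lambda>\<omega>. W \<omega> powr (- \<beta>))"
    and "expectation (\<lambda>\<omega>. W \<omega> powr (- \<beta>)) = 1 / Gamma \<beta> * (LBINT v:{0<..}. Phi v * v powr (\<beta> - 1))"
proof -
  interpret P: pair_sigma_finite lborel M ..
  let ?h = "\<lambda>v \<omega>. ennreal (indicator {0<..} v * (exp (- v * W \<omega>) * v powr (\<beta> - 1)))"
  have G0: "0 < Gamma \<beta>" using \<beta> by (intro Gamma_real_pos) auto
  have i: "integrable lborel (\<lambda>v. indicator {0<..} v * (Phi v * v powr (\<beta> - 1)))"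
    using int by (simp add: set_integrable_def)
  have nn0: "0 \<le> indicator {0<..} v * (Phi v * v powr (\<beta> - 1))" for v
    using Phi_range[of v] by (auto simp: indicator_def)
  have "(\<integral>\<^sup>+v. ennreal (indicator {0<..} v * (Phi v * v powr (\<beta> - 1))) \<partial>lborel) = (\<integral>\<^sup>+v. (\<integral>\<^sup>+\<omega>. ?h v \<omega> \<partial>M) \<partial>lborel)"
  proof (intro nn_integral_cong)
    fix v :: real
    show "ennreal (indicator {0<..} v * (Phi v * v powr (\<beta> - 1))) = (\<integral>\<^sup>+\<omega>. ?h v \<omega> \<partial>M)"
    proof (cases "0 < v")
      case True
      have "(\<integral>\<^sup>+\<omega>. ?h v \<omega> \<partial>M) = ennreal (expectation (\<lambda>\<omega>. exp (- v * W \<omega>) * v powr (\<beta> - 1)))"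
        using True Phi_int[of v] by (subst nn_integral_eq_integral[symmetric]) auto
      then show ?thesis using True by (simp add: Phi_def)
    qed simp
  qed
  also have "\<dots> = (\<integral>\<^sup>+\<omega>. (\<integral>\<^sup>+v. ?h v \<omega> \<partial>lborel) \<partial>M)"
    by (rule P.Fubini'[symmetric]) measurable
  finally have F: "(\<integral>\<^sup>+\<omega>. (\<integral>\<^sup>+v. ?h v \<omega> \<partial>lborel) \<partial>M) = (\<integral>\<^sup>+v. ennreal (indicator {0<..} v * (Phi v * v powr (\<beta> - 1))) \<partial>lborel)" by simp
  also have "\<dots> = ennreal (LBINT v:{0<..}. Phi v * v powr (\<beta> - 1))"
    using nn_integral_eq_integral[OF i] nn0 by (simp add: set_lebesgue_integral_def)
  finally have F: "(\<integral>\<^sup>+\<omega>. (\<integral>\<^sup>+v. ?h v \<omega> \<partial>lborel) \<partial>M) = ennreal (LBINT v:{0<..}. Phi v * v powr (\<beta> - 1))" .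
  have "AE \<omega> in M. (\<integral>\<^sup>+v. ?h v \<omega> \<partial>lborel) \<noteq> \<infinity>"
  proof (rule nn_integral_PInf_AE)
    show "(\<integral>\<^sup>+\<omega>. (\<integral>\<^sup>+v. ?h v \<omega> \<partial>lborel) \<partial>M) \<noteq> \<infinity>" unfolding F by simp
  qed measurable
  then have W0: "AE \<omega> in M. 0 < W \<omega>"
    using W_nonneg
  proof eventually_elim
    case (elim \<omega>)
    have "W \<omega> \<noteq> 0"
    proof
      assume W: "W \<omega> = 0"
      obtain r where r: "0 \<le> r" "(\<integral>\<^sup>+v. ?h v \<omega> \<partial>lborel) = ennreal r"
        using elim(1) by (cases "\<integral>\<^sup>+v. ?h v \<omega> \<partial>lborel" rule: ennreal_cases) auto
      \<comment> \<open>If \<open>W\<close> vanished, the integrand would be at least 1 on an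
        interval of length \<open>r + 1\<close>, more than the assumed value \<open>r\<close> of the
        integral.\<close>
      have "ennreal (r + 1) = emeasure lborel {1..r + 2}" using r by simp
      also have "\<dots> = (\<integral>\<^sup>+v. indicator {1..r + 2} v \<partial>lborel)" by simp
      also have "\<dots> \<le> (\<integral>\<^sup>+v. ?h v \<omega> \<partial>lborel)"
      proof (intro nn_integral_mono)
        fix v :: real
        show "indicator {1..r + 2} v \<le> ?h v \<omega>"
        proof (cases "1 \<le> v")
          case True
          then have "1 \<le> v powr (\<beta> - 1)" using \<beta> by (simp add: ge_one_powr_ge_zero)
          then have "1 \<le> ?h v \<omega>" using True W by (simp add: ennreal_leI ennreal_1[symmetric] del: ennreal_1)
          then show ?thesis by (auto simp: indicator_def)
        qed simp
      qed
      finally show False using r by simp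
    qed
    then show ?case using elim by simp
  qed
  have "q0 = 0" by (subst prob_Collect_eq_0) (use W0 in \<open>auto elim!: eventually_mono\<close>)
  then show "q = 0" using prob_W_0 by simp
  have "(\<integral>\<^sup>+\<omega>. (\<integral>\<^sup>+v. ?h v \<omega> \<partial>lborel) \<partial>M) = (\<integral>\<^sup>+\<omega>. ennreal (Gamma \<beta>) * ennreal (W \<omega> powr (- \<beta>)) \<partial>M)"
    by (rule nn_integral_cong_AE, use W0 in eventually_elim)
       (use laplace_power_integral[of \<beta>] \<beta> G0 in \<open>auto simp: ennreal_mult\<close>)
  also have "\<dots> = ennreal (Gamma \<beta>) * (\<integral>\<^sup>+\<omega>. ennreal (W \<omega> powr (- \<beta>)) \<partial>M)"
    by (intro nn_integral_cmult) measurable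
  finally have E: "ennreal (Gamma \<beta>) * (\<integral>\<^sup>+\<omega>. ennreal (W \<omega> powr (- \<beta>)) \<partial>M) = ennreal (LBINT v:{0<..}. Phi v * v powr (\<beta> - 1))"
    using F by simp
  have fin: "(\<integral>\<^sup>+\<omega>. ennreal (W \<omega> powr (- \<beta>)) \<partial>M) < \<infinity>"
  proof (rule ccontr)
    assume "\<not> (\<integral>\<^sup>+\<omega>. ennreal (W \<omega> powr (- \<beta>)) \<partial>M) < \<infinity>"
    then have "(\<integral>\<^sup>+\<omega>. ennreal (W \<omega> powr (- \<beta>)) \<partial>M) = \<infinity>" by (simp add: less_top[symmetric])
    then show False using E G0 by (simp add: ennreal_mult_top)
  qed
  show iW: "integrable M (\<lambda>\<omega>. W \<omega> powr (- \<beta>))"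
    by (rule integrableI_nonneg) (use fin in auto)
  have "ennreal (Gamma \<beta> * expectation (\<lambda>\<omega>. W \<omega> powr (- \<beta>))) = ennreal (LBINT v:{0<..}. Phi v * v powr (\<beta> - 1))"
    using E nn_integral_eq_integral[OF iW] G0 by (simp add: ennreal_mult)
  moreover have "0 \<le> (LBINT v:{0<..}. Phi v * v powr (\<beta> - 1))"
    unfolding set_lebesgue_integral_def using nn0 by (intro Bochner_Integration.integral_nonneg) simp
  ultimately have "Gamma \<beta> * expectation (\<lambda>\<omega>. W \<omega> powr (- \<beta>)) = (LBINT v:{0<..}. Phi v * v powr (\<beta> - 1))"
    using G0 by (subst (asm) ennreal_inj) (auto intro!: mult_nonneg_nonneg Bochner_Integration.integral_nonneg)
  then show "expectation (\<lambda>\<omega>. W \<omega> powr (- \<beta>)) = 1 / Gamma \<beta> * (LBINT v:{0<..}. Phi v * v powr (\<beta> - 1))"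
    using G0 by (simp add: field_simps)
qed


section \<open>Expectations of functions of \<open>Z n\<close> on the event
  \<open>Z n > 0\<close>\<close>

definition EZ :: "nat \<Rightarrow> (nat \<Rightarrow> real) \<Rightarrow> real" where
  "EZ n g = expectation (\<lambda>\<omega>. if Z n \<omega> = 0 then 0 else g (Z n \<omega>))"

text \<open>The value at 0 is cut off by \<open>EZ\<close>, so boundedness on positive arguments
  guarantees integrability. Negative powers satisfy it.\<close>

definition bdd_pos :: "(nat \<Rightarrow> real) \<Rightarrow> bool" where
  "bdd_pos g \<longleftrightarrow> (\<exists>B. \<forall>k>0. \<bar>g k\<bar> \<le> B)"

lemma bdd_posI: "(\<And>k. 0 < k \<Longrightarrow> \<bar>g k\<bar> \<le> B) \<Longrightarrow> bdd_pos g"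
  unfolding bdd_pos_def by blast

lemma EZ_int: "bdd_pos g \<Longrightarrow> integrable M (\<lambda>\<omega>. if Z n \<omega> = 0 then 0 else g (Z n \<omega>))"
proof -
  assume "bdd_pos g"
  then obtain B where B: "\<And>k. 0 < k \<Longrightarrow> \<bar>g k\<bar> \<le> B" unfolding bdd_pos_def by blast
  have "0 \<le> B" using B[of 1] by auto
  then show ?thesis by (intro integrable_const_bound[where B=B]) (use B in auto)
qed

lemma EZ_mono: "bdd_pos f \<Longrightarrow> bdd_pos g \<Longrightarrow> (\<And>k. 0 < k \<Longrightarrow> f k \<le> g k) \<Longrightarrow> EZ n f \<le> EZ n g"
  unfolding EZ_def by (intro integral_mono EZ_int) auto

lemma EZ_nonneg: "(\<And>k. 0 < k \<Longrightarrow> 0 \<le> g k) \<Longrightarrow> 0 \<le> EZ n g"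
  unfolding EZ_def by (intro Bochner_Integration.integral_nonneg) auto

lemma EZ_add: "bdd_pos f \<Longrightarrow> bdd_pos g \<Longrightarrow> EZ n (\<lambda>k. f k + g k) = EZ n f + EZ n g"
  unfolding EZ_def by (subst Bochner_Integration.integral_add[symmetric, OF EZ_int EZ_int])
    (auto intro!: Bochner_Integration.integral_cong)

lemma EZ_cmult: "EZ n (\<lambda>k. c * g k) = c * EZ n g"
proof -
  have "(\<lambda>\<omega>. if Z n \<omega> = 0 then 0 else c * g (Z n \<omega>)) = (\<lambda>\<omega>. c * (if Z n \<omega> = 0 then 0 else g (Z n \<omega>)))" by auto
  then show ?thesis unfolding EZ_def by simp
qed

lemma EZ_cong: "(\<And>k. 0 < k \<Longrightarrow> f k = g k) \<Longrightarrow> EZ n f = EZ n g"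
  unfolding EZ_def by (intro Bochner_Integration.integral_cong) auto

lemma bdd_pos_add: "bdd_pos f \<Longrightarrow> bdd_pos g \<Longrightarrow> bdd_pos (\<lambda>k. f k + g k)"
proof -
  assume "bdd_pos f" "bdd_pos g"
  then obtain A B where "\<And>k. 0 < k \<Longrightarrow> \<bar>f k\<bar> \<le> A" "\<And>k. 0 < k \<Longrightarrow> \<bar>g k\<bar> \<le> B" unfolding bdd_pos_def by blast
  then show ?thesis by (intro bdd_posI[of _ "A + B"]) (use abs_triangle_ineq order_trans add_mono in meson)
qed

lemma bdd_pos_cmult: "bdd_pos g \<Longrightarrow> bdd_pos (\<lambda>k. c * g k)"
proof -
  assume "bdd_pos g"
  then obtain B where "\<And>k. 0 < k \<Longrightarrow> \<bar>g k\<bar> \<le> B" unfolding bdd_pos_def by blast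
  then show ?thesis by (intro bdd_posI[of _ "\<bar>c\<bar> * B"]) (auto simp: abs_mult intro: mult_left_mono)
qed

lemma bdd_pos_if: "bdd_pos f \<Longrightarrow> bdd_pos g \<Longrightarrow> bdd_pos (\<lambda>k. if P k then f k else g k)"
proof -
  assume "bdd_pos f" "bdd_pos g"
  then obtain A B where "\<And>k. 0 < k \<Longrightarrow> \<bar>f k\<bar> \<le> A" "\<And>k. 0 < k \<Longrightarrow> \<bar>g k\<bar> \<le> B" unfolding bdd_pos_def by blast
  then show ?thesis by (intro bdd_posI[of _ "max A B"]) (auto simp: le_max_iff_disj)
qed

lemma bdd_pos_const: "bdd_pos (\<lambda>k. c)" by (intro bdd_posI[of _ "\<bar>c\<bar>"]) auto

lemma bdd_pos_powr: "0 \<le> b \<Longrightarrow> bdd_pos (\<lambda>k. real k powr (- b))"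
  by (intro bdd_posI[of _ 1]) (auto simp: powr_minus_divide ge_one_powr_ge_zero divide_le_eq_1)

lemma EZ_indicator: "EZ n (\<lambda>k. if real k \<le> x then 1 else 0) = prob_Z_le n x"
proof -
  have "EZ n (\<lambda>k. if real k \<le> x then 1 else 0) =
      expectation (\<lambda>\<omega>. indicator {\<omega>\<in>space M. 0 < Z n \<omega> \<and> real (Z n \<omega>) \<le> x} \<omega> *\<^sub>R 1)"
    unfolding EZ_def by (intro Bochner_Integration.integral_cong) (auto simp: indicator_def)
  then show ?thesis by (subst (asm) integral_indicator_scaleR) auto
qed

end

section \<open>The two contributions to the tail of the ratio\<close>

locale gw_walk = gw_density M p \<xi> Z X m W q \<alpha> w
  for M :: "'a measure" and p \<xi> Z X m W q \<alpha> w +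
  fixes \<theta> a \<sigma>2 :: real
  assumes X1_int: "integrable M (X 1)" and X1_mean: "expectation (X 1) = 0"
    and X1_sq_int: "integrable M (\<lambda>\<omega>. (X 1 \<omega>)\<^sup>2)"
    and s2_eq: "\<sigma>2 = expectation (\<lambda>\<omega>. (X 1 \<omega>)\<^sup>2)" and s2_pos: "0 < \<sigma>2"
    and theta_range: "2 < \<theta>" "\<theta> < 1 + \<alpha>" and a_pos: "0 < a"
    and tail_equiv: "(\<lambda>x. measure M {\<omega>\<in>space M. X 1 \<omega> \<ge> x}) \<sim>[at_top] (\<lambda>x. a * x powr (- \<theta>))"
begin

sublocale walk: centered_walk M "\<lambda>i. X (Suc i)" \<sigma>2
proof
  show "indep_vars (\<lambda>_. borel) (\<lambda>i. X (Suc i)) UNIV" by (rule X_indep)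
  show "distr M borel (X (Suc i)) = distr M borel (X (Suc 0))" for i
    using X_distr[of "Suc i"] by simp
qed (use X1_int X1_mean X1_sq_int s2_eq s2_pos in auto)

abbreviation xtail :: "real \<Rightarrow> real" where "xtail \<equiv> walk.xtail"

definition hit :: "nat \<Rightarrow> real \<Rightarrow> real" where
  "hit k e = \<P>(\<omega> in M. e * real k \<le> walk.Sm k \<omega>)"

lemma hit_range: "0 \<le> hit k e" "hit k e \<le> 1" by (auto simp: hit_def)

lemma bdd_hit: "bdd_pos (\<lambda>k. hit k e)" by (intro bdd_posI[of _ 1]) (use hit_range in auto)

lemma prob_R_eq_EZ: "prob_R_ge M Z X n e = EZ n (\<lambda>k. hit k e)"
  unfolding prob_R_ge_eq EZ_def hit_def walk.Sm_def ..

text \<open>Dsc and Jsc are the costs of a small population and of a single big jump; gpart and jpart are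
  the corresponding parts of the probability, T being a cut-off that tends to infinity last.\<close>

definition Dsc :: "nat \<Rightarrow> real \<Rightarrow> real" where "Dsc n e = (e\<^sup>2 * m ^ n) powr (- \<alpha>)"
definition Jsc :: "nat \<Rightarrow> real \<Rightarrow> real" where "Jsc n e = e powr (- \<theta>) * m powr (- (\<theta> - 1) * real n)"

lemma Dsc_pos: "0 < e \<Longrightarrow> 0 < Dsc n e" using m_pos by (simp add: Dsc_def)
lemma Jsc_pos: "0 < e \<Longrightarrow> 0 < Jsc n e" using m_pos by (simp add: Jsc_def)

definition gpart :: "nat \<Rightarrow> real \<Rightarrow> real \<Rightarrow> real" where
  "gpart n e T = EZ n (\<lambda>k. if real k \<le> T / e\<^sup>2 then hit k e else 0)"

definition jpart :: "nat \<Rightarrow> real \<Rightarrow> real \<Rightarrow> real" where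
  "jpart n e c = EZ n (\<lambda>k. real k * xtail (c * e * real k))"

lemma beta_range: "1 < \<theta> - 1" "\<theta> - 1 < \<alpha>" using theta_range by auto

lemma xtail_scaled_tendsto: "((\<lambda>x. x powr \<theta> * xtail x) \<longlongrightarrow> a) at_top"
proof -
  have "((\<lambda>x. if measure M {\<omega>\<in>space M. X 1 \<omega> \<ge> x} = 0 \<and> a * x powr (- \<theta>) = 0 then 1
      else measure M {\<omega>\<in>space M. X 1 \<omega> \<ge> x} / (a * x powr (- \<theta>))) \<longlongrightarrow> 1) at_top"
    using tail_equiv unfolding asymp_equiv_def .
  then have "((\<lambda>x. a * (if measure M {\<omega>\<in>space M. X 1 \<omega> \<ge> x} = 0 \<and> a * x powr (- \<theta>) = 0 then 1
      else measure M {\<omega>\<in>space M. X 1 \<omega> \<ge> x} / (a * x powr (- \<theta>)))) \<longlongrightarrow> a * 1) at_top"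
    by (intro tendsto_mult tendsto_const)
  moreover have "\<forall>\<^sub>F x in at_top. a * (if measure M {\<omega>\<in>space M. X 1 \<omega> \<ge> x} = 0 \<and> a * x powr (- \<theta>) = 0 then 1
      else measure M {\<omega>\<in>space M. X 1 \<omega> \<ge> x} / (a * x powr (- \<theta>))) = x powr \<theta> * xtail x"
    using eventually_gt_at_top[of 0]
    by eventually_elim (use a_pos in \<open>auto simp: walk.xtail_def powr_minus field_simps\<close>)
  ultimately show ?thesis using Lim_transform_eventually by fastforce
qed

text \<open>The asymptotic tail controls large \<open>x\<close>; for smaller \<open>x\<close> the
  trivial bound 1 is absorbed into the constant. A bound valid for all positive \<open>x\<close>
  allows uniform estimates in \<open>k\<close>.\<close>

lemma xtail_bound: "\<exists>K>0. \<forall>x>0. xtail x \<le> K * x powr (- \<theta>)"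
proof -
  have "\<forall>\<^sub>F x in at_top. x powr \<theta> * xtail x < 2 * a"
    using xtail_scaled_tendsto by (rule order_tendstoD(2)) (use a_pos in simp)
  then obtain x0 where x0: "\<And>x. x0 \<le> x \<Longrightarrow> x powr \<theta> * xtail x < 2 * a" by (auto simp: eventually_at_top_linorder)
  define K where "K = max (2 * a) (max x0 1 powr \<theta>)"
  have "xtail x \<le> K * x powr (- \<theta>)" if x: "0 < x" for x
  proof -
    have "x powr \<theta> * xtail x \<le> K"
    proof (cases "x0 \<le> x")
      case True
      then show ?thesis using x0[OF True] by (simp add: K_def)
    next
      case False
      have "x powr \<theta> * xtail x \<le> max x0 1 powr \<theta> * 1"
        using False x theta_range walk.xtail_nonneg walk.xtail_le_1 by (intro mult_mono powr_mono2) auto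
      then show ?thesis by (simp add: K_def)
    qed
    then show ?thesis using x by (simp add: powr_minus field_simps)
  qed
  then show ?thesis using a_pos by (intro exI[of _ K]) (auto simp: K_def)
qed

lemma k_xtail_le:
  assumes "\<And>x. 0 < x \<Longrightarrow> xtail x \<le> K * x powr (- \<theta>)" "0 < k" "0 < e" "0 < c"
  shows "real k * xtail (c * e * real k) \<le> K * c powr (- \<theta>) * e powr (- \<theta>) * real k powr (- (\<theta> - 1))"
proof -
  have "real k * xtail (c * e * real k) \<le> real k * (K * (c * e * real k) powr (- \<theta>))"
    using assms by (intro mult_left_mono) auto
  also have "(c * e * real k) powr (- \<theta>) = c powr (- \<theta>) * e powr (- \<theta>) * real k powr (- \<theta>)"
    using assms by (simp add: powr_mult)
  also have "real k * (K * (c powr (- \<theta>) * e powr (- \<theta>) * real k powr (- \<theta>))) =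
      K * c powr (- \<theta>) * e powr (- \<theta>) * real k powr (- (\<theta> - 1))"
    using assms(2) powr_add[of "real k" 1 "- \<theta>"] by (simp add: algebra_simps)
  finally show ?thesis .
qed

lemma bdd_jterm: "0 < e \<Longrightarrow> 0 < c \<Longrightarrow> bdd_pos (\<lambda>k. real k * xtail (c * e * real k))"
proof -
  assume ec: "0 < e" "0 < c"
  obtain K where K: "0 < K" "\<And>x. 0 < x \<Longrightarrow> xtail x \<le> K * x powr (- \<theta>)" using xtail_bound by blast
  show ?thesis
  proof (intro bdd_posI[of _ "K * c powr (- \<theta>) * e powr (- \<theta>)"])
    fix k :: nat assume k: "0 < k"
    have "real k powr (- (\<theta> - 1)) \<le> 1"
      using k theta_range powr_mono2'[of "- (\<theta> - 1)" 1 "real k"] by simp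
    then have "K * c powr (- \<theta>) * e powr (- \<theta>) * real k powr (- (\<theta> - 1)) \<le> K * c powr (- \<theta>) * e powr (- \<theta>) * 1"
      using K by (intro mult_left_mono) auto
    then show "\<bar>real k * xtail (c * e * real k)\<bar> \<le> K * c powr (- \<theta>) * e powr (- \<theta>)"
      using k_xtail_le[OF K(2) k ec] walk.xtail_nonneg[of "c * e * real k"] by simp
  qed
qed

text \<open>The tail bound turns the summand into a multiple of
  \<open>k powr (- (\<theta> - 1))\<close>; the order is that of the corresponding negative moment
  of \<open>Z n\<close>, finite at the right scale because
  \<open>\<theta> - 1 < \<alpha>\<close>.\<close>

lemma jpart_bound:
  assumes c: "0 < c"
  shows "\<exists>K>0. \<forall>n e. 0 < e \<longrightarrow> jpart n e c \<le> K * Jsc n e"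
proof -
  obtain K where K: "0 < K" "\<And>x. 0 < x \<Longrightarrow> xtail x \<le> K * x powr (- \<theta>)" using xtail_bound by blast
  obtain C where C: "0 < C" "\<And>n. expectation (\<lambda>\<omega>. if Z n \<omega> = 0 then 0 else real (Z n \<omega>) powr (- (\<theta> - 1))) \<le> C * m powr (- (\<theta> - 1) * real n)"
    using Z_neg_moment_bound[of "\<theta> - 1"] beta_range by auto
  show ?thesis
  proof (intro exI[of _ "K * c powr (- \<theta>) * C"] conjI allI impI)
    fix n e assume e: "0 < (e::real)"
    have "jpart n e c \<le> EZ n (\<lambda>k. K * c powr (- \<theta>) * e powr (- \<theta>) * real k powr (- (\<theta> - 1)))"
      unfolding jpart_def using bdd_jterm[OF e c] beta_range
      by (intro EZ_mono bdd_pos_cmult bdd_pos_powr k_xtail_le[OF K(2)]) (use e c in auto)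
    also have "\<dots> = K * c powr (- \<theta>) * e powr (- \<theta>) * EZ n (\<lambda>k. real k powr (- (\<theta> - 1)))" by (rule EZ_cmult)
    also have "\<dots> \<le> K * c powr (- \<theta>) * e powr (- \<theta>) * (C * m powr (- (\<theta> - 1) * real n))"
      unfolding EZ_def using K by (intro mult_left_mono C(2)) auto
    finally show "jpart n e c \<le> K * c powr (- \<theta>) * C * Jsc n e" by (simp add: Jsc_def mult_ac)
  qed (use K C c in auto)
qed

lemma prob_small_Z_scaled:
  assumes C: "\<And>n x. 0 < x \<Longrightarrow> prob_Z_le n x \<le> C * (x / m ^ n) powr \<alpha>"
    and e: "0 < e" and s: "0 < s"
  shows "prob_Z_le n (s / e\<^sup>2) \<le> C * s powr \<alpha> * Dsc n e"
proof -
  have "(s / e\<^sup>2 / m ^ n) powr \<alpha> = s powr \<alpha> * Dsc n e"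
    using e s m_pos by (simp add: Dsc_def powr_divide powr_minus_divide)
  then show ?thesis using C[of "s / e\<^sup>2" n] e s by simp
qed

text \<open>Above the cut-off, \<open>e\<^sup>2 * k > T\<close> and \<open>walk_tail_upper\<close>
  applies at \<open>x = e * k\<close>. Its second term gains a factor \<open>1 / T\<close> on the
  jump cost; its third term is a negative power of order \<open>1 / \<eta> > \<alpha>\<close> of
  \<open>Z n\<close>, which adds \<open>T powr (\<alpha> - 1 / \<eta>)\<close> population costs.
  Both remainders vanish for large \<open>T\<close>, uniformly in \<open>n\<close> and
  \<open>e\<close>.\<close>

lemma prob_R_upper:
  assumes \<eta>: "0 < \<eta>" "\<eta> < 1" "\<alpha> < 1 / \<eta>"
  shows "\<exists>K>0. \<forall>n e T. 0 < e \<longrightarrow> 0 < T \<longrightarrow>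
    prob_R_ge M Z X n e \<le> gpart n e T + jpart n e (1 - \<eta>) + K / T * Jsc n e + K * T powr (\<alpha> - 1 / \<eta>) * Dsc n e"
proof -
  define L where "L = 1 / \<eta>"
  obtain K where K: "0 < K" "\<And>x. 0 < x \<Longrightarrow> xtail x \<le> K * x powr (- \<theta>)" using xtail_bound by blast
  obtain C1 where C1: "0 < C1" "\<And>n. expectation (\<lambda>\<omega>. if Z n \<omega> = 0 then 0 else real (Z n \<omega>) powr (- (\<theta> - 1))) \<le> C1 * m powr (- (\<theta> - 1) * real n)"
    using Z_neg_moment_bound[of "\<theta> - 1"] beta_range by auto
  obtain C2 where C2: "0 < C2" "\<And>n y. 0 < y \<Longrightarrow> expectation (\<lambda>\<omega>. if Z n \<omega> = 0 then 0 else if y < real (Z n \<omega>) then real (Z n \<omega>) powr (- L) else 0)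
    \<le> C2 * y powr (\<alpha> - L) * m powr (- \<alpha> * real n)"
    using large_Z_moment_bound[of L] \<eta> by (auto simp: L_def)
  define K2 where "K2 = K * \<eta> powr (- \<theta>) * (\<sigma>2 / \<eta>\<^sup>2)"
  define K3 where "K3 = (exp 1 * \<sigma>2 / \<eta>) powr L"
  have K20: "0 < K2" "0 < K3" using K \<eta> s2_pos by (auto simp: K2_def K3_def)
  define KK where "KK = max (K2 * C1) (K3 * C2)"
  show ?thesis
  proof (intro exI[of _ KK] conjI allI impI)
    show "0 < KK" using K20 C1 by (simp add: KK_def less_max_iff_disj)
    fix n e T assume e: "0 < (e::real)" and T: "0 < (T::real)"
    let ?g = "\<lambda>k. if real k \<le> T / e\<^sup>2 then hit k e else 0"
    let ?j = "\<lambda>k. real k * xtail ((1 - \<eta>) * e * real k)"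
    let ?b = "\<lambda>k::nat. real k powr (- (\<theta> - 1))"
    let ?l = "\<lambda>k::nat. if T / e\<^sup>2 < real k then real k powr (- L) else 0"
    have bdb: "bdd_pos ?b" using beta_range by (intro bdd_pos_powr) simp
    have bd: "bdd_pos ?g" "bdd_pos ?j" "bdd_pos ?b" "bdd_pos ?l"
      using bdb bdd_hit bdd_jterm[OF e, of "1 - \<eta>"] \<eta> bdd_pos_powr[of L]
      by (auto intro!: bdd_pos_if bdd_pos_const simp: L_def)
    have pt: "hit k e \<le> ?g k + ?j k + (K2 / T * e powr (- \<theta>)) * ?b k + (K3 * e powr (- 2 * L)) * ?l k" if k: "0 < k" for k
    proof (cases "real k \<le> T / e\<^sup>2")
      case True
      have "0 \<le> ?j k" "0 \<le> (K2 / T * e powr (- \<theta>)) * ?b k"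
        using walk.xtail_nonneg K20 T by auto
      then show ?thesis using True by simp
    next
      case False
      have x: "0 < e * real k" using e k by simp
      have ek: "T < e\<^sup>2 * real k" using False e by (simp add: field_simps)
      have "hit k e \<le> real k * xtail ((1 - \<eta>) * (e * real k)) + real k * xtail (\<eta> * (e * real k)) * (real k * \<sigma>2 / (\<eta> * (e * real k))\<^sup>2)
          + (exp 1 * real k * \<sigma>2 / (\<eta> * (e * real k)\<^sup>2)) powr (1 / \<eta>)"
        unfolding hit_def by (rule walk.walk_tail_upper[OF x \<eta>(1,2) k])
      also have "real k * xtail (\<eta> * (e * real k)) * (real k * \<sigma>2 / (\<eta> * (e * real k))\<^sup>2) \<le> (K2 / T * e powr (- \<theta>)) * ?b k"
      proof -
        have "real k * \<sigma>2 / (\<eta> * (e * real k))\<^sup>2 = (\<sigma>2 / \<eta>\<^sup>2) / (e\<^sup>2 * real k)"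
          using k by (simp add: power_mult_distrib power2_eq_square)
        also have "\<dots> \<le> (\<sigma>2 / \<eta>\<^sup>2) / T" using ek T s2_pos \<eta> by (intro divide_left_mono) auto
        finally have 1: "real k * \<sigma>2 / (\<eta> * (e * real k))\<^sup>2 \<le> (\<sigma>2 / \<eta>\<^sup>2) / T" .
        have "real k * xtail (\<eta> * e * real k) \<le> K * \<eta> powr (- \<theta>) * e powr (- \<theta>) * ?b k"
          by (rule k_xtail_le[OF K(2) k e \<eta>(1)])
        then have 2: "real k * xtail (\<eta> * (e * real k)) \<le> K * \<eta> powr (- \<theta>) * e powr (- \<theta>) * ?b k"
          by (simp only: mult.assoc)
        have "real k * xtail (\<eta> * (e * real k)) * (real k * \<sigma>2 / (\<eta> * (e * real k))\<^sup>2) \<le>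
            (K * \<eta> powr (- \<theta>) * e powr (- \<theta>) * ?b k) * ((\<sigma>2 / \<eta>\<^sup>2) / T)"
          by (rule mult_mono[OF 2 1]) (use K s2_pos in auto)
        then show ?thesis by (simp add: K2_def mult_ac)
      qed
      also have "(exp 1 * real k * \<sigma>2 / (\<eta> * (e * real k)\<^sup>2)) powr (1 / \<eta>) = (K3 * e powr (- 2 * L)) * ?l k"
      proof -
        have "exp 1 * real k * \<sigma>2 / (\<eta> * (e * real k)\<^sup>2) = (exp 1 * \<sigma>2 / \<eta>) * (e powr (- 2) * real k powr (- 1))"
          using k e \<eta> by (simp add: powr_minus powr_numeral power2_eq_square field_simps)
        then have "(exp 1 * real k * \<sigma>2 / (\<eta> * (e * real k)\<^sup>2)) powr (1 / \<eta>) = K3 * ((e powr (- 2)) powr L * (real k powr (- 1)) powr L)"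
          by (simp only: L_def[symmetric] powr_mult K3_def)
        then show ?thesis using False k by (simp add: powr_powr powr_divide powr_minus_divide)
      qed
      finally show ?thesis using False by (simp add: mult.assoc)
    qed
    have "prob_R_ge M Z X n e \<le> EZ n (\<lambda>k. ?g k + ?j k + (K2 / T * e powr (- \<theta>)) * ?b k + (K3 * e powr (- 2 * L)) * ?l k)"
      unfolding prob_R_eq_EZ by (intro EZ_mono bdd_hit bdd_pos_add bdd_pos_cmult bd pt)
    also have "\<dots> = gpart n e T + jpart n e (1 - \<eta>) + (K2 / T * e powr (- \<theta>)) * EZ n ?b + (K3 * e powr (- 2 * L)) * EZ n ?l"
      unfolding gpart_def jpart_def by (simp only: EZ_add EZ_cmult bdd_pos_add bdd_pos_cmult bd)
    also have "(K2 / T * e powr (- \<theta>)) * EZ n ?b \<le> (K2 / T * e powr (- \<theta>)) * (C1 * m powr (- (\<theta> - 1) * real n))"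
      unfolding EZ_def using K20 T by (intro mult_left_mono C1(2)) auto
    also have "\<dots> = K2 * C1 / T * Jsc n e" by (simp add: Jsc_def mult_ac)
    also have "\<dots> \<le> KK / T * Jsc n e"
      using T Jsc_pos[OF e, of n] by (intro mult_right_mono divide_right_mono) (auto simp: KK_def)
    also have "(K3 * e powr (- 2 * L)) * EZ n ?l \<le> (K3 * e powr (- 2 * L)) * (C2 * (T / e\<^sup>2) powr (\<alpha> - L) * m powr (- \<alpha> * real n))"
      unfolding EZ_def using K20 T e by (intro mult_left_mono C2(2)) auto
    also have "\<dots> = K3 * C2 * T powr (\<alpha> - L) * Dsc n e"
    proof -
      have e2: "e\<^sup>2 = e powr 2" using e by (simp add: powr_numeral)
      have "e powr (- 2 * L) * ((T / e\<^sup>2) powr (\<alpha> - L) * m powr (- \<alpha> * real n)) = T powr (\<alpha> - L) * (e powr (- 2 * \<alpha>) * m powr (- \<alpha> * real n))"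
        unfolding e2 using e T
        by (simp add: powr_divide powr_powr powr_diff powr_minus powr_add field_simps del: powr_numeral)
      moreover have "Dsc n e = e powr (- 2 * \<alpha>) * m powr (- \<alpha> * real n)"
        unfolding Dsc_def e2 using e m_pos
        by (simp add: powr_mult powr_powr powr_realpow[symmetric] mult.commute del: powr_numeral)
      ultimately show ?thesis by (simp add: mult_ac)
    qed
    also have "\<dots> \<le> KK * T powr (\<alpha> - L) * Dsc n e"
      using Dsc_pos[OF e, of n] by (intro mult_right_mono) (auto simp: KK_def)
    finally show "prob_R_ge M Z X n e \<le> gpart n e T + jpart n e (1 - \<eta>) + KK / T * Jsc n e + KK * T powr (\<alpha> - 1 / \<eta>) * Dsc n e"
      by (simp add: L_def)
  qed
qed

text \<open>Above the cut-off the relative loss in \<open>walk_tail_lower\<close> is at most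
  \<open>K / T\<close>. Since \<open>jpart\<close> runs over all \<open>k\<close>, its portion below
  the cut-off has to be subtracted. By the truncated negative moment it is smaller than the jump
  cost by a power of \<open>e\<^sup>2 * m ^ n\<close>.\<close>

lemma prob_R_lower:
  assumes \<eta>: "0 < \<eta>"
  shows "\<exists>K>0. \<forall>n e T. 0 < e \<longrightarrow> K \<le> T \<longrightarrow>
    gpart n e T + (1 - K / T) * (jpart n e (1 + \<eta>) - K * T powr (\<alpha> - (\<theta> - 1)) * (e\<^sup>2 * m ^ n) powr (- (\<alpha> - (\<theta> - 1))) * Jsc n e)
      \<le> prob_R_ge M Z X n e"
proof -
  obtain K where K: "0 < K" "\<And>x. 0 < x \<Longrightarrow> xtail x \<le> K * x powr (- \<theta>)" using xtail_bound by blast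
  obtain C where C: "0 < C" "\<And>n x. 0 < x \<Longrightarrow> expectation (\<lambda>\<omega>. if Z n \<omega> = 0 then 0 else if real (Z n \<omega>) \<le> x then real (Z n \<omega>) powr (- (\<theta> - 1)) else 0)
    \<le> C * x powr (\<alpha> - (\<theta> - 1)) * m powr (- \<alpha> * real n)"
    using small_Z_moment_bound[of "\<theta> - 1"] beta_range by auto
  define K4 where "K4 = \<sigma>2 / \<eta>\<^sup>2 + \<sigma>2"
  have K40: "0 < K4" using s2_pos \<eta> by (simp add: K4_def add_pos_pos)
  define K5 where "K5 = K * (1 + \<eta>) powr (- \<theta>)"
  have K50: "0 < K5" using K \<eta> by (simp add: K5_def)
  define KK where "KK = max K4 (K5 * C)"
  show ?thesis
  proof (intro exI[of _ KK] conjI allI impI)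
    show "0 < KK" using K40 by (simp add: KK_def less_max_iff_disj)
    fix n e T assume e: "0 < (e::real)" and TK: "KK \<le> (T::real)"
    have T: "0 < T" using TK K40 by (simp add: KK_def)
    let ?g = "\<lambda>k. if real k \<le> T / e\<^sup>2 then hit k e else 0"
    let ?J = "\<lambda>k. real k * xtail ((1 + \<eta>) * e * real k)"
    let ?j = "\<lambda>k. if T / e\<^sup>2 < real k then ?J k else 0"
    let ?s = "\<lambda>k. if real k \<le> T / e\<^sup>2 then real k powr (- (\<theta> - 1)) else 0"
    have r0: "0 \<le> 1 - KK / T" using T TK by simp
    have e1: "0 < 1 + \<eta>" using \<eta> by simp
    have bdb: "bdd_pos (\<lambda>k. real k powr (- (\<theta> - 1)))" using beta_range by (intro bdd_pos_powr) simp
    have bd: "bdd_pos ?g" "bdd_pos ?J" "bdd_pos ?j" "bdd_pos ?s"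
      using bdb bdd_hit bdd_jterm[OF e e1] by (auto intro!: bdd_pos_if bdd_pos_const)
    have pt: "?g k + (1 - KK / T) * ?j k \<le> hit k e" if k: "0 < k" for k
    proof (cases "real k \<le> T / e\<^sup>2")
      case False
      have x: "0 < e * real k" using e k by simp
      have ek: "T < e\<^sup>2 * real k" using False e by (simp add: field_simps)
      have "1 - KK / T \<le> 1 - real k * \<sigma>2 / (\<eta> * (e * real k))\<^sup>2 - real k * \<sigma>2 / (e * real k)\<^sup>2"
      proof -
        have "real k * \<sigma>2 / (\<eta> * (e * real k))\<^sup>2 + real k * \<sigma>2 / (e * real k)\<^sup>2 = K4 / (e\<^sup>2 * real k)"
          using k by (simp add: K4_def power_mult_distrib power2_eq_square add_divide_distrib mult_ac)
        also have "\<dots> \<le> K4 / T" using ek T K40 by (intro divide_left_mono) auto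
        also have "\<dots> \<le> KK / T" using T by (intro divide_right_mono) (auto simp: KK_def)
        finally show ?thesis by simp
      qed
      then have "?J k * (1 - KK / T) \<le> ?J k * (1 - real k * \<sigma>2 / (\<eta> * (e * real k))\<^sup>2 - real k * \<sigma>2 / (e * real k)\<^sup>2)"
        using walk.xtail_nonneg by (intro mult_left_mono) auto
      also have "\<dots> \<le> hit k e"
        using walk.walk_tail_lower[OF x \<eta> k] unfolding hit_def by (simp add: mult.assoc)
      finally show ?thesis using False by (simp add: mult.commute)
    qed simp
    have js: "jpart n e (1 + \<eta>) - K5 * e powr (- \<theta>) * EZ n ?s \<le> EZ n ?j"
    proof -
      have "jpart n e (1 + \<eta>) \<le> EZ n (\<lambda>k. ?j k + (K5 * e powr (- \<theta>)) * ?s k)"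
        unfolding jpart_def
      proof (intro EZ_mono bd bdd_pos_add bdd_pos_cmult)
        fix k :: nat assume k: "0 < k"
        show "?J k \<le> ?j k + (K5 * e powr (- \<theta>)) * ?s k"
          using k_xtail_le[OF K(2) k e e1] by (simp add: K5_def)
      qed
      also have "\<dots> = EZ n ?j + (K5 * e powr (- \<theta>)) * EZ n ?s"
        by (simp only: EZ_add EZ_cmult bdd_pos_cmult bd)
      finally show ?thesis by simp
    qed
    have "K5 * e powr (- \<theta>) * EZ n ?s \<le> K5 * e powr (- \<theta>) * (C * (T / e\<^sup>2) powr (\<alpha> - (\<theta> - 1)) * m powr (- \<alpha> * real n))"
      unfolding EZ_def using K50 T e by (intro mult_left_mono C(2)) auto
    also have "\<dots> = K5 * C * T powr (\<alpha> - (\<theta> - 1)) * (e\<^sup>2 * m ^ n) powr (- (\<alpha> - (\<theta> - 1))) * Jsc n e"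
    proof -
      define \<gamma> where "\<gamma> = \<alpha> - (\<theta> - 1)"
      have "m powr (- \<alpha> * real n) = (m ^ n) powr (- \<gamma>) * m powr (- (\<theta> - 1) * real n)"
        using m_pos by (simp add: powr_realpow[symmetric] powr_powr powr_add[symmetric] \<gamma>_def algebra_simps)
      moreover have "(T / e\<^sup>2) powr \<gamma> = T powr \<gamma> * (e\<^sup>2) powr (- \<gamma>)"
        using e T by (simp add: powr_divide powr_minus_divide)
      ultimately show ?thesis unfolding \<gamma>_def[symmetric] Jsc_def by (simp add: powr_mult mult_ac)
    qed
    also have "\<dots> \<le> KK * T powr (\<alpha> - (\<theta> - 1)) * (e\<^sup>2 * m ^ n) powr (- (\<alpha> - (\<theta> - 1))) * Jsc n e"
      using Jsc_pos[OF e, of n] by (intro mult_right_mono) (auto simp: KK_def)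
    finally have "jpart n e (1 + \<eta>) - KK * T powr (\<alpha> - (\<theta> - 1)) * (e\<^sup>2 * m ^ n) powr (- (\<alpha> - (\<theta> - 1))) * Jsc n e \<le> EZ n ?j"
      using js by linarith
    then have "gpart n e T + (1 - KK / T) * (jpart n e (1 + \<eta>) - KK * T powr (\<alpha> - (\<theta> - 1)) * (e\<^sup>2 * m ^ n) powr (- (\<alpha> - (\<theta> - 1))) * Jsc n e)
      \<le> gpart n e T + (1 - KK / T) * EZ n ?j"
      using r0 by (intro add_left_mono mult_left_mono)
    also have "\<dots> = EZ n (\<lambda>k. ?g k + (1 - KK / T) * ?j k)"
      unfolding gpart_def by (simp only: EZ_add EZ_cmult bdd_pos_cmult bd)
    also have "\<dots> \<le> prob_R_ge M Z X n e"
      unfolding prob_R_eq_EZ by (intro EZ_mono bdd_hit bdd_pos_add bdd_pos_cmult bd pt)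
    finally show "gpart n e T + (1 - KK / T) * (jpart n e (1 + \<eta>) - KK * T powr (\<alpha> - (\<theta> - 1)) * (e\<^sup>2 * m ^ n) powr (- (\<alpha> - (\<theta> - 1))) * Jsc n e)
      \<le> prob_R_ge M Z X n e" .
  qed
qed

lemma gpart_le_prob_R: "gpart n e T \<le> prob_R_ge M Z X n e"
  unfolding gpart_def prob_R_eq_EZ using hit_range by (intro EZ_mono bdd_hit bdd_pos_if bdd_pos_const) auto

lemma gpart_bound: "\<exists>C>0. \<forall>n e T. 0 < e \<longrightarrow> 0 < T \<longrightarrow> gpart n e T \<le> C * T powr \<alpha> * Dsc n e"
proof -
  obtain C where C: "0 < C" "\<And>n x. 0 < x \<Longrightarrow> prob_Z_le n x \<le> C * (x / m ^ n) powr \<alpha>"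
    using small_Z_bound by blast
  have "gpart n e T \<le> C * T powr \<alpha> * Dsc n e" if "0 < e" "0 < T" for n e T
  proof -
    have "gpart n e T \<le> EZ n (\<lambda>k. if real k \<le> T / e\<^sup>2 then 1 else 0)"
      unfolding gpart_def using hit_range by (intro EZ_mono bdd_hit bdd_pos_if bdd_pos_const) auto
    then show ?thesis using prob_small_Z_scaled[OF C(2) that, of n] unfolding EZ_indicator by simp
  qed
  then show ?thesis using C(1) by blast
qed


text \<open>With \<open>Y = Z n / m ^ n\<close> and \<open>G x = x powr \<theta> * xtail x\<close>,
  the scaled summand is \<open>Y powr (- \<beta>) * G (b n * Y)\<close>, where \<open>Y\<close>
  tends to \<open>W\<close> and \<open>G\<close> tends to \<open>a\<close>. A dominating constant
  exists only for \<open>Y > \<eta>\<close>; the rest is small uniformly in \<open>n\<close> by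
  \<open>small_Z_moment_bound\<close>, and \<open>\<eta>\<close> tends to 0 last.\<close>

lemma jpart_tendsto:
  assumes int: "set_integrable lborel {0<..} (\<lambda>v. Phi v * v powr (\<theta> - 2))"
    and e: "\<And>n. 0 < e n" and em: "filterlim (\<lambda>n. e n * m ^ n) at_top sequentially" and c: "0 < c"
  shows "(\<lambda>n. jpart n (e n) c / Jsc n (e n)) \<longlonglongrightarrow> a * c powr (- \<theta>) * expectation (\<lambda>\<omega>. W \<omega> powr (- (\<theta> - 1)))"
proof -
  define \<beta> where "\<beta> = \<theta> - 1"
  have \<beta>: "1 < \<beta>" "\<beta> < \<alpha>" using beta_range by (auto simp: \<beta>_def)
  have q0: "q = 0" and Wint: "integrable M (\<lambda>\<omega>. W \<omega> powr (- \<beta>))"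
    using neg_moment_W(1,2)[of \<beta>] int \<beta> by (auto simp: \<beta>_def)
  have W_pos: "AE \<omega> in M. 0 < W \<omega>"
  proof -
    have "AE \<omega> in M. W \<omega> \<noteq> 0" using prob_W_0 q0 by (subst prob_Collect_eq_0[symmetric]) auto
    then show ?thesis using W_nonneg by eventually_elim auto
  qed
  obtain K where K: "0 < K" "\<And>x. 0 < x \<Longrightarrow> xtail x \<le> K * x powr (- \<theta>)" using xtail_bound by blast
  obtain C where C: "0 < C" "\<And>n x. 0 < x \<Longrightarrow> expectation (\<lambda>\<omega>. if Z n \<omega> = 0 then 0 else if real (Z n \<omega>) \<le> x then real (Z n \<omega>) powr (- \<beta>) else 0)
    \<le> C * x powr (\<alpha> - \<beta>) * m powr (- \<alpha> * real n)"
    using small_Z_moment_bound[of \<beta>] \<beta> by auto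
  define G where "G x = x powr \<theta> * xtail x" for x
  have G: "0 \<le> G x" "0 < x \<Longrightarrow> G x \<le> K" for x
  proof -
    show "0 \<le> G x" using walk.xtail_nonneg by (simp add: G_def)
    show "G x \<le> K" if "0 < x"
    proof -
      have "G x \<le> x powr \<theta> * (K * x powr (- \<theta>))" unfolding G_def using that by (intro mult_left_mono K(2)) auto
      then show ?thesis using that by (simp add: powr_minus field_simps)
    qed
  qed
  have xtail_m: "xtail \<in> borel_measurable borel"
  proof -
    have "mono (\<lambda>x. - xtail x)" by (auto intro!: monoI walk.xtail_antimono)
    then have "(\<lambda>x. - xtail x) \<in> borel_measurable borel" by (rule borel_measurable_mono)
    then show ?thesis by simp
  qed
  then have Gm [measurable]: "G \<in> borel_measurable borel" unfolding G_def by measurable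
  define b where "b n = c * (e n * m ^ n)" for n
  have b_top: "filterlim b at_top sequentially"
    unfolding b_def by (rule filterlim_tendsto_pos_mult_at_top[OF tendsto_const c em])
  have b_pos: "0 < b n" for n using c e m_pos by (simp add: b_def)
  let ?Y = "\<lambda>n \<omega>. real (Z n \<omega>) / m ^ n"
  define U where "U n \<eta> = expectation (\<lambda>\<omega>. if \<eta> < ?Y n \<omega> then ?Y n \<omega> powr (- \<beta>) * G (b n * ?Y n \<omega>) else 0)" for n \<eta>
  have term_eq: "real k * xtail (c * e n * real k) = c powr (- \<theta>) * Jsc n (e n) * ((real k / m ^ n) powr (- \<beta>) * G (b n * (real k / m ^ n)))"
    if k: "0 < k" for k n
  proof -
    have "b n * (real k / m ^ n) = c * e n * real k" using m_pos by (simp add: b_def)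
    then have "G (b n * (real k / m ^ n)) = c powr \<theta> * e n powr \<theta> * real k powr \<theta> * xtail (c * e n * real k)"
      using c e[of n] k by (simp add: G_def powr_mult)
    moreover have "(real k / m ^ n) powr (- \<beta>) = real k powr (- \<beta>) * m powr (\<beta> * real n)"
      using k m_pos by (simp add: powr_divide powr_realpow[symmetric] powr_powr powr_minus_divide mult.commute)
    moreover have "Jsc n (e n) = e n powr (- \<theta>) * m powr (- (\<beta> * real n))" by (simp only: Jsc_def \<beta>_def mult_minus_left)
    moreover have "real k powr (- \<beta>) * real k powr \<theta> = real k" using k by (simp add: powr_add[symmetric] \<beta>_def)
    moreover have "c powr (- \<theta>) * c powr \<theta> = 1" "e n powr (- \<theta>) * e n powr \<theta> = 1"
      "m powr (- (\<beta> * real n)) * m powr (\<beta> * real n) = 1"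
      using c e[of n] m_pos by (auto simp: powr_add[symmetric])
    moreover have "A * (B * D) * (E * D' * (A' * B' * E' * x)) = (A * A') * (B * B') * (D * D') * (E * E') * x"
      for A A' B B' D D' E E' x :: real by (simp only: mult_ac)
    ultimately show ?thesis by (simp only: mult_1_left)
  qed
  have split_le: "U n \<eta> \<le> jpart n (e n) c / (c powr (- \<theta>) * Jsc n (e n))"
    "jpart n (e n) c / (c powr (- \<theta>) * Jsc n (e n)) \<le> U n \<eta> + K * C * \<eta> powr (\<alpha> - \<beta>)" if \<eta>: "0 < \<eta>" for n \<eta>
  proof -
    let ?f = "\<lambda>k. (real k / m ^ n) powr (- \<beta>) * G (b n * (real k / m ^ n))"
    have cJ: "0 < c powr (- \<theta>) * Jsc n (e n)" using c Jsc_pos[OF e, of n n] by simp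
    have bdf: "bdd_pos ?f"
    proof (intro bdd_posI[of _ "(1 / m ^ n) powr (- \<beta>) * K"])
      fix k :: nat assume k: "0 < k"
      have "(real k / m ^ n) powr (- \<beta>) \<le> (1 / m ^ n) powr (- \<beta>)"
        using k m_pos \<beta> by (intro powr_mono2') (auto simp: divide_right_mono)
      then have "?f k \<le> (1 / m ^ n) powr (- \<beta>) * K"
        using G b_pos[of n] k m_pos by (intro mult_mono) auto
      then show "\<bar>?f k\<bar> \<le> (1 / m ^ n) powr (- \<beta>) * K" using G(1) by simp
    qed
    have "jpart n (e n) c = EZ n (\<lambda>k. (c powr (- \<theta>) * Jsc n (e n)) * ?f k)"
      unfolding jpart_def by (intro EZ_cong) (simp add: term_eq)
    then have jp: "jpart n (e n) c / (c powr (- \<theta>) * Jsc n (e n)) = EZ n ?f"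
      unfolding EZ_cmult using nonzero_mult_div_cancel_left[OF less_imp_neq[OF cJ, symmetric]] by (simp only:)
    have Ueq: "U n \<eta> = EZ n (\<lambda>k. if \<eta> < real k / m ^ n then ?f k else 0)"
      unfolding U_def EZ_def using \<eta> by (intro Bochner_Integration.integral_cong) auto
    show "U n \<eta> \<le> jpart n (e n) c / (c powr (- \<theta>) * Jsc n (e n))"
      unfolding jp Ueq using G(1) by (intro EZ_mono bdd_pos_if bdf bdd_pos_const) auto
    let ?s = "\<lambda>k. if real k \<le> \<eta> * m ^ n then real k powr (- \<beta>) else 0"
    have bds: "bdd_pos ?s" using \<beta> by (intro bdd_pos_if bdd_pos_powr bdd_pos_const) auto
    have "EZ n ?f \<le> EZ n (\<lambda>k. (if \<eta> < real k / m ^ n then ?f k else 0) + (K * m powr (\<beta> * real n)) * ?s k)"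
    proof (rule EZ_mono[OF bdf bdd_pos_add[OF bdd_pos_if[OF bdf bdd_pos_const] bdd_pos_cmult[OF bds]]])
      fix k :: nat assume k: "0 < k"
      show "?f k \<le> (if \<eta> < real k / m ^ n then ?f k else 0) + (K * m powr (\<beta> * real n)) * ?s k"
      proof (cases "\<eta> < real k / m ^ n")
        case False
        then have le: "real k \<le> \<eta> * m ^ n" using m_pos by (simp add: field_simps)
        have "(real k / m ^ n) powr (- \<beta>) = real k powr (- \<beta>) * m powr (\<beta> * real n)"
          using k m_pos by (simp add: powr_divide powr_realpow[symmetric] powr_powr powr_minus_divide mult.commute)
        moreover have "G (b n * (real k / m ^ n)) \<le> K" using b_pos[of n] k m_pos by (intro G(2)) simp
        ultimately have "?f k \<le> real k powr (- \<beta>) * m powr (\<beta> * real n) * K"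
          by (simp add: mult_left_mono)
        then show ?thesis using False le by (simp add: mult_ac)
      next
        case True
        then show ?thesis using K by auto
      qed
    qed
    also have "\<dots> = U n \<eta> + (K * m powr (\<beta> * real n)) * EZ n ?s"
      unfolding Ueq by (simp only: EZ_add[OF bdd_pos_if[OF bdf bdd_pos_const] bdd_pos_cmult[OF bds]] EZ_cmult)
    also have "(K * m powr (\<beta> * real n)) * EZ n ?s \<le> (K * m powr (\<beta> * real n)) * (C * (\<eta> * m ^ n) powr (\<alpha> - \<beta>) * m powr (- \<alpha> * real n))"
      unfolding EZ_def using K \<eta> m_pos by (intro mult_left_mono C(2)) auto
    also have "\<dots> = K * C * \<eta> powr (\<alpha> - \<beta>)"
    proof -
      have "(\<eta> * m ^ n) powr (\<alpha> - \<beta>) = \<eta> powr (\<alpha> - \<beta>) * m powr ((\<alpha> - \<beta>) * real n)"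
        using m_pos by (simp add: powr_mult powr_realpow[symmetric] powr_powr mult.commute)
      moreover have "m powr (\<beta> * real n) * (m powr ((\<alpha> - \<beta>) * real n) * m powr (- \<alpha> * real n)) = 1"
        using m_pos by (simp add: powr_add[symmetric]) (simp add: algebra_simps)
      moreover have "K * A * (C * (B * D) * E) = K * C * B * (A * (D * E))" for A B D E :: real by (simp only: mult_ac)
      ultimately show ?thesis by simp
    qed
    finally show "jpart n (e n) c / (c powr (- \<theta>) * Jsc n (e n)) \<le> U n \<eta> + K * C * \<eta> powr (\<alpha> - \<beta>)"
      unfolding jp by simp
  qed
  define V where "V \<eta> = expectation (\<lambda>\<omega>. if \<eta> < W \<omega> then W \<omega> powr (- \<beta>) * a else 0)" for \<eta>
  have U_lim: "(\<lambda>n. U n \<eta>) \<longlonglongrightarrow> V \<eta>" if \<eta>: "0 < \<eta>" for \<eta>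
    unfolding U_def V_def
  proof (rule integral_dominated_convergence[where w="\<lambda>_. \<eta> powr (- \<beta>) * K"])
    \<comment> \<open>The cut-off is discontinuous only at \<open>W = \<eta>\<close>, a null event
      because \<open>W\<close> has a density there.\<close>
    have "AE \<omega> in M. W \<omega> \<noteq> \<eta>" using prob_W_point[OF \<eta>] by (subst prob_Collect_eq_0[symmetric]) auto
    then show "AE \<omega> in M. (\<lambda>n. if \<eta> < ?Y n \<omega> then ?Y n \<omega> powr (- \<beta>) * G (b n * ?Y n \<omega>) else 0)
        \<longlonglongrightarrow> (if \<eta> < W \<omega> then W \<omega> powr (- \<beta>) * a else 0)"
      using W_lim W_pos
    proof eventually_elim
      case (elim \<omega>)
      show ?case
      proof (cases "\<eta> < W \<omega>")
        case True
        have ev: "\<forall>\<^sub>F n in sequentially. \<eta> < ?Y n \<omega>" by (rule order_tendstoD(1)[OF elim(2) True])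
        have "filterlim (\<lambda>n. ?Y n \<omega> * b n) at_top sequentially"
          by (rule filterlim_tendsto_pos_mult_at_top[OF elim(2) elim(3) b_top])
        then have "(\<lambda>n. G (b n * ?Y n \<omega>)) \<longlonglongrightarrow> a"
          unfolding G_def using filterlim_compose[OF xtail_scaled_tendsto] by (simp add: mult.commute)
        then have "(\<lambda>n. ?Y n \<omega> powr (- \<beta>) * G (b n * ?Y n \<omega>)) \<longlonglongrightarrow> W \<omega> powr (- \<beta>) * a"
          using elim by (intro tendsto_mult tendsto_powr tendsto_const) auto
        moreover have "\<forall>\<^sub>F n in sequentially. ?Y n \<omega> powr (- \<beta>) * G (b n * ?Y n \<omega>) =
            (if \<eta> < ?Y n \<omega> then ?Y n \<omega> powr (- \<beta>) * G (b n * ?Y n \<omega>) else 0)"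
          using ev by eventually_elim simp
        ultimately show ?thesis using True by (auto intro: Lim_transform_eventually)
      next
        case False
        then have lt: "W \<omega> < \<eta>" using elim by simp
        have "\<forall>\<^sub>F n in sequentially. (if \<eta> < ?Y n \<omega> then ?Y n \<omega> powr (- \<beta>) * G (b n * ?Y n \<omega>) else 0) = 0"
          using order_tendstoD(2)[OF elim(2) lt] by eventually_elim simp
        then show ?thesis using False by (auto intro: tendsto_eventually)
      qed
    qed
    show "AE \<omega> in M. norm (if \<eta> < ?Y n \<omega> then ?Y n \<omega> powr (- \<beta>) * G (b n * ?Y n \<omega>) else 0) \<le> \<eta> powr (- \<beta>) * K" for n
    proof (rule AE_I2)
      fix \<omega>
      show "norm (if \<eta> < ?Y n \<omega> then ?Y n \<omega> powr (- \<beta>) * G (b n * ?Y n \<omega>) else 0) \<le> \<eta> powr (- \<beta>) * K"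
      proof (cases "\<eta> < ?Y n \<omega>")
        case True
        have "?Y n \<omega> powr (- \<beta>) * G (b n * ?Y n \<omega>) \<le> \<eta> powr (- \<beta>) * K"
        proof (intro mult_mono)
          show "?Y n \<omega> powr (- \<beta>) \<le> \<eta> powr (- \<beta>)" using True \<eta> \<beta> by (intro powr_mono2') auto
          show "G (b n * ?Y n \<omega>) \<le> K"
          proof (rule G(2))
            have "0 < ?Y n \<omega>" using True \<eta> by linarith
            then show "0 < b n * ?Y n \<omega>" using b_pos[of n] by (rule mult_pos_pos[rotated])
          qed
        qed (use G(1) in auto)
        then show ?thesis using True G(1) by simp
      qed (use K in simp)
    qed
  qed measurable
  have V_lim: "(\<lambda>j. V (1 / real (Suc j))) \<longlonglongrightarrow> expectation (\<lambda>\<omega>. W \<omega> powr (- \<beta>) * a)"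
    unfolding V_def
  proof (rule integral_dominated_convergence[where w="\<lambda>\<omega>. W \<omega> powr (- \<beta>) * a"])
    show "AE \<omega> in M. (\<lambda>j. if 1 / real (Suc j) < W \<omega> then W \<omega> powr (- \<beta>) * a else 0) \<longlonglongrightarrow> W \<omega> powr (- \<beta>) * a"
      using W_pos
    proof eventually_elim
      case (elim \<omega>)
      have "\<forall>\<^sub>F j in sequentially. 1 / real (Suc j) < W \<omega>"
        by (rule order_tendstoD(2)[OF LIMSEQ_Suc[OF lim_const_over_n[of 1]] elim])
      then have "\<forall>\<^sub>F j in sequentially. (if 1 / real (Suc j) < W \<omega> then W \<omega> powr (- \<beta>) * a else 0) = W \<omega> powr (- \<beta>) * a"
        by eventually_elim simp
      then show ?case by (rule tendsto_eventually)
    qed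
    show "integrable M (\<lambda>\<omega>. W \<omega> powr (- \<beta>) * a)" using Wint by simp
    show "AE \<omega> in M. norm (if 1 / real (Suc j) < W \<omega> then W \<omega> powr (- \<beta>) * a else 0) \<le> W \<omega> powr (- \<beta>) * a" for j
      using a_pos by (intro AE_I2) auto
  qed measurable
  define E where "E = expectation (\<lambda>\<omega>. W \<omega> powr (- \<beta>) * a)"
  have "(\<lambda>n. jpart n (e n) c / (c powr (- \<theta>) * Jsc n (e n))) \<longlonglongrightarrow> E"
  proof (rule tendstoI)
    fix d :: real assume d: "0 < d"
    have "(\<lambda>j. K * C * (1 / real (Suc j)) powr (\<alpha> - \<beta>)) \<longlonglongrightarrow> K * C * 0 powr (\<alpha> - \<beta>)"
      using \<beta> by (intro tendsto_mult tendsto_const tendsto_powr'[OF LIMSEQ_Suc[OF lim_const_over_n[of 1]] tendsto_const]) auto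
    then have "\<forall>\<^sub>F j in sequentially. K * C * (1 / real (Suc j)) powr (\<alpha> - \<beta>) < d / 3"
      by (rule order_tendstoD(2)) (use d \<beta> in simp)
    moreover have "\<forall>\<^sub>F j in sequentially. dist (V (1 / real (Suc j))) E < d / 3"
      using V_lim d unfolding E_def by (intro tendstoD) auto
    ultimately have "\<forall>\<^sub>F j in sequentially. K * C * (1 / real (Suc j)) powr (\<alpha> - \<beta>) < d / 3 \<and> dist (V (1 / real (Suc j))) E < d / 3"
      by eventually_elim auto
    then obtain j where j: "K * C * (1 / real (Suc j)) powr (\<alpha> - \<beta>) < d / 3" "dist (V (1 / real (Suc j))) E < d / 3"
      by (auto dest: eventually_happens)
    define \<eta> where "\<eta> = 1 / real (Suc j)"
    have \<eta>: "0 < \<eta>" by (simp add: \<eta>_def)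
    have "\<forall>\<^sub>F n in sequentially. dist (U n \<eta>) (V \<eta>) < d / 3" using U_lim[OF \<eta>] d by (intro tendstoD) auto
    then show "\<forall>\<^sub>F n in sequentially. dist (jpart n (e n) c / (c powr (- \<theta>) * Jsc n (e n))) E < d"
    proof eventually_elim
      case (elim n)
      have "K * C * \<eta> powr (\<alpha> - \<beta>) < d / 3" "dist (V \<eta>) E < d / 3" using j by (simp_all add: \<eta>_def)
      then show ?case using elim split_le[OF \<eta>, of n] unfolding dist_real_def abs_less_iff by linarith
    qed
  qed
  then have "(\<lambda>n. c powr (- \<theta>) * (jpart n (e n) c / (c powr (- \<theta>) * Jsc n (e n)))) \<longlonglongrightarrow> c powr (- \<theta>) * E"
    by (intro tendsto_mult tendsto_const)
  moreover have "c powr (- \<theta>) * (jpart n (e n) c / (c powr (- \<theta>) * Jsc n (e n))) = jpart n (e n) c / Jsc n (e n)" for n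
    using c by simp
  moreover have "c powr (- \<theta>) * E = a * c powr (- \<theta>) * expectation (\<lambda>\<omega>. W \<omega> powr (- (\<theta> - 1)))"
    by (simp add: E_def \<beta>_def)
  ultimately show ?thesis by simp
qed

text \<open>With N standard normal, P(N \<le> - e sqrt k / \<sigma>) integrated over the lower tail of Z n becomes, by
  Fubini, the half moment of \<sigma>2 N^2, truncated at T; momt is its limit, that is \<alpha> times the constant \<Gamma>\<alpha>.\<close>

definition mom :: "real \<Rightarrow> real" where
  "mom T = (\<integral>x. indicator {..0} x * (min T (\<sigma>2 * x\<^sup>2)) powr \<alpha> \<partial>std_normal_distribution)"

definition momt :: real where
  "momt = 2 powr (\<alpha> - 1) * Gamma (\<alpha> + 1/2) / sqrt pi * \<sigma>2 powr \<alpha>"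

lemma mom_int: "0 < T \<Longrightarrow> integrable std_normal_distribution (\<lambda>x. indicator {..0} x * (min T (\<sigma>2 * x\<^sup>2)) powr \<alpha>)"
proof -
  assume T: "0 < T"
  interpret N: real_distribution std_normal_distribution by (rule real_dist_normal_dist)
  show ?thesis
  proof (rule N.integrable_const_bound[where B="T powr \<alpha>"])
    show "AE x in std_normal_distribution. norm (indicator {..0} x * (min T (\<sigma>2 * x\<^sup>2)) powr \<alpha>) \<le> T powr \<alpha>"
      using T s2_pos alpha_gt_1 by (intro AE_I2) (auto simp: indicator_def intro!: powr_mono2)
  qed measurable
qed

lemma momt_eq: "momt = (\<integral>x. indicator {..0} x * (\<sigma>2 * x\<^sup>2) powr \<alpha> \<partial>std_normal_distribution)"
  unfolding momt_def using gaussian_half_moment(2)[of \<alpha> \<sigma>2] alpha_gt_1 s2_pos by simp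

lemma mom_le: "0 < T \<Longrightarrow> mom T \<le> momt"
  unfolding mom_def momt_eq
  by (intro integral_mono mom_int gaussian_half_moment(1))
     (use alpha_gt_1 s2_pos in \<open>auto simp: indicator_def intro!: powr_mono2\<close>)

lemma mom_tendsto: "(\<lambda>j. mom (real (Suc j))) \<longlonglongrightarrow> momt"
  unfolding mom_def momt_eq
proof (rule integral_dominated_convergence[where w="\<lambda>x. indicator {..0} x * (\<sigma>2 * x\<^sup>2) powr \<alpha>"])
  show "AE x in std_normal_distribution. (\<lambda>j. indicator {..0} x * (min (real (Suc j)) (\<sigma>2 * x\<^sup>2)) powr \<alpha>) \<longlonglongrightarrow> indicator {..0} x * (\<sigma>2 * x\<^sup>2) powr \<alpha>"
  proof (rule AE_I2)
    fix x :: real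
    obtain N :: nat where N: "\<sigma>2 * x\<^sup>2 \<le> real N" using real_arch_simple by blast
    have "\<forall>\<^sub>F j in sequentially. indicator {..0} x * (min (real (Suc j)) (\<sigma>2 * x\<^sup>2)) powr \<alpha> = indicator {..0} x * (\<sigma>2 * x\<^sup>2) powr \<alpha>"
      using eventually_ge_at_top[of N]
    proof eventually_elim
      case (elim j)
      then have "\<sigma>2 * x\<^sup>2 \<le> real (Suc j)" using N by linarith
      then show ?case by (simp add: min_absorb2 del: of_nat_Suc)
    qed
    then show "(\<lambda>j. indicator {..0} x * (min (real (Suc j)) (\<sigma>2 * x\<^sup>2)) powr \<alpha>) \<longlonglongrightarrow> indicator {..0} x * (\<sigma>2 * x\<^sup>2) powr \<alpha>"
      by (rule tendsto_eventually)
  qed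
  show "AE x in std_normal_distribution. norm (indicator {..0} x * (min (real (Suc j)) (\<sigma>2 * x\<^sup>2)) powr \<alpha>) \<le> indicator {..0} x * (\<sigma>2 * x\<^sup>2) powr \<alpha>" for j
    using alpha_gt_1 s2_pos by (intro AE_I2) (auto simp: indicator_def intro!: powr_mono2)
qed (use gaussian_half_moment(1)[of \<alpha> \<sigma>2] alpha_gt_1 s2_pos in auto)

text \<open>The quantity \<open>gpart\<close> with the walk replaced by its central limit
  approximation.\<close>

definition gsum :: "nat \<Rightarrow> real \<Rightarrow> real \<Rightarrow> real" where
  "gsum n e T = EZ n (\<lambda>k. if real k \<le> T / e\<^sup>2 then cdf std_normal_distribution (- (e * sqrt (real k) / sqrt \<sigma>2)) else 0)"

text \<open>For \<open>k\<close> beyond \<open>k1\<close> the uniform central limit theorem has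
  error at most \<open>\<eta>\<close>. Shorter walks come from populations of bounded size, whose
  probability is a vanishing multiple of \<open>Dsc\<close> since \<open>e\<close> tends to
  0.\<close>

lemma gpart_gsum:
  assumes e: "\<And>n. 0 < e n" and e0: "e \<longlonglongrightarrow> 0" and T: "0 < T" and d: "0 < d"
  shows "\<forall>\<^sub>F n in sequentially. \<bar>gpart n (e n) T - gsum n (e n) T\<bar> \<le> d * Dsc n (e n)"
proof -
  interpret N: real_distribution std_normal_distribution by (rule real_dist_normal_dist)
  obtain C where C: "0 < C" "\<And>n x. 0 < x \<Longrightarrow> prob_Z_le n x \<le> C * (x / m ^ n) powr \<alpha>"
    using small_Z_bound by blast
  let ?G = "\<lambda>k (e::real). cdf std_normal_distribution (- (e * sqrt (real k) / sqrt \<sigma>2))"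
  \<comment> \<open>Chosen so that \<open>\<eta>\<close> times the bound for
    \<open>P(0 < Z n \<le> T / e\<^sup>2)\<close> is \<open>d / 2 * Dsc\<close>.\<close>
  define \<eta> where "\<eta> = d / (2 * (C * T powr \<alpha>))"
  have \<eta>: "0 < \<eta>" using d C T by (simp add: \<eta>_def)
  obtain k0 where k0: "\<And>k x. k0 \<le> k \<Longrightarrow> \<bar>\<P>(\<omega> in M. x * sqrt (real k * \<sigma>2) \<le> walk.Sm k \<omega>) - cdf std_normal_distribution (- x)\<bar> \<le> \<eta>"
    using walk.uniform_clt[OF \<eta>] unfolding eventually_sequentially by blast
  define k1 where "k1 = Suc k0"
  have G01: "0 \<le> ?G k e" "?G k e \<le> 1" for k e using N.cdf_nonneg N.cdf_bounded_prob by auto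
  have diff1: "\<bar>hit k e' - ?G k e'\<bar> \<le> \<eta> + (if real k \<le> real k1 then 1 else 0)" if k: "0 < k" for k e'
  proof (cases "k \<le> k1")
    case True
    have "\<bar>hit k e' - ?G k e'\<bar> \<le> 1" using hit_range[of k e'] G01[of e' k] by linarith
    then show ?thesis using True \<eta> by simp
  next
    case False
    have "e' * sqrt (real k) / sqrt \<sigma>2 * sqrt (real k * \<sigma>2) = e' * real k"
      using s2_pos k by (simp add: real_sqrt_mult)
    then have "hit k e' = \<P>(\<omega> in M. (e' * sqrt (real k) / sqrt \<sigma>2) * sqrt (real k * \<sigma>2) \<le> walk.Sm k \<omega>)"
      by (simp only: hit_def)
    then show ?thesis using k0[of k "e' * sqrt (real k) / sqrt \<sigma>2"] False by (simp add: k1_def)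
  qed
  have "(\<lambda>n. C * (real k1 * (e n)\<^sup>2) powr \<alpha>) \<longlonglongrightarrow> C * (real k1 * 0\<^sup>2) powr \<alpha>"
    using alpha_gt_1 by (intro tendsto_mult tendsto_const tendsto_powr'[OF tendsto_mult[OF tendsto_const tendsto_power[OF e0]] tendsto_const]) auto
  then have "\<forall>\<^sub>F n in sequentially. C * (real k1 * (e n)\<^sup>2) powr \<alpha> < d / 2"
    by (rule order_tendstoD(2)) (use d alpha_gt_1 in simp)
  then show ?thesis
  proof eventually_elim
    case (elim n)
    let ?g = "\<lambda>k. if real k \<le> T / (e n)\<^sup>2 then hit k (e n) else 0"
    let ?c = "\<lambda>k. if real k \<le> T / (e n)\<^sup>2 then ?G k (e n) else 0"
    let ?i = "\<lambda>x k. if real k \<le> x then 1 else (0::real)"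
    have bd: "bdd_pos ?g" "bdd_pos ?c" "bdd_pos (?i x)" for x
      using bdd_hit bdd_pos_const by (auto intro!: bdd_pos_if bdd_posI[of "\<lambda>k. ?G k (e n)" 1] simp: abs_le_iff)
        (use G01 in \<open>auto intro: order_trans[OF _ G01(1)]\<close>)
    let ?r = "\<lambda>k. \<eta> * ?i (T / (e n)\<^sup>2) k + ?i (real k1) k"
    have "gpart n (e n) T \<le> EZ n (\<lambda>k. ?c k + ?r k)"
      unfolding gpart_def
    proof (intro EZ_mono bd bdd_pos_add bdd_pos_cmult)
      fix k :: nat assume k: "0 < k"
      show "?g k \<le> ?c k + ?r k" using diff1[OF k, of "e n"] \<eta> by (auto split: if_splits)
    qed
    moreover have "gsum n (e n) T \<le> EZ n (\<lambda>k. ?g k + ?r k)"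
      unfolding gsum_def
    proof (intro EZ_mono bd bdd_pos_add bdd_pos_cmult)
      fix k :: nat assume k: "0 < k"
      show "?c k \<le> ?g k + ?r k" using diff1[OF k, of "e n"] \<eta> by (auto split: if_splits)
    qed
    moreover have "EZ n (\<lambda>k. ?c k + ?r k) = gsum n (e n) T + EZ n ?r" "EZ n (\<lambda>k. ?g k + ?r k) = gpart n (e n) T + EZ n ?r"
      unfolding gsum_def gpart_def by (intro EZ_add bd bdd_pos_add bdd_pos_cmult)+
    moreover have "EZ n ?r \<le> d * Dsc n (e n)"
    proof -
      have "EZ n ?r = \<eta> * EZ n (?i (T / (e n)\<^sup>2)) + EZ n (?i (real k1))"
        by (simp only: EZ_add[OF bdd_pos_cmult[OF bd(3)] bd(3)] EZ_cmult)
      also have "EZ n (?i (T / (e n)\<^sup>2)) \<le> C * T powr \<alpha> * Dsc n (e n)"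
        unfolding EZ_indicator by (rule prob_small_Z_scaled[OF C(2) e T])
      also have "EZ n (?i (real k1)) \<le> C * (real k1 * (e n)\<^sup>2) powr \<alpha> * Dsc n (e n)"
      proof -
        have "real k1 = real k1 * (e n)\<^sup>2 / (e n)\<^sup>2" using e[of n] by simp
        then show ?thesis unfolding EZ_indicator
          using prob_small_Z_scaled[OF C(2) e[of n], of "real k1 * (e n)\<^sup>2" n] e[of n] by (simp add: k1_def del: of_nat_Suc)
      qed
      also have "\<dots> \<le> d / 2 * Dsc n (e n)"
        using elim Dsc_pos[OF e, of n n] by (intro mult_right_mono) auto
      also have "\<eta> * (C * T powr \<alpha> * Dsc n (e n)) = d / 2 * Dsc n (e n)"
        using C T by (simp add: \<eta>_def)
      finally show ?thesis using \<eta> by simp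
    qed
    ultimately show ?case by linarith
  qed
qed

text \<open>Write the normal distribution function as an integral over an independent variable
  \<open>x\<close> and solve \<open>x \<le> - e * sqrt k / sqrt \<sigma>2\<close> for
  \<open>k\<close>: after Fubini only the lower tail of \<open>Z n\<close> remains.\<close>

lemma gsum_eq:
  assumes e: "0 < e" and T: "0 < T"
  shows "gsum n e T = (\<integral>x. indicator {..0} x * prob_Z_le n (min T (\<sigma>2 * x\<^sup>2) / e\<^sup>2) \<partial>std_normal_distribution)"
proof -
  let ?N = std_normal_distribution
  interpret N: real_distribution ?N by (rule real_dist_normal_dist)
  interpret P: pair_prob_space M ?N ..
  define h where "h \<omega> x = (if 0 < Z n \<omega> \<and> real (Z n \<omega>) \<le> T / e\<^sup>2 \<and> x \<le> - (e * sqrt (real (Z n \<omega>)) / sqrt \<sigma>2) then 1 else 0 :: real)" for \<omega> x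
  have hint: "integrable (M \<Otimes>\<^sub>M ?N) (case_prod h)"
    by (rule P.integrable_const_bound[where B=1]) (auto simp: h_def[abs_def])
  have inner1: "(\<integral>x. h \<omega> x \<partial>?N) = (if Z n \<omega> = 0 then 0 else if real (Z n \<omega>) \<le> T / e\<^sup>2 then cdf ?N (- (e * sqrt (real (Z n \<omega>)) / sqrt \<sigma>2)) else 0)" for \<omega>
  proof (cases "0 < Z n \<omega> \<and> real (Z n \<omega>) \<le> T / e\<^sup>2")
    case True
    then have "(\<integral>x. h \<omega> x \<partial>?N) = (\<integral>x. indicator {..- (e * sqrt (real (Z n \<omega>)) / sqrt \<sigma>2)} x *\<^sub>R (1::real) \<partial>?N)"
      by (intro Bochner_Integration.integral_cong) (auto simp: h_def indicator_def)
    also have "\<dots> = cdf ?N (- (e * sqrt (real (Z n \<omega>)) / sqrt \<sigma>2))"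
      by (subst N.integral_indicator_scaleR) (auto simp: cdf_def)
    finally show ?thesis using True by simp
  qed (auto simp: h_def)
  have inner2: "(\<integral>\<omega>. h \<omega> x \<partial>M) = indicator {..0} x * prob_Z_le n (min T (\<sigma>2 * x\<^sup>2) / e\<^sup>2)" for x
  proof -
    have eqv: "(x \<le> - (e * sqrt k / sqrt \<sigma>2)) \<longleftrightarrow> x \<le> 0 \<and> k \<le> \<sigma>2 * x\<^sup>2 / e\<^sup>2" if k: "0 < k" for k
    proof -
      have pos: "0 < e * sqrt k / sqrt \<sigma>2" using e k s2_pos by simp
      have "(x \<le> - (e * sqrt k / sqrt \<sigma>2)) \<longleftrightarrow> x \<le> 0 \<and> e * sqrt k / sqrt \<sigma>2 \<le> - x" using pos by auto
      also have "\<dots> \<longleftrightarrow> x \<le> 0 \<and> (e * sqrt k / sqrt \<sigma>2)\<^sup>2 \<le> x\<^sup>2"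
        using pos abs_le_square_iff[of "e * sqrt k / sqrt \<sigma>2" x] by linarith
      also have "(e * sqrt k / sqrt \<sigma>2)\<^sup>2 = e\<^sup>2 * k / \<sigma>2"
        using k s2_pos by (simp add: power_divide power_mult_distrib)
      also have "e\<^sup>2 * k / \<sigma>2 \<le> x\<^sup>2 \<longleftrightarrow> k \<le> \<sigma>2 * x\<^sup>2 / e\<^sup>2"
        using e s2_pos by (simp add: field_simps)
      finally show ?thesis .
    qed
    have mn: "min T (\<sigma>2 * x\<^sup>2) / e\<^sup>2 = min (T / e\<^sup>2) (\<sigma>2 * x\<^sup>2 / e\<^sup>2)"
      using e by (simp add: min_divide_distrib_right)
    have "(\<integral>\<omega>. h \<omega> x \<partial>M) = (\<integral>\<omega>. indicator {\<omega>\<in>space M. 0 < Z n \<omega> \<and> real (Z n \<omega>) \<le> min T (\<sigma>2 * x\<^sup>2) / e\<^sup>2} \<omega> *\<^sub>R (indicator {..0} x :: real) \<partial>M)"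
      unfolding mn
    proof (intro Bochner_Integration.integral_cong refl)
      fix \<omega> assume "\<omega> \<in> space M"
      then show "h \<omega> x = indicator {\<omega>\<in>space M. 0 < Z n \<omega> \<and> real (Z n \<omega>) \<le> min (T / e\<^sup>2) (\<sigma>2 * x\<^sup>2 / e\<^sup>2)} \<omega> *\<^sub>R (indicator {..0} x :: real)"
        using eqv[of "real (Z n \<omega>)"] by (auto simp: h_def indicator_def)
    qed
    then show ?thesis by (subst (asm) integral_indicator_scaleR) auto
  qed
  have "gsum n e T = (\<integral>\<omega>. (\<integral>x. h \<omega> x \<partial>?N) \<partial>M)" unfolding gsum_def EZ_def inner1 ..
  also have "\<dots> = (\<integral>x. (\<integral>\<omega>. h \<omega> x \<partial>M) \<partial>?N)" by (rule P.Fubini_integral[symmetric, OF hint])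
  finally show ?thesis unfolding inner2 .
qed

end

text \<open>A one-sided dominated convergence: it applies to the positive part of
  \<open>g n - f\<close>, which tends to 0. The two-sided version would require convergence, whereas
  an oscillating density only provides bounds from one side.\<close>

lemma (in prob_space) eventually_expectation_le:
  fixes f :: "'a \<Rightarrow> real"
  assumes g: "\<And>n. integrable M (g n)" and f: "integrable M f"
    and bd: "\<And>n x. x \<in> space M \<Longrightarrow> g n x \<le> f x + B"
    and pt: "\<And>x d. x \<in> space M \<Longrightarrow> 0 < d \<Longrightarrow> \<forall>\<^sub>F n in sequentially. g n x \<le> f x + d"
    and d: "0 < d"
  shows "\<forall>\<^sub>F n in sequentially. expectation (g n) \<le> expectation f + d"
proof -
  define r where "r n x = max 0 (g n x - f x)" for n x
  have rm [measurable]: "r n \<in> borel_measurable M" for n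
    unfolding r_def using g[of n] f by measurable
  have r_le: "norm (r n x) \<le> max 0 B" if "x \<in> space M" for n x using bd[OF that, of n] by (auto simp: r_def)
  have r_int: "integrable M (r n)" for n by (rule integrable_const_bound[OF AE_I2[OF r_le] rm])
  have "(\<lambda>n. expectation (r n)) \<longlonglongrightarrow> expectation (\<lambda>_. 0)"
  proof (rule integral_dominated_convergence[where w="\<lambda>_. max 0 B"])
    show "AE x in M. (\<lambda>n. r n x) \<longlonglongrightarrow> 0"
    proof (intro AE_I2 tendstoI)
      fix x and e :: real assume x: "x \<in> space M" and e: "0 < e"
      have "\<forall>\<^sub>F n in sequentially. g n x \<le> f x + e / 2" using pt[OF x, of "e / 2"] e by simp
      then show "\<forall>\<^sub>F n in sequentially. dist (r n x) 0 < e"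
        by eventually_elim (use e in \<open>auto simp: r_def\<close>)
    qed
  qed (use r_le in \<open>auto intro: AE_I2\<close>)
  then have "\<forall>\<^sub>F n in sequentially. expectation (r n) < d" by (rule order_tendstoD(2)) (use d in simp)
  then show ?thesis
  proof eventually_elim
    case (elim n)
    have "expectation (g n) \<le> expectation (\<lambda>x. f x + r n x)"
      using g f r_int by (intro integral_mono) (auto simp: r_def)
    also have "\<dots> = expectation f + expectation (r n)" by (rule Bochner_Integration.integral_add[OF f r_int])
    finally show ?case using elim by simp
  qed
qed

context gw_walk
begin

lemma gsum_scaled:
  assumes T: "0 < T"
  defines "s \<equiv> \<lambda>x. min T (\<sigma>2 * x\<^sup>2)"
  assumes e: "0 < e n"
  shows "gsum n (e n) T / Dsc n (e n) = (\<integral>x. indicator {..0} x * prob_Z_le n (s x / (e n)\<^sup>2) / Dsc n (e n) \<partial>std_normal_distribution)"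
    and "integrable std_normal_distribution (\<lambda>x. indicator {..0} x * prob_Z_le n (s x / (e n)\<^sup>2) / Dsc n (e n))"
proof -
  interpret N: real_distribution std_normal_distribution by (rule real_dist_normal_dist)
  define H where "H y = prob_Z_le n y" for y
  have "mono H" unfolding H_def by (intro monoI finite_measure_mono) auto
  then have [measurable]: "H \<in> borel_measurable borel" by (rule borel_measurable_mono)
  have "integrable std_normal_distribution (\<lambda>x. indicator {..0} x * H (s x / (e n)\<^sup>2))"
    by (rule N.integrable_const_bound[where B=1]) (auto simp: s_def indicator_def H_def[symmetric] intro!: AE_I2, auto simp: H_def)
  then show "integrable std_normal_distribution (\<lambda>x. indicator {..0} x * prob_Z_le n (s x / (e n)\<^sup>2) / Dsc n (e n))"
    unfolding H_def by (rule integrable_divide)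
  show "gsum n (e n) T / Dsc n (e n) = (\<integral>x. indicator {..0} x * prob_Z_le n (s x / (e n)\<^sup>2) / Dsc n (e n) \<partial>std_normal_distribution)"
    unfolding gsum_eq[OF e T] s_def by simp
qed

lemma Dsc_inverse_scale: "0 < e \<Longrightarrow> 0 < s \<Longrightarrow> (s / e\<^sup>2 / m ^ n) powr \<alpha> = s powr \<alpha> * Dsc n e"
  using m_pos by (simp add: Dsc_def powr_divide powr_minus_divide)

lemma window_limits:
  assumes e: "\<And>n. 0 < e n" and e0: "e \<longlonglongrightarrow> 0" and emn: "filterlim (\<lambda>n. (e n)\<^sup>2 * m ^ n) at_top sequentially"
    and s: "0 < s"
  shows "filterlim (\<lambda>n. s / (e n)\<^sup>2) at_top sequentially" and "(\<lambda>n. s / (e n)\<^sup>2 / m ^ n) \<longlonglongrightarrow> 0"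
proof -
  have "filterlim (\<lambda>n. (e n)\<^sup>2) (at_right 0) sequentially"
    unfolding filterlim_at_right_to_0 using tendsto_power[OF e0, of 2] e
    by (auto simp: filterlim_at less_imp_neq[symmetric] intro!: always_eventually)
  then show "filterlim (\<lambda>n. s / (e n)\<^sup>2) at_top sequentially"
    unfolding divide_inverse
    by (intro filterlim_tendsto_pos_mult_at_top[OF tendsto_const s] filterlim_compose[OF filterlim_inverse_at_top_right])
  have "(\<lambda>n. s / ((e n)\<^sup>2 * m ^ n)) \<longlonglongrightarrow> 0"
    by (rule tendsto_divide_0[OF tendsto_const filterlim_at_top_imp_at_infinity[OF emn]])
  then show "(\<lambda>n. s / (e n)\<^sup>2 / m ^ n) \<longlonglongrightarrow> 0" by (simp add: divide_divide_eq_left)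
qed

text \<open>For each fixed Gaussian value \<open>x\<close> the window \<open>s x / e\<^sup>2\<close>
  tends to infinity but is small compared with \<open>m ^ n\<close>, so
  \<open>Z_lower_tail_upper\<close> applies. The truncation at \<open>T\<close> supplies the bound
  that is uniform in \<open>x\<close>.\<close>

lemma gpart_upper:
  assumes e: "\<And>n. 0 < e n" and e0: "e \<longlonglongrightarrow> 0" and emn: "filterlim (\<lambda>n. (e n)\<^sup>2 * m ^ n) at_top sequentially"
    and v0: "0 \<le> v" and v: "\<forall>\<^sub>F u in at_right 0. prob_W_le u \<le> v * u powr \<alpha>"
    and T: "0 < T" and d: "0 < d"
  shows "\<forall>\<^sub>F n in sequentially. gpart n (e n) T \<le> (v * mom T + d) * Dsc n (e n)"
proof -
  interpret N: real_distribution std_normal_distribution by (rule real_dist_normal_dist)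
  define s where "s x = min T (\<sigma>2 * x\<^sup>2)" for x
  let ?g = "\<lambda>n x. indicator {..0} x * prob_Z_le n (s x / (e n)\<^sup>2) / Dsc n (e n)"
  let ?f = "\<lambda>x. v * (indicator {..0} x * s x powr \<alpha>)"
  obtain C where C: "0 < C" "\<And>n x. 0 < x \<Longrightarrow> prob_Z_le n x \<le> C * (x / m ^ n) powr \<alpha>"
    using small_Z_bound by blast
  have s0: "0 \<le> s x" for x using T s2_pos by (simp add: s_def)
  have zero: "?g n x = 0" if "s x = 0 \<or> 0 < x" for n x
  proof -
    have "{\<omega>\<in>space M. 0 < Z n \<omega> \<and> real (Z n \<omega>) \<le> s x / (e n)\<^sup>2} = {}" if "s x = 0" using that by auto
    then show ?thesis using that by (elim disjE) (simp_all only: measure_empty, auto)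
  qed
  have "\<forall>\<^sub>F n in sequentially. N.expectation (?g n) \<le> N.expectation ?f + d / 2"
  proof (rule N.eventually_expectation_le[where B="C * T powr \<alpha>"])
    show "integrable std_normal_distribution (?g n)" for n
      using gsum_scaled(2)[where e=e, OF T e] by (simp add: s_def)
    show "integrable std_normal_distribution ?f" unfolding s_def by (intro integrable_mult_right mom_int T)
    show "?g n x \<le> ?f x + C * T powr \<alpha>" for n x
    proof (cases "s x = 0 \<or> 0 < x")
      case True
      have "0 \<le> ?f x" using v0 by simp
      then show ?thesis unfolding zero[OF True] using C(1) by simp
    next
      case False
      then have sx: "0 < s x" using s0[of x] by linarith
      have "prob_Z_le n (s x / (e n)\<^sup>2) \<le> C * s x powr \<alpha> * Dsc n (e n)"
        by (rule prob_small_Z_scaled[OF C(2) e sx])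
      then have "?g n x \<le> C * s x powr \<alpha>" using False Dsc_pos[OF e, of n n] by (simp add: divide_le_eq)
      also have "\<dots> \<le> C * T powr \<alpha>" using C(1) sx alpha_gt_1 by (intro mult_left_mono powr_mono2) (auto simp: s_def)
      finally have "?g n x \<le> C * T powr \<alpha>" .
      moreover have "0 \<le> ?f x" using v0 by simp
      ultimately show ?thesis by linarith
    qed
    show "\<forall>\<^sub>F n in sequentially. ?g n x \<le> ?f x + d'" if d': "0 < d'" for x d'
    proof (cases "s x = 0 \<or> 0 < x")
      case True
      have "0 \<le> ?f x" using v0 by simp
      then have "0 \<le> ?f x + d'" using d' by linarith
      then show ?thesis unfolding zero[OF True] by (intro always_eventually allI)
    next
      case False
      then have sx: "0 < s x" using s0[of x] by linarith
      have "\<forall>\<^sub>F n in sequentially. prob_Z_le n (s x / (e n)\<^sup>2) \<le> (v + d' / s x powr \<alpha>) * (s x / (e n)\<^sup>2 / m ^ n) powr \<alpha>"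
        using sx d' by (intro Z_lower_tail_upper[OF window_limits[OF e e0 emn sx] v]) simp
      then show ?thesis
      proof eventually_elim
        case (elim n)
        have "prob_Z_le n (s x / (e n)\<^sup>2) \<le> (v * s x powr \<alpha> + d') * Dsc n (e n)"
        proof -
          have "(v + d' / s x powr \<alpha>) * (s x powr \<alpha> * Dsc n (e n)) = (v * s x powr \<alpha> + d') * Dsc n (e n)"
            using sx by (simp add: field_simps)
          then show ?thesis using elim unfolding Dsc_inverse_scale[OF e sx] by (simp only:)
        qed
        then show ?case using False Dsc_pos[OF e, of n n] by (simp add: divide_le_eq)
      qed
    qed
  qed (use d in simp)
  moreover have "N.expectation ?f = v * mom T" by (simp add: mom_def s_def)
  ultimately have "\<forall>\<^sub>F n in sequentially. gsum n (e n) T / Dsc n (e n) \<le> v * mom T + d / 2"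
    unfolding s_def gsum_scaled(1)[where e=e, OF T e] by (simp only:)
  moreover have "\<forall>\<^sub>F n in sequentially. \<bar>gpart n (e n) T - gsum n (e n) T\<bar> \<le> d / 2 * Dsc n (e n)"
    using d by (intro gpart_gsum e e0 T) simp
  ultimately show ?thesis
  proof eventually_elim
    case (elim n)
    have "gsum n (e n) T \<le> (v * mom T + d / 2) * Dsc n (e n)"
      using elim(1) Dsc_pos[OF e, of n n] by (simp add: divide_le_eq)
    moreover have "gpart n (e n) T - gsum n (e n) T \<le> d / 2 * Dsc n (e n)" "gsum n (e n) T - gpart n (e n) T \<le> d / 2 * Dsc n (e n)"
      using elim(2) by linarith+
    ultimately show ?case by (simp add: algebra_simps)
  qed
qed

text \<open>The counterpart of \<open>gpart_upper\<close>: \<open>eventually_expectation_le\<close>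
  is applied to the negated functions, and domination is immediate because the scaled probabilities
  are nonnegative.\<close>

lemma gpart_lower:
  assumes e: "\<And>n. 0 < e n" and e0: "e \<longlonglongrightarrow> 0" and emn: "filterlim (\<lambda>n. (e n)\<^sup>2 * m ^ n) at_top sequentially"
    and v0: "0 \<le> v" and v: "\<forall>\<^sub>F u in at_right 0. v * u powr \<alpha> \<le> prob_W_le u"
    and T: "0 < T" and d: "0 < d"
  shows "\<forall>\<^sub>F n in sequentially. (v * mom T - d) * Dsc n (e n) \<le> gpart n (e n) T"
proof -
  interpret N: real_distribution std_normal_distribution by (rule real_dist_normal_dist)
  define s where "s x = min T (\<sigma>2 * x\<^sup>2)" for x
  let ?g = "\<lambda>n x. indicator {..0} x * prob_Z_le n (s x / (e n)\<^sup>2) / Dsc n (e n)"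
  let ?f = "\<lambda>x. v * (indicator {..0} x * s x powr \<alpha>)"
  have s0: "0 \<le> s x" for x using T s2_pos by (simp add: s_def)
  have g0: "0 \<le> ?g n x" for n x using Dsc_pos[OF e, of n n] by simp
  have "\<forall>\<^sub>F n in sequentially. N.expectation (\<lambda>x. - ?g n x) \<le> N.expectation (\<lambda>x. - ?f x) + d / 2"
  proof (rule N.eventually_expectation_le[where B="v * T powr \<alpha>"])
    show "integrable std_normal_distribution (\<lambda>x. - ?g n x)" for n
      using gsum_scaled(2)[where e=e, OF T e] by (intro Bochner_Integration.integrable_minus) (simp add: s_def)
    show "integrable std_normal_distribution (\<lambda>x. - ?f x)"
      unfolding s_def by (intro Bochner_Integration.integrable_minus integrable_mult_right mom_int T)
    show "- ?g n x \<le> - ?f x + v * T powr \<alpha>" for n x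
    proof -
      have "?f x \<le> v * T powr \<alpha>"
        using v0 s0[of x] alpha_gt_1 by (intro mult_left_mono) (auto simp: indicator_def s_def intro!: powr_mono2)
      then show ?thesis using g0[of x n] by linarith
    qed
    show "\<forall>\<^sub>F n in sequentially. - ?g n x \<le> - ?f x + d'" if d': "0 < d'" for x d'
    proof (cases "s x = 0 \<or> 0 < x")
      case True
      then have "?f x = 0" by auto
      then show ?thesis using g0[of x] d' by (auto intro!: always_eventually intro: order_trans[of _ 0])
    next
      case False
      then have sx: "0 < s x" using s0[of x] by linarith
      have "\<forall>\<^sub>F n in sequentially. (v - d' / s x powr \<alpha>) * (s x / (e n)\<^sup>2 / m ^ n) powr \<alpha> \<le> prob_Z_le n (s x / (e n)\<^sup>2)"
        using sx d' by (intro Z_lower_tail_lower[OF window_limits[OF e e0 emn sx] v]) simp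
      then show ?thesis
      proof eventually_elim
        case (elim n)
        have "(v * s x powr \<alpha> - d') * Dsc n (e n) \<le> prob_Z_le n (s x / (e n)\<^sup>2)"
        proof -
          have "(v - d' / s x powr \<alpha>) * (s x powr \<alpha> * Dsc n (e n)) = (v * s x powr \<alpha> - d') * Dsc n (e n)"
            using sx by (simp add: field_simps)
          then show ?thesis using elim unfolding Dsc_inverse_scale[OF e sx] by (simp only:)
        qed
        then have "v * s x powr \<alpha> - d' \<le> ?g n x" using False Dsc_pos[OF e, of n n] by (simp add: le_divide_eq)
        then show ?case using False by simp
      qed
    qed
  qed (use d in simp)
  moreover have "N.expectation (\<lambda>x. - ?f x) = - (v * mom T)" by (simp add: mom_def s_def)
  moreover have "N.expectation (\<lambda>x. - ?g n x) = - (gsum n (e n) T / Dsc n (e n))" for n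
    unfolding s_def gsum_scaled(1)[where e=e, OF T e] by (rule Bochner_Integration.integral_minus)
  ultimately have "\<forall>\<^sub>F n in sequentially. - (gsum n (e n) T / Dsc n (e n)) \<le> - (v * mom T) + d / 2"
    by (simp only:)
  then have "\<forall>\<^sub>F n in sequentially. v * mom T - d / 2 \<le> gsum n (e n) T / Dsc n (e n)"
    by eventually_elim linarith
  moreover have "\<forall>\<^sub>F n in sequentially. \<bar>gpart n (e n) T - gsum n (e n) T\<bar> \<le> d / 2 * Dsc n (e n)"
    using d by (intro gpart_gsum e e0 T) simp
  ultimately show ?thesis
  proof eventually_elim
    case (elim n)
    have "(v * mom T - d / 2) * Dsc n (e n) \<le> gsum n (e n) T"
      using elim(1) Dsc_pos[OF e, of n n] by (simp add: le_divide_eq)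
    moreover have "gpart n (e n) T - gsum n (e n) T \<le> d / 2 * Dsc n (e n)" "gsum n (e n) T - gpart n (e n) T \<le> d / 2 * Dsc n (e n)"
      using elim(2) by linarith+
    ultimately show ?case by (simp add: algebra_simps)
  qed
qed

end

lemma limsup_le_realI:
  assumes "\<And>d. 0 < d \<Longrightarrow> \<forall>\<^sub>F n in sequentially. x n \<le> L + d"
  shows "limsup (\<lambda>n. ereal (x n)) \<le> ereal L"
proof (rule ereal_le_epsilon2)
  fix d :: real assume "0 < d"
  then have "\<forall>\<^sub>F n in sequentially. ereal (x n) \<le> ereal (L + d)" using assms[of d] by simp
  then show "limsup (\<lambda>n. ereal (x n)) \<le> ereal L + ereal d"
    using Limsup_bounded[of "\<lambda>n. ereal (x n)" "ereal (L + d)"] by simp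
qed

lemma liminf_ge_realI:
  assumes "\<And>d. 0 < d \<Longrightarrow> \<forall>\<^sub>F n in sequentially. L - d \<le> x n"
  shows "ereal L \<le> liminf (\<lambda>n. ereal (x n))"
proof (rule ereal_le_epsilon2)
  fix d :: real assume "0 < d"
  then have "\<forall>\<^sub>F n in sequentially. ereal (L - d) \<le> ereal (x n)" using assms[of d] by simp
  then have "ereal (L - d) \<le> liminf (\<lambda>n. ereal (x n))" by (rule Liminf_bounded)
  then have "ereal (L - d) + ereal d \<le> liminf (\<lambda>n. ereal (x n)) + ereal d" by (rule add_right_mono)
  then show "ereal L \<le> liminf (\<lambda>n. ereal (x n)) + ereal d" by simp
qed

context gw_walk
begin

lemma momt_pos: "0 < momt"
proof -
  have "0 < Gamma (\<alpha> + 1/2)" using alpha_gt_1 by (intro Gamma_real_pos) auto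
  then show ?thesis using s2_pos by (simp add: momt_def)
qed

lemma eventually_powr_less:
  assumes "0 < d" "0 < \<gamma>"
  shows "\<forall>\<^sub>F j in sequentially. K * real (Suc j) powr (- \<gamma>) < d"
proof -
  have "filterlim (\<lambda>j. real (Suc j)) at_top sequentially"
    by (rule filterlim_compose[OF filterlim_real_sequentially filterlim_Suc])
  then have "(\<lambda>j. K * real (Suc j) powr (- \<gamma>)) \<longlonglongrightarrow> K * 0"
    using assms by (intro tendsto_mult tendsto_const tendsto_neg_powr) auto
  then show ?thesis by (rule order_tendstoD(2)) (use assms in simp)
qed

text \<open>The cut-off \<open>T\<close> is chosen first, so large that both remainders of
  \<open>prob_R_upper\<close> fit the error; only then does \<open>n\<close> grow. The jump part is
  left untouched so that it can be bounded crudely or sharply.\<close>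

lemma gauss_upper:
  assumes e: "\<And>n. 0 < e n" and e0: "e \<longlonglongrightarrow> 0" and emn: "filterlim (\<lambda>n. (e n)\<^sup>2 * m ^ n) at_top sequentially"
    and v0: "0 \<le> v" and v: "\<And>v'. v < v' \<Longrightarrow> \<forall>\<^sub>F u in at_right 0. w u \<le> v' * u powr (\<alpha> - 1)"
    and \<eta>: "0 < \<eta>" "\<eta> < 1" "\<alpha> < 1 / \<eta>" and d: "0 < d"
  shows "\<forall>\<^sub>F n in sequentially. prob_R_ge M Z X n (e n) \<le>
    (v * (momt / \<alpha>) + d) * Dsc n (e n) + jpart n (e n) (1 - \<eta>) + d * Jsc n (e n)"
proof -
  obtain K where K: "0 < K" "\<And>n e T. 0 < e \<Longrightarrow> 0 < T \<Longrightarrow>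
    prob_R_ge M Z X n e \<le> gpart n e T + jpart n e (1 - \<eta>) + K / T * Jsc n e + K * T powr (\<alpha> - 1 / \<eta>) * Dsc n e"
    using prob_R_upper[OF \<eta>] by blast
  have "\<forall>\<^sub>F j in sequentially. K * real (Suc j) powr (- 1) < d \<and> K * real (Suc j) powr (- (1 / \<eta> - \<alpha>)) < d / 3"
    using \<eta> d by (intro eventually_conj eventually_powr_less) auto
  then obtain j where j: "K * real (Suc j) powr (- 1) < d" "K * real (Suc j) powr (- (1 / \<eta> - \<alpha>)) < d / 3"
    by (auto dest: eventually_happens)
  define T where "T = real (Suc j)"
  have T: "0 < T" by (simp add: T_def)
  have KT: "K / T < d" "K * T powr (\<alpha> - 1 / \<eta>) < d / 3"
    using j T unfolding T_def[symmetric] by (simp_all add: powr_minus_divide)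
  \<comment> \<open>The error \<open>d\<close> is spent in thirds: on the slack \<open>r\<close> in
    the density bound, on \<open>gpart_upper\<close>, and on the Fuk-Nagaev remainder.\<close>
  define r where "r = d * \<alpha> / (3 * momt)"
  have r: "0 < r" using d alpha_gt_1 momt_pos by (simp add: r_def)
  have vr: "(v + r) / \<alpha> * momt = v * (momt / \<alpha>) + d / 3"
    using alpha_gt_1 momt_pos by (simp add: r_def field_simps)
  have "\<forall>\<^sub>F u in at_right 0. prob_W_le u \<le> (v + r) / \<alpha> * u powr \<alpha>"
    using r by (intro W_lower_tail_le v) simp
  then have "\<forall>\<^sub>F n in sequentially. gpart n (e n) T \<le> ((v + r) / \<alpha> * mom T + d / 3) * Dsc n (e n)"
    using v0 r alpha_gt_1 d by (intro gpart_upper e e0 emn T) auto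
  then show ?thesis
  proof eventually_elim
    case (elim n)
    have D: "0 < Dsc n (e n)" and J: "0 < Jsc n (e n)" using e Dsc_pos Jsc_pos by auto
    have "(v + r) / \<alpha> * mom T \<le> (v + r) / \<alpha> * momt"
      using mom_le[OF T] v0 r alpha_gt_1 by (intro mult_left_mono) auto
    then have "((v + r) / \<alpha> * mom T + d / 3) * Dsc n (e n) \<le> (v * (momt / \<alpha>) + d / 3 + d / 3) * Dsc n (e n)"
      using D unfolding vr by (intro mult_right_mono) auto
    moreover have "K * T powr (\<alpha> - 1 / \<eta>) * Dsc n (e n) \<le> d / 3 * Dsc n (e n)"
      using KT D by (intro mult_right_mono) auto
    moreover have "K / T * Jsc n (e n) \<le> d * Jsc n (e n)" using KT J by (intro mult_right_mono) auto
    moreover have "(v * (momt / \<alpha>) + d / 3 + d / 3) * Dsc n (e n) + d / 3 * Dsc n (e n) = (v * (momt / \<alpha>) + d) * Dsc n (e n)"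
      by (simp add: algebra_simps)
    ultimately show ?case using elim K(2)[OF e[of n] T, of n] by linarith
  qed
qed

text \<open>Valid for every large \<open>T\<close> rather than for one, because the cut-off has to
  be shared with \<open>jump_lower\<close>.\<close>

lemma gauss_lower:
  assumes e: "\<And>n. 0 < e n" and e0: "e \<longlonglongrightarrow> 0" and emn: "filterlim (\<lambda>n. (e n)\<^sup>2 * m ^ n) at_top sequentially"
    and v0: "0 < v" and v: "\<And>v'. v' < v \<Longrightarrow> \<forall>\<^sub>F u in at_right 0. v' * u powr (\<alpha> - 1) \<le> w u"
    and d: "0 < d"
  shows "\<exists>T0. \<forall>T\<ge>T0. \<forall>\<^sub>F n in sequentially. (v * (momt / \<alpha>) - d) * Dsc n (e n) \<le> gpart n (e n) T"
proof -
  \<comment> \<open>The cap \<open>v / 2\<close> keeps the constant \<open>c\<close> below positive,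
    so that it can be multiplied through.\<close>
  define r where "r = min (v / 2) (d * \<alpha> / (3 * momt))"
  have r: "0 < r" "r < v" using d alpha_gt_1 momt_pos v0 by (auto simp: r_def)
  have rd: "r / \<alpha> * momt \<le> d / 3"
  proof -
    have "r \<le> d * \<alpha> / (3 * momt)" by (simp add: r_def)
    then show ?thesis using alpha_gt_1 momt_pos by (simp add: field_simps)
  qed
  have mono: "mom S \<le> mom T" if "0 < S" "S \<le> T" for S T
    unfolding mom_def using that s2_pos alpha_gt_1
    by (intro integral_mono mom_int) (auto simp: indicator_def intro!: powr_mono2)
  define c where "c = (v - r) / \<alpha>"
  have c: "0 < c" using r alpha_gt_1 by (simp add: c_def)
  have "\<forall>\<^sub>F j in sequentially. momt - d / (3 * c) < mom (real (Suc j))"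
    by (rule order_tendstoD(1)[OF mom_tendsto]) (use c d in simp)
  then obtain j where j: "momt - d / (3 * c) < mom (real (Suc j))" by (auto dest: eventually_happens)
  show ?thesis
  proof (intro exI[of _ "real (Suc j)"] allI impI)
    fix T assume Tj: "real (Suc j) \<le> T"
    have T: "0 < T" using Tj by simp
    have "momt - d / (3 * c) \<le> mom T" using j mono[OF _ Tj] by simp
    then have "c * (momt - d / (3 * c)) \<le> c * mom T" using c by (intro mult_left_mono) auto
    moreover have "c * (momt - d / (3 * c)) = c * momt - d / 3" using c by (simp add: right_diff_distrib)
    ultimately have cm: "c * momt - d / 3 \<le> c * mom T" by simp
    have "c * momt = v * (momt / \<alpha>) - r / \<alpha> * momt" by (simp add: c_def diff_divide_distrib left_diff_distrib)
    then have cm2: "v * (momt / \<alpha>) - d \<le> c * mom T - d / 3" using cm rd by linarith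
    have "\<forall>\<^sub>F u in at_right 0. c * u powr \<alpha> \<le> prob_W_le u"
      unfolding c_def using r by (intro W_lower_tail_ge v) simp
    then have "\<forall>\<^sub>F n in sequentially. (c * mom T - d / 3) * Dsc n (e n) \<le> gpart n (e n) T"
      using c d by (intro gpart_lower e e0 emn T) auto
    then show "\<forall>\<^sub>F n in sequentially. (v * (momt / \<alpha>) - d) * Dsc n (e n) \<le> gpart n (e n) T"
    proof eventually_elim
      case (elim n)
      have "(v * (momt / \<alpha>) - d) * Dsc n (e n) \<le> (c * mom T - d / 3) * Dsc n (e n)"
        using cm2 Dsc_pos[OF e, of n n] by (intro mult_right_mono) auto
      then show ?case using elim by linarith
    qed
  qed
qed

text \<open>A large \<open>T\<close> beats the relative loss \<open>K / T\<close>; then, with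
  \<open>T\<close> fixed, the portion of \<open>jpart\<close> below the cut-off disappears as
  \<open>e\<^sup>2 * m ^ n\<close> tends to infinity.\<close>

lemma jump_lower:
  assumes e: "\<And>n. 0 < e n" and emn: "filterlim (\<lambda>n. (e n)\<^sup>2 * m ^ n) at_top sequentially"
    and \<eta>: "0 < \<eta>" and d: "0 < d"
  shows "\<exists>T1. \<forall>T\<ge>T1. \<forall>\<^sub>F n in sequentially.
    gpart n (e n) T + jpart n (e n) (1 + \<eta>) - d * Jsc n (e n) \<le> prob_R_ge M Z X n (e n)"
proof -
  define \<gamma> where "\<gamma> = \<alpha> - (\<theta> - 1)"
  have \<gamma>: "0 < \<gamma>" using theta_range by (simp add: \<gamma>_def)
  obtain K where K: "0 < K" "\<And>n e T. 0 < e \<Longrightarrow> K \<le> T \<Longrightarrow>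
    gpart n e T + (1 - K / T) * (jpart n e (1 + \<eta>) - K * T powr \<gamma> * (e\<^sup>2 * m ^ n) powr (- \<gamma>) * Jsc n e)
      \<le> prob_R_ge M Z X n e"
    using prob_R_lower[OF \<eta>] unfolding \<gamma>_def by blast
  obtain K' where K': "0 < K'" "\<And>n e. 0 < e \<Longrightarrow> jpart n e (1 + \<eta>) \<le> K' * Jsc n e"
    using jpart_bound[of "1 + \<eta>"] \<eta> by auto
  show ?thesis
  proof (intro exI[of _ "max K (2 * K * K' / d)"] allI impI)
    fix T assume T1: "max K (2 * K * K' / d) \<le> T"
    then have TK: "K \<le> T" and T2: "2 * K * K' / d \<le> T" by auto
    have T: "0 < T" using TK K by linarith
    have KT: "K / T * K' \<le> d / 2" using T2 T d by (simp add: field_simps)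
    have "(\<lambda>n. K * T powr \<gamma> * ((e n)\<^sup>2 * m ^ n) powr (- \<gamma>)) \<longlonglongrightarrow> K * T powr \<gamma> * 0"
      using \<gamma> by (intro tendsto_mult tendsto_const tendsto_neg_powr[OF _ emn]) simp
    then have "\<forall>\<^sub>F n in sequentially. K * T powr \<gamma> * ((e n)\<^sup>2 * m ^ n) powr (- \<gamma>) < d / 2"
      by (rule order_tendstoD(2)) (use d in simp)
    then show "\<forall>\<^sub>F n in sequentially. gpart n (e n) T + jpart n (e n) (1 + \<eta>) - d * Jsc n (e n) \<le> prob_R_ge M Z X n (e n)"
    proof eventually_elim
      case (elim n)
      define x where "x = K * T powr \<gamma> * ((e n)\<^sup>2 * m ^ n) powr (- \<gamma>)"
      have x: "0 \<le> x" "x \<le> d / 2" using elim K by (auto simp: x_def)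
      have J: "0 < Jsc n (e n)" using e Jsc_pos by auto
      have "K / T * jpart n (e n) (1 + \<eta>) \<le> K / T * (K' * Jsc n (e n))"
        using K T by (intro mult_left_mono K'(2) e) auto
      also have "\<dots> \<le> d / 2 * Jsc n (e n)" using KT J by (simp only: mult.assoc[symmetric]) (intro mult_right_mono, auto)
      finally have 1: "K / T * jpart n (e n) (1 + \<eta>) \<le> d / 2 * Jsc n (e n)" .
      have "(1 - K / T) * (x * Jsc n (e n)) \<le> 1 * (d / 2 * Jsc n (e n))"
        using x J K T TK by (intro mult_mono mult_right_mono) auto
      moreover have "(1 - K / T) * (jpart n (e n) (1 + \<eta>) - x * Jsc n (e n)) =
          jpart n (e n) (1 + \<eta>) - K / T * jpart n (e n) (1 + \<eta>) - (1 - K / T) * (x * Jsc n (e n))"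
        by (simp add: algebra_simps)
      ultimately show ?case using 1 K(2)[OF e[of n] TK, of n] unfolding x_def[symmetric] by linarith
    qed
  qed
qed

lemma gpart_nonneg: "0 \<le> gpart n e T" unfolding gpart_def using hit_range by (intro EZ_nonneg) auto

section \<open>Bounds with the exact constant of the jump part\<close>

context
  fixes e :: "nat \<Rightarrow> real" and E :: real
  assumes e_pos: "\<And>n. 0 < e n" and em: "filterlim (\<lambda>n. e n * m ^ n) at_top sequentially"
    and phi_int: "set_integrable lborel {0<..} (\<lambda>v. Phi v * v powr (\<theta> - 2))"
  defines "E \<equiv> expectation (\<lambda>\<omega>. W \<omega> powr (- (\<theta> - 1)))"
begin

text \<open>A small \<open>\<eta>\<close> brings \<open>(1 - \<eta>) powr (- \<theta>)\<close> close
  to 1, and \<open>\<eta> < 1 / \<alpha>\<close> secures the condition of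
  \<open>prob_R_upper\<close>.\<close>

lemma jpart_upper_limit:
  assumes d: "0 < d"
  shows "\<exists>\<eta>. 0 < \<eta> \<and> \<eta> < 1 \<and> \<alpha> < 1 / \<eta> \<and> (\<forall>\<^sub>F n in sequentially. jpart n (e n) (1 - \<eta>) \<le> (a * E + d) * Jsc n (e n))"
proof -
  have "((\<lambda>\<eta>. a * (1 - \<eta>) powr (- \<theta>) * E) \<longlongrightarrow> a * (1 - 0) powr (- \<theta>) * E) (at_right 0)"
    by (intro tendsto_intros) auto
  then have "\<forall>\<^sub>F \<eta> in at_right 0. a * (1 - \<eta>) powr (- \<theta>) * E < a * E + d"
    by (rule order_tendstoD(2)) (use d in simp)
  moreover have "\<forall>\<^sub>F \<eta> in at_right 0. 0 < \<eta> \<and> \<eta> < 1 / \<alpha>"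
    using alpha_gt_1 by (auto simp: eventually_at_right_field intro!: exI[of _ "1 / \<alpha>"])
  ultimately have "\<forall>\<^sub>F \<eta> in at_right 0. a * (1 - \<eta>) powr (- \<theta>) * E < a * E + d \<and> 0 < \<eta> \<and> \<eta> < 1 / \<alpha>"
    by eventually_elim auto
  then obtain \<eta> where \<eta>: "a * (1 - \<eta>) powr (- \<theta>) * E < a * E + d" "0 < \<eta>" "\<eta> < 1 / \<alpha>"
    by (auto dest: eventually_happens)
  have "1 / \<alpha> < 1" using alpha_gt_1 by simp
  then have \<eta>1: "\<eta> < 1" using \<eta> by linarith
  have \<eta>2: "\<alpha> < 1 / \<eta>" using \<eta> alpha_gt_1 by (simp add: field_simps)
  have "\<forall>\<^sub>F n in sequentially. jpart n (e n) (1 - \<eta>) / Jsc n (e n) < a * E + d"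
    by (rule order_tendstoD(2)[OF jpart_tendsto[OF phi_int e_pos em, folded E_def] \<eta>(1)]) (use \<eta>1 in simp)
  then have "\<forall>\<^sub>F n in sequentially. jpart n (e n) (1 - \<eta>) \<le> (a * E + d) * Jsc n (e n)"
  proof eventually_elim
    case (elim n)
    then show ?case using Jsc_pos[OF e_pos, of n n] by (simp add: divide_less_eq)
  qed
  then show ?thesis using \<eta> \<eta>1 \<eta>2 by blast
qed

lemma jpart_lower_limit:
  assumes d: "0 < d"
  shows "\<exists>\<eta>>0. \<forall>\<^sub>F n in sequentially. (a * E - d) * Jsc n (e n) \<le> jpart n (e n) (1 + \<eta>)"
proof -
  have "((\<lambda>\<eta>. a * (1 + \<eta>) powr (- \<theta>) * E) \<longlongrightarrow> a * (1 + 0) powr (- \<theta>) * E) (at_right 0)"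
    by (intro tendsto_intros) auto
  then have "\<forall>\<^sub>F \<eta> in at_right 0. a * E - d < a * (1 + \<eta>) powr (- \<theta>) * E"
    by (rule order_tendstoD(1)) (use d in simp)
  moreover have "\<forall>\<^sub>F \<eta>::real in at_right 0. 0 < \<eta>" by (simp add: eventually_at_right_less)
  ultimately have "\<forall>\<^sub>F \<eta> in at_right 0. a * E - d < a * (1 + \<eta>) powr (- \<theta>) * E \<and> 0 < \<eta>"
    by eventually_elim auto
  then obtain \<eta> where \<eta>: "a * E - d < a * (1 + \<eta>) powr (- \<theta>) * E" "0 < \<eta>"
    by (auto dest: eventually_happens)
  have "\<forall>\<^sub>F n in sequentially. a * E - d < jpart n (e n) (1 + \<eta>) / Jsc n (e n)"
    by (rule order_tendstoD(1)[OF jpart_tendsto[OF phi_int e_pos em, folded E_def] \<eta>(1)]) (use \<eta> in simp)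
  then have "\<forall>\<^sub>F n in sequentially. (a * E - d) * Jsc n (e n) \<le> jpart n (e n) (1 + \<eta>)"
  proof eventually_elim
    case (elim n)
    then show ?case using Jsc_pos[OF e_pos, of n n] by (simp add: less_divide_eq)
  qed
  then show ?thesis using \<eta> by blast
qed

text \<open>The cut-off is fixed, so the population part keeps only a crude constant. That is enough
  where \<open>Dsc\<close> is negligible against \<open>Jsc\<close>.\<close>

lemma prob_R_upper_jump:
  assumes d: "0 < d"
  shows "\<exists>K. \<forall>\<^sub>F n in sequentially. prob_R_ge M Z X n (e n) \<le> (a * E + d) * Jsc n (e n) + K * Dsc n (e n)"
proof -
  obtain \<eta> where \<eta>: "0 < \<eta>" "\<eta> < 1" "\<alpha> < 1 / \<eta>"
    and ev: "\<forall>\<^sub>F n in sequentially. jpart n (e n) (1 - \<eta>) \<le> (a * E + d / 2) * Jsc n (e n)"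
    using jpart_upper_limit[of "d / 2"] d by auto
  obtain K where K: "0 < K" "\<And>n e T. 0 < e \<Longrightarrow> 0 < T \<Longrightarrow>
    prob_R_ge M Z X n e \<le> gpart n e T + jpart n e (1 - \<eta>) + K / T * Jsc n e + K * T powr (\<alpha> - 1 / \<eta>) * Dsc n e"
    using prob_R_upper[OF \<eta>] by blast
  obtain C where C: "0 < C" "\<And>n e T. 0 < e \<Longrightarrow> 0 < T \<Longrightarrow> gpart n e T \<le> C * T powr \<alpha> * Dsc n e"
    using gpart_bound by blast
  define T where "T = 2 * K / d"
  have T: "0 < T" using K d by (simp add: T_def)
  have KT: "K / T = d / 2" using K d by (simp add: T_def)
  have "\<forall>\<^sub>F n in sequentially. prob_R_ge M Z X n (e n) \<le> (a * E + d) * Jsc n (e n) + (C * T powr \<alpha> + K * T powr (\<alpha> - 1 / \<eta>)) * Dsc n (e n)"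
    using ev
  proof eventually_elim
    case (elim n)
    then show ?case using K(2)[OF e_pos[of n] T, of n] C(2)[OF e_pos[of n] T, of n] unfolding KT
      by (simp add: algebra_simps)
  qed
  then show ?thesis by blast
qed

lemma prob_R_lower_jump:
  assumes emn: "filterlim (\<lambda>n. (e n)\<^sup>2 * m ^ n) at_top sequentially" and d: "0 < d"
  shows "\<forall>\<^sub>F n in sequentially. (a * E - d) * Jsc n (e n) \<le> prob_R_ge M Z X n (e n)"
proof -
  obtain \<eta> where \<eta>: "0 < \<eta>" and ev: "\<forall>\<^sub>F n in sequentially. (a * E - d / 2) * Jsc n (e n) \<le> jpart n (e n) (1 + \<eta>)"
    using jpart_lower_limit[of "d / 2"] d by auto
  obtain T where "\<forall>\<^sub>F n in sequentially. gpart n (e n) T + jpart n (e n) (1 + \<eta>) - d / 2 * Jsc n (e n) \<le> prob_R_ge M Z X n (e n)"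
    using jump_lower[OF e_pos emn \<eta>, of "d / 2"] d by auto
  then show ?thesis using ev
  proof eventually_elim
    case (elim n)
    have "(a * E - d) * Jsc n (e n) = (a * E - d / 2) * Jsc n (e n) - d / 2 * Jsc n (e n)" by (simp add: algebra_simps)
    then show ?case using elim gpart_nonneg[of n "e n" T] by linarith
  qed
qed

lemma prob_R_upper_both:
  assumes e0: "e \<longlonglongrightarrow> 0" and emn: "filterlim (\<lambda>n. (e n)\<^sup>2 * m ^ n) at_top sequentially"
    and v0: "0 \<le> v" and v: "\<And>v'. v < v' \<Longrightarrow> \<forall>\<^sub>F u in at_right 0. w u \<le> v' * u powr (\<alpha> - 1)" and d: "0 < d"
  shows "\<forall>\<^sub>F n in sequentially. prob_R_ge M Z X n (e n) \<le> (v * (momt / \<alpha>) + d) * Dsc n (e n) + (a * E + d) * Jsc n (e n)"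
proof -
  obtain \<eta> where \<eta>: "0 < \<eta>" "\<eta> < 1" "\<alpha> < 1 / \<eta>"
    and ev: "\<forall>\<^sub>F n in sequentially. jpart n (e n) (1 - \<eta>) \<le> (a * E + d / 2) * Jsc n (e n)"
    using jpart_upper_limit[of "d / 2"] d by auto
  have "\<forall>\<^sub>F n in sequentially. prob_R_ge M Z X n (e n) \<le>
    (v * (momt / \<alpha>) + d / 2) * Dsc n (e n) + jpart n (e n) (1 - \<eta>) + d / 2 * Jsc n (e n)"
    using d by (intro gauss_upper e_pos e0 emn v0 v \<eta>) auto
  then show ?thesis using ev
  proof eventually_elim
    case (elim n)
    have "(v * (momt / \<alpha>) + d / 2) * Dsc n (e n) \<le> (v * (momt / \<alpha>) + d) * Dsc n (e n)"
      using d Dsc_pos[OF e_pos, of n n] by (intro mult_right_mono) auto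
    moreover have "(a * E + d) * Jsc n (e n) = (a * E + d / 2) * Jsc n (e n) + d / 2 * Jsc n (e n)" by (simp add: algebra_simps)
    ultimately show ?case using elim by linarith
  qed
qed

lemma prob_R_lower_both:
  assumes e0: "e \<longlonglongrightarrow> 0" and emn: "filterlim (\<lambda>n. (e n)\<^sup>2 * m ^ n) at_top sequentially"
    and v0: "0 < v" and v: "\<And>v'. v' < v \<Longrightarrow> \<forall>\<^sub>F u in at_right 0. v' * u powr (\<alpha> - 1) \<le> w u" and d: "0 < d"
  shows "\<forall>\<^sub>F n in sequentially. (v * (momt / \<alpha>) - d) * Dsc n (e n) + (a * E - d) * Jsc n (e n) \<le> prob_R_ge M Z X n (e n)"
proof -
  obtain \<eta> where \<eta>: "0 < \<eta>" and ev: "\<forall>\<^sub>F n in sequentially. (a * E - d / 2) * Jsc n (e n) \<le> jpart n (e n) (1 + \<eta>)"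
    using jpart_lower_limit[of "d / 2"] d by auto
  obtain T1 where T1: "\<And>T. T1 \<le> T \<Longrightarrow> \<forall>\<^sub>F n in sequentially. gpart n (e n) T + jpart n (e n) (1 + \<eta>) - d / 2 * Jsc n (e n) \<le> prob_R_ge M Z X n (e n)"
    using jump_lower[OF e_pos emn \<eta>, of "d / 2"] d by auto
  obtain T0 where T0: "\<And>T. T0 \<le> T \<Longrightarrow> \<forall>\<^sub>F n in sequentially. (v * (momt / \<alpha>) - d) * Dsc n (e n) \<le> gpart n (e n) T"
    using gauss_lower[OF e_pos e0 emn v0 v d] by blast
  show ?thesis using T1[OF max.cobounded1[of T1 T0]] T0[OF max.cobounded2[of T0 T1]] ev
  proof eventually_elim
    case (elim n)
    have "(a * E - d) * Jsc n (e n) = (a * E - d / 2) * Jsc n (e n) - d / 2 * Jsc n (e n)" by (simp add: algebra_simps)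
    then show ?case using elim by linarith
  qed
qed

end

text \<open>The mirror image of \<open>prob_R_upper_jump\<close>, with a crude constant on the jump
  part. It stands outside the context because no integrability of \<open>Phi\<close> is assumed, so
  a positive extinction probability is allowed. Any \<open>\<eta>\<close> with
  \<open>\<alpha> < 1 / \<eta>\<close> would do.\<close>

lemma prob_R_upper_gauss:
  assumes e: "\<And>n. 0 < e n" and e0: "e \<longlonglongrightarrow> 0" and emn: "filterlim (\<lambda>n. (e n)\<^sup>2 * m ^ n) at_top sequentially"
    and v0: "0 \<le> v" and v: "\<And>v'. v < v' \<Longrightarrow> \<forall>\<^sub>F u in at_right 0. w u \<le> v' * u powr (\<alpha> - 1)" and d: "0 < d"
  shows "\<exists>K. \<forall>\<^sub>F n in sequentially. prob_R_ge M Z X n (e n) \<le> (v * (momt / \<alpha>) + d) * Dsc n (e n) + K * Jsc n (e n)"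
proof -
  define \<eta> where "\<eta> = 1 / (\<alpha> + 1)"
  have \<eta>: "0 < \<eta>" "\<eta> < 1" "\<alpha> < 1 / \<eta>" using alpha_gt_1 by (auto simp: \<eta>_def)
  obtain K' where K': "0 < K'" "\<And>n e. 0 < e \<Longrightarrow> jpart n e (1 - \<eta>) \<le> K' * Jsc n e"
    using jpart_bound[of "1 - \<eta>"] \<eta> by auto
  have "\<forall>\<^sub>F n in sequentially. prob_R_ge M Z X n (e n) \<le> (v * (momt / \<alpha>) + d) * Dsc n (e n) + (K' + d) * Jsc n (e n)"
  proof -
    have "\<forall>\<^sub>F n in sequentially. prob_R_ge M Z X n (e n) \<le>
      (v * (momt / \<alpha>) + d) * Dsc n (e n) + jpart n (e n) (1 - \<eta>) + d * Jsc n (e n)"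
      by (intro gauss_upper e e0 emn v0 v \<eta> d)
    then show ?thesis
    proof eventually_elim
    case (elim n)
    then show ?case using K'(2)[OF e[of n], of n] by (simp add: algebra_simps)
    qed
  qed
  then show ?thesis by blast
qed

text \<open>Finiteness comes from \<open>density_upper_bound\<close>. The extended-real limit is
  traded for a real \<open>v\<close> and one-sided inequalities, the form in which the tail
  estimates consume it.\<close>

lemma density_limsup:
  obtains v where "0 \<le> v" "Limsup (at_right 0) (\<lambda>u. ereal (u powr (1 - \<alpha>) * w u)) = ereal v"
    "\<And>v'. v < v' \<Longrightarrow> \<forall>\<^sub>F u in at_right 0. w u \<le> v' * u powr (\<alpha> - 1)"
proof -
  let ?L = "Limsup (at_right 0) (\<lambda>u. ereal (u powr (1 - \<alpha>) * w u))"
  obtain C where C: "0 < C" "\<And>u. 0 < u \<Longrightarrow> u < 1 \<Longrightarrow> w u \<le> C * u powr (\<alpha> - 1)"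
    using density_upper_bound by blast
  have swap: "u powr (1 - \<alpha>) * w u \<le> c \<longleftrightarrow> w u \<le> c * u powr (\<alpha> - 1)" if "0 < u" for u c
  proof -
    have "u powr (1 - \<alpha>) = 1 / u powr (\<alpha> - 1)" using powr_minus_divide[of u "\<alpha> - 1"] by simp
    then show ?thesis using that by (simp only: mult_1_left times_divide_eq_left) (simp add: divide_le_eq le_divide_eq)
  qed
  have "\<forall>\<^sub>F u::real in at_right 0. 0 < u \<and> u < 1" by (auto simp: eventually_at_right_field intro!: exI[of _ 1])
  then have "\<forall>\<^sub>F u in at_right 0. u powr (1 - \<alpha>) * w u \<le> C \<and> 0 \<le> u powr (1 - \<alpha>) * w u"
  proof eventually_elim
    case (elim u)
    then show ?case using swap[of u C] C(2)[of u] w_nonneg[of u] by simp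
  qed
  then have ev: "\<forall>\<^sub>F u in at_right 0. u powr (1 - \<alpha>) * w u \<le> C" "\<forall>\<^sub>F u in at_right 0. 0 \<le> u powr (1 - \<alpha>) * w u"
    unfolding eventually_conj_iff by blast+
  have up: "?L \<le> ereal C" using ev(1) by (intro Limsup_bounded) simp
  have lo: "ereal 0 \<le> ?L"
    using ev(2) by (intro order_trans[OF Liminf_bounded Liminf_le_Limsup]) (auto simp: trivial_limit_at_right_real)
  obtain v where v: "?L = ereal v" using up lo by (cases ?L) auto
  show ?thesis
  proof (rule that)
    show "0 \<le> v" using lo v by simp
    show "?L = ereal v" by (rule v)
    fix v' assume "v < v'"
    then have "\<forall>\<^sub>F u in at_right 0. ereal (u powr (1 - \<alpha>) * w u) < ereal v'"
      by (intro Limsup_lessD) (simp add: v)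
    moreover have "\<forall>\<^sub>F u::real in at_right 0. 0 < u" by (simp add: eventually_at_right_less)
    ultimately show "\<forall>\<^sub>F u in at_right 0. w u \<le> v' * u powr (\<alpha> - 1)"
    proof eventually_elim
      case (elim u)
      then show ?case using swap[OF elim(2), of v'] by simp
    qed
  qed
qed

lemma density_liminf:
  obtains v where "0 < v" "Liminf (at_right 0) (\<lambda>u. ereal (u powr (1 - \<alpha>) * w u)) = ereal v"
    "\<And>v'. v' < v \<Longrightarrow> \<forall>\<^sub>F u in at_right 0. v' * u powr (\<alpha> - 1) \<le> w u"
proof -
  let ?L = "Liminf (at_right 0) (\<lambda>u. ereal (u powr (1 - \<alpha>) * w u))"
  obtain C c where C: "0 < C" "0 < c" "\<And>u. 0 < u \<Longrightarrow> u < c \<Longrightarrow> C * u powr (\<alpha> - 1) \<le> w u"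
    using density_lower_bound by blast
  have swap: "c \<le> u powr (1 - \<alpha>) * w u \<longleftrightarrow> c * u powr (\<alpha> - 1) \<le> w u" if "0 < u" for u c
  proof -
    have "u powr (1 - \<alpha>) = 1 / u powr (\<alpha> - 1)" using powr_minus_divide[of u "\<alpha> - 1"] by simp
    then show ?thesis using that by (simp only: mult_1_left times_divide_eq_left) (simp add: divide_le_eq le_divide_eq)
  qed
  have "\<forall>\<^sub>F u::real in at_right 0. 0 < u \<and> u < c" using C(2) by (auto simp: eventually_at_right_field intro!: exI[of _ c])
  then have ev: "\<forall>\<^sub>F u in at_right 0. C \<le> u powr (1 - \<alpha>) * w u"
  proof eventually_elim
    case (elim u)
    then show ?case using swap[of u C] C(3)[of u] by simp
  qed
  have lo: "ereal C \<le> ?L" using ev by (intro Liminf_bounded) simp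
  have up: "?L < \<infinity>"
  proof -
    obtain v where "Limsup (at_right 0) (\<lambda>u. ereal (u powr (1 - \<alpha>) * w u)) = ereal v" using density_limsup by blast
    then have "?L \<le> ereal v" using Liminf_le_Limsup[of "at_right (0::real)" "\<lambda>u. ereal (u powr (1 - \<alpha>) * w u)"]
      by (simp add: trivial_limit_at_right_real)
    then show ?thesis by auto
  qed
  obtain v where v: "?L = ereal v" using up lo by (cases ?L) auto
  show ?thesis
  proof (rule that)
    show "0 < v" using lo v C by simp
    show "?L = ereal v" by (rule v)
    fix v' assume "v' < v"
    then have "\<forall>\<^sub>F u in at_right 0. ereal v' < ereal (u powr (1 - \<alpha>) * w u)"
      by (intro less_LiminfD) (simp add: v)
    moreover have "\<forall>\<^sub>F u::real in at_right 0. 0 < u" by (simp add: eventually_at_right_less)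
    ultimately show "\<forall>\<^sub>F u in at_right 0. v' * u powr (\<alpha> - 1) \<le> w u"
    proof eventually_elim
      case (elim u)
      then show ?case using swap[OF elim(2), of v'] by simp
    qed
  qed
qed


section \<open>The critical scale and the three regimes\<close>

definition kap :: real where "kap = (1 + \<alpha> - \<theta>) / (2 * \<alpha> - \<theta>)"

lemma two_alpha_gt: "\<theta> < 2 * \<alpha>" using theta_range alpha_gt_1 by linarith

lemma kap_mult: "kap * (2 * \<alpha> - \<theta>) = 1 + \<alpha> - \<theta>"
  using two_alpha_gt by (simp add: kap_def)

text \<open>The second inequality is equivalent to \<open>2 < \<theta>\<close>. It makes
  \<open>e\<^sup>2 * m ^ n\<close> tend to infinity as soon as \<open>e * m powr (kap * n)\<close>
  stays away from 0.\<close>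

lemma kap_range: "0 < kap" "2 * kap < 1"
  using two_alpha_gt theta_range by (auto simp: kap_def field_simps)

lemma Dsc_eq: "0 < e \<Longrightarrow> Dsc n e = e powr (- (2 * \<alpha>)) * m powr (- (\<alpha> * real n))"
proof -
  assume e: "0 < e"
  have "(e\<^sup>2) powr (- \<alpha>) = e powr (- (2 * \<alpha>))"
    using powr_powr[of e 2 "- \<alpha>"] powr_realpow[OF e, of 2] by simp
  moreover have "(m ^ n) powr (- \<alpha>) = m powr (- (\<alpha> * real n))"
    using powr_powr[of m "real n" "- \<alpha>"] powr_realpow[OF m_pos, of n] by (simp add: mult.commute)
  ultimately show ?thesis unfolding Dsc_def powr_mult by simp
qed

lemma inverse_Dsc: "0 < e \<Longrightarrow> e powr (2 * \<alpha>) * m powr (\<alpha> * real n) = 1 / Dsc n e"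
  using m_pos by (simp add: Dsc_eq powr_minus field_simps)

lemma inverse_Jsc: "0 < e \<Longrightarrow> e powr \<theta> * m powr ((\<theta> - 1) * real n) = 1 / Jsc n e"
proof -
  have "Jsc n e = e powr (- \<theta>) * m powr (- ((\<theta> - 1) * real n))" by (simp only: Jsc_def mult_minus_left)
  then show "0 < e \<Longrightarrow> ?thesis" using m_pos by (simp only: powr_minus) (simp add: field_simps)
qed

lemma scaled_powr: "0 < e \<Longrightarrow> (e * m powr (kap * real n)) powr c = e powr c * m powr (kap * c * real n)"
  using m_pos by (simp add: powr_mult powr_powr mult_ac)

text \<open>The ratio of the two costs is a power of \<open>e * m powr (kap * n)\<close> with
  positive exponent. The limits 0, infinity and a positive number of this quantity are the three
  regimes.\<close>

lemma Jsc_Dsc: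
  assumes "0 < e"
  shows "Jsc n e = (e * m powr (kap * real n)) powr (2 * \<alpha> - \<theta>) * Dsc n e"
proof -
  have "(e * m powr (kap * real n)) powr (2 * \<alpha> - \<theta>) * Dsc n e =
      (e powr (2 * \<alpha> - \<theta>) * e powr (- (2 * \<alpha>))) * (m powr ((1 + \<alpha> - \<theta>) * real n) * m powr (- (\<alpha> * real n)))"
    unfolding scaled_powr[OF assms] Dsc_eq[OF assms] kap_mult by (simp only: mult_ac)
  also have "\<dots> = e powr (- \<theta>) * m powr (- (\<theta> - 1) * real n)"
    unfolding powr_add[symmetric] by (simp add: algebra_simps)
  finally show ?thesis by (simp only: Jsc_def)
qed

text \<open>The reciprocal of either cost at the critical level
  \<open>e = m powr (- kap * n)\<close>, where both costs agree.\<close>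

abbreviation Fsc :: "nat \<Rightarrow> real" where "Fsc n \<equiv> m powr (\<alpha> * (\<theta> - 2) * real n / (2 * \<alpha> - \<theta>))"

lemma critical_scale:
  assumes "0 < e"
  shows "Fsc n * Dsc n e = (e * m powr (kap * real n)) powr (- (2 * \<alpha>))"
    and "Fsc n * Jsc n e = (e * m powr (kap * real n)) powr (- \<theta>)"
proof -
  let ?x = "e * m powr (kap * real n)"
  have ex: "\<alpha> * (\<theta> - 2) * real n / (2 * \<alpha> - \<theta>) + - (\<alpha> * real n) = kap * - (2 * \<alpha>) * real n"
    using two_alpha_gt by (simp add: kap_def divide_simps) (simp add: algebra_simps)
  have "Fsc n * Dsc n e =
      e powr (- (2 * \<alpha>)) * (Fsc n * m powr (- (\<alpha> * real n)))"
    unfolding Dsc_eq[OF assms] by (simp only: mult_ac)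
  then show 1: "Fsc n * Dsc n e = ?x powr (- (2 * \<alpha>))"
    unfolding scaled_powr[OF assms] powr_add[symmetric] ex .
  have "Fsc n * Jsc n e = ?x powr (2 * \<alpha> - \<theta>) * ?x powr (- (2 * \<alpha>))"
    unfolding Jsc_Dsc[OF assms] 1[symmetric] by (simp only: mult_ac)
  then show "Fsc n * Jsc n e = ?x powr (- \<theta>)"
    by (simp add: powr_add[symmetric])
qed

lemma m_powr_at_top: "0 < c \<Longrightarrow> filterlim (\<lambda>n. m powr (c * real n)) at_top sequentially"
proof -
  assume c: "0 < c"
  have "filterlim (\<lambda>n. exp ((c * ln m) * real n)) at_top sequentially"
    using m_gt_1 c by (intro filterlim_compose[OF exp_at_top] filterlim_tendsto_pos_mult_at_top[OF tendsto_const _ filterlim_real_sequentially]) simp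
  moreover have "exp ((c * ln m) * real n) = m powr (c * real n)" for n using m_pos by (simp add: powr_def mult_ac)
  ultimately show ?thesis by simp
qed

lemma scale_eq:
  shows "e\<^sup>2 * m ^ n = (e * m powr (kap * real n))\<^sup>2 * m powr ((1 - 2 * kap) * real n)"
    and "e * m ^ n = (e * m powr (kap * real n)) * m powr ((1 - kap) * real n)"
proof -
  have "(m powr (kap * real n))\<^sup>2 * m powr ((1 - 2 * kap) * real n) = m ^ n"
    using m_pos by (simp add: power2_eq_square powr_add[symmetric] powr_realpow[symmetric]) (simp add: algebra_simps)
  then show "e\<^sup>2 * m ^ n = (e * m powr (kap * real n))\<^sup>2 * m powr ((1 - 2 * kap) * real n)"
    by (simp only: power_mult_distrib mult.assoc)
  have "m powr (kap * real n) * m powr ((1 - kap) * real n) = m ^ n"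
    using m_pos by (simp add: powr_add[symmetric] powr_realpow[symmetric]) (simp add: algebra_simps)
  then show "e * m ^ n = (e * m powr (kap * real n)) * m powr ((1 - kap) * real n)"
    by (simp only: mult.assoc)
qed

context
  fixes e :: "nat \<Rightarrow> real" and x :: "nat \<Rightarrow> real"
  assumes e_pos: "\<And>n. 0 < e n"
  defines "x \<equiv> \<lambda>n. e n * m powr (kap * real n)"
begin

lemma x_eq: "x n = e n * m powr (kap * real n)" by (simp add: x_def)

lemma x_pos: "0 < x n" using e_pos[of n] m_pos by (simp add: x_def)

lemma e_tendsto_0:
  assumes "x \<longlonglongrightarrow> c" shows "e \<longlonglongrightarrow> 0"
proof -
  have "(\<lambda>n. x n / m powr (kap * real n)) \<longlonglongrightarrow> 0"
    using m_powr_at_top[OF kap_range(1)] by (intro tendsto_divide_0[OF assms] filterlim_at_top_imp_at_infinity)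
  moreover have "x n / m powr (kap * real n) = e n" for n using m_pos by (simp add: x_def)
  ultimately show ?thesis by simp
qed

lemma scales_at_top_lim:
  assumes "x \<longlonglongrightarrow> c" "0 < c"
  shows "filterlim (\<lambda>n. (e n)\<^sup>2 * m ^ n) at_top sequentially" "filterlim (\<lambda>n. e n * m ^ n) at_top sequentially"
proof -
  show "filterlim (\<lambda>n. (e n)\<^sup>2 * m ^ n) at_top sequentially"
    unfolding scale_eq(1) x_eq[symmetric] using assms(2) kap_range
    by (intro filterlim_tendsto_pos_mult_at_top[OF tendsto_power[OF assms(1)]] m_powr_at_top) auto
  show "filterlim (\<lambda>n. e n * m ^ n) at_top sequentially"
    unfolding scale_eq(2) x_eq[symmetric] using kap_range
    by (intro filterlim_tendsto_pos_mult_at_top[OF assms] m_powr_at_top) auto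
qed

lemma scales_at_top_inf:
  assumes x: "filterlim x at_top sequentially"
  shows "filterlim (\<lambda>n. (e n)\<^sup>2 * m ^ n) at_top sequentially" "filterlim (\<lambda>n. e n * m ^ n) at_top sequentially"
proof -
  show "filterlim (\<lambda>n. (e n)\<^sup>2 * m ^ n) at_top sequentially"
    unfolding scale_eq(1) x_eq[symmetric] using kap_range
    by (intro filterlim_at_top_mult_at_top filterlim_pow_at_top x m_powr_at_top) auto
  show "filterlim (\<lambda>n. e n * m ^ n) at_top sequentially"
    unfolding scale_eq(2) x_eq[symmetric] using kap_range
    by (intro filterlim_at_top_mult_at_top x m_powr_at_top) auto
qed

lemma limsup_prob_R_gaussian:
  assumes x0: "x \<longlonglongrightarrow> 0" and emn: "filterlim (\<lambda>n. (e n)\<^sup>2 * m ^ n) at_top sequentially"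
    and v0: "0 \<le> v" and v: "\<And>v'. v < v' \<Longrightarrow> \<forall>\<^sub>F u in at_right 0. w u \<le> v' * u powr (\<alpha> - 1)"
  shows "limsup (\<lambda>n. ereal (e n powr (2 * \<alpha>) * m powr (\<alpha> * real n) * prob_R_ge M Z X n (e n))) \<le> ereal (v * (momt / \<alpha>))"
proof (rule limsup_le_realI)
  fix d :: real assume d: "0 < d"
  obtain K where K: "\<forall>\<^sub>F n in sequentially. prob_R_ge M Z X n (e n) \<le> (v * (momt / \<alpha>) + d / 2) * Dsc n (e n) + K * Jsc n (e n)"
    using prob_R_upper_gauss[OF e_pos e_tendsto_0[OF x0] emn v0 v, of "d / 2"] d by auto
  have "(\<lambda>n. K * x n powr (2 * \<alpha> - \<theta>)) \<longlonglongrightarrow> K * 0 powr (2 * \<alpha> - \<theta>)"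
    using two_alpha_gt x_pos by (intro tendsto_mult tendsto_const tendsto_powr'[OF x0 tendsto_const]) (auto intro!: always_eventually simp: less_imp_le)
  then have "\<forall>\<^sub>F n in sequentially. K * x n powr (2 * \<alpha> - \<theta>) < d / 2"
    by (rule order_tendstoD(2)) (use d in simp)
  then show "\<forall>\<^sub>F n in sequentially. e n powr (2 * \<alpha>) * m powr (\<alpha> * real n) * prob_R_ge M Z X n (e n) \<le> v * (momt / \<alpha>) + d"
    using K
  proof eventually_elim
    case (elim n)
    have D: "0 < Dsc n (e n)" using Dsc_pos e_pos by simp
    have J: "Jsc n (e n) = x n powr (2 * \<alpha> - \<theta>) * Dsc n (e n)" unfolding x_def by (rule Jsc_Dsc[OF e_pos])
    have "K * x n powr (2 * \<alpha> - \<theta>) * Dsc n (e n) \<le> d / 2 * Dsc n (e n)" using elim D by (intro mult_right_mono) auto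
    then have "prob_R_ge M Z X n (e n) \<le> (v * (momt / \<alpha>) + d) * Dsc n (e n)"
      using elim(2) unfolding J by (simp add: algebra_simps)
    then show ?case using D unfolding inverse_Dsc[OF e_pos] by (simp add: divide_le_eq)
  qed
qed

lemma liminf_prob_R_gaussian:
  assumes x0: "x \<longlonglongrightarrow> 0" and emn: "filterlim (\<lambda>n. (e n)\<^sup>2 * m ^ n) at_top sequentially"
    and v0: "0 < v" and v: "\<And>v'. v' < v \<Longrightarrow> \<forall>\<^sub>F u in at_right 0. v' * u powr (\<alpha> - 1) \<le> w u"
  shows "ereal (v * (momt / \<alpha>)) \<le> liminf (\<lambda>n. ereal (e n powr (2 * \<alpha>) * m powr (\<alpha> * real n) * prob_R_ge M Z X n (e n)))"
proof (rule liminf_ge_realI)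
  fix d :: real assume d: "0 < d"
  obtain T where "\<forall>\<^sub>F n in sequentially. (v * (momt / \<alpha>) - d) * Dsc n (e n) \<le> gpart n (e n) T"
    using gauss_lower[OF e_pos e_tendsto_0[OF x0] emn v0 v d] by auto
  then show "\<forall>\<^sub>F n in sequentially. v * (momt / \<alpha>) - d \<le> e n powr (2 * \<alpha>) * m powr (\<alpha> * real n) * prob_R_ge M Z X n (e n)"
  proof eventually_elim
    case (elim n)
    have "0 < Dsc n (e n)" using Dsc_pos e_pos by simp
    moreover have "(v * (momt / \<alpha>) - d) * Dsc n (e n) \<le> prob_R_ge M Z X n (e n)"
      using elim gpart_le_prob_R[of n "e n" T] by linarith
    ultimately show ?case unfolding inverse_Dsc[OF e_pos] by (simp add: le_divide_eq)
  qed
qed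

context
  fixes E :: real
  assumes phi_int: "set_integrable lborel {0<..} (\<lambda>v. Phi v * v powr (\<theta> - 2))"
  defines "E \<equiv> expectation (\<lambda>\<omega>. W \<omega> powr (- (\<theta> - 1)))"
begin

lemma prob_R_jump_limit:
  assumes x: "filterlim x at_top sequentially"
  shows "(\<lambda>n. e n powr \<theta> * m powr ((\<theta> - 1) * real n) * prob_R_ge M Z X n (e n)) \<longlonglongrightarrow> a * E"
proof (rule tendstoI)
  fix d :: real assume d: "0 < d"
  note emn = scales_at_top_inf[OF x]
  obtain K where K: "\<forall>\<^sub>F n in sequentially. prob_R_ge M Z X n (e n) \<le> (a * E + d / 3) * Jsc n (e n) + K * Dsc n (e n)"
    using prob_R_upper_jump[OF e_pos emn(2) phi_int, of "d / 3"] d unfolding E_def by auto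
  have L: "\<forall>\<^sub>F n in sequentially. (a * E - d / 3) * Jsc n (e n) \<le> prob_R_ge M Z X n (e n)"
    unfolding E_def using d by (intro prob_R_lower_jump e_pos emn phi_int) simp
  have "(\<lambda>n. K * x n powr (- (2 * \<alpha> - \<theta>))) \<longlonglongrightarrow> K * 0"
    using two_alpha_gt by (intro tendsto_mult tendsto_const tendsto_neg_powr[OF _ x]) simp
  then have "\<forall>\<^sub>F n in sequentially. K * x n powr (- (2 * \<alpha> - \<theta>)) < d / 3"
    by (rule order_tendstoD(2)) (use d in simp)
  then show "\<forall>\<^sub>F n in sequentially. dist (e n powr \<theta> * m powr ((\<theta> - 1) * real n) * prob_R_ge M Z X n (e n)) (a * E) < d"
    using K L
  proof eventually_elim
    case (elim n)
    have J: "0 < Jsc n (e n)" using Jsc_pos e_pos by simp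
    have D: "Dsc n (e n) = x n powr (- (2 * \<alpha> - \<theta>)) * Jsc n (e n)"
      using Jsc_Dsc[OF e_pos, of n n] x_pos[of n] unfolding x_eq[symmetric]
      by (simp add: mult.assoc[symmetric] powr_add[symmetric])
    have "K * x n powr (- (2 * \<alpha> - \<theta>)) * Jsc n (e n) \<le> d / 3 * Jsc n (e n)" using elim(1) J by (intro mult_right_mono) auto
    then have "prob_R_ge M Z X n (e n) \<le> (a * E + 2 * d / 3) * Jsc n (e n)"
      using elim(2) unfolding D by (simp add: algebra_simps)
    then have "prob_R_ge M Z X n (e n) / Jsc n (e n) \<le> a * E + 2 * d / 3" using J by (simp only: pos_divide_le_eq)
    moreover have "a * E - d / 3 \<le> prob_R_ge M Z X n (e n) / Jsc n (e n)" using J elim(3) by (simp only: pos_le_divide_eq)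
    ultimately show ?case unfolding inverse_Jsc[OF e_pos] dist_real_def using d by (simp add: abs_less_iff)
  qed
qed

lemma critical_limits:
  assumes x: "x \<longlonglongrightarrow> 1 / \<tau>" and \<tau>: "0 < \<tau>"
  shows "(\<lambda>n. c * (Fsc n * Dsc n (e n)) + c' * (Fsc n * Jsc n (e n)))
    \<longlonglongrightarrow> c * \<tau> powr (2 * \<alpha>) + c' * \<tau> powr \<theta>"
proof -
  have t: "(1 / \<tau>) powr (- b) = \<tau> powr b" for b using \<tau> by (simp add: powr_divide powr_minus_divide)
  have "(\<lambda>n. c * x n powr (- (2 * \<alpha>)) + c' * x n powr (- \<theta>)) \<longlonglongrightarrow> c * (1 / \<tau>) powr (- (2 * \<alpha>)) + c' * (1 / \<tau>) powr (- \<theta>)"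
    using \<tau> by (intro tendsto_intros x) auto
  then show ?thesis unfolding critical_scale[OF e_pos] x_eq[symmetric] t .
qed

lemma limsup_prob_R_critical:
  assumes x: "x \<longlonglongrightarrow> 1 / \<tau>" and \<tau>: "0 < \<tau>"
    and v0: "0 \<le> v" and v: "\<And>v'. v < v' \<Longrightarrow> \<forall>\<^sub>F u in at_right 0. w u \<le> v' * u powr (\<alpha> - 1)"
  shows "limsup (\<lambda>n. ereal (Fsc n * prob_R_ge M Z X n (e n)))
    \<le> ereal (v * (momt / \<alpha>) * \<tau> powr (2 * \<alpha>) + a * E * \<tau> powr \<theta>)"
proof (rule limsup_le_realI)
  fix d :: real assume d: "0 < d"
  have emn: "filterlim (\<lambda>n. (e n)\<^sup>2 * m ^ n) at_top sequentially" "filterlim (\<lambda>n. e n * m ^ n) at_top sequentially"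
    using scales_at_top_lim[OF x] \<tau> by auto
  define s where "s = \<tau> powr (2 * \<alpha>) + \<tau> powr \<theta>"
  have s: "0 < s" using \<tau> by (simp add: s_def add_pos_pos)
  define r where "r = d / (2 * s)"
  have r: "0 < r" using d s by (simp add: r_def)
  have "r * s < d" using d s by (simp add: r_def)
  then have lt: "(v * (momt / \<alpha>) + r) * \<tau> powr (2 * \<alpha>) + (a * E + r) * \<tau> powr \<theta> < v * (momt / \<alpha>) * \<tau> powr (2 * \<alpha>) + a * E * \<tau> powr \<theta> + d"
    by (simp add: s_def algebra_simps)
  have "\<forall>\<^sub>F n in sequentially. prob_R_ge M Z X n (e n) \<le> (v * (momt / \<alpha>) + r) * Dsc n (e n) + (a * E + r) * Jsc n (e n)"
    unfolding E_def by (intro prob_R_upper_both e_pos emn phi_int e_tendsto_0[OF x] v0 v r)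
  then show "\<forall>\<^sub>F n in sequentially. Fsc n * prob_R_ge M Z X n (e n) \<le> v * (momt / \<alpha>) * \<tau> powr (2 * \<alpha>) + a * E * \<tau> powr \<theta> + d"
    using order_tendstoD(2)[OF critical_limits[OF x \<tau>] lt]
  proof eventually_elim
    case (elim n)
    have "Fsc n * prob_R_ge M Z X n (e n) \<le> Fsc n * ((v * (momt / \<alpha>) + r) * Dsc n (e n) + (a * E + r) * Jsc n (e n))"
      using elim(1) by (intro mult_left_mono) auto
    then show ?case using elim(2) by (simp only: distrib_left mult.left_commute[of "Fsc n"])
  qed
qed

lemma liminf_prob_R_critical:
  assumes x: "x \<longlonglongrightarrow> 1 / \<tau>" and \<tau>: "0 < \<tau>"
    and v0: "0 < v" and v: "\<And>v'. v' < v \<Longrightarrow> \<forall>\<^sub>F u in at_right 0. v' * u powr (\<alpha> - 1) \<le> w u"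
  shows "ereal (v * (momt / \<alpha>) * \<tau> powr (2 * \<alpha>) + a * E * \<tau> powr \<theta>)
    \<le> liminf (\<lambda>n. ereal (Fsc n * prob_R_ge M Z X n (e n)))"
proof (rule liminf_ge_realI)
  fix d :: real assume d: "0 < d"
  have emn: "filterlim (\<lambda>n. (e n)\<^sup>2 * m ^ n) at_top sequentially" "filterlim (\<lambda>n. e n * m ^ n) at_top sequentially"
    using scales_at_top_lim[OF x] \<tau> by auto
  define s where "s = \<tau> powr (2 * \<alpha>) + \<tau> powr \<theta>"
  have s: "0 < s" using \<tau> by (simp add: s_def add_pos_pos)
  define r where "r = d / (2 * s)"
  have r: "0 < r" using d s by (simp add: r_def)
  have "r * s < d" using d s by (simp add: r_def)
  then have lt: "v * (momt / \<alpha>) * \<tau> powr (2 * \<alpha>) + a * E * \<tau> powr \<theta> - d < (v * (momt / \<alpha>) - r) * \<tau> powr (2 * \<alpha>) + (a * E - r) * \<tau> powr \<theta>"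
    by (simp add: s_def algebra_simps)
  have "\<forall>\<^sub>F n in sequentially. (v * (momt / \<alpha>) - r) * Dsc n (e n) + (a * E - r) * Jsc n (e n) \<le> prob_R_ge M Z X n (e n)"
    unfolding E_def by (intro prob_R_lower_both e_pos emn phi_int e_tendsto_0[OF x] v0 v r)
  then show "\<forall>\<^sub>F n in sequentially. v * (momt / \<alpha>) * \<tau> powr (2 * \<alpha>) + a * E * \<tau> powr \<theta> - d \<le> Fsc n * prob_R_ge M Z X n (e n)"
    using order_tendstoD(1)[OF critical_limits[OF x \<tau>] lt]
  proof eventually_elim
    case (elim n)
    have "Fsc n * ((v * (momt / \<alpha>) - r) * Dsc n (e n) + (a * E - r) * Jsc n (e n)) \<le> Fsc n * prob_R_ge M Z X n (e n)"
      using elim(1) by (intro mult_left_mono) auto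
    then show ?case using elim(2) by (simp only: distrib_left mult.left_commute[of "Fsc n"])
  qed
qed

end

end

end

theorem theorem2:
  fixes M :: "'a measure" and p :: "nat pmf"
    and \<xi> :: "nat \<Rightarrow> nat \<Rightarrow> 'a \<Rightarrow> nat" and Z :: "nat \<Rightarrow> 'a \<Rightarrow> nat"
    and X :: "nat \<Rightarrow> 'a \<Rightarrow> real"
    and m q \<alpha> \<sigma>2 \<theta> a :: real
    and W :: "'a \<Rightarrow> real" and w :: "real \<Rightarrow> real" and \<phi> :: "real \<Rightarrow> real"
    and \<epsilon> :: "nat \<Rightarrow> real"
    and \<kappa> \<Gamma>\<alpha> I\<theta> :: real and V_low V_up :: ereal and P :: "nat \<Rightarrow> real"
  assumes gw: "gw_setup M p \<xi> Z X"
    and mean_fin: "integrable (measure_pmf p) real"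
    and m_def: "m = offspring_mean p" and m_gt1: "1 < m"
    and LlogL: "integrable (measure_pmf p) (\<lambda>k. real k * ln (real k))"
    and X_int: "integrable M (X 1)" and X_mean: "(\<integral>\<omega>. X 1 \<omega> \<partial>M) = 0"
    and X_sq_int: "integrable M (\<lambda>\<omega>. (X 1 \<omega>)\<^sup>2)"
    and \<sigma>2_def: "\<sigma>2 = (\<integral>\<omega>. (X 1 \<omega>)\<^sup>2 \<partial>M)" and \<sigma>2_pos: "0 < \<sigma>2"
    and q_def: "q = measure M {\<omega>\<in>space M. \<exists>n. Z n \<omega> = 0}"
    and schroeder: "deriv (offspring_gf p) q = m powr (- \<alpha>)"
    and \<alpha>_gt1: "1 < \<alpha>"
    and W_meas: "W \<in> borel_measurable M"
    and W_lim: "AE \<omega> in M. (\<lambda>n. real (Z n \<omega>) / m ^ n) \<longlonglongrightarrow> W \<omega>"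
    and w_cont: "continuous_on {0<..} w" and w_nonneg: "\<And>u. 0 < u \<Longrightarrow> 0 \<le> w u"
    and w_density: "\<And>c d. 0 < c \<Longrightarrow> c \<le> d \<Longrightarrow>
         measure M {\<omega>\<in>space M. W \<omega> \<in> {c..d}} = (LBINT u:{c..d}. w u)"
    and \<phi>_def: "\<And>h. \<phi> h = (\<integral>\<omega>. exp (- h * W \<omega>) \<partial>M)"
    and \<theta>_range: "2 < \<theta>" "\<theta> < 1 + \<alpha>"
    and a_pos: "0 < a"
    and tail: "(\<lambda>x. measure M {\<omega>\<in>space M. X 1 \<omega> \<ge> x}) \<sim>[at_top] (\<lambda>x. a * x powr (- \<theta>))"
    and \<epsilon>_pos: "\<And>n. 0 < \<epsilon> n"
  defines "\<kappa> \<equiv> (1 + \<alpha> - \<theta>) / (2 * \<alpha> - \<theta>)"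
    and "V_low \<equiv> Liminf (at_right 0) (\<lambda>u. ereal (u powr (1 - \<alpha>) * w u))"
    and "V_up \<equiv> Limsup (at_right 0) (\<lambda>u. ereal (u powr (1 - \<alpha>) * w u))"
    and "\<Gamma>\<alpha> \<equiv> 2 powr (\<alpha> - 1) * Gamma (\<alpha> + 1/2) / (\<alpha> * sqrt pi) * \<sigma>2 powr \<alpha>"
    and "I\<theta> \<equiv> 1 / Gamma (\<theta> - 1) * (LBINT v:{0<..}. \<phi> v * v powr (\<theta> - 2))"
    and "P \<equiv> \<lambda>n. prob_R_ge M Z X n (\<epsilon> n)"
  shows
    "(((\<lambda>n. \<epsilon> n * m powr (\<kappa> * real n)) \<longlonglongrightarrow> 0) \<and>
       filterlim (\<lambda>n. (\<epsilon> n)\<^sup>2 * m ^ n) at_top sequentially \<longrightarrow>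
        V_low * ereal \<Gamma>\<alpha> \<le> liminf (\<lambda>n. ereal (\<epsilon> n powr (2 * \<alpha>) * m powr (\<alpha> * real n) * P n)) \<and>
        limsup (\<lambda>n. ereal (\<epsilon> n powr (2 * \<alpha>) * m powr (\<alpha> * real n) * P n)) \<le> V_up * ereal \<Gamma>\<alpha> \<and>
        0 < V_low * ereal \<Gamma>\<alpha> \<and> V_up * ereal \<Gamma>\<alpha> < \<infinity>)
   \<and> (set_integrable lborel {0<..} (\<lambda>v. \<phi> v * v powr (\<theta> - 2)) \<and>
       filterlim (\<lambda>n. \<epsilon> n * m powr (\<kappa> * real n)) at_top sequentially \<longrightarrow>
        (\<lambda>n. \<epsilon> n powr \<theta> * m powr ((\<theta> - 1) * real n) * P n) \<longlonglongrightarrow> a * I\<theta>)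
   \<and> (\<forall>\<tau>>0. set_integrable lborel {0<..} (\<lambda>v. \<phi> v * v powr (\<theta> - 2)) \<and>
       ((\<lambda>n. \<epsilon> n * m powr (\<kappa> * real n)) \<longlonglongrightarrow> 1 / \<tau>) \<longrightarrow>
        ereal (\<tau> powr (2 * \<alpha>)) * V_low * ereal \<Gamma>\<alpha> + ereal (\<tau> powr \<theta> * a * I\<theta>)
          \<le> liminf (\<lambda>n. ereal (m powr (\<alpha> * (\<theta> - 2) * real n / (2 * \<alpha> - \<theta>)) * P n)) \<and>
        limsup (\<lambda>n. ereal (m powr (\<alpha> * (\<theta> - 2) * real n / (2 * \<alpha> - \<theta>)) * P n))
          \<le> ereal (\<tau> powr (2 * \<alpha>)) * V_up * ereal \<Gamma>\<alpha> + ereal (\<tau> powr \<theta> * a * I\<theta>))"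
proof -
  interpret gw_walk M p \<xi> Z X m W q \<alpha> w \<theta> a \<sigma>2
    using assms(1-24) m_def by unfold_locales (simp_all add: offspring_mean_def)
  have \<kappa>: "\<kappa> = kap" by (simp add: \<kappa>_def kap_def)
  have \<phi>: "\<phi> = Phi" by (simp add: \<phi>_def Phi_def fun_eq_iff)
  have \<Gamma>: "\<Gamma>\<alpha> = momt / \<alpha>" using \<alpha>_gt1 by (simp add: \<Gamma>\<alpha>_def momt_def)
  have \<Gamma>0: "0 < \<Gamma>\<alpha>" using momt_pos \<alpha>_gt1 by (simp add: \<Gamma>)
  obtain vu where vu: "0 \<le> vu" "V_up = ereal vu" "\<And>v'. vu < v' \<Longrightarrow> \<forall>\<^sub>F u in at_right 0. w u \<le> v' * u powr (\<alpha> - 1)"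
    using density_limsup unfolding V_up_def by metis
  obtain vl where vl: "0 < vl" "V_low = ereal vl" "\<And>v'. v' < vl \<Longrightarrow> \<forall>\<^sub>F u in at_right 0. v' * u powr (\<alpha> - 1) \<le> w u"
    using density_liminf unfolding V_low_def by metis
  \<comment> \<open>Conditional on integrability: a non-integrable integrand would give the Bochner
    integral its default value 0.\<close>
  have I: "I\<theta> = expectation (\<lambda>\<omega>. W \<omega> powr (- (\<theta> - 1)))"
    if "set_integrable lborel {0<..} (\<lambda>v. \<phi> v * v powr (\<theta> - 2))"
    using neg_moment_W(3)[of "\<theta> - 1"] that beta_range by (simp add: I\<theta>_def \<phi>)
  show ?thesis
    unfolding P_def \<kappa>
  proof (intro conjI impI allI; elim conjE)
    assume x: "(\<lambda>n. \<epsilon> n * m powr (kap * real n)) \<longlonglongrightarrow> 0"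
      and emn: "filterlim (\<lambda>n. (\<epsilon> n)\<^sup>2 * m ^ n) at_top sequentially"
    show "V_low * ereal \<Gamma>\<alpha> \<le> liminf (\<lambda>n. ereal (\<epsilon> n powr (2 * \<alpha>) * m powr (\<alpha> * real n) * prob_R_ge M Z X n (\<epsilon> n)))"
      using liminf_prob_R_gaussian[OF \<epsilon>_pos x emn vl(1,3)] by (simp add: vl(2) \<Gamma>)
    show "limsup (\<lambda>n. ereal (\<epsilon> n powr (2 * \<alpha>) * m powr (\<alpha> * real n) * prob_R_ge M Z X n (\<epsilon> n))) \<le> V_up * ereal \<Gamma>\<alpha>"
      using limsup_prob_R_gaussian[OF \<epsilon>_pos x emn vu(1,3)] by (simp add: vu(2) \<Gamma>)
    show "0 < V_low * ereal \<Gamma>\<alpha>" using vl \<Gamma>0 by simp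
    show "V_up * ereal \<Gamma>\<alpha> < \<infinity>" by (simp add: vu)
  next
    assume int: "set_integrable lborel {0<..} (\<lambda>v. \<phi> v * v powr (\<theta> - 2))"
      and x: "filterlim (\<lambda>n. \<epsilon> n * m powr (kap * real n)) at_top sequentially"
    show "(\<lambda>n. \<epsilon> n powr \<theta> * m powr ((\<theta> - 1) * real n) * prob_R_ge M Z X n (\<epsilon> n)) \<longlonglongrightarrow> a * I\<theta>"
      unfolding I[OF int] by (rule prob_R_jump_limit[OF \<epsilon>_pos int[unfolded \<phi>] x])
  next
    fix \<tau> :: real assume \<tau>: "0 < \<tau>"
      and int: "set_integrable lborel {0<..} (\<lambda>v. \<phi> v * v powr (\<theta> - 2))"
      and x: "(\<lambda>n. \<epsilon> n * m powr (kap * real n)) \<longlonglongrightarrow> 1 / \<tau>"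
    show "ereal (\<tau> powr (2 * \<alpha>)) * V_low * ereal \<Gamma>\<alpha> + ereal (\<tau> powr \<theta> * a * I\<theta>)
        \<le> liminf (\<lambda>n. ereal (m powr (\<alpha> * (\<theta> - 2) * real n / (2 * \<alpha> - \<theta>)) * prob_R_ge M Z X n (\<epsilon> n)))"
      using liminf_prob_R_critical[OF \<epsilon>_pos int[unfolded \<phi>] x \<tau> vl(1,3)] unfolding I[OF int] vl(2) \<Gamma>
      by (simp add: mult_ac)
    show "limsup (\<lambda>n. ereal (m powr (\<alpha> * (\<theta> - 2) * real n / (2 * \<alpha> - \<theta>)) * prob_R_ge M Z X n (\<epsilon> n)))
        \<le> ereal (\<tau> powr (2 * \<alpha>)) * V_up * ereal \<Gamma>\<alpha> + ereal (\<tau> powr \<theta> * a * I\<theta>)"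
      using limsup_prob_R_critical[OF \<epsilon>_pos int[unfolded \<phi>] x \<tau> vu(1,3)] unfolding I[OF int] vu(2) \<Gamma>
      by (simp add: mult_ac)
  qed
qed

end
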